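(* Let $A$ and $B$ be algebras with differential calculi, and suppose that $(E,\nabla_E,\sigma_E)$ is a bimodule differential fibre bundle (with $E$ a $B$-$A$ bimodule). Then there is a spectral sequence for the filtration $F^mC$ of the cochain complex $(C^n=E\otimes_A\Omega^n_A,\ \nabla_E^{[n]})$ which has first page $$E_1^{p,q}=H^{p+q}(M_{p,q})\cong H^{p+q}(\Omega^p_B\otimes_B N_q)=\Omega^p_B\otimes_B H^q(N),$$ and second page with entry in position $(p,q)$ given by $H^p(B,H^q(N),\nabla_q)$, and which converges to $H(A,E,\nabla_E)$ in the sense that the entries stabilise at large page number.
   Context: Algebras are associative and unital over a field. A differential calculus on an algebra $A$ is a graded algebra $\Omega_A=\bigoplus_{n\ge 0}\Omega^n_A$ with product $\wedge$ and $\Omega^0_A=A$, with a linear map $\mathrm{d}:\Omega^n_A\to\Omega^{n+1}_A$ such that $\mathrm{d}^2=0$, $\mathrm{d}(\xi\wedge\eta)=\mathrm{d}\xi\wedge\eta+(-1)^{|\xi|}\xi\wedge\mathrm{d}\eta$, $\Omega^1_A=\mathrm{span}\{a'\,\mathrm{d}a\mid a,a'\in A\}$, and every element of $\Omega^n_A$ ($n\ge1$) is a sum of wedge products of elements of $\Omega^1_A$. A right bimodule connection $(\nabla_E,\sigma_E)$ on a $B$-$A$ bimodule $E$ is a linear map $\nabla_E:E\to E\otimes_A\Omega^1_A$ with $\nabla_E(e.a)=\nabla_E(e).a+e\otimes\mathrm{d}a$ ($a\in A$), together with a bimodule map $\sigma_E:\Omega^1_B\otimes_BE\to E\otimes_A\Omega^1_A$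 with $\nabla_E(be)=\sigma_E(\mathrm{d}b\otimes e)+b\nabla_E(e)$ ($b\in B$). It is extendable if $\sigma_E$ extends to maps $\sigma_E:\Omega^n_B\otimes_BE\to E\otimes_A\Omega^n_A$ for all $n$ (with $\sigma_E(b\otimes e)=be\otimes 1$ for $n=0$) by $\sigma_E(\xi\wedge\eta\otimes e)=(\sigma_E\wedge\mathrm{id})(\xi\otimes\sigma_E(\eta\otimes e))$. Here $(\sigma_E\wedge\mathrm{id})(\xi\otimes e\otimes\eta)=\sigma_E(\xi\otimes e)\wedge\eta$. Put $\nabla_E^{[n]}=\mathrm{id}\otimes\mathrm{d}+\nabla_E\wedge\mathrm{id}:E\otimes_A\Omega^n_A\to E\otimes_A\Omega^{n+1}_A$. The curvature is $R_E=\nabla_E^{[1]}\circ\nabla_E$; if $R_E=0$ then $C^n=E\otimes_A\Omega^n_A$ with $\mathrm{d}_C=\nabla_E^{[n]}$ is a cochain complex, whose cohomology is $H^n(A,E,\nabla_E)$. Filtration: for $m\le n$, $F^mC^n=\mathrm{image}(\sigma_E\wedge\mathrm{id}:\Omega^m_B\otimes_BE\otimes_A\Omega^{n-m}_A\to E\otimes_A\Omega^n_A)$, and $F^mC^n=0$ for $m>n$. Set $M_{p,q}=F^pC^{p+q}/F^{p+1}C^{p+q}$ and $N_q=M_{0,q}$ (a left $B$-module via $b[e\otimes\eta]=[be\otimes\eta]$). There is a well-defined linear map $g:\Omega^p_B\otimes_BN_q\to M_{p,q}$, $g(\xi\otimes[e\otimes\eta])=[(\sigma_E\wedge\mathrm{id})(\xi\otimes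 e\otimes\eta)]$. $(E,\nabla_E,\sigma_E)$ is a bimodule differential fibre bundle if (1) $(\nabla_E,\sigma_E)$ is an extendable zero-curvature right bimodule connection on $E$; (2) for all $p\ge1$, $\Omega^p_B$ is flat as a right $B$-module; (3) for all $p,q\ge0$ the map $g$ is an isomorphism. For fixed $p$, the $M_{p,q}$ ($q\ge 0$) form a cochain complex with differential $[\nabla_E^{[p+q]}]:M_{p,q}\to M_{p,q+1}$; $H^{p+q}(M_{p,q})$ is its cohomology at $M_{p,q}$, and $H^q(N)$ is the cohomology at $N_q=M_{0,q}$ in the case $p=0$. Double brackets $[[\cdot]]$ denote cohomology classes. The map $g$ induces an isomorphism $\hat g:\Omega^p_B\otimes_BH^q(N)\to H^{p+q}(M_{p,q})$, $\xi\otimes[[e\otimes\eta]]\mapsto[[\sigma_E(\xi\otimes e)\wedge\eta]]$. The zero-curvature left connection $\nabla_q:H^q(N)\to\Omega^1_B\otimes_BH^q(N)$ is defined as follows (summations implicit): for $[[e\otimes\xi]]\in H^q(N)$ one has $\nabla_E^{[q]}(e\otimes\xi)\in F^1C^{q+1}$, and $\nabla_q([[e\otimes\xi]])=\hat g^{-1}$ of the class of $\nabla_E^{[q]}(e\otimes\xi)$ in $H^{1+q}(M_{1,q})$; i.e. $\nabla_q([[e\otimes\xi]])=\eta\otimes[[f\otimes\kappa]]$ where $\nabla_E^{[q]}(e\otimes\xi)=\sigma_E(\eta\otimes f)\wedge\kappa$. $H^p(B,H^q(N),\nabla_q)$ is the cohomology at degree $p$ of the complex $\Omega^p_B\otimes_BH^q(N)$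 with differentials $\nabla_q^{[p]}(\omega\otimes x)=\mathrm{d}\omega\otimes x+(-1)^p\omega\wedge\nabla_q(x)$. A spectral sequence has pages $E_r^{p,q}$ with differentials $\mathrm{d}_r:E_r^{p,q}\to E_r^{p+r,q+1-r}$, page $r+1$ being the cohomology of page $r$. The spectral sequence of a filtration has first page $E_1^{p,q}=H^{p+q}(F^pC/F^{p+1}C)$ and convergence is understood as $H^k(A,E,\nabla_E)\cong\bigoplus_{p+q=k}E_\infty^{p,q}$, where $E_\infty^{p,q}$ is the stable value. *)

theory Defs
  imports "HOL-Algebra.AbelCoset" "HOL-Algebra.Module"
begin

section \<open>Linear algebra over a field\<close>

definition lin_maps ::
  "('k, 'r) ring_scheme \<Rightarrow> ('k, 'x, 'm) module_scheme \<Rightarrow> ('k, 'y, 'n) module_scheme \<Rightarrow> ('x \<Rightarrow> 'y) set"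
  where "lin_maps K V W = {f \<in> carrier V \<rightarrow> carrier W.
     (\<forall>x\<in>carrier V. \<forall>y\<in>carrier V. f (x \<oplus>\<^bsub>V\<^esub> y) = f x \<oplus>\<^bsub>W\<^esub> f y) \<and>
     (\<forall>c\<in>carrier K. \<forall>x\<in>carrier V. f (c \<odot>\<^bsub>V\<^esub> x) = c \<odot>\<^bsub>W\<^esub> f x)}"

definition lin_isos ::
  "('k, 'r) ring_scheme \<Rightarrow> ('k, 'x, 'm) module_scheme \<Rightarrow> ('k, 'y, 'n) module_scheme \<Rightarrow> ('x \<Rightarrow> 'y) set"
  where "lin_isos K V W = {f \<in> lin_maps K V W. bij_betw f (carrier V) (carrier W)}"

definition lin_isomorphic ::
  "('k, 'r) ring_scheme \<Rightarrow> ('k, 'x, 'm) module_scheme \<Rightarrow> ('k, 'y, 'n) module_scheme \<Rightarrow> bool"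
  where "lin_isomorphic K V W \<longleftrightarrow> lin_isos K V W \<noteq> {}"

definition lin_span ::
  "('k, 'r) ring_scheme \<Rightarrow> ('k, 'x, 'm) module_scheme \<Rightarrow> 'x set \<Rightarrow> 'x set"
  where "lin_span K V S = \<Inter>{H. submodule H K V \<and> S \<subseteq> H}"

text \<open>The quotient by a subspace, with cosets as elements; multiplication and unit of the record
  play no role.  As in the construction of factor rings, an operation on cosets is the union of the
  cosets of the results on representatives.\<close>

definition quot_map :: "('k, 'y, 'm) module_scheme \<Rightarrow> 'y set \<Rightarrow> ('x \<Rightarrow> 'y) \<Rightarrow> 'x set \<Rightarrow> 'y set"
  where "quot_map W H f X = (\<Union>x\<in>X. H +>\<^bsub>W\<^esub> f x)"

definition quot_space :: "('k, 'x, 'm) module_scheme \<Rightarrow> 'x set \<Rightarrow> ('k, 'x set) module"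
  where "quot_space V H = \<lparr>carrier = a_rcosets\<^bsub>V\<^esub> H, mult = undefined, one = undefined,
     zero = H, add = set_add V, smult = (\<lambda>c. quot_map V H (\<lambda>x. c \<odot>\<^bsub>V\<^esub> x))\<rparr>"

definition direct_sum :: "'i set \<Rightarrow> ('i \<Rightarrow> ('k, 'x, 'm) module_scheme) \<Rightarrow> ('k, 'i \<Rightarrow> 'x) module"
  where "direct_sum I V = \<lparr>carrier = {f \<in> (\<Pi>\<^sub>E i\<in>I. carrier (V i)). finite {i \<in> I. f i \<noteq> \<zero>\<^bsub>V i\<^esub>}},
     mult = undefined, one = undefined, zero = (\<lambda>i\<in>I. \<zero>\<^bsub>V i\<^esub>),
     add = (\<lambda>f g. \<lambda>i\<in>I. f i \<oplus>\<^bsub>V i\<^esub> g i), smult = (\<lambda>c f. \<lambda>i\<in>I. c \<odot>\<^bsub>V i\<^esub> f i)\<rparr>"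

section \<open>Algebras and bimodules\<close>

locale k_algebra = field K + M?: module K A + A?: ring A
  for K (structure) and A (structure) +
  assumes smult_mult_left: "\<lbrakk>c \<in> carrier K; x \<in> carrier A; y \<in> carrier A\<rbrakk> \<Longrightarrow>
      (c \<odot>\<^bsub>A\<^esub> x) \<otimes>\<^bsub>A\<^esub> y = c \<odot>\<^bsub>A\<^esub> (x \<otimes>\<^bsub>A\<^esub> y)"
    and smult_mult_right: "\<lbrakk>c \<in> carrier K; x \<in> carrier A; y \<in> carrier A\<rbrakk> \<Longrightarrow>
      x \<otimes>\<^bsub>A\<^esub> (c \<odot>\<^bsub>A\<^esub> y) = c \<odot>\<^bsub>A\<^esub> (x \<otimes>\<^bsub>A\<^esub> y)"

text \<open>One record type serves left modules, right modules and bimodules; an action that is irrelevant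
  (or not defined on the given carrier) is simply never used.\<close>

record ('k, 'b, 'a, 'x) bimod = "('k, 'x) module" +
  lact :: "'b \<Rightarrow> 'x \<Rightarrow> 'x" (infixr \<open>\<triangleright>\<index>\<close> 70)
  ract :: "'x \<Rightarrow> 'a \<Rightarrow> 'x" (infixl \<open>\<triangleleft>\<index>\<close> 70)

definition left_module ::
  "('k, 'r) ring_scheme \<Rightarrow> ('k, 'b, 'm) module_scheme \<Rightarrow> ('k, 'b, 'a, 'x) bimod \<Rightarrow> bool"
  where "left_module K B M \<longleftrightarrow> module K M \<and>
    (\<forall>b\<in>carrier B. \<forall>x\<in>carrier M. b \<triangleright>\<^bsub>M\<^esub> x \<in> carrier M) \<and>
    (\<forall>b\<in>carrier B. \<forall>x\<in>carrier M. \<forall>y\<in>carrier M. b \<triangleright>\<^bsub>M\<^esub> (x \<oplus>\<^bsub>M\<^esub> y) = (b \<triangleright>\<^bsub>M\<^esub> x) \<oplus>\<^bsub>M\<^esub> (b \<triangleright>\<^bsub>M\<^esub> y)) \<and>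
    (\<forall>b\<in>carrier B. \<forall>b'\<in>carrier B. \<forall>x\<in>carrier M. (b \<oplus>\<^bsub>B\<^esub> b') \<triangleright>\<^bsub>M\<^esub> x = (b \<triangleright>\<^bsub>M\<^esub> x) \<oplus>\<^bsub>M\<^esub> (b' \<triangleright>\<^bsub>M\<^esub> x)) \<and>
    (\<forall>b\<in>carrier B. \<forall>b'\<in>carrier B. \<forall>x\<in>carrier M. (b \<otimes>\<^bsub>B\<^esub> b') \<triangleright>\<^bsub>M\<^esub> x = b \<triangleright>\<^bsub>M\<^esub> (b' \<triangleright>\<^bsub>M\<^esub> x)) \<and>
    (\<forall>x\<in>carrier M. \<one>\<^bsub>B\<^esub> \<triangleright>\<^bsub>M\<^esub> x = x) \<and>
    (\<forall>c\<in>carrier K. \<forall>b\<in>carrier B. \<forall>x\<in>carrier M.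
       (c \<odot>\<^bsub>B\<^esub> b) \<triangleright>\<^bsub>M\<^esub> x = c \<odot>\<^bsub>M\<^esub> (b \<triangleright>\<^bsub>M\<^esub> x) \<and> b \<triangleright>\<^bsub>M\<^esub> (c \<odot>\<^bsub>M\<^esub> x) = c \<odot>\<^bsub>M\<^esub> (b \<triangleright>\<^bsub>M\<^esub> x))"

definition right_module ::
  "('k, 'r) ring_scheme \<Rightarrow> ('k, 'a, 'm) module_scheme \<Rightarrow> ('k, 'b, 'a, 'x) bimod \<Rightarrow> bool"
  where "right_module K A M \<longleftrightarrow> module K M \<and>
    (\<forall>a\<in>carrier A. \<forall>x\<in>carrier M. x \<triangleleft>\<^bsub>M\<^esub> a \<in> carrier M) \<and>
    (\<forall>a\<in>carrier A. \<forall>x\<in>carrier M. \<forall>y\<in>carrier M. (x \<oplus>\<^bsub>M\<^esub> y) \<triangleleft>\<^bsub>M\<^esub> a = (x \<triangleleft>\<^bsub>M\<^esub> a) \<oplus>\<^bsub>M\<^esub> (y \<triangleleft>\<^bsub>M\<^esub> a)) \<and>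
    (\<forall>a\<in>carrier A. \<forall>a'\<in>carrier A. \<forall>x\<in>carrier M. x \<triangleleft>\<^bsub>M\<^esub> (a \<oplus>\<^bsub>A\<^esub> a') = (x \<triangleleft>\<^bsub>M\<^esub> a) \<oplus>\<^bsub>M\<^esub> (x \<triangleleft>\<^bsub>M\<^esub> a')) \<and>
    (\<forall>a\<in>carrier A. \<forall>a'\<in>carrier A. \<forall>x\<in>carrier M. x \<triangleleft>\<^bsub>M\<^esub> (a \<otimes>\<^bsub>A\<^esub> a') = (x \<triangleleft>\<^bsub>M\<^esub> a) \<triangleleft>\<^bsub>M\<^esub> a') \<and>
    (\<forall>x\<in>carrier M. x \<triangleleft>\<^bsub>M\<^esub> \<one>\<^bsub>A\<^esub> = x) \<and>
    (\<forall>c\<in>carrier K. \<forall>a\<in>carrier A. \<forall>x\<in>carrier M.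
       x \<triangleleft>\<^bsub>M\<^esub> (c \<odot>\<^bsub>A\<^esub> a) = c \<odot>\<^bsub>M\<^esub> (x \<triangleleft>\<^bsub>M\<^esub> a) \<and> (c \<odot>\<^bsub>M\<^esub> x) \<triangleleft>\<^bsub>M\<^esub> a = c \<odot>\<^bsub>M\<^esub> (x \<triangleleft>\<^bsub>M\<^esub> a))"

definition bimodule ::
  "('k, 'r) ring_scheme \<Rightarrow> ('k, 'b, 'm) module_scheme \<Rightarrow> ('k, 'a, 'n) module_scheme \<Rightarrow>
   ('k, 'b, 'a, 'x) bimod \<Rightarrow> bool"
  where "bimodule K B A M \<longleftrightarrow> left_module K B M \<and> right_module K A M \<and>
    (\<forall>b\<in>carrier B. \<forall>x\<in>carrier M. \<forall>a\<in>carrier A. (b \<triangleright>\<^bsub>M\<^esub> x) \<triangleleft>\<^bsub>M\<^esub> a = b \<triangleright>\<^bsub>M\<^esub> (x \<triangleleft>\<^bsub>M\<^esub> a))"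

definition left_maps ::
  "('k, 'r) ring_scheme \<Rightarrow> ('k, 'b, 'm) module_scheme \<Rightarrow>
   ('k, 'b, 'a, 'x) bimod \<Rightarrow> ('k, 'b, 'c, 'y) bimod \<Rightarrow> ('x \<Rightarrow> 'y) set"
  where "left_maps K B M N = {f \<in> lin_maps K M N.
     \<forall>b\<in>carrier B. \<forall>x\<in>carrier M. f (b \<triangleright>\<^bsub>M\<^esub> x) = b \<triangleright>\<^bsub>N\<^esub> f x}"

definition bimodule_maps ::
  "('k, 'r) ring_scheme \<Rightarrow> ('k, 'b, 'm) module_scheme \<Rightarrow> ('k, 'a, 'n) module_scheme \<Rightarrow>
   ('k, 'b, 'a, 'x) bimod \<Rightarrow> ('k, 'b, 'a, 'y) bimod \<Rightarrow> ('x \<Rightarrow> 'y) set"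
  where "bimodule_maps K B A M N = {f \<in> left_maps K B M N.
     \<forall>x\<in>carrier M. \<forall>a\<in>carrier A. f (x \<triangleleft>\<^bsub>M\<^esub> a) = f x \<triangleleft>\<^bsub>N\<^esub> a}"

text \<open>The induced actions on the quotient are meaningful only when the carrier and \<open>H\<close> are stable
  under the action in question.\<close>

definition quot_bimod :: "('k, 'b, 'a, 'x) bimod \<Rightarrow> 'x set \<Rightarrow> ('k, 'b, 'a, 'x set) bimod"
  where "quot_bimod M H = \<lparr>carrier = a_rcosets\<^bsub>M\<^esub> H, mult = undefined, one = undefined,
     zero = H, add = set_add M, smult = (\<lambda>c. quot_map M H (\<lambda>x. c \<odot>\<^bsub>M\<^esub> x)),
     lact = (\<lambda>b. quot_map M H (\<lambda>x. b \<triangleright>\<^bsub>M\<^esub> x)), ract = (\<lambda>X a. quot_map M H (\<lambda>x. x \<triangleleft>\<^bsub>M\<^esub> a) X)\<rparr>"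

section \<open>Tensor products over a noncommutative algebra\<close>

definition free_space :: "('k, 'r) ring_scheme \<Rightarrow> 's set \<Rightarrow> ('k, 's \<Rightarrow> 'k) module"
  where "free_space K S = \<lparr>carrier = {\<phi>. (\<forall>s\<in>S. \<phi> s \<in> carrier K) \<and> (\<forall>s. s \<notin> S \<longrightarrow> \<phi> s = \<zero>\<^bsub>K\<^esub>) \<and>
       finite {s. \<phi> s \<noteq> \<zero>\<^bsub>K\<^esub>}},
     mult = undefined, one = undefined, zero = (\<lambda>s. \<zero>\<^bsub>K\<^esub>),
     add = (\<lambda>\<phi> \<psi> s. \<phi> s \<oplus>\<^bsub>K\<^esub> \<psi> s), smult = (\<lambda>c \<phi> s. c \<otimes>\<^bsub>K\<^esub> \<phi> s)\<rparr>"

definition basis_vec :: "('k, 'r) ring_scheme \<Rightarrow> 's \<Rightarrow> 's \<Rightarrow> 'k"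
  where "basis_vec K s = (\<lambda>t. if t = s then \<one>\<^bsub>K\<^esub> else \<zero>\<^bsub>K\<^esub>)"

definition free_lift ::
  "('k, 'r) ring_scheme \<Rightarrow> ('k, 'y, 'm) module_scheme \<Rightarrow> ('s \<Rightarrow> 'y) \<Rightarrow> ('s \<Rightarrow> 'k) \<Rightarrow> 'y"
  where "free_lift K V f \<phi> = (\<Oplus>\<^bsub>V\<^esub>s\<in>{s. \<phi> s \<noteq> \<zero>\<^bsub>K\<^esub>}. \<phi> s \<odot>\<^bsub>V\<^esub> f s)"

text \<open>The vector space with basis \<open>X \<times> Y\<close>, with the actions \<open>b(x,y) = (bx,y)\<close>
  and \<open>(x,y)a = (x,ya)\<close> on basis vectors.\<close>

definition tensor_free ::
  "('k, 'r) ring_scheme \<Rightarrow> ('k, 'b, 'a, 'x) bimod \<Rightarrow> ('k, 'a, 'c, 'y) bimod \<Rightarrow>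
   ('k, 'b, 'c, 'x \<times> 'y \<Rightarrow> 'k) bimod"
  where "tensor_free K X Y = (let G = free_space K (carrier X \<times> carrier Y) in
     \<lparr>carrier = carrier G, mult = undefined, one = undefined, zero = zero G, add = add G, smult = smult G,
      lact = (\<lambda>b. free_lift K G (\<lambda>(x, y). basis_vec K (b \<triangleright>\<^bsub>X\<^esub> x, y))),
      ract = (\<lambda>\<phi> c. free_lift K G (\<lambda>(x, y). basis_vec K (x, y \<triangleleft>\<^bsub>Y\<^esub> c)) \<phi>)\<rparr>)"

definition tensor_null ::
  "('k, 'r) ring_scheme \<Rightarrow> ('k, 'a, 'm) module_scheme \<Rightarrow>
   ('k, 'b, 'a, 'x) bimod \<Rightarrow> ('k, 'a, 'c, 'y) bimod \<Rightarrow> ('x \<times> 'y \<Rightarrow> 'k) set"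
  where "tensor_null K A X Y = (let G = tensor_free K X Y; e = basis_vec K in lin_span K G
    ({e (x \<oplus>\<^bsub>X\<^esub> x', y) \<ominus>\<^bsub>G\<^esub> (e (x, y) \<oplus>\<^bsub>G\<^esub> e (x', y)) | x x' y.
        x \<in> carrier X \<and> x' \<in> carrier X \<and> y \<in> carrier Y} \<union>
     {e (x, y \<oplus>\<^bsub>Y\<^esub> y') \<ominus>\<^bsub>G\<^esub> (e (x, y) \<oplus>\<^bsub>G\<^esub> e (x, y')) | x y y'.
        x \<in> carrier X \<and> y \<in> carrier Y \<and> y' \<in> carrier Y} \<union>
     {e (c \<odot>\<^bsub>X\<^esub> x, y) \<ominus>\<^bsub>G\<^esub> (c \<odot>\<^bsub>G\<^esub> e (x, y)) | c x y.
        c \<in> carrier K \<and> x \<in> carrier X \<and> y \<in> carrier Y} \<union>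
     {e (x, c \<odot>\<^bsub>Y\<^esub> y) \<ominus>\<^bsub>G\<^esub> (c \<odot>\<^bsub>G\<^esub> e (x, y)) | c x y.
        c \<in> carrier K \<and> x \<in> carrier X \<and> y \<in> carrier Y} \<union>
     {e (x \<triangleleft>\<^bsub>X\<^esub> a, y) \<ominus>\<^bsub>G\<^esub> e (x, a \<triangleright>\<^bsub>Y\<^esub> y) | x a y.
        x \<in> carrier X \<and> a \<in> carrier A \<and> y \<in> carrier Y}))"

definition tensor ::
  "('k, 'r) ring_scheme \<Rightarrow> ('k, 'a, 'm) module_scheme \<Rightarrow>
   ('k, 'b, 'a, 'x) bimod \<Rightarrow> ('k, 'a, 'c, 'y) bimod \<Rightarrow> ('k, 'b, 'c, ('x \<times> 'y \<Rightarrow> 'k) set) bimod"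
  where "tensor K A X Y = quot_bimod (tensor_free K X Y) (tensor_null K A X Y)"

definition tens ::
  "('k, 'r) ring_scheme \<Rightarrow> ('k, 'a, 'm) module_scheme \<Rightarrow>
   ('k, 'b, 'a, 'x) bimod \<Rightarrow> ('k, 'a, 'c, 'y) bimod \<Rightarrow> 'x \<Rightarrow> 'y \<Rightarrow> ('x \<times> 'y \<Rightarrow> 'k) set"
  where "tens K A X Y x y = tensor_null K A X Y +>\<^bsub>tensor_free K X Y\<^esub> basis_vec K (x, y)"

text \<open>The linear map \<open>x \<otimes> y \<mapsto> f x y\<close> with values in \<open>V\<close>, for balanced bilinear \<open>f\<close>.\<close>

definition tensor_lift ::
  "('k, 'r) ring_scheme \<Rightarrow> ('k, 'z, 'm) module_scheme \<Rightarrow> ('x \<Rightarrow> 'y \<Rightarrow> 'z) \<Rightarrow> ('x \<times> 'y \<Rightarrow> 'k) set \<Rightarrow> 'z"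
  where "tensor_lift K V f Z = the_elem (free_lift K V (\<lambda>(x, y). f x y) ` Z)"

text \<open>Flatness of a right \<open>B\<close>-module: tensoring preserves injectivity of left \<open>B\<close>-module maps.
  Since one cannot quantify over types, the test modules are those whose elements have type
  \<open>(nat \<Rightarrow> 'b) set\<close>. Every quotient of some \<open>B\<^sup>n\<close> lives there, hence so does a copy of every
  finitely generated left \<open>B\<close>-module, and an element in the kernel of a map
  \<open>X \<otimes> M \<rightarrow> X \<otimes> N\<close> already comes from finitely generated submodules of \<open>M\<close> and \<open>N\<close>;
  so this is flatness with respect to all left \<open>B\<close>-modules.\<close>

definition flat_right ::
  "('k, 'r) ring_scheme \<Rightarrow> ('k, 'b, 'm) module_scheme \<Rightarrow> ('k, 'c, 'b, 'x) bimod \<Rightarrow> bool"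
  where "flat_right K B X \<longleftrightarrow> right_module K B X \<and>
    (\<forall>(M :: ('k, 'b, unit, (nat \<Rightarrow> 'b) set) bimod) (N :: ('k, 'b, unit, (nat \<Rightarrow> 'b) set) bimod) f.
       left_module K B M \<and> left_module K B N \<and> f \<in> left_maps K B M N \<and> inj_on f (carrier M) \<longrightarrow>
       inj_on (tensor_lift K (tensor K B X N) (\<lambda>x y. tens K B X N x (f y))) (carrier (tensor K B X M)))"

section \<open>Differential calculi\<close>

text \<open>The record is the total algebra of forms, with \<open>\<otimes>\<close> for the wedge product.\<close>

record ('k, 'w) calculus = "('k, 'w) module" +
  grade :: "nat \<Rightarrow> 'w set"
  dif :: "'w \<Rightarrow> 'w"

definition degree_zero :: "('k, 'w) calculus \<Rightarrow> ('k, 'w) module"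
  where "degree_zero \<Omega> = \<lparr>carrier = grade \<Omega> 0, mult = mult \<Omega>, one = one \<Omega>,
     zero = zero \<Omega>, add = add \<Omega>, smult = smult \<Omega>\<rparr>"

definition forms :: "('k, 'w) calculus \<Rightarrow> nat \<Rightarrow> ('k, 'w, 'w, 'w) bimod"
  where "forms \<Omega> n = \<lparr>carrier = grade \<Omega> n, mult = mult \<Omega>, one = one \<Omega>,
     zero = zero \<Omega>, add = add \<Omega>, smult = smult \<Omega>, lact = mult \<Omega>, ract = mult \<Omega>\<rparr>"

definition msign :: "('k, 'r) ring_scheme \<Rightarrow> nat \<Rightarrow> 'k"
  where "msign K n = (\<ominus>\<^bsub>K\<^esub> \<one>\<^bsub>K\<^esub>) [^]\<^bsub>K\<^esub> n"

definition differential_calculus ::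
  "('k, 'r) ring_scheme \<Rightarrow> ('k, 'w) module \<Rightarrow> ('k, 'w) calculus \<Rightarrow> bool"
  where "differential_calculus K A \<Omega> \<longleftrightarrow>
    k_algebra K \<Omega> \<and>
    (\<forall>n. submodule (grade \<Omega> n) K \<Omega>) \<and>
    (\<forall>x\<in>carrier \<Omega>. \<exists>!f. (\<forall>n. f n \<in> grade \<Omega> n) \<and> finite {n. f n \<noteq> \<zero>\<^bsub>\<Omega>\<^esub>} \<and>
        x = (\<Oplus>\<^bsub>\<Omega>\<^esub>n\<in>{n. f n \<noteq> \<zero>\<^bsub>\<Omega>\<^esub>}. f n)) \<and>
    \<one>\<^bsub>\<Omega>\<^esub> \<in> grade \<Omega> 0 \<and>
    (\<forall>m n. \<forall>\<xi>\<in>grade \<Omega> m. \<forall>\<eta>\<in>grade \<Omega> n. \<xi> \<otimes>\<^bsub>\<Omega>\<^esub> \<eta> \<in> grade \<Omega> (m + n)) \<and>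
    degree_zero \<Omega> = A \<and>
    (\<forall>n. dif \<Omega> \<in> lin_maps K (forms \<Omega> n) (forms \<Omega> (n + 1))) \<and>
    (\<forall>n. \<forall>\<xi>\<in>grade \<Omega> n. dif \<Omega> (dif \<Omega> \<xi>) = \<zero>\<^bsub>\<Omega>\<^esub>) \<and>
    (\<forall>m n. \<forall>\<xi>\<in>grade \<Omega> m. \<forall>\<eta>\<in>grade \<Omega> n. dif \<Omega> (\<xi> \<otimes>\<^bsub>\<Omega>\<^esub> \<eta>) =
        (dif \<Omega> \<xi> \<otimes>\<^bsub>\<Omega>\<^esub> \<eta>) \<oplus>\<^bsub>\<Omega>\<^esub> (msign K m \<odot>\<^bsub>\<Omega>\<^esub> (\<xi> \<otimes>\<^bsub>\<Omega>\<^esub> dif \<Omega> \<eta>))) \<and>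
    grade \<Omega> 1 = lin_span K \<Omega> {a' \<otimes>\<^bsub>\<Omega>\<^esub> dif \<Omega> a | a a'. a \<in> carrier A \<and> a' \<in> carrier A} \<and>
    (\<forall>n\<ge>1. grade \<Omega> n = lin_span K \<Omega>
        {foldr (mult \<Omega>) \<xi>s \<one>\<^bsub>\<Omega>\<^esub> | \<xi>s. length \<xi>s = n \<and> set \<xi>s \<subseteq> grade \<Omega> 1})"

section \<open>Cohomology and spectral sequences\<close>

definition cocycles ::
  "(nat \<Rightarrow> ('k, 'x, 'm) module_scheme) \<Rightarrow> (nat \<Rightarrow> 'x \<Rightarrow> 'x) \<Rightarrow> nat \<Rightarrow> 'x set"
  where "cocycles X d n = {x \<in> carrier (X n). d n x = \<zero>\<^bsub>X (n + 1)\<^esub>}"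

definition coboundaries ::
  "(nat \<Rightarrow> ('k, 'x, 'm) module_scheme) \<Rightarrow> (nat \<Rightarrow> 'x \<Rightarrow> 'x) \<Rightarrow> nat \<Rightarrow> 'x set"
  where "coboundaries X d n = (if n = 0 then {\<zero>\<^bsub>X n\<^esub>} else d (n - 1) ` carrier (X (n - 1)))"

definition cohomology ::
  "(nat \<Rightarrow> ('k, 'x, 'm) module_scheme) \<Rightarrow> (nat \<Rightarrow> 'x \<Rightarrow> 'x) \<Rightarrow> nat \<Rightarrow> ('k, 'x set) module"
  where "cohomology X d n = quot_space ((X n)\<lparr>carrier := cocycles X d n\<rparr>) (coboundaries X d n)"

definition spectral_sequence ::
  "('k, 'r) ring_scheme \<Rightarrow> (nat \<Rightarrow> int \<Rightarrow> int \<Rightarrow> ('k, 'x, 'm) module_scheme) \<Rightarrow>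
   (nat \<Rightarrow> int \<Rightarrow> int \<Rightarrow> 'x \<Rightarrow> 'x) \<Rightarrow> bool"
  where "spectral_sequence K E d \<longleftrightarrow> (\<forall>r\<ge>1. \<forall>p q.
     module K (E r p q) \<and>
     d r p q \<in> lin_maps K (E r p q) (E r (p + int r) (q + 1 - int r)) \<and>
     (\<forall>x\<in>carrier (E r p q). d r (p + int r) (q + 1 - int r) (d r p q x)
        = \<zero>\<^bsub>E r (p + 2 * int r) (q + 2 - 2 * int r)\<^esub>) \<and>
     lin_isomorphic K (E (r + 1) p q)
       (quot_space
         ((E r p q)\<lparr>carrier := {x \<in> carrier (E r p q). d r p q x = \<zero>\<^bsub>E r (p + int r) (q + 1 - int r)\<^esub>}\<rparr>)
         (d r (p - int r) (q - 1 + int r) ` carrier (E r (p - int r) (q - 1 + int r)))))"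

text \<open>From page \<open>r\<^sub>0\<close> on, no nonzero differential enters or leaves position \<open>(p, q)\<close>.\<close>

definition stable_from ::
  "(nat \<Rightarrow> int \<Rightarrow> int \<Rightarrow> ('k, 'x, 'm) module_scheme) \<Rightarrow> (nat \<Rightarrow> int \<Rightarrow> int \<Rightarrow> 'x \<Rightarrow> 'x) \<Rightarrow>
   int \<Rightarrow> int \<Rightarrow> nat \<Rightarrow> bool"
  where "stable_from E d p q r\<^sub>0 \<longleftrightarrow> r\<^sub>0 \<ge> 1 \<and> (\<forall>r\<ge>r\<^sub>0.
     (\<forall>x\<in>carrier (E r p q). d r p q x = \<zero>\<^bsub>E r (p + int r) (q + 1 - int r)\<^esub>) \<and>
     (\<forall>x\<in>carrier (E r (p - int r) (q - 1 + int r)).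
        d r (p - int r) (q - 1 + int r) x = \<zero>\<^bsub>E r p q\<^esub>))"

definition converges_to ::
  "('k, 'r) ring_scheme \<Rightarrow> (nat \<Rightarrow> int \<Rightarrow> int \<Rightarrow> ('k, 'x, 'm) module_scheme) \<Rightarrow>
   (nat \<Rightarrow> int \<Rightarrow> int \<Rightarrow> 'x \<Rightarrow> 'x) \<Rightarrow> (nat \<Rightarrow> ('k, 'y, 'n) module_scheme) \<Rightarrow> bool"
  where "converges_to K E d H \<longleftrightarrow> (\<exists>s. (\<forall>p q. stable_from E d p q (s p q)) \<and>
     (\<forall>k. lin_isomorphic K (H k)
        (direct_sum {(p, q). p + q = int k} (\<lambda>(p, q). E (s p q) p q))))"

text \<open>The spectral sequence of a decreasing filtration \<open>F\<close> of a cochain complex \<open>(C, d)\<close>: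
  \<open>E\<^sub>r\<^sup>p\<^sup>q = Z\<^sub>r\<^sup>p\<^sup>q / (Z\<^sub>r\<^sub>-\<^sub>1\<^sup>p\<^sup>+\<^sup>1\<^sup>,\<^sup>q\<^sup>-\<^sup>1 + d Z\<^sub>r\<^sub>-\<^sub>1\<^sup>p\<^sup>-\<^sup>r\<^sup>+\<^sup>1\<^sup>,\<^sup>q\<^sup>+\<^sup>r\<^sup>-\<^sup>2)\<close>
  where \<open>Z\<^sub>r\<^sup>p\<^sup>q\<close> consists of the elements of \<open>F\<^sup>p\<close> in degree \<open>p + q\<close> with differential in
  \<open>F\<^sup>p\<^sup>+\<^sup>r\<close>; the differential of a page is induced by \<open>d\<close>.\<close>

definition ss_cycles ::
  "(int \<Rightarrow> 'x \<Rightarrow> 'x) \<Rightarrow> (int \<Rightarrow> int \<Rightarrow> 'x set) \<Rightarrow> int \<Rightarrow> int \<Rightarrow> int \<Rightarrow> 'x set"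
  where "ss_cycles d F r p q = {x \<in> F p (p + q). d (p + q) x \<in> F (p + r) (p + q + 1)}"

definition ss_null ::
  "(int \<Rightarrow> ('k, 'x, 'm) module_scheme) \<Rightarrow> (int \<Rightarrow> 'x \<Rightarrow> 'x) \<Rightarrow> (int \<Rightarrow> int \<Rightarrow> 'x set) \<Rightarrow>
   int \<Rightarrow> int \<Rightarrow> int \<Rightarrow> 'x set"
  where "ss_null C d F r p q = ss_cycles d F (r - 1) (p + 1) (q - 1)
     <+>\<^bsub>C (p + q)\<^esub> d (p + q - 1) ` ss_cycles d F (r - 1) (p - r + 1) (q + r - 2)"

definition ss_page ::
  "(int \<Rightarrow> ('k, 'x, 'm) module_scheme) \<Rightarrow> (int \<Rightarrow> 'x \<Rightarrow> 'x) \<Rightarrow> (int \<Rightarrow> int \<Rightarrow> 'x set) \<Rightarrow>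
   nat \<Rightarrow> int \<Rightarrow> int \<Rightarrow> ('k, 'x set) module"
  where "ss_page C d F r p q =
     quot_space ((C (p + q))\<lparr>carrier := ss_cycles d F (int r) p q\<rparr>) (ss_null C d F (int r) p q)"

definition ss_diff ::
  "(int \<Rightarrow> ('k, 'x, 'm) module_scheme) \<Rightarrow> (int \<Rightarrow> 'x \<Rightarrow> 'x) \<Rightarrow> (int \<Rightarrow> int \<Rightarrow> 'x set) \<Rightarrow>
   nat \<Rightarrow> int \<Rightarrow> int \<Rightarrow> 'x set \<Rightarrow> 'x set"
  where "ss_diff C d F r p q = quot_map (C (p + q + 1))
     (ss_null C d F (int r) (p + int r) (q + 1 - int r)) (d (p + q))"

section \<open>Bimodule connections\<close>

text \<open>The data \<open>(A, \<Omega>\<^sub>A)\<close>, \<open>(B, \<Omega>\<^sub>B)\<close>, \<open>(E, \<nabla>\<^sub>E, \<sigma>\<^sub>E)\<close> over a field. The component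
  \<open>braid\<close> is the whole family of maps \<open>\<sigma>\<^sub>E\<close> on \<open>\<Omega>\<^sup>n\<^sub>B \<otimes>\<^sub>B E\<close>; its member at \<open>n = 1\<close> is the
  bimodule map of the connection, which determines the others because \<open>\<Omega>\<^sub>B\<close> is generated in
  degrees \<open>0\<close> and \<open>1\<close>.\<close>

record ('k, 'w, 'v, 'e) bundle_data =
  scal :: "'k ring"
  algA :: "('k, 'w) module"
  calA :: "('k, 'w) calculus"
  algB :: "('k, 'v) module"
  calB :: "('k, 'v) calculus"
  bim :: "('k, 'v, 'w, 'e) bimod"
  conn :: "'e \<Rightarrow> ('e \<times> 'w \<Rightarrow> 'k) set"
  braid :: "nat \<Rightarrow> ('v \<times> 'e \<Rightarrow> 'k) set \<Rightarrow> ('e \<times> 'w \<Rightarrow> 'k) set"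

definition cochains ::
  "('k, 'w, 'v, 'e) bundle_data \<Rightarrow> nat \<Rightarrow> ('k, 'v, 'w, ('e \<times> 'w \<Rightarrow> 'k) set) bimod"
  where "cochains D n = tensor (scal D) (algA D) (bim D) (forms (calA D) n)"

abbreviation ctens ::
  "('k, 'w, 'v, 'e) bundle_data \<Rightarrow> nat \<Rightarrow> 'e \<Rightarrow> 'w \<Rightarrow> ('e \<times> 'w \<Rightarrow> 'k) set"
  where "ctens D n \<equiv> tens (scal D) (algA D) (bim D) (forms (calA D) n)"

abbreviation formsE ::
  "('k, 'w, 'v, 'e) bundle_data \<Rightarrow> nat \<Rightarrow> ('k, 'v, 'w, ('v \<times> 'e \<Rightarrow> 'k) set) bimod"
  where "formsE D n \<equiv> tensor (scal D) (algB D) (forms (calB D) n) (bim D)"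

abbreviation formsE_tens ::
  "('k, 'w, 'v, 'e) bundle_data \<Rightarrow> nat \<Rightarrow> 'v \<Rightarrow> 'e \<Rightarrow> ('v \<times> 'e \<Rightarrow> 'k) set"
  where "formsE_tens D n \<equiv> tens (scal D) (algB D) (forms (calB D) n) (bim D)"

text \<open>\<open>(e \<otimes> \<eta>) \<and> \<kappa> = e \<otimes> (\<eta> \<and> \<kappa>)\<close> for \<open>\<eta>\<close>, \<open>\<kappa>\<close> of degrees \<open>m\<close>, \<open>n\<close>.\<close>

definition wedge_right ::
  "('k, 'w, 'v, 'e) bundle_data \<Rightarrow> nat \<Rightarrow> nat \<Rightarrow> ('e \<times> 'w \<Rightarrow> 'k) set \<Rightarrow> 'w \<Rightarrow> ('e \<times> 'w \<Rightarrow> 'k) set"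
  where "wedge_right D m n Z \<kappa> =
     tensor_lift (scal D) (cochains D (m + n)) (\<lambda>e \<eta>. ctens D (m + n) e (\<eta> \<otimes>\<^bsub>calA D\<^esub> \<kappa>)) Z"

text \<open>\<open>(\<sigma>\<^sub>E \<and> id)(\<xi> \<otimes> Z)\<close> for \<open>\<xi>\<close> of degree \<open>m\<close> and \<open>Z \<in> C\<^sup>n\<close>.\<close>

definition sigma_wedge ::
  "('k, 'w, 'v, 'e) bundle_data \<Rightarrow> nat \<Rightarrow> nat \<Rightarrow> 'v \<Rightarrow> ('e \<times> 'w \<Rightarrow> 'k) set \<Rightarrow> ('e \<times> 'w \<Rightarrow> 'k) set"
  where "sigma_wedge D m n \<xi> Z =
     tensor_lift (scal D) (cochains D (m + n))
       (\<lambda>e \<eta>. wedge_right D m n (braid D m (formsE_tens D m \<xi> e)) \<eta>) Z"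

text \<open>The two summands \<open>id \<otimes> d\<close> and \<open>\<nabla>\<^sub>E \<and> id\<close> are not separately balanced over \<open>A\<close>;
  their sum is.\<close>

definition nabla ::
  "('k, 'w, 'v, 'e) bundle_data \<Rightarrow> nat \<Rightarrow> ('e \<times> 'w \<Rightarrow> 'k) set \<Rightarrow> ('e \<times> 'w \<Rightarrow> 'k) set"
  where "nabla D n = tensor_lift (scal D) (cochains D (n + 1))
     (\<lambda>e \<xi>. ctens D (n + 1) e (dif (calA D) \<xi>) \<oplus>\<^bsub>cochains D (n + 1)\<^esub> wedge_right D 1 n (conn D e) \<xi>)"

definition right_bimodule_connection :: "('k, 'w, 'v, 'e) bundle_data \<Rightarrow> bool"
  where "right_bimodule_connection D \<longleftrightarrow>
    conn D \<in> lin_maps (scal D) (bim D) (cochains D 1) \<and>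
    (\<forall>e\<in>carrier (bim D). \<forall>a\<in>carrier (algA D). conn D (e \<triangleleft>\<^bsub>bim D\<^esub> a) =
       (conn D e \<triangleleft>\<^bsub>cochains D 1\<^esub> a) \<oplus>\<^bsub>cochains D 1\<^esub> ctens D 1 e (dif (calA D) a)) \<and>
    braid D 1 \<in> bimodule_maps (scal D) (algB D) (algA D) (formsE D 1) (cochains D 1) \<and>
    (\<forall>b\<in>carrier (algB D). \<forall>e\<in>carrier (bim D). conn D (b \<triangleright>\<^bsub>bim D\<^esub> e) =
       braid D 1 (formsE_tens D 1 (dif (calB D) b) e) \<oplus>\<^bsub>cochains D 1\<^esub> (b \<triangleright>\<^bsub>cochains D 1\<^esub> conn D e))"

definition extendable :: "('k, 'w, 'v, 'e) bundle_data \<Rightarrow> bool"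
  where "extendable D \<longleftrightarrow>
    (\<forall>n. braid D n \<in> bimodule_maps (scal D) (algB D) (algA D) (formsE D n) (cochains D n)) \<and>
    (\<forall>b\<in>carrier (algB D). \<forall>e\<in>carrier (bim D).
       braid D 0 (formsE_tens D 0 b e) = ctens D 0 (b \<triangleright>\<^bsub>bim D\<^esub> e) \<one>\<^bsub>algA D\<^esub>) \<and>
    (\<forall>m n. \<forall>\<xi>\<in>grade (calB D) m. \<forall>\<eta>\<in>grade (calB D) n. \<forall>e\<in>carrier (bim D).
       braid D (m + n) (formsE_tens D (m + n) (\<xi> \<otimes>\<^bsub>calB D\<^esub> \<eta>) e) =
       sigma_wedge D m n \<xi> (braid D n (formsE_tens D n \<eta> e)))"

definition zero_curvature :: "('k, 'w, 'v, 'e) bundle_data \<Rightarrow> bool"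
  where "zero_curvature D \<longleftrightarrow> (\<forall>e\<in>carrier (bim D). nabla D 1 (conn D e) = \<zero>\<^bsub>cochains D 2\<^esub>)"

section \<open>The filtration and the fibre bundle condition\<close>

definition filt :: "('k, 'w, 'v, 'e) bundle_data \<Rightarrow> nat \<Rightarrow> nat \<Rightarrow> ('e \<times> 'w \<Rightarrow> 'k) set set"
  where "filt D m n =
     (if m \<le> n
      then tensor_lift (scal D) (cochains D n) (sigma_wedge D m (n - m)) `
             carrier (tensor (scal D) (algB D) (forms (calB D) m) (cochains D (n - m)))
      else {\<zero>\<^bsub>cochains D n\<^esub>})"

definition M_mod ::
  "('k, 'w, 'v, 'e) bundle_data \<Rightarrow> nat \<Rightarrow> nat \<Rightarrow> ('k, 'v, 'w, ('e \<times> 'w \<Rightarrow> 'k) set set) bimod"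
  where "M_mod D p q = quot_bimod ((cochains D (p + q))\<lparr>carrier := filt D p (p + q)\<rparr>) (filt D (p + 1) (p + q))"

definition M_class ::
  "('k, 'w, 'v, 'e) bundle_data \<Rightarrow> nat \<Rightarrow> nat \<Rightarrow> ('e \<times> 'w \<Rightarrow> 'k) set \<Rightarrow> ('e \<times> 'w \<Rightarrow> 'k) set set"
  where "M_class D p q x = filt D (p + 1) (p + q) +>\<^bsub>cochains D (p + q)\<^esub> x"

definition M_diff ::
  "('k, 'w, 'v, 'e) bundle_data \<Rightarrow> nat \<Rightarrow> nat \<Rightarrow> ('e \<times> 'w \<Rightarrow> 'k) set set \<Rightarrow> ('e \<times> 'w \<Rightarrow> 'k) set set"
  where "M_diff D p q =
     quot_map (cochains D (p + q + 1)) (filt D (p + 1) (p + q + 1)) (nabla D (p + q))"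

abbreviation N_mod ::
  "('k, 'w, 'v, 'e) bundle_data \<Rightarrow> nat \<Rightarrow> ('k, 'v, 'w, ('e \<times> 'w \<Rightarrow> 'k) set set) bimod"
  where "N_mod D \<equiv> M_mod D 0"

abbreviation N_diff ::
  "('k, 'w, 'v, 'e) bundle_data \<Rightarrow> nat \<Rightarrow> ('e \<times> 'w \<Rightarrow> 'k) set set \<Rightarrow> ('e \<times> 'w \<Rightarrow> 'k) set set"
  where "N_diff D \<equiv> M_diff D 0"

definition forms_N ::
  "('k, 'w, 'v, 'e) bundle_data \<Rightarrow> nat \<Rightarrow> nat \<Rightarrow>
   ('k, 'v, 'w, ('v \<times> ('e \<times> 'w \<Rightarrow> 'k) set set \<Rightarrow> 'k) set) bimod"
  where "forms_N D p q = tensor (scal D) (algB D) (forms (calB D) p) (N_mod D q)"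

abbreviation forms_N_tens ::
  "('k, 'w, 'v, 'e) bundle_data \<Rightarrow> nat \<Rightarrow> nat \<Rightarrow> 'v \<Rightarrow> ('e \<times> 'w \<Rightarrow> 'k) set set \<Rightarrow>
   ('v \<times> ('e \<times> 'w \<Rightarrow> 'k) set set \<Rightarrow> 'k) set"
  where "forms_N_tens D p q \<equiv> tens (scal D) (algB D) (forms (calB D) p) (N_mod D q)"

text \<open>\<open>g(\<xi> \<otimes> [x]) = [(\<sigma>\<^sub>E \<and> id)(\<xi> \<otimes> x)]\<close>\<close>

definition g_map ::
  "('k, 'w, 'v, 'e) bundle_data \<Rightarrow> nat \<Rightarrow> nat \<Rightarrow>
   ('v \<times> ('e \<times> 'w \<Rightarrow> 'k) set set \<Rightarrow> 'k) set \<Rightarrow> ('e \<times> 'w \<Rightarrow> 'k) set set"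
  where "g_map D p q = tensor_lift (scal D) (M_mod D p q)
     (\<lambda>\<xi>. quot_map (cochains D (p + q)) (filt D (p + 1) (p + q)) (sigma_wedge D p q \<xi>))"

definition bimodule_differential_fibre_bundle :: "('k, 'w, 'v, 'e) bundle_data \<Rightarrow> bool"
  where "bimodule_differential_fibre_bundle D \<longleftrightarrow>
    right_bimodule_connection D \<and> extendable D \<and> zero_curvature D \<and>
    (\<forall>p\<ge>1. flat_right (scal D) (algB D) (forms (calB D) p)) \<and>
    (\<forall>p q. g_map D p q \<in> lin_isos (scal D) (forms_N D p q) (M_mod D p q))"

section \<open>The cohomology groups\<close>

definition HM ::
  "('k, 'w, 'v, 'e) bundle_data \<Rightarrow> nat \<Rightarrow> nat \<Rightarrow> ('k, ('e \<times> 'w \<Rightarrow> 'k) set set set) module"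
  where "HM D p q = cohomology (M_mod D p) (M_diff D p) q"

definition HM_class ::
  "('k, 'w, 'v, 'e) bundle_data \<Rightarrow> nat \<Rightarrow> nat \<Rightarrow> ('e \<times> 'w \<Rightarrow> 'k) set set \<Rightarrow> ('e \<times> 'w \<Rightarrow> 'k) set set set"
  where "HM_class D p q X = coboundaries (M_mod D p) (M_diff D p) q +>\<^bsub>M_mod D p q\<^esub> X"

text \<open>The cohomology of \<open>N\<close> with the left \<open>B\<close>-action inherited from \<open>N\<close>.\<close>

definition HN ::
  "('k, 'w, 'v, 'e) bundle_data \<Rightarrow> nat \<Rightarrow> ('k, 'v, 'w, ('e \<times> 'w \<Rightarrow> 'k) set set set) bimod"
  where "HN D q = quot_bimod ((N_mod D q)\<lparr>carrier := cocycles (N_mod D) (N_diff D) q\<rparr>)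
     (coboundaries (N_mod D) (N_diff D) q)"

definition forms_HN ::
  "('k, 'w, 'v, 'e) bundle_data \<Rightarrow> nat \<Rightarrow> nat \<Rightarrow>
   ('k, 'v, 'w, ('v \<times> ('e \<times> 'w \<Rightarrow> 'k) set set set \<Rightarrow> 'k) set) bimod"
  where "forms_HN D p q = tensor (scal D) (algB D) (forms (calB D) p) (HN D q)"

abbreviation forms_HN_tens ::
  "('k, 'w, 'v, 'e) bundle_data \<Rightarrow> nat \<Rightarrow> nat \<Rightarrow> 'v \<Rightarrow> ('e \<times> 'w \<Rightarrow> 'k) set set set \<Rightarrow>
   ('v \<times> ('e \<times> 'w \<Rightarrow> 'k) set set set \<Rightarrow> 'k) set"
  where "forms_HN_tens D p q \<equiv> tens (scal D) (algB D) (forms (calB D) p) (HN D q)"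

text \<open>\<open>\<xi> \<otimes> [[x]] \<mapsto> [[(\<sigma>\<^sub>E \<and> id)(\<xi> \<otimes> x)]]\<close>\<close>

definition g_hat ::
  "('k, 'w, 'v, 'e) bundle_data \<Rightarrow> nat \<Rightarrow> nat \<Rightarrow>
   ('v \<times> ('e \<times> 'w \<Rightarrow> 'k) set set set \<Rightarrow> 'k) set \<Rightarrow> ('e \<times> 'w \<Rightarrow> 'k) set set set"
  where "g_hat D p q = tensor_lift (scal D) (HM D p q)
     (\<lambda>\<xi>. quot_map (M_mod D p q) (coboundaries (M_mod D p) (M_diff D p) q)
            (\<lambda>X. g_map D p q (forms_N_tens D p q \<xi> X)))"

abbreviation g_hat_inv ::
  "('k, 'w, 'v, 'e) bundle_data \<Rightarrow> nat \<Rightarrow> nat \<Rightarrow>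
   ('e \<times> 'w \<Rightarrow> 'k) set set set \<Rightarrow> ('v \<times> ('e \<times> 'w \<Rightarrow> 'k) set set set \<Rightarrow> 'k) set"
  where "g_hat_inv D p q \<equiv> inv_into (carrier (forms_HN D p q)) (g_hat D p q)"

text \<open>The complex \<open>\<Omega>\<^sup>p\<^sub>B \<otimes>\<^sub>B N\<close> (\<open>p\<close> fixed) with differential \<open>id \<otimes> d\<close>, its cohomology, the
  comparison map \<open>\<xi> \<otimes> [[x]] \<mapsto> [[\<xi> \<otimes> [x]]]\<close>, and the map induced by \<open>g\<close> on cohomology.
  (The map \<open>g\<close> commutes with the differentials up to the sign \<open>(-1)\<^sup>p\<close>, which affects
  neither cocycles nor coboundaries.)\<close>

definition forms_N_diff ::
  "('k, 'w, 'v, 'e) bundle_data \<Rightarrow> nat \<Rightarrow> nat \<Rightarrow>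
   ('v \<times> ('e \<times> 'w \<Rightarrow> 'k) set set \<Rightarrow> 'k) set \<Rightarrow> ('v \<times> ('e \<times> 'w \<Rightarrow> 'k) set set \<Rightarrow> 'k) set"
  where "forms_N_diff D p q = tensor_lift (scal D) (forms_N D p (q + 1))
     (\<lambda>\<xi> X. forms_N_tens D p (q + 1) \<xi> (N_diff D q X))"

definition H_forms_N ::
  "('k, 'w, 'v, 'e) bundle_data \<Rightarrow> nat \<Rightarrow> nat \<Rightarrow> ('k, ('v \<times> ('e \<times> 'w \<Rightarrow> 'k) set set \<Rightarrow> 'k) set set) module"
  where "H_forms_N D p q = cohomology (forms_N D p) (forms_N_diff D p) q"

definition comparison ::
  "('k, 'w, 'v, 'e) bundle_data \<Rightarrow> nat \<Rightarrow> nat \<Rightarrow>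
   ('v \<times> ('e \<times> 'w \<Rightarrow> 'k) set set set \<Rightarrow> 'k) set \<Rightarrow> ('v \<times> ('e \<times> 'w \<Rightarrow> 'k) set set \<Rightarrow> 'k) set set"
  where "comparison D p q = tensor_lift (scal D) (H_forms_N D p q)
     (\<lambda>\<xi>. quot_map (forms_N D p q) (coboundaries (forms_N D p) (forms_N_diff D p) q)
            (\<lambda>X. forms_N_tens D p q \<xi> X))"

definition g_coh ::
  "('k, 'w, 'v, 'e) bundle_data \<Rightarrow> nat \<Rightarrow> nat \<Rightarrow>
   ('v \<times> ('e \<times> 'w \<Rightarrow> 'k) set set \<Rightarrow> 'k) set set \<Rightarrow> ('e \<times> 'w \<Rightarrow> 'k) set set set"
  where "g_coh D p q =
     quot_map (M_mod D p q) (coboundaries (M_mod D p) (M_diff D p) q) (g_map D p q)"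

text \<open>The connection \<open>\<nabla>\<^sub>q\<close> applied to the class \<open>Y\<close>; the union ranges over all representing
  cochains \<open>x\<close> and all its members agree.\<close>

definition nabla_q ::
  "('k, 'w, 'v, 'e) bundle_data \<Rightarrow> nat \<Rightarrow>
   ('e \<times> 'w \<Rightarrow> 'k) set set set \<Rightarrow> ('v \<times> ('e \<times> 'w \<Rightarrow> 'k) set set set \<Rightarrow> 'k) set"
  where "nabla_q D q Y =
     g_hat_inv D 1 q (\<Union>X\<in>Y. \<Union>x\<in>X. HM_class D 1 q (M_class D 1 q (nabla D q x)))"

definition wedge_left ::
  "('k, 'w, 'v, 'e) bundle_data \<Rightarrow> nat \<Rightarrow> nat \<Rightarrow> 'v \<Rightarrow>
   ('v \<times> ('e \<times> 'w \<Rightarrow> 'k) set set set \<Rightarrow> 'k) set \<Rightarrow> ('v \<times> ('e \<times> 'w \<Rightarrow> 'k) set set set \<Rightarrow> 'k) set"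
  where "wedge_left D p q \<omega> = tensor_lift (scal D) (forms_HN D (p + 1) q)
     (\<lambda>\<eta> Y. forms_HN_tens D (p + 1) q (\<omega> \<otimes>\<^bsub>calB D\<^esub> \<eta>) Y)"

definition nabla_q_ext ::
  "('k, 'w, 'v, 'e) bundle_data \<Rightarrow> nat \<Rightarrow> nat \<Rightarrow>
   ('v \<times> ('e \<times> 'w \<Rightarrow> 'k) set set set \<Rightarrow> 'k) set \<Rightarrow> ('v \<times> ('e \<times> 'w \<Rightarrow> 'k) set set set \<Rightarrow> 'k) set"
  where "nabla_q_ext D q p = tensor_lift (scal D) (forms_HN D (p + 1) q)
     (\<lambda>\<omega> Y. forms_HN_tens D (p + 1) q (dif (calB D) \<omega>) Y \<oplus>\<^bsub>forms_HN D (p + 1) q\<^esub>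
        (msign (scal D) p \<odot>\<^bsub>forms_HN D (p + 1) q\<^esub> wedge_left D p q \<omega> (nabla_q D q Y)))"

definition HB ::
  "('k, 'w, 'v, 'e) bundle_data \<Rightarrow> nat \<Rightarrow> nat \<Rightarrow>
   ('k, ('v \<times> ('e \<times> 'w \<Rightarrow> 'k) set set set \<Rightarrow> 'k) set set) module"
  where "HB D p q = cohomology (\<lambda>p. forms_HN D p q) (nabla_q_ext D q) p"

definition HE :: "('k, 'w, 'v, 'e) bundle_data \<Rightarrow> nat \<Rightarrow> ('k, ('e \<times> 'w \<Rightarrow> 'k) set set) module"
  where "HE D k = cohomology (cochains D) (nabla D) k"

section \<open>The spectral sequence of the bundle\<close>

text \<open>The filtered complex is extended to integer indices by \<open>C\<^sup>n = 0\<close> for \<open>n < 0\<close> and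
  \<open>F\<^sup>m C = F\<^sup>0 C\<close> for \<open>m < 0\<close> (which is all of \<open>C\<close>, the maps \<open>\<sigma>\<^sub>E\<close> being given by the
  action for \<open>m = 0\<close>).\<close>

definition int_cochains ::
  "('k, 'w, 'v, 'e) bundle_data \<Rightarrow> int \<Rightarrow> ('k, 'v, 'w, ('e \<times> 'w \<Rightarrow> 'k) set) bimod"
  where "int_cochains D n =
     (if n < 0 then (cochains D 0)\<lparr>carrier := {\<zero>\<^bsub>cochains D 0\<^esub>}\<rparr> else cochains D (nat n))"

definition int_nabla ::
  "('k, 'w, 'v, 'e) bundle_data \<Rightarrow> int \<Rightarrow> ('e \<times> 'w \<Rightarrow> 'k) set \<Rightarrow> ('e \<times> 'w \<Rightarrow> 'k) set"
  where "int_nabla D n x = (if n < 0 then \<zero>\<^bsub>cochains D 0\<^esub> else nabla D (nat n) x)"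

definition int_filt :: "('k, 'w, 'v, 'e) bundle_data \<Rightarrow> int \<Rightarrow> int \<Rightarrow> ('e \<times> 'w \<Rightarrow> 'k) set set"
  where "int_filt D m n = (if n < 0 then {\<zero>\<^bsub>cochains D 0\<^esub>} else filt D (nat m) (nat n))"

abbreviation page ::
  "('k, 'w, 'v, 'e) bundle_data \<Rightarrow> nat \<Rightarrow> int \<Rightarrow> int \<Rightarrow> ('k, ('e \<times> 'w \<Rightarrow> 'k) set set) module"
  where "page D \<equiv> ss_page (int_cochains D) (int_nabla D) (int_filt D)"

abbreviation page_diff ::
  "('k, 'w, 'v, 'e) bundle_data \<Rightarrow> nat \<Rightarrow> int \<Rightarrow> int \<Rightarrow>
   ('e \<times> 'w \<Rightarrow> 'k) set set \<Rightarrow> ('e \<times> 'w \<Rightarrow> 'k) set set"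
  where "page_diff D \<equiv> ss_diff (int_cochains D) (int_nabla D) (int_filt D)"

text \<open>The canonical maps induced on the first two pages by \<open>x \<mapsto> [[x]]\<close> and
  \<open>x \<mapsto> g_hat\<^sup>-\<^sup>1 [[x]]\<close>.\<close>

definition page1_map ::
  "('k, 'w, 'v, 'e) bundle_data \<Rightarrow> nat \<Rightarrow> nat \<Rightarrow> ('e \<times> 'w \<Rightarrow> 'k) set set \<Rightarrow> ('e \<times> 'w \<Rightarrow> 'k) set set set"
  where "page1_map D p q X = (\<Union>x\<in>X. HM_class D p q (M_class D p q x))"

definition page2_map ::
  "('k, 'w, 'v, 'e) bundle_data \<Rightarrow> nat \<Rightarrow> nat \<Rightarrow> ('e \<times> 'w \<Rightarrow> 'k) set set \<Rightarrow>
   ('v \<times> ('e \<times> 'w \<Rightarrow> 'k) set set set \<Rightarrow> 'k) set set"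
  where "page2_map D p q =
     quot_map (forms_HN D p q) (coboundaries (\<lambda>p. forms_HN D p q) (nabla_q_ext D q) p)
       (\<lambda>x. g_hat_inv D p q (HM_class D p q (M_class D p q x)))"

end

theory Submission
  imports Defs
begin

text \<open>Write \<open>L\<^sub>\<xi> x = (\<sigma>\<^sub>E \<and> id)(\<xi> \<otimes> x)\<close>. Extendability says that \<open>L\<close> is an action of \<open>\<Omega>\<^sub>B\<close> on
  \<open>C\<close>, and zero curvature gives the graded Leibniz rule
  \<open>\<nabla> (L\<^sub>\<xi> x) = L\<^sub>d\<^sub>\<xi> x + (-1)\<^sup>m L\<^sub>\<xi> (\<nabla> x)\<close>, since it holds in degree 0 and on exact 1-forms and is stable
  under products. So \<open>F\<^sup>m C = L\<^sub>\<Omega>\<^sub>m C\<close> is a filtration by subcomplexes, bounded in each degree, and the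
  general spectral sequence of a filtered complex applies; over a field the limit splits as a direct sum.
  The Leibniz rule also shows that \<open>g\<close> commutes with the differentials up to a sign, and flatness lets
  \<open>\<Omega>\<^sup>p\<^sub>B \<otimes>\<close> commute with cohomology, which identifies the first page. Finally, the Leibniz rule
  modulo \<open>F\<^sup>p\<^sup>+\<^sup>2\<close> is the formula for \<open>\<nabla>\<^sub>q\<close> extended to \<open>\<Omega>\<^sup>p\<^sub>B \<otimes> H\<^sup>q(N)\<close>, so the first differential
  is this extension.\<close>

section \<open>Linear maps and quotients\<close>

text \<open>Two gaps separate the flatness hypothesis from its use: it speaks of test modules of one
  element type, whereas elements of \<open>N_mod D q\<close> are sets of cosets of functions, and it
  starts in degree 1. A finiteness argument closes the former: a tensor that dies in a larger module
  dies already over a finitely generated piece of it, and such a piece has a copy in the test type.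
  In degree 0 the forms are \<open>B\<close> itself, which is always flat. Well-definedness is the
  other obstacle. Maps on tensor products are given by formulas on pure tensors, and balancedness
  over \<open>B\<close> of the formula for the extended connection would require the Leibniz rule of
  \<open>nabla_q\<close>. Instead the formula is compared on pure tensors with a map already known
  to be linear, the differential of the first page conjugated by \<open>g_hat\<close>; linearity and
  vanishing square are inherited. The same device treats \<open>g_hat\<close> as the composite of
  \<open>comparison\<close> and \<open>g_coh\<close>. The complex is continued by zero to negative
  degrees so that the general theory of filtered complexes has no special case for incoming
  differentials.\<close>

lemma coset_carrier_update [simp]:
  "a_r_coset (V\<lparr>carrier := U\<rparr>) = a_r_coset V"
  "set_add (V\<lparr>carrier := U\<rparr>) = set_add V"
  by (auto simp: fun_eq_iff a_r_coset_def r_coset_def set_add_def set_mult_def)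

text \<open>Cosets, their sums and the maps induced on them read only the addition of a record.
  Shrinking the carrier to cocycles or to a filtration step changes none of them, so quotients of
  subspaces can be compared by rewriting.\<close>

lemma quot_map_carrier_update [simp]: "quot_map (V\<lparr>carrier := U\<rparr>) = quot_map V"
  by (simp add: fun_eq_iff quot_map_def)

lemma quot_space_fields [simp]:
  "carrier (quot_space V H) = (\<lambda>x. H +>\<^bsub>V\<^esub> x) ` carrier V"
  "zero (quot_space V H) = H"
  "add (quot_space V H) = set_add V"
  "smult (quot_space V H) c = quot_map V H (\<lambda>x. c \<odot>\<^bsub>V\<^esub> x)"
  by (auto simp: quot_space_def A_RCOSETS_def')

lemma quot_bimod_fields [simp]:
  "carrier (quot_bimod V H) = (\<lambda>x. H +>\<^bsub>V\<^esub> x) ` carrier V"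
  "zero (quot_bimod V H) = H"
  "add (quot_bimod V H) = set_add V"
  "smult (quot_bimod V H) c = quot_map V H (\<lambda>x. c \<odot>\<^bsub>V\<^esub> x)"
  "lact (quot_bimod V H) b = quot_map V H (\<lambda>x. b \<triangleright>\<^bsub>V\<^esub> x)"
  "ract (quot_bimod V H) X a = quot_map V H (\<lambda>x. x \<triangleleft>\<^bsub>V\<^esub> a) X"
  by (auto simp: quot_bimod_def A_RCOSETS_def')

text \<open>Transfers the module axioms between records of different extension types, such as plain
  modules, bimodules and pieces of a calculus; only the fields that enter the axioms are
  compared.\<close>

lemma module_cong:
  assumes "module K V" "carrier V = carrier W" "zero V = zero W" "add V = add W" "smult V = smult W"
  shows "module K W"
proof -
  interpret V: module K V by fact
  note eq = assms(2-5)[symmetric]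
  have "\<exists>y\<in>carrier V. y \<oplus>\<^bsub>V\<^esub> x = \<zero>\<^bsub>V\<^esub>" if "x \<in> carrier V" for x
    using that V.l_neg by blast
  then have "abelian_group W"
    by (intro abelian_groupI) (auto simp: eq V.a_ac)
  then show ?thesis
    using assms V.smult_l_distr V.smult_r_distr V.smult_assoc1 V.smult_one V.smult_closed module.axioms(1)[OF assms(1)]
    by (intro moduleI) auto
qed

lemma lin_mapsI:
  assumes "\<And>x. x \<in> carrier V \<Longrightarrow> f x \<in> carrier W"
    and "\<And>x y. \<lbrakk>x \<in> carrier V; y \<in> carrier V\<rbrakk> \<Longrightarrow> f (x \<oplus>\<^bsub>V\<^esub> y) = f x \<oplus>\<^bsub>W\<^esub> f y"
    and "\<And>c x. \<lbrakk>c \<in> carrier K; x \<in> carrier V\<rbrakk> \<Longrightarrow> f (c \<odot>\<^bsub>V\<^esub> x) = c \<odot>\<^bsub>W\<^esub> f x"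
  shows "f \<in> lin_maps K V W"
  using assms by (auto simp: lin_maps_def)

lemma lin_maps_closed: "\<lbrakk>f \<in> lin_maps K V W; x \<in> carrier V\<rbrakk> \<Longrightarrow> f x \<in> carrier W"
  by (auto simp: lin_maps_def)

lemma lin_maps_add:
  "\<lbrakk>f \<in> lin_maps K V W; x \<in> carrier V; y \<in> carrier V\<rbrakk> \<Longrightarrow> f (x \<oplus>\<^bsub>V\<^esub> y) = f x \<oplus>\<^bsub>W\<^esub> f y"
  by (auto simp: lin_maps_def)

lemma lin_maps_smult:
  "\<lbrakk>f \<in> lin_maps K V W; c \<in> carrier K; x \<in> carrier V\<rbrakk> \<Longrightarrow> f (c \<odot>\<^bsub>V\<^esub> x) = c \<odot>\<^bsub>W\<^esub> f x"
  by (auto simp: lin_maps_def)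

lemma lin_maps_comp:
  "\<lbrakk>f \<in> lin_maps K U V; g \<in> lin_maps K V W\<rbrakk> \<Longrightarrow> (\<lambda>x. g (f x)) \<in> lin_maps K U W"
  by (auto simp: lin_maps_def Pi_def)

text \<open>The module axioms keep sums and multiples inside the carrier, the only place where
  \<open>f\<close> and \<open>g\<close> are known to agree.\<close>

lemma lin_maps_cong:
  "\<lbrakk>f \<in> lin_maps K V W; \<And>x. x \<in> carrier V \<Longrightarrow> f x = g x; module K V\<rbrakk> \<Longrightarrow> g \<in> lin_maps K V W"
  by (auto simp: lin_maps_def Pi_def abelian_monoid.a_closed abelian_group_def module_def
      module.smult_closed)

lemma lin_maps_restrict:
  "\<lbrakk>f \<in> lin_maps K V W; U \<subseteq> carrier V; \<And>x. x \<in> U \<Longrightarrow> f x \<in> U'\<rbrakk>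
    \<Longrightarrow> f \<in> lin_maps K (V\<lparr>carrier := U\<rparr>) (W\<lparr>carrier := U'\<rparr>)"
  by (auto simp: lin_maps_def Pi_def subset_iff)

lemma
  assumes "module K V" "module K W" "f \<in> lin_maps K V W"
  shows lin_maps_zero: "f \<zero>\<^bsub>V\<^esub> = \<zero>\<^bsub>W\<^esub>"
    and lin_maps_minus: "\<lbrakk>x \<in> carrier V; y \<in> carrier V\<rbrakk> \<Longrightarrow> f (x \<ominus>\<^bsub>V\<^esub> y) = f x \<ominus>\<^bsub>W\<^esub> f y"
    and lin_maps_finsum: "\<lbrakk>g \<in> S \<rightarrow> carrier V\<rbrakk> \<Longrightarrow>
      f (\<Oplus>\<^bsub>V\<^esub>i\<in>S. g i) = (\<Oplus>\<^bsub>W\<^esub>i\<in>S. f (g i))"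
proof -
  interpret V: module K V by fact
  interpret W: module K W by fact
  note cl = lin_maps_closed[OF assms(3)]
  \<comment> \<open>\<open>lin_maps\<close> does not list \<open>f 0 = 0\<close>; it results from
    scaling the zero vector by the scalar 0.\<close>
  show z: "f \<zero>\<^bsub>V\<^esub> = \<zero>\<^bsub>W\<^esub>"
    using lin_maps_smult[OF assms(3), of "\<zero>\<^bsub>K\<^esub>" "\<zero>\<^bsub>V\<^esub>"] cl by simp
  have n: "f (\<ominus>\<^bsub>V\<^esub> x) = \<ominus>\<^bsub>W\<^esub> f x" if "x \<in> carrier V" for x
    using lin_maps_add[OF assms(3), of x "\<ominus>\<^bsub>V\<^esub> x"] that cl z
    by (simp add: V.r_neg) (metis V.a_inv_closed W.minus_equality W.a_comm)
  show "f (x \<ominus>\<^bsub>V\<^esub> y) = f x \<ominus>\<^bsub>W\<^esub> f y" if "x \<in> carrier V" "y \<in> carrier V" for x y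
    using that by (simp add: V.minus_eq W.minus_eq lin_maps_add[OF assms(3)] n)
  show "f (\<Oplus>\<^bsub>V\<^esub>i\<in>S. g i) = (\<Oplus>\<^bsub>W\<^esub>i\<in>S. f (g i))" if "g \<in> S \<rightarrow> carrier V"
    using that
  proof (induction S rule: infinite_finite_induct)
    case (insert x F)
    then have "(\<lambda>i. f (g i)) \<in> F \<rightarrow> carrier W" using cl by (auto simp: Pi_def)
    then show ?case using insert cl by (auto simp: Pi_def lin_maps_add[OF assms(3)])
  qed (auto simp: z)
qed

lemma minus_zero_iff:
  assumes "module K V" "x \<in> carrier V" "y \<in> carrier V"
  shows "x \<ominus>\<^bsub>V\<^esub> y = \<zero>\<^bsub>V\<^esub> \<longleftrightarrow> x = y"
proof -
  interpret V: module K V by fact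
  show ?thesis
    using assms(2,3) V.minus_equality[of x "\<ominus>\<^bsub>V\<^esub> y"] by (auto simp: V.minus_eq V.r_neg)
qed

section \<open>Subspaces\<close>

lemma submodule_subset: "submodule H K V \<Longrightarrow> H \<subseteq> carrier V"
  by (auto simp: submodule_def subgroup_def)

lemma
  assumes "module K V" "submodule H K V"
  shows submodule_zero: "\<zero>\<^bsub>V\<^esub> \<in> H"
    and submodule_neg: "x \<in> H \<Longrightarrow> \<ominus>\<^bsub>V\<^esub> x \<in> H"
    and submodule_add: "\<lbrakk>x \<in> H; y \<in> H\<rbrakk> \<Longrightarrow> x \<oplus>\<^bsub>V\<^esub> y \<in> H"
    and submodule_minus: "\<lbrakk>x \<in> H; y \<in> H\<rbrakk> \<Longrightarrow> x \<ominus>\<^bsub>V\<^esub> y \<in> H"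
    and submodule_smult: "\<lbrakk>c \<in> carrier K; x \<in> H\<rbrakk> \<Longrightarrow> c \<odot>\<^bsub>V\<^esub> x \<in> H"
proof -
  interpret V: module K V by fact
  note s = V.submoduleE[OF assms(2)]
  show z: "\<zero>\<^bsub>V\<^esub> \<in> H"
    using assms(2) by (auto simp: submodule_def subgroup_def)
  show "\<ominus>\<^bsub>V\<^esub> x \<in> H" if "x \<in> H" for x using s that by blast
  show "x \<oplus>\<^bsub>V\<^esub> y \<in> H" if "x \<in> H" "y \<in> H" for x y using s that by blast
  show "x \<ominus>\<^bsub>V\<^esub> y \<in> H" if "x \<in> H" "y \<in> H" for x y using s that by (simp add: V.minus_eq)
  show "c \<odot>\<^bsub>V\<^esub> x \<in> H" if "c \<in> carrier K" "x \<in> H" for c x using s that by blast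
qed

text \<open>Closure under negation comes for free, negation being multiplication by the scalar
  -1.\<close>

lemma submoduleI':
  assumes "module K V" "H \<subseteq> carrier V" "\<zero>\<^bsub>V\<^esub> \<in> H"
    and "\<And>x y. \<lbrakk>x \<in> H; y \<in> H\<rbrakk> \<Longrightarrow> x \<oplus>\<^bsub>V\<^esub> y \<in> H"
    and "\<And>c x. \<lbrakk>c \<in> carrier K; x \<in> H\<rbrakk> \<Longrightarrow> c \<odot>\<^bsub>V\<^esub> x \<in> H"
  shows "submodule H K V"
proof -
  interpret V: module K V by fact
  show ?thesis
  proof (rule V.submoduleI)
    fix a assume a: "a \<in> H"
    then have "\<ominus>\<^bsub>V\<^esub> a = (\<ominus>\<^bsub>K\<^esub> \<one>\<^bsub>K\<^esub>) \<odot>\<^bsub>V\<^esub> a"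
      using assms(2) by (subst V.smult_l_minus) auto
    then show "\<ominus>\<^bsub>V\<^esub> a \<in> H" using assms(5) a by auto
  qed (use assms in auto)
qed

lemma module_restrict: "\<lbrakk>module K V; submodule U K V\<rbrakk> \<Longrightarrow> module K (V\<lparr>carrier := U\<rparr>)"
  by (rule submodule.submodule_is_module)

lemma submodule_restrict:
  assumes "module K V" "submodule U K V" "submodule H K V" "H \<subseteq> U"
  shows "submodule H K (V\<lparr>carrier := U\<rparr>)"
  by (rule submoduleI'[OF module_restrict[OF assms(1,2)]])
    (use assms in \<open>auto simp: submodule_zero[OF assms(1,3)] submodule_add[OF assms(1,3)]
      submodule_smult[OF assms(1,3)]\<close>)

lemma submodule_carrier: "module K V \<Longrightarrow> submodule (carrier V) K V"
  by (rule module.carrier_is_submodule)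

lemma submodule_zero_set: "module K V \<Longrightarrow> submodule {\<zero>\<^bsub>V\<^esub>} K V"
proof -
  assume "module K V"
  then interpret V: module K V .
  show ?thesis by (rule submoduleI') (auto simp: V.module_axioms)
qed

lemma submodule_Int:
  assumes "module K V" "submodule U K V" "submodule H K V"
  shows "submodule (U \<inter> H) K V"
  by (rule submoduleI'[OF assms(1)])
    (use assms submodule_subset[OF assms(2)] in \<open>auto simp: submodule_zero submodule_add submodule_smult\<close>)

lemma set_add_iff: "x \<in> U <+>\<^bsub>V\<^esub> H \<longleftrightarrow> (\<exists>u\<in>U. \<exists>h\<in>H. x = u \<oplus>\<^bsub>V\<^esub> h)"
  by (auto simp: set_add_def')

lemma set_addI: "\<lbrakk>u \<in> U; h \<in> H\<rbrakk> \<Longrightarrow> u \<oplus>\<^bsub>V\<^esub> h \<in> U <+>\<^bsub>V\<^esub> H"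
  by (auto simp: set_add_iff)

lemma submodule_set_add:
  assumes "module K V" "submodule U K V" "submodule H K V"
  shows "submodule (U <+>\<^bsub>V\<^esub> H) K V"
proof -
  interpret V: module K V by fact
  note su = submodule_subset[OF assms(2)] submodule_subset[OF assms(3)]
  show ?thesis
  proof (rule submoduleI'[OF assms(1)])
    show "U <+>\<^bsub>V\<^esub> H \<subseteq> carrier V" using su by (auto simp: set_add_iff subset_iff)
    show "\<zero>\<^bsub>V\<^esub> \<in> U <+>\<^bsub>V\<^esub> H"
      using submodule_zero[OF assms(1,2)] submodule_zero[OF assms(1,3)] by (force simp: set_add_iff)
    fix x y assume "x \<in> U <+>\<^bsub>V\<^esub> H" "y \<in> U <+>\<^bsub>V\<^esub> H"
    then obtain u h u' h' where *: "u \<in> U" "u' \<in> U" "h \<in> H" "h' \<in> H"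
      "x = u \<oplus>\<^bsub>V\<^esub> h" "y = u' \<oplus>\<^bsub>V\<^esub> h'" by (auto simp: set_add_iff)
    then have "x \<oplus>\<^bsub>V\<^esub> y = (u \<oplus>\<^bsub>V\<^esub> u') \<oplus>\<^bsub>V\<^esub> (h \<oplus>\<^bsub>V\<^esub> h')"
      using su by (simp add: V.a_ac subset_iff)
    then show "x \<oplus>\<^bsub>V\<^esub> y \<in> U <+>\<^bsub>V\<^esub> H"
      using * by (auto intro!: set_addI submodule_add[OF assms(1,2)] submodule_add[OF assms(1,3)])
  next
    fix c x assume c: "c \<in> carrier K" and "x \<in> U <+>\<^bsub>V\<^esub> H"
    then obtain u h where *: "u \<in> U" "h \<in> H" "x = u \<oplus>\<^bsub>V\<^esub> h" by (auto simp: set_add_iff)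
    then have "c \<odot>\<^bsub>V\<^esub> x = (c \<odot>\<^bsub>V\<^esub> u) \<oplus>\<^bsub>V\<^esub> (c \<odot>\<^bsub>V\<^esub> h)"
      using su c by (simp add: V.smult_r_distr subset_iff)
    then show "c \<odot>\<^bsub>V\<^esub> x \<in> U <+>\<^bsub>V\<^esub> H"
      using * c by (auto intro!: set_addI submodule_smult[OF assms(1,2)] submodule_smult[OF assms(1,3)])
  qed
qed

lemma submodule_image:
  assumes "module K V" "module K W" "f \<in> lin_maps K V W" "submodule U K V"
  shows "submodule (f ` U) K W"
proof (rule submoduleI'[OF assms(2)])
  note su = submodule_subset[OF assms(4)]
  show "f ` U \<subseteq> carrier W" using su lin_maps_closed[OF assms(3)] by auto
  show "\<zero>\<^bsub>W\<^esub> \<in> f ` U" using lin_maps_zero[OF assms(1-3)] submodule_zero[OF assms(1,4)] by force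
  show "x \<oplus>\<^bsub>W\<^esub> y \<in> f ` U" if "x \<in> f ` U" "y \<in> f ` U" for x y
  proof -
    from that obtain a b where *: "a \<in> U" "b \<in> U" "x = f a" "y = f b" by blast
    then have "x \<oplus>\<^bsub>W\<^esub> y = f (a \<oplus>\<^bsub>V\<^esub> b)" using su by (simp add: lin_maps_add[OF assms(3)] subset_iff)
    then show ?thesis using * submodule_add[OF assms(1,4)] by auto
  qed
  show "c \<odot>\<^bsub>W\<^esub> x \<in> f ` U" if "c \<in> carrier K" "x \<in> f ` U" for c x
  proof -
    from that obtain a where *: "a \<in> U" "x = f a" by auto
    then have "c \<odot>\<^bsub>W\<^esub> x = f (c \<odot>\<^bsub>V\<^esub> a)"
      using su that by (simp add: lin_maps_smult[OF assms(3)] subset_iff)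
    then show ?thesis using * submodule_smult[OF assms(1,4)] that by auto
  qed
qed

lemma submodule_preimage:
  assumes "module K V" "module K W" "f \<in> lin_maps K V W" "submodule U K V" "submodule H K W"
  shows "submodule {x \<in> U. f x \<in> H} K V"
proof (rule submoduleI'[OF assms(1)])
  note su = submodule_subset[OF assms(4)]
  note [simp] = subsetD[OF su]
  show "{x \<in> U. f x \<in> H} \<subseteq> carrier V" using su by auto
  show "\<zero>\<^bsub>V\<^esub> \<in> {x \<in> U. f x \<in> H}"
    using lin_maps_zero[OF assms(1-3)] submodule_zero[OF assms(1,4)] submodule_zero[OF assms(2,5)]
    by auto
qed (use subsetD[OF submodule_subset[OF assms(4)]] in \<open>auto simp: lin_maps_add[OF assms(3)]
    lin_maps_smult[OF assms(3)] submodule_add[OF assms(1,4)] submodule_add[OF assms(2,5)]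
    submodule_smult[OF assms(1,4)] submodule_smult[OF assms(2,5)]\<close>)

lemma submodule_kernel:
  assumes "module K V" "module K W" "f \<in> lin_maps K V W"
  shows "submodule {x \<in> carrier V. f x = \<zero>\<^bsub>W\<^esub>} K V"
  using submodule_preimage[OF assms submodule_carrier[OF assms(1)] submodule_zero_set[OF assms(2)]]
  by simp

section \<open>Cosets and maps between quotients\<close>

lemma
  assumes "module K V" "submodule H K V"
  shows coset_eq_iff: "\<lbrakk>x \<in> carrier V; y \<in> carrier V\<rbrakk> \<Longrightarrow> H +>\<^bsub>V\<^esub> x = H +>\<^bsub>V\<^esub> y \<longleftrightarrow> x \<ominus>\<^bsub>V\<^esub> y \<in> H"
    and coset_zero_iff: "x \<in> carrier V \<Longrightarrow> H +>\<^bsub>V\<^esub> x = H \<longleftrightarrow> x \<in> H"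
    and coset_self: "x \<in> carrier V \<Longrightarrow> x \<in> H +>\<^bsub>V\<^esub> x"
    and coset_mem: "\<lbrakk>x \<in> carrier V; y \<in> H +>\<^bsub>V\<^esub> x\<rbrakk> \<Longrightarrow> y \<in> carrier V \<and> H +>\<^bsub>V\<^esub> y = H +>\<^bsub>V\<^esub> x"
    and coset_add: "\<lbrakk>x \<in> carrier V; y \<in> carrier V\<rbrakk> \<Longrightarrow>
      (H +>\<^bsub>V\<^esub> x) <+>\<^bsub>V\<^esub> (H +>\<^bsub>V\<^esub> y) = H +>\<^bsub>V\<^esub> (x \<oplus>\<^bsub>V\<^esub> y)"
    and coset_zero: "H +>\<^bsub>V\<^esub> \<zero>\<^bsub>V\<^esub> = H"
proof -
  interpret V: module K V by fact
  have sg: "subgroup H (add_monoid V)" using assms(2) by (simp add: submodule_def)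
  interpret H: abelian_subgroup H V
    by (rule abelian_subgroupI3) (auto intro: additive_subgroup.intro sg V.abelian_group_axioms)
  show "x \<in> carrier V \<Longrightarrow> x \<in> H +>\<^bsub>V\<^esub> x" by (rule H.a_rcos_self)
  show "H +>\<^bsub>V\<^esub> x = H +>\<^bsub>V\<^esub> y \<longleftrightarrow> x \<ominus>\<^bsub>V\<^esub> y \<in> H" if "x \<in> carrier V" "y \<in> carrier V" for x y
    using H.a_rcos_module[of y x] H.a_repr_independence'[of x y] H.a_rcos_self[of x] that
    by (auto simp: V.minus_eq)
  show "x \<in> carrier V \<Longrightarrow> H +>\<^bsub>V\<^esub> x = H \<longleftrightarrow> x \<in> H" for x
    by (metis H.a_rcos_self H.a_rcos_const)
  show "\<lbrakk>x \<in> carrier V; y \<in> H +>\<^bsub>V\<^esub> x\<rbrakk> \<Longrightarrow> y \<in> carrier V \<and> H +>\<^bsub>V\<^esub> y = H +>\<^bsub>V\<^esub> x"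
    using H.a_repr_independence'[of y x] H.a_elemrcos_carrier by auto
  show "\<lbrakk>x \<in> carrier V; y \<in> carrier V\<rbrakk> \<Longrightarrow>
      (H +>\<^bsub>V\<^esub> x) <+>\<^bsub>V\<^esub> (H +>\<^bsub>V\<^esub> y) = H +>\<^bsub>V\<^esub> (x \<oplus>\<^bsub>V\<^esub> y)" by (rule H.a_rcos_sum)
  show "H +>\<^bsub>V\<^esub> \<zero>\<^bsub>V\<^esub> = H" by (rule H.a_rcos_const) simp
qed

text \<open>The condition on \<open>f\<close> says that it descends to a map from the cosets of \<open>H\<close> to the cosets
  of \<open>H'\<close>; \<open>f\<close> itself need not be linear.\<close>

lemma quot_map_coset:
  assumes "module K V" "submodule H K V" "x \<in> carrier V"
    and "\<And>y. \<lbrakk>y \<in> carrier V; H +>\<^bsub>V\<^esub> y = H +>\<^bsub>V\<^esub> x\<rbrakk> \<Longrightarrow> H' +>\<^bsub>W\<^esub> f y = H' +>\<^bsub>W\<^esub> f x"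
  shows "quot_map W H' f (H +>\<^bsub>V\<^esub> x) = H' +>\<^bsub>W\<^esub> f x"
proof -
  have "H' +>\<^bsub>W\<^esub> f y = H' +>\<^bsub>W\<^esub> f x" if "y \<in> H +>\<^bsub>V\<^esub> x" for y
    using coset_mem[OF assms(1-3) that] assms(4) by blast
  then show ?thesis
    using coset_self[OF assms(1-3)] unfolding quot_map_def by blast
qed

text \<open>The main tool for evaluating induced maps: \<open>f\<close> preserves differences, so
  representatives that differ by \<open>H\<close> have images that differ by
  \<open>H'\<close>.\<close>

lemma quot_map_linear:
  assumes "module K V" "module K W" "f \<in> lin_maps K V W" "submodule H K V" "submodule H' K W"
    "f ` H \<subseteq> H'" "x \<in> carrier V"
  shows "quot_map W H' f (H +>\<^bsub>V\<^esub> x) = H' +>\<^bsub>W\<^esub> f x"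
  by (rule quot_map_coset[OF assms(1,4,7)])
    (use assms in \<open>auto simp: coset_eq_iff[OF assms(1,4)] coset_eq_iff[OF assms(2,5)]
      lin_maps_minus[OF assms(1-3), symmetric] lin_maps_closed[OF assms(3)]\<close>)

lemma coset_smult:
  assumes "module K V" "submodule H K V" "x \<in> carrier V" "c \<in> carrier K"
  shows "quot_map V H (\<lambda>x. c \<odot>\<^bsub>V\<^esub> x) (H +>\<^bsub>V\<^esub> x) = H +>\<^bsub>V\<^esub> (c \<odot>\<^bsub>V\<^esub> x)"
proof -
  interpret V: module K V by fact
  show ?thesis
    by (rule quot_map_linear[OF assms(1,1) _ assms(2,2) _ assms(3)], rule lin_mapsI)
      (use assms submodule_smult[OF assms(1,2)] in
        \<open>auto simp: V.smult_r_distr V.smult_assoc1[symmetric] V.R.m_comm\<close>)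
qed

lemma module_quot_space:
  assumes "module K V" "submodule H K V"
  shows "module K (quot_space V H)"
proof -
  interpret V: module K V by fact
  note ca = coset_add[OF assms] and cs = coset_smult[OF assms] and cz = coset_zero[OF assms]
  have cc: "H +>\<^bsub>V\<^esub> (x \<oplus>\<^bsub>V\<^esub> y) = H +>\<^bsub>V\<^esub> (y \<oplus>\<^bsub>V\<^esub> x)" if "x \<in> carrier V" "y \<in> carrier V" for x y
    using that by (simp add: V.a_comm)
  have c0: "H <+>\<^bsub>V\<^esub> (H +>\<^bsub>V\<^esub> x) = H +>\<^bsub>V\<^esub> x" if "x \<in> carrier V" for x
    using ca[OF V.zero_closed that] that by (simp add: cz)
  show ?thesis
  proof (rule moduleI)
    show "abelian_group (quot_space V H)"
    proof (rule abelian_groupI)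
      show "\<exists>y\<in>carrier (quot_space V H). y \<oplus>\<^bsub>quot_space V H\<^esub> x = \<zero>\<^bsub>quot_space V H\<^esub>"
        if x: "x \<in> carrier (quot_space V H)" for x
      proof -
        obtain a where a: "a \<in> carrier V" "x = H +>\<^bsub>V\<^esub> a" using x by auto
        then have "(H +>\<^bsub>V\<^esub> \<ominus>\<^bsub>V\<^esub> a) <+>\<^bsub>V\<^esub> x = H" by (simp add: ca cz V.l_neg)
        then show ?thesis using a by auto
      qed
      show "\<zero>\<^bsub>quot_space V H\<^esub> \<in> carrier (quot_space V H)"
        using cz by (force simp: image_iff)
    qed (use cc in \<open>auto simp: ca c0 V.a_assoc\<close>)
  qed (auto simp: ca cs module.axioms(1)[OF assms(1)] V.smult_l_distr V.smult_r_distr V.smult_assoc1)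
qed

lemma module_quot_bimod: "\<lbrakk>module K V; submodule H K V\<rbrakk> \<Longrightarrow> module K (quot_bimod V H)"
  by (rule module_cong[OF module_quot_space]) (auto simp: fun_eq_iff)

lemma coset_linear:
  "\<lbrakk>module K V; submodule H K V\<rbrakk> \<Longrightarrow> (\<lambda>x. H +>\<^bsub>V\<^esub> x) \<in> lin_maps K V (quot_space V H)"
  by (rule lin_mapsI) (auto simp: coset_add coset_smult)

section \<open>Isomorphisms and the first isomorphism theorem\<close>

lemma lin_isosI:
  assumes "module K V" "module K W" "f \<in> lin_maps K V W" "carrier W \<subseteq> f ` carrier V"
    and "\<And>x. \<lbrakk>x \<in> carrier V; f x = \<zero>\<^bsub>W\<^esub>\<rbrakk> \<Longrightarrow> x = \<zero>\<^bsub>V\<^esub>"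
  shows "f \<in> lin_isos K V W"
proof -
  interpret V: module K V by fact
  interpret W: module K W by fact
  note cl = lin_maps_closed[OF assms(3)]
  have "inj_on f (carrier V)"
  proof (rule inj_onI)
    fix x y assume *: "x \<in> carrier V" "y \<in> carrier V" "f x = f y"
    then have "f (x \<ominus>\<^bsub>V\<^esub> y) = \<zero>\<^bsub>W\<^esub>"
      by (simp add: lin_maps_minus[OF assms(1-3)] cl W.minus_eq W.r_neg)
    then have "x \<ominus>\<^bsub>V\<^esub> y = \<zero>\<^bsub>V\<^esub>" using assms(5) * by auto
    then show "x = y" using * minus_zero_iff[OF assms(1)] by simp
  qed
  then show ?thesis using assms(3,4) cl by (auto simp: lin_isos_def bij_betw_def)
qed

lemma lin_isosD:
  assumes "f \<in> lin_isos K V W"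
  shows "f \<in> lin_maps K V W" "inj_on f (carrier V)" "f ` carrier V = carrier W"
  using assms by (auto simp: lin_isos_def bij_betw_def)

lemma lin_isos_comp:
  "\<lbrakk>f \<in> lin_isos K U V; g \<in> lin_isos K V W\<rbrakk> \<Longrightarrow> (\<lambda>x. g (f x)) \<in> lin_isos K U W"
  using bij_betw_trans[of f _ _ g] by (auto simp: lin_isos_def lin_maps_comp comp_def)

lemma lin_isos_cong:
  "\<lbrakk>f \<in> lin_isos K V W; \<And>x. x \<in> carrier V \<Longrightarrow> f x = g x; module K V\<rbrakk> \<Longrightarrow> g \<in> lin_isos K V W"
  unfolding lin_isos_def mem_Collect_eq
  using lin_maps_cong[of f K V W g] bij_betw_cong[of "carrier V" f g "carrier W"] by blast

lemma inv_lin_isos: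
  assumes "module K V" "f \<in> lin_isos K V W"
  shows "inv_into (carrier V) f \<in> lin_isos K W V"
proof -
  interpret V: module K V by fact
  let ?g = "inv_into (carrier V) f"
  note f = lin_isosD[OF assms(2)]
  have bij: "bij_betw f (carrier V) (carrier W)" using assms(2) by (simp add: lin_isos_def)
  have gf: "?g (f x) = x" if "x \<in> carrier V" for x using that f(2) by simp
  have "?g \<in> lin_maps K W V"
  proof (rule lin_mapsI)
    fix x assume "x \<in> carrier W" then show "?g x \<in> carrier V" using f(3) by (metis inv_into_into)
  next
    fix x y assume "x \<in> carrier W" "y \<in> carrier W"
    then obtain a b where "a \<in> carrier V" "b \<in> carrier V" "x = f a" "y = f b" using f(3) by blast
    then show "?g (x \<oplus>\<^bsub>W\<^esub> y) = ?g x \<oplus>\<^bsub>V\<^esub> ?g y"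
      by (simp add: gf lin_maps_add[OF f(1), symmetric])
  next
    fix c x assume "c \<in> carrier K" "x \<in> carrier W"
    then obtain a where "a \<in> carrier V" "x = f a" "c \<in> carrier K" using f(3) by blast
    then show "?g (c \<odot>\<^bsub>W\<^esub> x) = c \<odot>\<^bsub>V\<^esub> ?g x"
      by (simp add: gf lin_maps_smult[OF f(1), symmetric])
  qed
  then show ?thesis using bij_betw_inv_into[OF bij] by (simp add: lin_isos_def)
qed

text \<open>First isomorphism theorem for a prescribed \<open>F\<close>. The canonical maps of the
  theorem are explicit formulas on cosets, so bijectivity must be shown for those formulas and not
  for an isomorphism of one's own choice; it suffices to evaluate \<open>F\<close> on
  cosets.\<close>

lemma factor_iso:
  assumes "module K V" "module K W" "f \<in> lin_maps K V W" "carrier W \<subseteq> f ` carrier V"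
    and H: "H = {x \<in> carrier V. f x = \<zero>\<^bsub>W\<^esub>}"
    and F: "\<And>x. x \<in> carrier V \<Longrightarrow> F (H +>\<^bsub>V\<^esub> x) = f x"
  shows "F \<in> lin_isos K (quot_space V H) W"
proof -
  interpret V: module K V by fact
  have sH: "submodule H K V" unfolding H by (rule submodule_kernel[OF assms(1-3)])
  show ?thesis
  proof (rule lin_isosI[OF module_quot_space[OF assms(1) sH] assms(2)])
    show "F \<in> lin_maps K (quot_space V H) W"
      by (rule lin_mapsI) (auto simp: F coset_add[OF assms(1) sH] coset_smult[OF assms(1) sH]
          lin_maps_add[OF assms(3)] lin_maps_smult[OF assms(3)] lin_maps_closed[OF assms(3)])
    show "carrier W \<subseteq> F ` carrier (quot_space V H)" using assms(4) F by (force simp: image_image)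
    show "x = \<zero>\<^bsub>quot_space V H\<^esub>" if x: "x \<in> carrier (quot_space V H)" "F x = \<zero>\<^bsub>W\<^esub>" for x
    proof -
      obtain a where a: "a \<in> carrier V" "x = H +>\<^bsub>V\<^esub> a" using x by auto
      then have "a \<in> H" using x(2) F H by auto
      then show ?thesis using a coset_zero_iff[OF assms(1) sH] by simp
    qed
  qed
qed

text \<open>The existential version, for passing to the next page and for the limit. Since
  \<open>f\<close> is constant on each coset of its kernel, any choice of representatives defines
  the isomorphism.\<close>

lemma factor_isomorphic:
  assumes "module K V" "module K W" "f \<in> lin_maps K V W" "carrier W \<subseteq> f ` carrier V"
    and H: "H = {x \<in> carrier V. f x = \<zero>\<^bsub>W\<^esub>}"
  shows "lin_isomorphic K (quot_space V H) W"
proof -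
  have sH: "submodule H K V" unfolding H by (rule submodule_kernel[OF assms(1-3)])
  interpret W: module K W by fact
  have "(\<lambda>X. f (SOME x. x \<in> X)) \<in> lin_isos K (quot_space V H) W"
  proof (rule factor_iso[OF assms])
    fix x assume x: "x \<in> carrier V"
    then have "(SOME y. y \<in> H +>\<^bsub>V\<^esub> x) \<in> H +>\<^bsub>V\<^esub> x" (is "?y \<in> _")
      by (intro someI[of "\<lambda>y. y \<in> H +>\<^bsub>V\<^esub> x" x] coset_self[OF assms(1) sH])
    from coset_mem[OF assms(1) sH x this] have y: "?y \<in> carrier V" "?y \<ominus>\<^bsub>V\<^esub> x \<in> H"
      using coset_eq_iff[OF assms(1) sH _ x] by blast+
    then have "f ?y \<ominus>\<^bsub>W\<^esub> f x = \<zero>\<^bsub>W\<^esub>" using x H by (simp add: lin_maps_minus[OF assms(1-3)])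
    then show "f ?y = f x" using x y lin_maps_closed[OF assms(3)] minus_zero_iff[OF assms(2)] by simp
  qed
  then show ?thesis by (auto simp: lin_isomorphic_def)
qed

lemma
  assumes "module K V" "S \<subseteq> carrier V"
  shows submodule_lin_span: "submodule (lin_span K V S) K V"
    and lin_span_superset: "S \<subseteq> lin_span K V S"
proof -
  let ?A = "{H. submodule H K V \<and> S \<subseteq> H}"
  have ne: "carrier V \<in> ?A" using assms submodule_carrier by auto
  show "S \<subseteq> lin_span K V S" by (auto simp: lin_span_def)
  show "submodule (lin_span K V S) K V"
  proof (rule submoduleI'[OF assms(1)])
    show "lin_span K V S \<subseteq> carrier V" using ne by (auto simp: lin_span_def)
  qed (auto simp: lin_span_def submodule_zero[OF assms(1)] submodule_add[OF assms(1)]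
      submodule_smult[OF assms(1)])
qed

lemma lin_span_minimal: "\<lbrakk>submodule H K V; S \<subseteq> H\<rbrakk> \<Longrightarrow> lin_span K V S \<subseteq> H"
  by (auto simp: lin_span_def)

section \<open>Tensor products\<close>

lemma free_space_fields [simp]:
  "zero (free_space K S) = (\<lambda>s. \<zero>\<^bsub>K\<^esub>)"
  "add (free_space K S) = (\<lambda>\<phi> \<psi> s. \<phi> s \<oplus>\<^bsub>K\<^esub> \<psi> s)"
  "smult (free_space K S) = (\<lambda>c \<phi> s. c \<otimes>\<^bsub>K\<^esub> \<phi> s)"
  by (simp_all add: free_space_def)

lemma free_space_carrier:
  "\<phi> \<in> carrier (free_space K S) \<longleftrightarrow> (\<forall>s\<in>S. \<phi> s \<in> carrier K) \<and> (\<forall>s. s \<notin> S \<longrightarrow> \<phi> s = \<zero>\<^bsub>K\<^esub>) \<and>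
     finite {s. \<phi> s \<noteq> \<zero>\<^bsub>K\<^esub>}"
  by (simp add: free_space_def)

lemma free_space_value: "\<lbrakk>cring K; \<phi> \<in> carrier (free_space K S)\<rbrakk> \<Longrightarrow> \<phi> s \<in> carrier K"
  by (cases "s \<in> S") (auto simp: free_space_carrier cring_def ring.ring_simprules(2))

lemma free_space_add_closed:
  assumes "cring K" "\<phi> \<in> carrier (free_space K S)" "\<psi> \<in> carrier (free_space K S)"
  shows "(\<lambda>s. \<phi> s \<oplus>\<^bsub>K\<^esub> \<psi> s) \<in> carrier (free_space K S)"
proof -
  interpret K: cring K by fact
  have "{s. \<phi> s \<oplus>\<^bsub>K\<^esub> \<psi> s \<noteq> \<zero>\<^bsub>K\<^esub>} \<subseteq> {s. \<phi> s \<noteq> \<zero>\<^bsub>K\<^esub>} \<union> {s. \<psi> s \<noteq> \<zero>\<^bsub>K\<^esub>}" by auto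
  then show ?thesis using assms by (auto simp: free_space_carrier intro: finite_subset)
qed

lemma free_space_smult_closed:
  assumes "cring K" "\<phi> \<in> carrier (free_space K S)" "c \<in> carrier K"
  shows "(\<lambda>s. c \<otimes>\<^bsub>K\<^esub> \<phi> s) \<in> carrier (free_space K S)"
proof -
  interpret K: cring K by fact
  have "{s. c \<otimes>\<^bsub>K\<^esub> \<phi> s \<noteq> \<zero>\<^bsub>K\<^esub>} \<subseteq> {s. \<phi> s \<noteq> \<zero>\<^bsub>K\<^esub>}" using assms(3) by auto
  then show ?thesis using assms by (auto simp: free_space_carrier intro: finite_subset)
qed

lemma module_free_space:
  assumes "cring K"
  shows "module K (free_space K S)"
proof -
  interpret K: cring K by fact
  note v [simp] = free_space_value[OF assms]
  show ?thesis
  proof (rule moduleI[OF assms])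
    show "abelian_group (free_space K S)"
    proof (rule abelian_groupI)
      show "\<exists>\<psi>\<in>carrier (free_space K S). \<psi> \<oplus>\<^bsub>free_space K S\<^esub> \<phi> = \<zero>\<^bsub>free_space K S\<^esub>"
        if "\<phi> \<in> carrier (free_space K S)" for \<phi>
      proof
        show "(\<lambda>s. (\<ominus>\<^bsub>K\<^esub> \<one>\<^bsub>K\<^esub>) \<otimes>\<^bsub>K\<^esub> \<phi> s) \<in> carrier (free_space K S)"
          using that by (simp add: free_space_smult_closed assms)
        show "(\<lambda>s. (\<ominus>\<^bsub>K\<^esub> \<one>\<^bsub>K\<^esub>) \<otimes>\<^bsub>K\<^esub> \<phi> s) \<oplus>\<^bsub>free_space K S\<^esub> \<phi> = \<zero>\<^bsub>free_space K S\<^esub>"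
          using that by (simp add: K.l_minus K.l_neg)
      qed
      show "\<zero>\<^bsub>free_space K S\<^esub> \<in> carrier (free_space K S)" by (simp add: free_space_carrier)
    qed (auto simp: free_space_add_closed[OF assms] K.a_ac)
  qed (auto simp: free_space_smult_closed[OF assms] K.l_distr K.r_distr K.m_assoc)
qed

lemma basis_vec_closed: "\<lbrakk>cring K; s \<in> S\<rbrakk> \<Longrightarrow> basis_vec K s \<in> carrier (free_space K S)"
proof -
  assume a: "cring K" "s \<in> S"
  interpret K: cring K by fact
  have "{t. basis_vec K s t \<noteq> \<zero>\<^bsub>K\<^esub>} \<subseteq> {s}" by (auto simp: basis_vec_def)
  then show ?thesis using a by (auto simp: free_space_carrier basis_vec_def intro: finite_subset)
qed

text \<open>Induction on the finite support: setting the function to zero at one point of the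
  support splits off a multiple of a basis vector.\<close>

lemma free_space_induct [consumes 2, case_names zero add]:
  assumes "cring K" "\<phi> \<in> carrier (free_space K S)"
    and zero: "P (\<lambda>s. \<zero>\<^bsub>K\<^esub>)"
    and add: "\<And>c s \<psi>. \<lbrakk>c \<in> carrier K; s \<in> S; \<psi> \<in> carrier (free_space K S); P \<psi>\<rbrakk> \<Longrightarrow>
      P ((c \<odot>\<^bsub>free_space K S\<^esub> basis_vec K s) \<oplus>\<^bsub>free_space K S\<^esub> \<psi>)"
  shows "P \<phi>"
proof -
  interpret K: cring K by fact
  have "P \<phi>" if "finite T" "{s. \<phi> s \<noteq> \<zero>\<^bsub>K\<^esub>} = T" "\<phi> \<in> carrier (free_space K S)" for T \<phi>
    using that
  proof (induction T arbitrary: \<phi> rule: finite_induct)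
    case empty
    then have "\<phi> = (\<lambda>s. \<zero>\<^bsub>K\<^esub>)" by auto
    then show ?case using zero by simp
  next
    case (insert t T)
    let ?\<psi> = "\<phi>(t := \<zero>\<^bsub>K\<^esub>)"
    note v = free_space_value[OF assms(1) insert.prems(2)]
    have eq: "{s. ?\<psi> s \<noteq> \<zero>\<^bsub>K\<^esub>} = T" using insert by auto
    have t: "t \<in> S" using insert by (auto simp: free_space_carrier)
    have c: "?\<psi> \<in> carrier (free_space K S)"
      using insert.prems(2) eq insert.hyps(1) by (auto simp: free_space_carrier)
    have "\<phi> = (\<phi> t \<odot>\<^bsub>free_space K S\<^esub> basis_vec K t) \<oplus>\<^bsub>free_space K S\<^esub> ?\<psi>"
      using v by (auto simp: basis_vec_def fun_eq_iff)
    with add[OF v[of t] t c insert.IH[OF eq c]] show ?case by (simp only:)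
  qed
  then show ?thesis using assms(2) by (auto simp: free_space_carrier)
qed

context
  fixes K :: "('k, 'r) ring_scheme" and V :: "('k, 'y, 'm) module_scheme"
    and f :: "'s \<Rightarrow> 'y" and S :: "'s set"
  assumes V: "module K V" and f: "\<And>s. s \<in> S \<Longrightarrow> f s \<in> carrier V"
begin

interpretation V: module K V by (rule V)

text \<open>Two functions and their sum have different supports. Summing over a common finite
  superset makes the three sums comparable, the additional terms being zero.\<close>

lemma free_lift_superset:
  assumes "finite T" "{s. \<phi> s \<noteq> \<zero>\<^bsub>K\<^esub>} \<subseteq> T" "T \<subseteq> S" "\<phi> \<in> carrier (free_space K S)"
  shows "free_lift K V f \<phi> = (\<Oplus>\<^bsub>V\<^esub>s\<in>T. \<phi> s \<odot>\<^bsub>V\<^esub> f s)"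
  unfolding free_lift_def
  by (rule V.add.finprod_mono_neutral_cong_left)
    (use assms f free_space_value[OF V.R.is_cring assms(4)] in \<open>auto simp: subset_iff\<close>)

lemma free_lift_closed: "\<phi> \<in> carrier (free_space K S) \<Longrightarrow> free_lift K V f \<phi> \<in> carrier V"
  unfolding free_lift_def
  by (rule V.finsum_closed) (auto simp: f free_space_carrier, metis f V.smult_closed)

lemma free_lift_linear: "free_lift K V f \<in> lin_maps K (free_space K S) V"
proof (rule lin_mapsI)
  fix \<phi> \<psi> assume a: "\<phi> \<in> carrier (free_space K S)" "\<psi> \<in> carrier (free_space K S)"
  note v = free_space_value[OF V.R.is_cring a(1)] free_space_value[OF V.R.is_cring a(2)]
  let ?T = "{s. \<phi> s \<noteq> \<zero>\<^bsub>K\<^esub>} \<union> {s. \<psi> s \<noteq> \<zero>\<^bsub>K\<^esub>}"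
  have T: "finite ?T" "?T \<subseteq> S" using a by (auto simp: free_space_carrier)
  have c: "(\<lambda>s. \<phi> s \<oplus>\<^bsub>K\<^esub> \<psi> s) \<in> carrier (free_space K S)"
    using free_space_add_closed[OF V.R.is_cring a] .
  have "free_lift K V f (\<lambda>s. \<phi> s \<oplus>\<^bsub>K\<^esub> \<psi> s) = (\<Oplus>\<^bsub>V\<^esub>s\<in>?T. (\<phi> s \<oplus>\<^bsub>K\<^esub> \<psi> s) \<odot>\<^bsub>V\<^esub> f s)"
    by (rule free_lift_superset[OF T(1) _ T(2) c]) auto
  also have "\<dots> = (\<Oplus>\<^bsub>V\<^esub>s\<in>?T. (\<phi> s \<odot>\<^bsub>V\<^esub> f s) \<oplus>\<^bsub>V\<^esub> (\<psi> s \<odot>\<^bsub>V\<^esub> f s))"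
    by (rule V.finsum_cong') (use T f v in \<open>auto simp: V.smult_l_distr subset_iff\<close>)
  also have "\<dots> = (\<Oplus>\<^bsub>V\<^esub>s\<in>?T. \<phi> s \<odot>\<^bsub>V\<^esub> f s) \<oplus>\<^bsub>V\<^esub> (\<Oplus>\<^bsub>V\<^esub>s\<in>?T. \<psi> s \<odot>\<^bsub>V\<^esub> f s)"
    by (rule V.finsum_addf) (use T f v in \<open>auto simp: subset_iff\<close>)
  also have "(\<Oplus>\<^bsub>V\<^esub>s\<in>?T. \<phi> s \<odot>\<^bsub>V\<^esub> f s) = free_lift K V f \<phi>"
    by (rule free_lift_superset[OF T(1) _ T(2) a(1), symmetric]) auto
  also have "(\<Oplus>\<^bsub>V\<^esub>s\<in>?T. \<psi> s \<odot>\<^bsub>V\<^esub> f s) = free_lift K V f \<psi>"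
    by (rule free_lift_superset[OF T(1) _ T(2) a(2), symmetric]) auto
  finally show "free_lift K V f (\<phi> \<oplus>\<^bsub>free_space K S\<^esub> \<psi>) = free_lift K V f \<phi> \<oplus>\<^bsub>V\<^esub> free_lift K V f \<psi>"
    by simp
next
  fix c \<phi> assume a: "c \<in> carrier K" "\<phi> \<in> carrier (free_space K S)"
  note v = free_space_value[OF V.R.is_cring a(2)]
  let ?T = "{s. \<phi> s \<noteq> \<zero>\<^bsub>K\<^esub>}"
  have T: "finite ?T" "?T \<subseteq> S" using a by (auto simp: free_space_carrier)
  have "free_lift K V f (\<lambda>s. c \<otimes>\<^bsub>K\<^esub> \<phi> s) = (\<Oplus>\<^bsub>V\<^esub>s\<in>?T. (c \<otimes>\<^bsub>K\<^esub> \<phi> s) \<odot>\<^bsub>V\<^esub> f s)"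
    by (rule free_lift_superset[OF T(1) _ T(2) free_space_smult_closed[OF V.R.is_cring a(2,1)]])
      (use a in auto)
  also have "\<dots> = (\<Oplus>\<^bsub>V\<^esub>s\<in>?T. c \<odot>\<^bsub>V\<^esub> (\<phi> s \<odot>\<^bsub>V\<^esub> f s))"
    by (rule V.finsum_cong') (use a T f v in \<open>auto simp: V.smult_assoc1 subset_iff\<close>)
  also have "\<dots> = c \<odot>\<^bsub>V\<^esub> free_lift K V f \<phi>"
    unfolding free_lift_def
    by (rule V.finsum_smult_ldistr[symmetric]) (use a T f v in \<open>auto simp: subset_iff\<close>)
  finally show "free_lift K V f (c \<odot>\<^bsub>free_space K S\<^esub> \<phi>) = c \<odot>\<^bsub>V\<^esub> free_lift K V f \<phi>" by simp
qed (rule free_lift_closed)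

lemma free_lift_basis:
  assumes "s \<in> S"
  shows "free_lift K V f (basis_vec K s) = f s"
proof -
  \<comment> \<open>Only an inclusion: over a ring with \<open>1 = 0\<close> the support is
    empty.\<close>
  have "{t. basis_vec K s t \<noteq> \<zero>\<^bsub>K\<^esub>} \<subseteq> {s}" by (auto simp: basis_vec_def)
  then have "free_lift K V f (basis_vec K s) = (\<Oplus>\<^bsub>V\<^esub>t\<in>{s}. basis_vec K s t \<odot>\<^bsub>V\<^esub> f t)"
    by (rule free_lift_superset[rotated]) (simp_all add: assms basis_vec_closed V.R.is_cring)
  also have "\<dots> = f s" using f[OF assms] by (simp add: basis_vec_def)
  finally show ?thesis .
qed

end

lemma free_space_ext:
  assumes "module K V" "g \<in> lin_maps K (free_space K S) V" "h \<in> lin_maps K (free_space K S) V"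
    and "\<And>s. s \<in> S \<Longrightarrow> g (basis_vec K s) = h (basis_vec K s)" "\<phi> \<in> carrier (free_space K S)"
  shows "g \<phi> = h \<phi>"
proof -
  interpret V: module K V by fact
  interpret G: module K "free_space K S" by (rule module_free_space[OF V.R.is_cring])
  show ?thesis
    using V.R.is_cring assms(5)
  proof (induction \<phi> rule: free_space_induct)
    case zero
    then show ?case
      using lin_maps_zero[OF G.module_axioms V.module_axioms assms(2)]
        lin_maps_zero[OF G.module_axioms V.module_axioms assms(3)] by simp
  next
    case (add c s \<psi>)
    then show ?case
      using basis_vec_closed[OF V.R.is_cring, of s S] G.smult_closed
      by (simp add: lin_maps_add[OF assms(2)] lin_maps_add[OF assms(3)] lin_maps_smult[OF assms(2)]
          lin_maps_smult[OF assms(3)] assms(4) del: free_space_fields)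
  qed
qed

lemma
  assumes "left_module K B M"
  shows left_module_module: "module K M"
    and lact_closed: "\<lbrakk>b \<in> carrier B; x \<in> carrier M\<rbrakk> \<Longrightarrow> b \<triangleright>\<^bsub>M\<^esub> x \<in> carrier M"
    and lact_add: "\<lbrakk>b \<in> carrier B; x \<in> carrier M; y \<in> carrier M\<rbrakk> \<Longrightarrow>
      b \<triangleright>\<^bsub>M\<^esub> (x \<oplus>\<^bsub>M\<^esub> y) = (b \<triangleright>\<^bsub>M\<^esub> x) \<oplus>\<^bsub>M\<^esub> (b \<triangleright>\<^bsub>M\<^esub> y)"
    and add_lact: "\<lbrakk>b \<in> carrier B; b' \<in> carrier B; x \<in> carrier M\<rbrakk> \<Longrightarrow>
      (b \<oplus>\<^bsub>B\<^esub> b') \<triangleright>\<^bsub>M\<^esub> x = (b \<triangleright>\<^bsub>M\<^esub> x) \<oplus>\<^bsub>M\<^esub> (b' \<triangleright>\<^bsub>M\<^esub> x)"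
    and lact_lact: "\<lbrakk>b \<in> carrier B; b' \<in> carrier B; x \<in> carrier M\<rbrakk> \<Longrightarrow>
      (b \<otimes>\<^bsub>B\<^esub> b') \<triangleright>\<^bsub>M\<^esub> x = b \<triangleright>\<^bsub>M\<^esub> (b' \<triangleright>\<^bsub>M\<^esub> x)"
    and one_lact: "x \<in> carrier M \<Longrightarrow> \<one>\<^bsub>B\<^esub> \<triangleright>\<^bsub>M\<^esub> x = x"
    and smult_lact: "\<lbrakk>c \<in> carrier K; b \<in> carrier B; x \<in> carrier M\<rbrakk> \<Longrightarrow>
      (c \<odot>\<^bsub>B\<^esub> b) \<triangleright>\<^bsub>M\<^esub> x = c \<odot>\<^bsub>M\<^esub> (b \<triangleright>\<^bsub>M\<^esub> x)"
    and lact_smult: "\<lbrakk>c \<in> carrier K; b \<in> carrier B; x \<in> carrier M\<rbrakk> \<Longrightarrow>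
      b \<triangleright>\<^bsub>M\<^esub> (c \<odot>\<^bsub>M\<^esub> x) = c \<odot>\<^bsub>M\<^esub> (b \<triangleright>\<^bsub>M\<^esub> x)"
    and lact_linear: "b \<in> carrier B \<Longrightarrow> (\<lambda>x. b \<triangleright>\<^bsub>M\<^esub> x) \<in> lin_maps K M M"
  using assms by (auto simp: left_module_def intro!: lin_mapsI)

lemma
  assumes "right_module K A M"
  shows right_module_module: "module K M"
    and ract_closed: "\<lbrakk>a \<in> carrier A; x \<in> carrier M\<rbrakk> \<Longrightarrow> x \<triangleleft>\<^bsub>M\<^esub> a \<in> carrier M"
    and ract_add: "\<lbrakk>a \<in> carrier A; x \<in> carrier M; y \<in> carrier M\<rbrakk> \<Longrightarrow>
      (x \<oplus>\<^bsub>M\<^esub> y) \<triangleleft>\<^bsub>M\<^esub> a = (x \<triangleleft>\<^bsub>M\<^esub> a) \<oplus>\<^bsub>M\<^esub> (y \<triangleleft>\<^bsub>M\<^esub> a)"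
    and smult_ract: "\<lbrakk>c \<in> carrier K; a \<in> carrier A; x \<in> carrier M\<rbrakk> \<Longrightarrow>
      (c \<odot>\<^bsub>M\<^esub> x) \<triangleleft>\<^bsub>M\<^esub> a = c \<odot>\<^bsub>M\<^esub> (x \<triangleleft>\<^bsub>M\<^esub> a)"
  using assms by (auto simp: right_module_def)

section \<open>Balanced maps and the universal property of the tensor product\<close>

definition balanced ::
  "('k, 'r) ring_scheme \<Rightarrow> ('k, 'a, 'm) module_scheme \<Rightarrow> ('k, 'b, 'a, 'x) bimod \<Rightarrow>
   ('k, 'a, 'c, 'y) bimod \<Rightarrow> ('k, 'z, 'n) module_scheme \<Rightarrow> ('x \<Rightarrow> 'y \<Rightarrow> 'z) \<Rightarrow> bool"
  where "balanced K A X Y V f \<longleftrightarrow>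
    (\<forall>y\<in>carrier Y. (\<lambda>x. f x y) \<in> lin_maps K X V) \<and>
    (\<forall>x\<in>carrier X. (\<lambda>y. f x y) \<in> lin_maps K Y V) \<and>
    (\<forall>x\<in>carrier X. \<forall>a\<in>carrier A. \<forall>y\<in>carrier Y. f (x \<triangleleft>\<^bsub>X\<^esub> a) y = f x (a \<triangleright>\<^bsub>Y\<^esub> y))"

lemma balancedI:
  assumes "\<And>y. y \<in> carrier Y \<Longrightarrow> (\<lambda>x. f x y) \<in> lin_maps K X V"
    and "\<And>x. x \<in> carrier X \<Longrightarrow> (\<lambda>y. f x y) \<in> lin_maps K Y V"
    and "\<And>x a y. \<lbrakk>x \<in> carrier X; a \<in> carrier A; y \<in> carrier Y\<rbrakk> \<Longrightarrow> f (x \<triangleleft>\<^bsub>X\<^esub> a) y = f x (a \<triangleright>\<^bsub>Y\<^esub> y)"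
  shows "balanced K A X Y V f"
  using assms by (auto simp: balanced_def)

text \<open>The generating set from \<open>tensor_null\<close>, under a name of its own because the
  finiteness argument behind flatness examines single generators.\<close>

definition tensor_relations ::
  "('k, 'r) ring_scheme \<Rightarrow> ('k, 'a, 'm) module_scheme \<Rightarrow>
   ('k, 'b, 'a, 'x) bimod \<Rightarrow> ('k, 'a, 'c, 'y) bimod \<Rightarrow> ('x \<times> 'y \<Rightarrow> 'k) set"
  where "tensor_relations K A X Y = (let G = tensor_free K X Y; e = basis_vec K in
    ({e (x \<oplus>\<^bsub>X\<^esub> x', y) \<ominus>\<^bsub>G\<^esub> (e (x, y) \<oplus>\<^bsub>G\<^esub> e (x', y)) | x x' y.
        x \<in> carrier X \<and> x' \<in> carrier X \<and> y \<in> carrier Y} \<union>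
     {e (x, y \<oplus>\<^bsub>Y\<^esub> y') \<ominus>\<^bsub>G\<^esub> (e (x, y) \<oplus>\<^bsub>G\<^esub> e (x, y')) | x y y'.
        x \<in> carrier X \<and> y \<in> carrier Y \<and> y' \<in> carrier Y} \<union>
     {e (c \<odot>\<^bsub>X\<^esub> x, y) \<ominus>\<^bsub>G\<^esub> (c \<odot>\<^bsub>G\<^esub> e (x, y)) | c x y.
        c \<in> carrier K \<and> x \<in> carrier X \<and> y \<in> carrier Y} \<union>
     {e (x, c \<odot>\<^bsub>Y\<^esub> y) \<ominus>\<^bsub>G\<^esub> (c \<odot>\<^bsub>G\<^esub> e (x, y)) | c x y.
        c \<in> carrier K \<and> x \<in> carrier X \<and> y \<in> carrier Y} \<union>
     {e (x \<triangleleft>\<^bsub>X\<^esub> a, y) \<ominus>\<^bsub>G\<^esub> e (x, a \<triangleright>\<^bsub>Y\<^esub> y) | x a y.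
        x \<in> carrier X \<and> a \<in> carrier A \<and> y \<in> carrier Y}))"

lemma tensor_null_eq: "tensor_null K A X Y = lin_span K (tensor_free K X Y) (tensor_relations K A X Y)"
  by (simp only: tensor_null_def tensor_relations_def Let_def)

lemma tensor_relationsI:
  fixes K A X Y
  defines "G \<equiv> tensor_free K X Y" and "e \<equiv> basis_vec K" and "R \<equiv> tensor_relations K A X Y"
  shows "\<lbrakk>x \<in> carrier X; x' \<in> carrier X; y \<in> carrier Y\<rbrakk> \<Longrightarrow>
      e (x \<oplus>\<^bsub>X\<^esub> x', y) \<ominus>\<^bsub>G\<^esub> (e (x, y) \<oplus>\<^bsub>G\<^esub> e (x', y)) \<in> R"
    and "\<lbrakk>x \<in> carrier X; y \<in> carrier Y; y' \<in> carrier Y\<rbrakk> \<Longrightarrow>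
      e (x, y \<oplus>\<^bsub>Y\<^esub> y') \<ominus>\<^bsub>G\<^esub> (e (x, y) \<oplus>\<^bsub>G\<^esub> e (x, y')) \<in> R"
    and "\<lbrakk>c \<in> carrier K; x \<in> carrier X; y \<in> carrier Y\<rbrakk> \<Longrightarrow>
      e (c \<odot>\<^bsub>X\<^esub> x, y) \<ominus>\<^bsub>G\<^esub> (c \<odot>\<^bsub>G\<^esub> e (x, y)) \<in> R"
    and "\<lbrakk>c \<in> carrier K; x \<in> carrier X; y \<in> carrier Y\<rbrakk> \<Longrightarrow>
      e (x, c \<odot>\<^bsub>Y\<^esub> y) \<ominus>\<^bsub>G\<^esub> (c \<odot>\<^bsub>G\<^esub> e (x, y)) \<in> R"
    and "\<lbrakk>x \<in> carrier X; a \<in> carrier A; y \<in> carrier Y\<rbrakk> \<Longrightarrow>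
      e (x \<triangleleft>\<^bsub>X\<^esub> a, y) \<ominus>\<^bsub>G\<^esub> e (x, a \<triangleright>\<^bsub>Y\<^esub> y) \<in> R"
  unfolding assms tensor_relations_def Let_def by blast+

lemma tensor_free_fields [simp]:
  "carrier (tensor_free K X Y) = carrier (free_space K (carrier X \<times> carrier Y))"
  "zero (tensor_free K X Y) = zero (free_space K (carrier X \<times> carrier Y))"
  "add (tensor_free K X Y) = add (free_space K (carrier X \<times> carrier Y))"
  "smult (tensor_free K X Y) = smult (free_space K (carrier X \<times> carrier Y))"
  by (simp_all add: tensor_free_def Let_def)

lemma module_tensor_free: "cring K \<Longrightarrow> module K (tensor_free K X Y)"
  by (rule module_cong[OF module_free_space]) auto

lemma lin_maps_tensor_free [simp]:
  "lin_maps K (tensor_free K X Y) V = lin_maps K (free_space K (carrier X \<times> carrier Y)) V"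
  by (simp add: lin_maps_def)

locale tensor_pair =
  fixes K :: "('k, 'r) ring_scheme" and A :: "('k, 'a, 'm) module_scheme"
    and X :: "('k, 'b, 'a, 'x) bimod" and Y :: "('k, 'a, 'c, 'y) bimod"
  assumes right: "right_module K A X" and left: "left_module K A Y"
begin

sublocale X: module K X by (rule right_module_module[OF right])
sublocale Y: module K Y by (rule left_module_module[OF left])
sublocale G: module K "tensor_free K X Y" by (rule module_tensor_free[OF X.R.is_cring])

abbreviation "G \<equiv> tensor_free K X Y"
abbreviation "T \<equiv> tensor K A X Y"
abbreviation "null \<equiv> tensor_null K A X Y"
abbreviation "tn \<equiv> tens K A X Y"

lemma basis_closed: "\<lbrakk>x \<in> carrier X; y \<in> carrier Y\<rbrakk> \<Longrightarrow> basis_vec K (x, y) \<in> carrier G"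
  by (simp add: basis_vec_closed X.R.is_cring)

lemma relations_closed: "tensor_relations K A X Y \<subseteq> carrier G"
  unfolding tensor_relations_def Let_def
  by (auto intro!: G.minus_closed G.a_closed G.smult_closed basis_closed
      ract_closed[OF right] lact_closed[OF left] simp del: tensor_free_fields)

lemma submodule_null: "submodule null K G"
  unfolding tensor_null_eq by (rule submodule_lin_span[OF G.module_axioms relations_closed])

lemma relations_null: "tensor_relations K A X Y \<subseteq> null"
  unfolding tensor_null_eq by (rule lin_span_superset[OF G.module_axioms relations_closed])

lemma module_tensor: "module K T"
  unfolding tensor_def by (rule module_quot_bimod[OF G.module_axioms submodule_null])

lemma carrier_T: "carrier T = (\<lambda>\<phi>. null +>\<^bsub>G\<^esub> \<phi>) ` carrier G"
  by (simp add: tensor_def)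

lemma coset_T: "(\<lambda>\<phi>. null +>\<^bsub>G\<^esub> \<phi>) \<in> lin_maps K G T"
  using coset_linear[OF G.module_axioms submodule_null]
  by (simp add: lin_maps_def tensor_def del: tensor_free_fields)

lemma tens_eq: "tn x y = null +>\<^bsub>G\<^esub> basis_vec K (x, y)"
  by (simp add: tens_def)

lemma tens_closed: "\<lbrakk>x \<in> carrier X; y \<in> carrier Y\<rbrakk> \<Longrightarrow> tn x y \<in> carrier T"
  unfolding tens_eq using lin_maps_closed[OF coset_T basis_closed] .

lemma null_eqI:
  assumes "\<phi> \<ominus>\<^bsub>G\<^esub> \<psi> \<in> tensor_relations K A X Y" "\<phi> \<in> carrier G" "\<psi> \<in> carrier G"
  shows "null +>\<^bsub>G\<^esub> \<phi> = null +>\<^bsub>G\<^esub> \<psi>"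
  using assms relations_null coset_eq_iff[OF G.module_axioms submodule_null assms(2,3)] by blast

lemma balanced_tens: "balanced K A X Y T tn"
proof (rule balancedI)
  note bc = basis_closed
  note [simp del] = tensor_free_fields
  note c = lin_maps_add[OF coset_T, symmetric] lin_maps_smult[OF coset_T, symmetric]
  show "(\<lambda>x. tn x y) \<in> lin_maps K X T" if y: "y \<in> carrier Y" for y
  proof (rule lin_mapsI)
    show "tn (x \<oplus>\<^bsub>X\<^esub> x') y = tn x y \<oplus>\<^bsub>T\<^esub> tn x' y" if "x \<in> carrier X" "x' \<in> carrier X" for x x'
      unfolding tens_eq using that y
      by (simp add: c bc) (rule null_eqI, auto intro: tensor_relationsI simp: bc)
    show "tn (k \<odot>\<^bsub>X\<^esub> x) y = k \<odot>\<^bsub>T\<^esub> tn x y" if "k \<in> carrier K" "x \<in> carrier X" for k x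
      unfolding tens_eq using that y
      by (simp add: c bc) (rule null_eqI, auto intro: tensor_relationsI simp: bc)
  qed (rule tens_closed[OF _ y])
  show "(\<lambda>y. tn x y) \<in> lin_maps K Y T" if x: "x \<in> carrier X" for x
  proof (rule lin_mapsI)
    show "tn x (y \<oplus>\<^bsub>Y\<^esub> y') = tn x y \<oplus>\<^bsub>T\<^esub> tn x y'" if "y \<in> carrier Y" "y' \<in> carrier Y" for y y'
      unfolding tens_eq using that x
      by (simp add: c bc) (rule null_eqI, auto intro: tensor_relationsI simp: bc)
    show "tn x (k \<odot>\<^bsub>Y\<^esub> y) = k \<odot>\<^bsub>T\<^esub> tn x y" if "k \<in> carrier K" "y \<in> carrier Y" for k y
      unfolding tens_eq using that x
      by (simp add: c bc) (rule null_eqI, auto intro: tensor_relationsI simp: bc)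
  qed (rule tens_closed[OF x])
  show "tn (x \<triangleleft>\<^bsub>X\<^esub> a) y = tn x (a \<triangleright>\<^bsub>Y\<^esub> y)" if "x \<in> carrier X" "a \<in> carrier A" "y \<in> carrier Y" for x a y
    unfolding tens_eq using that
    by (intro null_eqI tensor_relationsI) (auto simp: bc ract_closed[OF right] lact_closed[OF left])
qed

lemma tens_linear_left: "y \<in> carrier Y \<Longrightarrow> (\<lambda>x. tn x y) \<in> lin_maps K X T"
  and tens_linear_right: "x \<in> carrier X \<Longrightarrow> (\<lambda>y. tn x y) \<in> lin_maps K Y T"
  and tens_balanced: "\<lbrakk>x \<in> carrier X; a \<in> carrier A; y \<in> carrier Y\<rbrakk> \<Longrightarrow> tn (x \<triangleleft>\<^bsub>X\<^esub> a) y = tn x (a \<triangleright>\<^bsub>Y\<^esub> y)"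
  using balanced_tens by (auto simp: balanced_def)

lemmas tens_add_left = lin_maps_add[OF tens_linear_left]
  and tens_add_right = lin_maps_add[OF tens_linear_right]
  and tens_smult_left = lin_maps_smult[OF tens_linear_left]
  and tens_smult_right = lin_maps_smult[OF tens_linear_right]

text \<open>Sums of pure tensors exhaust the tensor product: a multiple of a pure tensor is again
  pure, the scalar moving into the left factor, and zero is the pure tensor of the two zeros. Hence
  there are no cases for scalars or zero.\<close>

lemma tensor_induct [consumes 1, case_names tens add]:
  assumes "Z \<in> carrier T"
    and "\<And>x y. \<lbrakk>x \<in> carrier X; y \<in> carrier Y\<rbrakk> \<Longrightarrow> P (tn x y)"
    and "\<And>Z W. \<lbrakk>Z \<in> carrier T; W \<in> carrier T; P Z; P W\<rbrakk> \<Longrightarrow> P (Z \<oplus>\<^bsub>T\<^esub> W)"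
  shows "P Z"
proof -
  note [simp del] = free_space_fields tensor_free_fields
  have "P (null +>\<^bsub>G\<^esub> \<phi>)" if "\<phi> \<in> carrier (free_space K (carrier X \<times> carrier Y))" for \<phi>
    using X.R.is_cring that
  proof (induction \<phi> rule: free_space_induct)
    case zero
    have "null +>\<^bsub>G\<^esub> (\<lambda>s. \<zero>\<^bsub>K\<^esub>) = \<zero>\<^bsub>T\<^esub>"
      using lin_maps_zero[OF G.module_axioms module_tensor coset_T]
      by (simp add: tensor_free_fields free_space_fields)
    also have "\<dots> = tn \<zero>\<^bsub>X\<^esub> \<zero>\<^bsub>Y\<^esub>"
      using lin_maps_zero[OF X.module_axioms module_tensor tens_linear_left[of "\<zero>\<^bsub>Y\<^esub>"]] by simp
    finally show ?case using assms(2) by simp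
  next
    case (add c s \<psi>)
    obtain x y where s: "s = (x, y)" "x \<in> carrier X" "y \<in> carrier Y" using add.hyps(2) by auto
    have \<psi>: "\<psi> \<in> carrier G" using add.hyps by (simp add: tensor_free_fields)
    have "null +>\<^bsub>G\<^esub> ((c \<odot>\<^bsub>G\<^esub> basis_vec K s) \<oplus>\<^bsub>G\<^esub> \<psi>) = tn (c \<odot>\<^bsub>X\<^esub> x) y \<oplus>\<^bsub>T\<^esub> (null +>\<^bsub>G\<^esub> \<psi>)"
      using s \<psi> add.hyps(1)
      by (simp add: lin_maps_add[OF coset_T] lin_maps_smult[OF coset_T] basis_closed
          tens_smult_left tens_eq[symmetric])
    then show ?case
      using assms(3)[OF _ _ assms(2) add.IH, of "c \<odot>\<^bsub>X\<^esub> x" y] s add.hyps(1) \<psi>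
        lin_maps_closed[OF coset_T] tens_closed
      by (simp add: tensor_free_fields)
  qed
  then show ?thesis using assms(1) by (auto simp: carrier_T tensor_free_fields)
qed

lemma tensor_ext:
  assumes "g \<in> lin_maps K T V" "h \<in> lin_maps K T V" "Z \<in> carrier T"
    and "\<And>x y. \<lbrakk>x \<in> carrier X; y \<in> carrier Y\<rbrakk> \<Longrightarrow> g (tn x y) = h (tn x y)"
  shows "g Z = h Z"
  using assms(3) by (induction rule: tensor_induct)
    (simp_all add: assms(4) lin_maps_add[OF assms(1)] lin_maps_add[OF assms(2)])

end

locale tensor_target = tensor_pair K A X Y
  for K :: "('k, 'r) ring_scheme" and A :: "('k, 'a, 'm) module_scheme"
    and X :: "('k, 'b, 'a, 'x) bimod" and Y :: "('k, 'a, 'c, 'y) bimod" +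
  fixes V :: "('k, 'z, 'n) module_scheme" and f :: "'x \<Rightarrow> 'y \<Rightarrow> 'z"
  assumes module_V: "module K V" and bal: "balanced K A X Y V f"
begin

sublocale V: module K V by (rule module_V)

abbreviation "F \<equiv> free_lift K V (\<lambda>(x, y). f x y)"

lemma f_closed: "\<lbrakk>x \<in> carrier X; y \<in> carrier Y\<rbrakk> \<Longrightarrow> f x y \<in> carrier V"
  using bal lin_maps_closed unfolding balanced_def by metis

lemma F_linear: "F \<in> lin_maps K G V"
  unfolding lin_maps_tensor_free by (rule free_lift_linear[OF module_V]) (auto simp: f_closed)

lemma F_basis: "\<lbrakk>x \<in> carrier X; y \<in> carrier Y\<rbrakk> \<Longrightarrow> F (basis_vec K (x, y)) = f x y"
  by (subst free_lift_basis[OF module_V, where S="carrier X \<times> carrier Y"]) (auto simp: f_closed)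

lemma F_relation:
  assumes "\<phi> \<in> tensor_relations K A X Y"
  shows "F \<phi> = \<zero>\<^bsub>V\<^esub>"
proof -
  note [simp del] = tensor_free_fields
  note [simp] = basis_closed f_closed F_basis ract_closed[OF right] lact_closed[OF left]
    lin_maps_add[OF F_linear] lin_maps_smult[OF F_linear]
    lin_maps_minus[OF G.module_axioms module_V F_linear] minus_zero_iff[OF module_V]
  have l: "(\<lambda>x. f x y) \<in> lin_maps K X V" if "y \<in> carrier Y" for y using bal that by (auto simp: balanced_def)
  have r: "(\<lambda>y. f x y) \<in> lin_maps K Y V" if "x \<in> carrier X" for x using bal that by (auto simp: balanced_def)
  have b: "f (x \<triangleleft>\<^bsub>X\<^esub> a) y = f x (a \<triangleright>\<^bsub>Y\<^esub> y)" if "x \<in> carrier X" "a \<in> carrier A" "y \<in> carrier Y" for x a y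
    using bal that by (auto simp: balanced_def)
  show ?thesis using assms unfolding tensor_relations_def Let_def
    by (elim UnE CollectE exE conjE)
      (simp_all add: lin_maps_add[OF l] lin_maps_smult[OF l] lin_maps_add[OF r] lin_maps_smult[OF r] b)
qed

lemma F_null:
  assumes "\<phi> \<in> null"
  shows "F \<phi> = \<zero>\<^bsub>V\<^esub>"
proof -
  have "null \<subseteq> {\<phi> \<in> carrier G. F \<phi> = \<zero>\<^bsub>V\<^esub>}"
    unfolding tensor_null_eq
    by (rule lin_span_minimal[OF submodule_kernel[OF G.module_axioms module_V F_linear]])
      (use relations_closed F_relation in blast)
  then show ?thesis using assms by blast
qed

lemma F_coset: "\<lbrakk>\<phi> \<in> carrier G; \<psi> \<in> null +>\<^bsub>G\<^esub> \<phi>\<rbrakk> \<Longrightarrow> F \<psi> = F \<phi>"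
proof -
  assume a: "\<phi> \<in> carrier G" "\<psi> \<in> null +>\<^bsub>G\<^esub> \<phi>"
  have "\<psi> \<in> carrier G" "\<psi> \<ominus>\<^bsub>G\<^esub> \<phi> \<in> null"
    using coset_mem[OF G.module_axioms submodule_null a] coset_eq_iff[OF G.module_axioms submodule_null _ a(1)]
    by blast+
  then have "F \<psi> \<ominus>\<^bsub>V\<^esub> F \<phi> = \<zero>\<^bsub>V\<^esub>"
    using F_null a by (metis lin_maps_minus[OF G.module_axioms module_V F_linear])
  then show ?thesis
    using minus_zero_iff[OF module_V] lin_maps_closed[OF F_linear] a(1) \<open>\<psi> \<in> carrier G\<close> by blast
qed

text \<open>\<open>tensor_lift\<close> picks the only element of the image of a coset. Balancedness
  annihilates the null space, so \<open>F\<close> is constant on the coset and that image is a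
  singleton.\<close>

lemma tensor_lift_coset: "\<phi> \<in> carrier G \<Longrightarrow> tensor_lift K V f (null +>\<^bsub>G\<^esub> \<phi>) = F \<phi>"
proof -
  assume a: "\<phi> \<in> carrier G"
  have "F ` (null +>\<^bsub>G\<^esub> \<phi>) = {F \<phi>}"
    using F_coset[OF a] coset_self[OF G.module_axioms submodule_null a] by blast
  then show ?thesis by (simp add: tensor_lift_def)
qed

lemma tensor_lift_linear: "tensor_lift K V f \<in> lin_maps K T V"
proof (rule lin_mapsI)
  note [simp del] = tensor_free_fields free_space_fields
  note c = lin_maps_add[OF coset_T, symmetric] lin_maps_smult[OF coset_T, symmetric]
  note [simp] = lin_maps_add[OF F_linear] lin_maps_smult[OF F_linear] tensor_lift_coset
  show "tensor_lift K V f Z \<in> carrier V" if "Z \<in> carrier T" for Z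
    using that by (auto simp: carrier_T lin_maps_closed[OF F_linear])
  show "tensor_lift K V f (Z \<oplus>\<^bsub>T\<^esub> W) = tensor_lift K V f Z \<oplus>\<^bsub>V\<^esub> tensor_lift K V f W"
    if "Z \<in> carrier T" "W \<in> carrier T" for Z W
    using that by (auto simp: carrier_T c)
  show "tensor_lift K V f (k \<odot>\<^bsub>T\<^esub> Z) = k \<odot>\<^bsub>V\<^esub> tensor_lift K V f Z"
    if "k \<in> carrier K" "Z \<in> carrier T" for k Z
    using that by (auto simp: carrier_T c)
qed

lemma tensor_lift_tens: "\<lbrakk>x \<in> carrier X; y \<in> carrier Y\<rbrakk> \<Longrightarrow> tensor_lift K V f (tn x y) = f x y"
  unfolding tens_eq by (simp add: tensor_lift_coset basis_closed F_basis del: tensor_free_fields)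

text \<open>Links \<open>tensor_lift\<close> to maps given as unions over all representatives, which
  is how \<open>quot_map\<close> presents the actions on a tensor product.\<close>

lemma tensor_lift_union: "Z \<in> carrier T \<Longrightarrow> (\<Union>\<phi>\<in>Z. {F \<phi>}) = {tensor_lift K V f Z}"
proof -
  assume "Z \<in> carrier T"
  then obtain \<phi> where \<phi>: "\<phi> \<in> carrier G" "Z = null +>\<^bsub>G\<^esub> \<phi>" unfolding carrier_T by blast
  have "(\<Union>\<psi>\<in>Z. {F \<psi>}) = {F \<phi>}"
    using F_coset[OF \<phi>(1)] coset_self[OF G.module_axioms submodule_null \<phi>(1)] unfolding \<phi>(2) by blast
  then show ?thesis by (simp only: \<phi>(2) tensor_lift_coset[OF \<phi>(1)])
qed

end

text \<open>A formula that agrees on pure tensors with a linear map \<open>h\<close> inherits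
  balancedness from the pure tensors themselves. This spares a direct proof of balancedness for
  \<open>g_hat\<close> and for the extended connection.\<close>

lemma (in tensor_pair) tensor_lift_factor:
  assumes "module K V" "h \<in> lin_maps K T V"
    and "\<And>x y. \<lbrakk>x \<in> carrier X; y \<in> carrier Y\<rbrakk> \<Longrightarrow> f x y = h (tn x y)" "Z \<in> carrier T"
  shows "tensor_lift K V f Z = h Z"
proof -
  have b: "balanced K A X Y V f"
  proof (rule balancedI)
    show "(\<lambda>x. f x y) \<in> lin_maps K X V" if "y \<in> carrier Y" for y
      by (rule lin_maps_cong[OF lin_maps_comp[OF tens_linear_left[OF that] assms(2)]])
        (auto simp: assms(3) that X.module_axioms)
    show "(\<lambda>y. f x y) \<in> lin_maps K Y V" if "x \<in> carrier X" for x
      by (rule lin_maps_cong[OF lin_maps_comp[OF tens_linear_right[OF that] assms(2)]])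
        (auto simp: assms(3) that Y.module_axioms)
  qed (simp add: assms(3) tens_balanced ract_closed[OF right] lact_closed[OF left])
  interpret tensor_target K A X Y V f 
    by (intro tensor_target.intro tensor_target_axioms.intro tensor_pair_axioms assms(1) b)
  show ?thesis
    by (rule tensor_ext[OF tensor_lift_linear assms(2,4)]) (simp add: tensor_lift_tens assms(3))
qed

subsection \<open>Actions on tensor products and quotients\<close>

text \<open>The balancing hypothesis couples \<open>u\<close> and \<open>v\<close>, so one statement
  covers an outer action, a module map in one factor and multiplication by a fixed form.\<close>

lemma balanced_map:
  assumes "tensor_pair K A X Y" "tensor_pair K A X' Y'" "u \<in> lin_maps K X X'" "v \<in> lin_maps K Y Y'"
    and "\<And>x a y. \<lbrakk>x \<in> carrier X; a \<in> carrier A; y \<in> carrier Y\<rbrakk> \<Longrightarrow>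
      tens K A X' Y' (u (x \<triangleleft>\<^bsub>X\<^esub> a)) (v y) = tens K A X' Y' (u x) (v (a \<triangleright>\<^bsub>Y\<^esub> y))"
  shows "balanced K A X Y (tensor K A X' Y') (\<lambda>x y. tens K A X' Y' (u x) (v y))"
proof -
  interpret S: tensor_pair K A X Y by fact
  interpret S': tensor_pair K A X' Y' by fact
  show ?thesis
    by (intro balancedI lin_maps_comp[OF assms(3) S'.tens_linear_left]
        lin_maps_comp[OF assms(4) S'.tens_linear_right] lin_maps_closed[OF assms(3)]
        lin_maps_closed[OF assms(4)] assms(5))
qed

context tensor_pair
begin

text \<open>The outer actions are defined by lifting to the free space and passing to cosets. On
  cosets this recipe is the linear map of the universal property, which makes the actions computable
  on pure tensors.\<close>

lemma quot_map_free_lift: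
  assumes "\<And>x. x \<in> carrier X \<Longrightarrow> u x \<in> carrier X" "\<And>y. y \<in> carrier Y \<Longrightarrow> v y \<in> carrier Y"
    and "balanced K A X Y T (\<lambda>x y. tn (u x) (v y))" "Z \<in> carrier T"
  shows "quot_map G null (free_lift K (free_space K (carrier X \<times> carrier Y))
      (\<lambda>(x, y). basis_vec K (u x, v y))) Z = tensor_lift K T (\<lambda>x y. tn (u x) (v y)) Z"
proof -
  interpret R: tensor_target K A X Y T "\<lambda>x y. tn (u x) (v y)"
    by (intro tensor_target.intro tensor_target_axioms.intro tensor_pair_axioms module_tensor assms(3))
  let ?FS = "free_space K (carrier X \<times> carrier Y)"
  let ?h = "free_lift K ?FS (\<lambda>(x, y). basis_vec K (u x, v y))"
  have h: "?h \<in> lin_maps K ?FS ?FS"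
    by (rule free_lift_linear[OF module_free_space[OF X.R.is_cring]])
      (auto simp: basis_vec_closed X.R.is_cring assms)
  have c: "(\<lambda>\<phi>. null +>\<^bsub>G\<^esub> \<phi>) \<in> lin_maps K ?FS T" using coset_T by simp
  have "null +>\<^bsub>G\<^esub> ?h \<phi> = R.F \<phi>" if "\<phi> \<in> carrier G" for \<phi>
  proof (rule free_space_ext[OF module_tensor lin_maps_comp[OF h c] R.F_linear[simplified]])
    fix s assume "s \<in> carrier X \<times> carrier Y"
    then obtain x y where s: "s = (x, y)" "x \<in> carrier X" "y \<in> carrier Y" by auto
    then have "?h (basis_vec K s) = basis_vec K (u x, v y)"
      by (subst free_lift_basis[OF module_free_space[OF X.R.is_cring], where S="carrier X \<times> carrier Y"])
        (auto simp: basis_vec_closed X.R.is_cring assms)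
    then show "null +>\<^bsub>G\<^esub> ?h (basis_vec K s) = R.F (basis_vec K s)"
      using s R.F_basis[of x y] by (simp only: tens_eq)
  qed (use that in simp)
  moreover have "Z \<subseteq> carrier G"
    using assms(4) coset_mem[OF G.module_axioms submodule_null] unfolding carrier_T by blast
  ultimately have "quot_map G null ?h Z = (\<Union>\<phi>\<in>Z. R.F \<phi>)"
    unfolding quot_map_def by (intro SUP_cong) (auto simp del: tensor_free_fields)
  moreover have "R.F ` Z = {tensor_lift K T (\<lambda>x y. tn (u x) (v y)) Z}"
    using R.tensor_lift_union[OF assms(4)] by (simp only: UNION_singleton_eq_range)
  ultimately show ?thesis by simp
qed

lemma
  assumes "bimodule K B A X" "b \<in> carrier B"
  shows lact_tensor_linear: "(\<lambda>Z. b \<triangleright>\<^bsub>T\<^esub> Z) \<in> lin_maps K T T"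
    and lact_tens: "\<lbrakk>x \<in> carrier X; y \<in> carrier Y\<rbrakk> \<Longrightarrow> b \<triangleright>\<^bsub>T\<^esub> tn x y = tn (b \<triangleright>\<^bsub>X\<^esub> x) y"
proof -
  have lX: "left_module K B X" using assms(1) by (simp add: bimodule_def)
  have "balanced K A X Y T (\<lambda>x y. tn (b \<triangleright>\<^bsub>X\<^esub> x) y)"
    by (rule balanced_map[OF tensor_pair_axioms tensor_pair_axioms lact_linear[OF lX assms(2)],
          where v="\<lambda>y. y"])
      (use assms in \<open>auto intro!: lin_mapsI simp: bimodule_def tens_balanced[symmetric] lact_closed[OF lX]\<close>)
  note b = this
  interpret R: tensor_target K A X Y T "\<lambda>x y. tn (b \<triangleright>\<^bsub>X\<^esub> x) y"
    by (intro tensor_target.intro tensor_target_axioms.intro tensor_pair_axioms module_tensor b)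
  have eq: "b \<triangleright>\<^bsub>T\<^esub> Z = tensor_lift K T (\<lambda>x y. tn (b \<triangleright>\<^bsub>X\<^esub> x) y) Z" if "Z \<in> carrier T" for Z
    using quot_map_free_lift[of "\<lambda>x. b \<triangleright>\<^bsub>X\<^esub> x" "\<lambda>y. y", OF _ _ b that] lact_closed[OF lX assms(2)]
    by (simp add: tensor_def tensor_free_def Let_def)
  show "(\<lambda>Z. b \<triangleright>\<^bsub>T\<^esub> Z) \<in> lin_maps K T T"
    by (rule lin_maps_cong[OF R.tensor_lift_linear eq[symmetric] module_tensor])
  show "b \<triangleright>\<^bsub>T\<^esub> tn x y = tn (b \<triangleright>\<^bsub>X\<^esub> x) y" if "x \<in> carrier X" "y \<in> carrier Y" for x y
    using that by (simp add: eq tens_closed R.tensor_lift_tens)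
qed

lemma
  assumes "bimodule K A C Y" "c \<in> carrier C"
  shows ract_tensor_linear: "(\<lambda>Z. Z \<triangleleft>\<^bsub>T\<^esub> c) \<in> lin_maps K T T"
    and ract_tens: "\<lbrakk>x \<in> carrier X; y \<in> carrier Y\<rbrakk> \<Longrightarrow> tn x y \<triangleleft>\<^bsub>T\<^esub> c = tn x (y \<triangleleft>\<^bsub>Y\<^esub> c)"
proof -
  have rY: "right_module K C Y" using assms(1) by (simp add: bimodule_def)
  have l: "(\<lambda>y. y \<triangleleft>\<^bsub>Y\<^esub> c) \<in> lin_maps K Y Y"
    using assms(2) by (intro lin_mapsI) (auto simp: ract_closed[OF rY] ract_add[OF rY] smult_ract[OF rY])
  have "balanced K A X Y T (\<lambda>x y. tn x (y \<triangleleft>\<^bsub>Y\<^esub> c))"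
    by (rule balanced_map[OF tensor_pair_axioms tensor_pair_axioms _ l, where u="\<lambda>y. y"])
      (use assms in \<open>auto intro!: lin_mapsI simp: bimodule_def tens_balanced ract_closed[OF rY]\<close>)
  note b = this
  interpret R: tensor_target K A X Y T "\<lambda>x y. tn x (y \<triangleleft>\<^bsub>Y\<^esub> c)"
    by (intro tensor_target.intro tensor_target_axioms.intro tensor_pair_axioms module_tensor b)
  have eq: "Z \<triangleleft>\<^bsub>T\<^esub> c = tensor_lift K T (\<lambda>x y. tn x (y \<triangleleft>\<^bsub>Y\<^esub> c)) Z" if "Z \<in> carrier T" for Z
    using quot_map_free_lift[of "\<lambda>y. y" "\<lambda>y. y \<triangleleft>\<^bsub>Y\<^esub> c", OF _ _ b that] ract_closed[OF rY assms(2)]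
    by (simp add: tensor_def tensor_free_def Let_def)
  show "(\<lambda>Z. Z \<triangleleft>\<^bsub>T\<^esub> c) \<in> lin_maps K T T"
    by (rule lin_maps_cong[OF R.tensor_lift_linear eq[symmetric] module_tensor])
  show "tn x y \<triangleleft>\<^bsub>T\<^esub> c = tn x (y \<triangleleft>\<^bsub>Y\<^esub> c)" if "x \<in> carrier X" "y \<in> carrier Y" for x y
    using that by (simp add: eq tens_closed R.tensor_lift_tens)
qed

lemma left_module_tensor:
  assumes "bimodule K B A X" "ring B" "module K B"
  shows "left_module K B T"
proof -
  interpret B: ring B by fact
  interpret BK: module K B by fact
  interpret TT: module K T by (rule module_tensor)
  have lX: "left_module K B X" using assms(1) by (simp add: bimodule_def)
  note lin = lact_tensor_linear[OF assms(1)]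
  note [simp] = lin_maps_closed[OF lin] lin_maps_add[OF lin] lin_maps_smult[OF lin] lact_tens[OF assms(1)]
    add_lact[OF lX] lact_lact[OF lX] one_lact[OF lX] smult_lact[OF lX] lact_closed[OF lX]
    tens_add_left tens_smult_left tens_closed TT.smult_r_distr
  show ?thesis
    unfolding left_module_def
  proof (intro conjI ballI)
    show "(b \<oplus>\<^bsub>B\<^esub> b') \<triangleright>\<^bsub>T\<^esub> Z = (b \<triangleright>\<^bsub>T\<^esub> Z) \<oplus>\<^bsub>T\<^esub> (b' \<triangleright>\<^bsub>T\<^esub> Z)"
      if "b \<in> carrier B" "b' \<in> carrier B" "Z \<in> carrier T" for b b' Z
      using that(3) by (induction rule: tensor_induct) (simp_all add: that TT.a_ac)
    show "(b \<otimes>\<^bsub>B\<^esub> b') \<triangleright>\<^bsub>T\<^esub> Z = b \<triangleright>\<^bsub>T\<^esub> (b' \<triangleright>\<^bsub>T\<^esub> Z)"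
      if "b \<in> carrier B" "b' \<in> carrier B" "Z \<in> carrier T" for b b' Z
      using that(3) by (induction rule: tensor_induct) (simp_all add: that)
    show "\<one>\<^bsub>B\<^esub> \<triangleright>\<^bsub>T\<^esub> Z = Z" if "Z \<in> carrier T" for Z
      using that by (induction rule: tensor_induct) simp_all
    show "(c \<odot>\<^bsub>B\<^esub> b) \<triangleright>\<^bsub>T\<^esub> Z = c \<odot>\<^bsub>T\<^esub> (b \<triangleright>\<^bsub>T\<^esub> Z)"
      if "c \<in> carrier K" "b \<in> carrier B" "Z \<in> carrier T" for b c Z
      using that(3) by (induction rule: tensor_induct) (simp_all add: that)
  qed (simp_all add: module_tensor)
qed

end

lemma left_module_restrict:
  assumes "left_module K B M" "submodule U K M" "\<And>b x. \<lbrakk>b \<in> carrier B; x \<in> U\<rbrakk> \<Longrightarrow> b \<triangleright>\<^bsub>M\<^esub> x \<in> U"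
  shows "left_module K B (M\<lparr>carrier := U\<rparr>)"
  using module_restrict[OF left_module_module[OF assms(1)] assms(2)] assms(1,3) submodule_subset[OF assms(2)]
  by (simp add: left_module_def subset_iff)

lemma
  assumes "left_module K B M" "submodule H K M" "\<And>b x. \<lbrakk>b \<in> carrier B; x \<in> H\<rbrakk> \<Longrightarrow> b \<triangleright>\<^bsub>M\<^esub> x \<in> H"
  shows lact_coset: "\<lbrakk>b \<in> carrier B; x \<in> carrier M\<rbrakk> \<Longrightarrow> b \<triangleright>\<^bsub>quot_bimod M H\<^esub> (H +>\<^bsub>M\<^esub> x) = H +>\<^bsub>M\<^esub> (b \<triangleright>\<^bsub>M\<^esub> x)"
    and left_module_quot: "\<lbrakk>ring B; module K B\<rbrakk> \<Longrightarrow> left_module K B (quot_bimod M H)"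
proof -
  have m: "module K M" using left_module_module[OF assms(1)] .
  show l: "b \<triangleright>\<^bsub>quot_bimod M H\<^esub> (H +>\<^bsub>M\<^esub> x) = H +>\<^bsub>M\<^esub> (b \<triangleright>\<^bsub>M\<^esub> x)" if "b \<in> carrier B" "x \<in> carrier M" for b x
    using quot_map_linear[OF m m lact_linear[OF assms(1) that(1)] assms(2,2) _ that(2)] assms(3) that(1)
    by auto
  assume "ring B" "module K B"
  then interpret B: ring B + BK: module K B by simp_all
  interpret M: module K M by (rule m)
  note [simp] = coset_add[OF m assms(2)] coset_smult[OF m assms(2)] l[simplified] lact_closed[OF assms(1)]
    lact_add[OF assms(1)] add_lact[OF assms(1)] lact_lact[OF assms(1)] one_lact[OF assms(1)]
    smult_lact[OF assms(1)] lact_smult[OF assms(1)]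
  show "left_module K B (quot_bimod M H)"
    unfolding left_module_def quot_bimod_fields(1)
    by (intro conjI ballI module_quot_bimod[OF m assms(2)]) (elim imageE, simp)+
qed

subsection \<open>Flatness and exactness\<close>

text \<open>The map \<open>id \<otimes> f\<close>.\<close>

abbreviation tensor_map ::
  "('k, 'r) ring_scheme \<Rightarrow> ('k, 'a, 'm) module_scheme \<Rightarrow> ('k, 'b, 'a, 'x) bimod \<Rightarrow>
   ('k, 'a, 'c, 'y) bimod \<Rightarrow> ('z \<Rightarrow> 'y) \<Rightarrow> ('x \<times> 'z \<Rightarrow> 'k) set \<Rightarrow> ('x \<times> 'y \<Rightarrow> 'k) set"
  where "tensor_map K A X Y f \<equiv> tensor_lift K (tensor K A X Y) (\<lambda>x y. tens K A X Y x (f y))"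

lemma left_mapsI:
  "\<lbrakk>f \<in> lin_maps K M N; \<And>b x. \<lbrakk>b \<in> carrier B; x \<in> carrier M\<rbrakk> \<Longrightarrow> f (b \<triangleright>\<^bsub>M\<^esub> x) = b \<triangleright>\<^bsub>N\<^esub> f x\<rbrakk>
    \<Longrightarrow> f \<in> left_maps K B M N"
  by (auto simp: left_maps_def)

lemma left_mapsD:
  assumes "f \<in> left_maps K B M N"
  shows "f \<in> lin_maps K M N" "\<lbrakk>b \<in> carrier B; x \<in> carrier M\<rbrakk> \<Longrightarrow> f (b \<triangleright>\<^bsub>M\<^esub> x) = b \<triangleright>\<^bsub>N\<^esub> f x"
  using assms by (auto simp: left_maps_def)

lemma tensor_target_map:
  assumes "right_module K A X" "left_module K A Y" "left_module K A Y'" "f \<in> left_maps K A Y Y'"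
  shows "tensor_target K A X Y (tensor K A X Y') (\<lambda>x y. tens K A X Y' x (f y))"
proof -
  interpret S: tensor_pair K A X Y by (rule tensor_pair.intro[OF assms(1,2)])
  interpret S': tensor_pair K A X Y' by (rule tensor_pair.intro[OF assms(1,3)])
  have "balanced K A X Y (tensor K A X Y') (\<lambda>x y. tens K A X Y' x (f y))"
    by (rule balanced_map[OF S.tensor_pair_axioms S'.tensor_pair_axioms _ left_mapsD(1)[OF assms(4)],
          where u="\<lambda>x. x"])
      (auto intro!: lin_mapsI simp: left_mapsD(2)[OF assms(4)] S'.tens_balanced
        lin_maps_closed[OF left_mapsD(1)[OF assms(4)]])
  then show ?thesis
    by (intro tensor_target.intro tensor_target_axioms.intro S.tensor_pair_axioms S'.module_tensor)
qed

lemmas tensor_map_linear = tensor_target.tensor_lift_linear[OF tensor_target_map]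
lemmas tensor_map_tens = tensor_target.tensor_lift_tens[OF tensor_target_map]

lemma tensor_map_surj:
  assumes "right_module K A X" "left_module K A Y" "left_module K A Y'" "f \<in> left_maps K A Y Y'"
    and "carrier Y' \<subseteq> f ` carrier Y" "Z \<in> carrier (tensor K A X Y')"
  obtains W where "W \<in> carrier (tensor K A X Y)" "tensor_map K A X Y' f W = Z"
proof -
  interpret S: tensor_pair K A X Y by (rule tensor_pair.intro[OF assms(1,2)])
  interpret S': tensor_pair K A X Y' by (rule tensor_pair.intro[OF assms(1,3)])
  interpret T: module K S.T by (rule S.module_tensor)
  note lin = tensor_map_linear[OF assms(1-4)] and tns = tensor_map_tens[OF assms(1-4)]
  have "\<exists>W\<in>carrier S.T. tensor_map K A X Y' f W = Z"
    using assms(6)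
  proof (induction Z rule: S'.tensor_induct)
    case (tens x y)
    then obtain y' where "y' \<in> carrier Y" "y = f y'" using assms(5) by blast
    then show ?case using tens tns[of x y'] S.tens_closed[of x y'] by blast
  next
    case (add Z W)
    then show ?case using lin_maps_add[OF lin] T.a_closed by metis
  qed
  then show thesis using that by blast
qed

definition left_submodule ::
  "('k, 'r) ring_scheme \<Rightarrow> ('k, 'b, 'm) module_scheme \<Rightarrow> ('k, 'b, 'a, 'x) bimod \<Rightarrow> 'x set \<Rightarrow> bool"
  where "left_submodule K B M U \<longleftrightarrow> submodule U K M \<and> (\<forall>b\<in>carrier B. \<forall>x\<in>U. b \<triangleright>\<^bsub>M\<^esub> x \<in> U)"

lemma
  assumes "left_submodule K B M U"
  shows left_submodule_submodule: "submodule U K M"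
    and left_submodule_lact: "\<lbrakk>b \<in> carrier B; x \<in> U\<rbrakk> \<Longrightarrow> b \<triangleright>\<^bsub>M\<^esub> x \<in> U"
    and left_submodule_subset: "U \<subseteq> carrier M"
  using assms submodule_subset by (auto simp: left_submodule_def)

lemma left_module_submodule:
  "\<lbrakk>left_module K B M; left_submodule K B M U\<rbrakk> \<Longrightarrow> left_module K B (M\<lparr>carrier := U\<rparr>)"
  by (auto simp: left_submodule_def intro: left_module_restrict)

lemma left_submodule_Int:
  "\<lbrakk>left_module K B M; left_submodule K B M U; left_submodule K B M U'\<rbrakk> \<Longrightarrow> left_submodule K B M (U \<inter> U')"
  by (auto simp: left_submodule_def submodule_Int left_module_module)

lemma left_submodule_kernel:
  assumes "left_module K B M" "left_module K B N" "f \<in> left_maps K B M N"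
  shows "left_submodule K B M {x \<in> carrier M. f x = \<zero>\<^bsub>N\<^esub>}"
  using submodule_kernel[OF left_module_module[OF assms(1)] left_module_module[OF assms(2)] left_mapsD(1)[OF assms(3)]]
    lin_maps_zero[OF left_module_module[OF assms(2)] left_module_module[OF assms(2)] lact_linear[OF assms(2)]]
  by (auto simp: left_submodule_def left_mapsD(2)[OF assms(3)] lact_closed[OF assms(1)])

lemma left_submodule_image:
  assumes "left_module K B M" "left_module K B N" "f \<in> left_maps K B M N" "left_submodule K B M U"
  shows "left_submodule K B N (f ` U)"
proof -
  have "b \<triangleright>\<^bsub>N\<^esub> f x \<in> f ` U" if "b \<in> carrier B" "x \<in> U" for b x
    using left_mapsD(2)[OF assms(3) that(1), of x] left_submodule_subset[OF assms(4)]
      left_submodule_lact[OF assms(4) that] that(2) by (auto intro!: image_eqI)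
  then show ?thesis
    using submodule_image[OF left_module_module[OF assms(1)] left_module_module[OF assms(2)]
        left_mapsD(1)[OF assms(3)] left_submodule_submodule[OF assms(4)]]
    by (auto simp: left_submodule_def)
qed

lemma left_submodule_restrict:
  assumes "left_module K B M" "left_submodule K B M U" "left_submodule K B M H" "H \<subseteq> U"
  shows "left_submodule K B (M\<lparr>carrier := U\<rparr>) H"
  using assms by (auto simp: left_submodule_def intro: submodule_restrict left_module_module)

lemma left_submodule_carrier: "left_module K B M \<Longrightarrow> left_submodule K B M (carrier M)"
  by (auto simp: left_submodule_def lact_closed intro: submodule_carrier left_module_module)

lemma inclusion_left_maps:
  "U \<subseteq> U' \<Longrightarrow> (\<lambda>y. y) \<in> left_maps K B (M\<lparr>carrier := U\<rparr>) (M\<lparr>carrier := U'\<rparr>)"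
  "U \<subseteq> carrier M \<Longrightarrow> (\<lambda>y. y) \<in> left_maps K B (M\<lparr>carrier := U\<rparr>) M"
  by (auto simp: left_maps_def lin_maps_def)

text \<open>Flatness against one fixed module \<open>Y\<close>, tested on inclusions of its
  submodules. No quantification over types occurs, so \<open>Y\<close> may have any element type;
  the exactness arguments ask for nothing more.\<close>

definition flat_for ::
  "('k, 'r) ring_scheme \<Rightarrow> ('k, 'a, 'm) module_scheme \<Rightarrow> ('k, 'b, 'a, 'x) bimod \<Rightarrow>
   ('k, 'a, 'c, 'y) bimod \<Rightarrow> bool"
  where "flat_for K A X Y \<longleftrightarrow> (\<forall>U. left_submodule K A Y U \<longrightarrow>
    (\<forall>Z\<in>carrier (tensor K A X (Y\<lparr>carrier := U\<rparr>)). tensor_map K A X Y (\<lambda>y. y) Z = \<zero>\<^bsub>tensor K A X Y\<^esub> \<longrightarrow>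
       Z = \<zero>\<^bsub>tensor K A X (Y\<lparr>carrier := U\<rparr>)\<^esub>))"

text \<open>Additive inverses in a record are defined relative to its carrier. Writing subtraction
  with the scalar -1 shows that it does not change when the carrier shrinks.\<close>

lemma minus_smult:
  assumes "module K V" "x \<in> carrier V" "y \<in> carrier V"
  shows "x \<ominus>\<^bsub>V\<^esub> y = x \<oplus>\<^bsub>V\<^esub> ((\<ominus>\<^bsub>K\<^esub> \<one>\<^bsub>K\<^esub>) \<odot>\<^bsub>V\<^esub> y)"
proof -
  interpret V: module K V by fact
  show ?thesis using assms(2,3) by (simp add: V.smult_l_minus V.minus_eq)
qed

context tensor_pair
begin

text \<open>A function supported on \<open>X \<times> U\<close> is, extended by zero, also one on
  \<open>X \<times> Y\<close>, so the map induced by the inclusion keeps the representative and only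
  enlarges the coset. That the smaller null space lies in the larger one then follows from the
  induced map being well defined, without looking at generators.\<close>

lemma
  assumes "left_submodule K A Y U"
  shows tensor_free_sub: "\<phi> \<in> carrier (tensor_free K X (Y\<lparr>carrier := U\<rparr>)) \<Longrightarrow> \<phi> \<in> carrier G"
    and inclusion_coset: "\<phi> \<in> carrier (tensor_free K X (Y\<lparr>carrier := U\<rparr>)) \<Longrightarrow>
      tensor_map K A X Y (\<lambda>y. y)
        (tensor_null K A X (Y\<lparr>carrier := U\<rparr>) +>\<^bsub>tensor_free K X (Y\<lparr>carrier := U\<rparr>)\<^esub> \<phi>) = null +>\<^bsub>G\<^esub> \<phi>"
    and null_sub: "tensor_null K A X (Y\<lparr>carrier := U\<rparr>) \<subseteq> null"
proof -
  let ?Y = "Y\<lparr>carrier := U\<rparr>"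
  have lU: "left_module K A ?Y" by (rule left_module_submodule[OF left assms])
  note su = left_submodule_subset[OF assms]
  interpret U: tensor_pair K A X ?Y by (rule tensor_pair.intro[OF right lU])
  note tgt = right lU left inclusion_left_maps(2)[OF su, of K A]
  interpret R: tensor_target K A X ?Y T "\<lambda>x y. tn x y" by (rule tensor_target_map[OF tgt])
  show sub: "\<phi> \<in> carrier G" if "\<phi> \<in> carrier U.G" for \<phi>
    using that su by (fastforce simp: free_space_carrier)
  show eq: "tensor_map K A X Y (\<lambda>y. y) (U.null +>\<^bsub>U.G\<^esub> \<phi>) = null +>\<^bsub>G\<^esub> \<phi>" if "\<phi> \<in> carrier U.G" for \<phi>
  proof -
    have "tensor_map K A X Y (\<lambda>y. y) (U.null +>\<^bsub>U.G\<^esub> \<phi>) = R.F \<phi>"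
      by (rule R.tensor_lift_coset[OF that])
    also have "\<dots> = null +>\<^bsub>G\<^esub> \<phi>"
    proof (rule free_space_ext[OF module_tensor R.F_linear[simplified]])
      show "(\<lambda>\<phi>. null +>\<^bsub>G\<^esub> \<phi>) \<in> lin_maps K (free_space K (carrier X \<times> U)) T"
        using coset_T sub by (simp add: lin_maps_def Pi_def)
      show "\<phi> \<in> carrier (free_space K (carrier X \<times> U))" using that by simp
      show "R.F (basis_vec K s) = null +>\<^bsub>G\<^esub> basis_vec K s" if "s \<in> carrier X \<times> U" for s
        using that R.F_basis[of "fst s" "snd s"] by (auto simp: tens_eq)
    qed
    finally show ?thesis .
  qed
  show "U.null \<subseteq> null"
  proof
    fix \<phi> assume "\<phi> \<in> U.null"
    then have \<phi>: "\<phi> \<in> carrier U.G" "U.null +>\<^bsub>U.G\<^esub> \<phi> = U.null +>\<^bsub>U.G\<^esub> \<zero>\<^bsub>U.G\<^esub>"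
      using submodule_subset[OF U.submodule_null] coset_zero_iff[OF U.G.module_axioms U.submodule_null]
        coset_zero[OF U.G.module_axioms U.submodule_null] by blast+
    have "null +>\<^bsub>G\<^esub> \<phi> = null +>\<^bsub>G\<^esub> \<zero>\<^bsub>G\<^esub>"
      using eq[OF \<phi>(1)] eq[OF U.G.zero_closed] \<phi>(2) by simp
    then show "\<phi> \<in> null"
      using coset_zero_iff[OF G.module_axioms submodule_null sub[OF \<phi>(1)]]
        coset_zero[OF G.module_axioms submodule_null] by simp
  qed
qed

lemma tensor_free_minus:
  "\<lbrakk>\<phi> \<in> carrier G; \<psi> \<in> carrier G\<rbrakk> \<Longrightarrow> \<phi> \<ominus>\<^bsub>G\<^esub> \<psi> = (\<lambda>s. \<phi> s \<oplus>\<^bsub>K\<^esub> ((\<ominus>\<^bsub>K\<^esub> \<one>\<^bsub>K\<^esub>) \<otimes>\<^bsub>K\<^esub> \<psi> s))"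
  by (subst minus_smult[OF G.module_axioms]) simp_all

text \<open>A relation names at most two elements of \<open>Y\<close>. A submodule that contains
  them also contains the sums, multiples and translates in the relation, so the relation already
  holds over that submodule.\<close>

lemma relation_finite:
  assumes "\<phi> \<in> tensor_relations K A X Y"
  obtains S where "finite S" "S \<subseteq> carrier Y"
    "\<And>U. \<lbrakk>left_submodule K A Y U; S \<subseteq> U\<rbrakk> \<Longrightarrow> \<phi> \<in> tensor_null K A X (Y\<lparr>carrier := U\<rparr>)"
proof -
  \<comment> \<open>Subtraction over \<open>Y\<close> and over the submodule is the same operation
    on functions, so a relation over the submodule may be written with the operations of
    \<open>G\<close>.\<close>
  have step: "\<phi> \<ominus>\<^bsub>G\<^esub> \<psi> \<in> tensor_null K A X (Y\<lparr>carrier := U\<rparr>)"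
    if U: "left_submodule K A Y U"
      and "\<phi> \<ominus>\<^bsub>tensor_free K X (Y\<lparr>carrier := U\<rparr>)\<^esub> \<psi> \<in> tensor_relations K A X (Y\<lparr>carrier := U\<rparr>)"
      and "\<phi> \<in> carrier (tensor_free K X (Y\<lparr>carrier := U\<rparr>))" "\<psi> \<in> carrier (tensor_free K X (Y\<lparr>carrier := U\<rparr>))"
    for \<phi> \<psi> U
  proof -
    interpret U: tensor_pair K A X "Y\<lparr>carrier := U\<rparr>"
      by (rule tensor_pair.intro[OF right left_module_submodule[OF left U]])
    show ?thesis
      using U.relations_null that(2) tensor_free_sub[OF U that(3)] tensor_free_sub[OF U that(4)]
      by (auto simp: tensor_free_minus U.tensor_free_minus that(3,4) simp del: tensor_free_fields)
  qed
  have cl1: "basis_vec K (x, y) \<in> carrier (tensor_free K X (Y\<lparr>carrier := U\<rparr>))"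
    if "x \<in> carrier X" "y \<in> U" for x y U
    using that by (simp add: basis_vec_closed X.R.is_cring)
  have cl2: "\<phi> \<oplus>\<^bsub>G\<^esub> \<psi> \<in> carrier (tensor_free K X (Y\<lparr>carrier := U\<rparr>))"
    if "\<phi> \<in> carrier (tensor_free K X (Y\<lparr>carrier := U\<rparr>))" "\<psi> \<in> carrier (tensor_free K X (Y\<lparr>carrier := U\<rparr>))"
    for U \<phi> \<psi>
    using that by (simp add: X.R.is_cring free_space_add_closed)
  have cl3: "c \<odot>\<^bsub>G\<^esub> \<phi> \<in> carrier (tensor_free K X (Y\<lparr>carrier := U\<rparr>))"
    if "\<phi> \<in> carrier (tensor_free K X (Y\<lparr>carrier := U\<rparr>))" "c \<in> carrier K" for U c \<phi>
    using that by (simp add: X.R.is_cring free_space_smult_closed)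
  have ops: "add (tensor_free K X (Y\<lparr>carrier := U\<rparr>)) = add G" "smult (tensor_free K X (Y\<lparr>carrier := U\<rparr>)) = smult G"
    for U by simp_all
  note [simp] = cl1 cl2 cl3 ops ract_closed[OF right]
  note [simp del] = tensor_free_fields
  have "\<exists>S. finite S \<and> S \<subseteq> carrier Y \<and>
    (\<forall>U. left_submodule K A Y U \<and> S \<subseteq> U \<longrightarrow> \<phi> \<in> tensor_null K A X (Y\<lparr>carrier := U\<rparr>))"
    using assms unfolding tensor_relations_def Let_def
  proof (elim UnE CollectE exE conjE)
    fix x x' y assume *: "\<phi> = basis_vec K (x \<oplus>\<^bsub>X\<^esub> x', y) \<ominus>\<^bsub>G\<^esub> (basis_vec K (x, y) \<oplus>\<^bsub>G\<^esub> basis_vec K (x', y))"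
      "x \<in> carrier X" "x' \<in> carrier X" "y \<in> carrier Y"
    show ?thesis
    proof (intro exI[of _ "{y}"] conjI allI impI)
      fix U assume "left_submodule K A Y U \<and> {y} \<subseteq> U"
      then have U: "left_submodule K A Y U" and yU: "y \<in> U" by auto
      note [simp] = submodule_add[OF Y.module_axioms left_submodule_submodule[OF U]] left_submodule_lact[OF U]
        submodule_smult[OF Y.module_axioms left_submodule_submodule[OF U]]
      show "\<phi> \<in> tensor_null K A X (Y\<lparr>carrier := U\<rparr>)"
        unfolding *(1) by (rule step[OF U])
          (use tensor_relationsI(1)[where X=X and Y="Y\<lparr>carrier := U\<rparr>" and K=K and A=A] * yU in simp_all)
    qed (use * in auto)
  next
    fix x y y' assume *: "\<phi> = basis_vec K (x, y \<oplus>\<^bsub>Y\<^esub> y') \<ominus>\<^bsub>G\<^esub> (basis_vec K (x, y) \<oplus>\<^bsub>G\<^esub> basis_vec K (x, y'))"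
      "x \<in> carrier X" "y \<in> carrier Y" "y' \<in> carrier Y"
    show ?thesis
    proof (intro exI[of _ "{y, y'}"] conjI allI impI)
      fix U assume "left_submodule K A Y U \<and> {y, y'} \<subseteq> U"
      then have U: "left_submodule K A Y U" and yU: "y \<in> U" "y' \<in> U" by auto
      note [simp] = submodule_add[OF Y.module_axioms left_submodule_submodule[OF U]] left_submodule_lact[OF U]
        submodule_smult[OF Y.module_axioms left_submodule_submodule[OF U]]
      show "\<phi> \<in> tensor_null K A X (Y\<lparr>carrier := U\<rparr>)"
        unfolding *(1) by (rule step[OF U])
          (use tensor_relationsI(2)[where X=X and Y="Y\<lparr>carrier := U\<rparr>" and K=K and A=A] * yU in simp_all)
    qed (use * in auto)
  next
    fix c x y assume *: "\<phi> = basis_vec K (c \<odot>\<^bsub>X\<^esub> x, y) \<ominus>\<^bsub>G\<^esub> (c \<odot>\<^bsub>G\<^esub> basis_vec K (x, y))"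
      "c \<in> carrier K" "x \<in> carrier X" "y \<in> carrier Y"
    show ?thesis
    proof (intro exI[of _ "{y}"] conjI allI impI)
      fix U assume "left_submodule K A Y U \<and> {y} \<subseteq> U"
      then have U: "left_submodule K A Y U" and yU: "y \<in> U" by auto
      note [simp] = submodule_add[OF Y.module_axioms left_submodule_submodule[OF U]] left_submodule_lact[OF U]
        submodule_smult[OF Y.module_axioms left_submodule_submodule[OF U]]
      show "\<phi> \<in> tensor_null K A X (Y\<lparr>carrier := U\<rparr>)"
        unfolding *(1) by (rule step[OF U])
          (use tensor_relationsI(3)[where X=X and Y="Y\<lparr>carrier := U\<rparr>" and K=K and A=A] * yU in simp_all)
    qed (use * in auto)
  next
    fix c x y assume *: "\<phi> = basis_vec K (x, c \<odot>\<^bsub>Y\<^esub> y) \<ominus>\<^bsub>G\<^esub> (c \<odot>\<^bsub>G\<^esub> basis_vec K (x, y))"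
      "c \<in> carrier K" "x \<in> carrier X" "y \<in> carrier Y"
    show ?thesis
    proof (intro exI[of _ "{y}"] conjI allI impI)
      fix U assume "left_submodule K A Y U \<and> {y} \<subseteq> U"
      then have U: "left_submodule K A Y U" and yU: "y \<in> U" by auto
      note [simp] = submodule_add[OF Y.module_axioms left_submodule_submodule[OF U]] left_submodule_lact[OF U]
        submodule_smult[OF Y.module_axioms left_submodule_submodule[OF U]]
      show "\<phi> \<in> tensor_null K A X (Y\<lparr>carrier := U\<rparr>)"
        unfolding *(1) by (rule step[OF U])
          (use tensor_relationsI(4)[where X=X and Y="Y\<lparr>carrier := U\<rparr>" and K=K and A=A] * yU in simp_all)
    qed (use * in auto)
  next
    fix x a y assume *: "\<phi> = basis_vec K (x \<triangleleft>\<^bsub>X\<^esub> a, y) \<ominus>\<^bsub>G\<^esub> basis_vec K (x, a \<triangleright>\<^bsub>Y\<^esub> y)"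
      "x \<in> carrier X" "a \<in> carrier A" "y \<in> carrier Y"
    show ?thesis
    proof (intro exI[of _ "{y}"] conjI allI impI)
      fix U assume "left_submodule K A Y U \<and> {y} \<subseteq> U"
      then have U: "left_submodule K A Y U" and yU: "y \<in> U" by auto
      note [simp] = submodule_add[OF Y.module_axioms left_submodule_submodule[OF U]] left_submodule_lact[OF U]
        submodule_smult[OF Y.module_axioms left_submodule_submodule[OF U]]
      show "\<phi> \<in> tensor_null K A X (Y\<lparr>carrier := U\<rparr>)"
        unfolding *(1) by (rule step[OF U])
          (use tensor_relationsI(5)[where X=X and Y="Y\<lparr>carrier := U\<rparr>" and K=K and A=A] * yU in simp_all)
    qed (use * in auto)
  qed
  then show thesis using that by blast
qed

text \<open>Membership in the null space is witnessed by finitely many relations; hence flatness can be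
  tested on finitely generated modules.\<close>

lemma null_finite:
  assumes "\<phi> \<in> null"
  obtains S where "finite S" "S \<subseteq> carrier Y"
    "\<And>U. \<lbrakk>left_submodule K A Y U; S \<subseteq> U\<rbrakk> \<Longrightarrow> \<phi> \<in> tensor_null K A X (Y\<lparr>carrier := U\<rparr>)"
proof -
  define P where "P \<phi> S \<longleftrightarrow> finite S \<and> S \<subseteq> carrier Y \<and>
    (\<forall>U. left_submodule K A Y U \<and> S \<subseteq> U \<longrightarrow> \<phi> \<in> tensor_null K A X (Y\<lparr>carrier := U\<rparr>))" for \<phi> S
  have sn: "submodule (tensor_null K A X (Y\<lparr>carrier := U\<rparr>)) K (tensor_free K X (Y\<lparr>carrier := U\<rparr>))"
    and mn: "module K (tensor_free K X (Y\<lparr>carrier := U\<rparr>))"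
    if "left_submodule K A Y U" for U
    using tensor_pair.submodule_null[OF tensor_pair.intro[OF right left_module_submodule[OF left that]]]
      module_tensor_free[OF X.R.is_cring] by blast+
  \<comment> \<open>The finitely witnessed elements form a subspace, with the union of two
    witnessing sets serving a sum. It contains every generator, hence the whole null space.\<close>
  have "submodule {\<phi> \<in> carrier G. \<exists>S. P \<phi> S} K G"
  proof (rule submoduleI'[OF G.module_axioms])
    show "\<zero>\<^bsub>G\<^esub> \<in> {\<phi> \<in> carrier G. \<exists>S. P \<phi> S}"
      using submodule_zero[OF mn sn] G.zero_closed by (auto simp: P_def intro!: exI[of _ "{}"])
  next
    fix \<phi> \<psi> assume a: "\<phi> \<in> {\<phi> \<in> carrier G. \<exists>S. P \<phi> S}" "\<psi> \<in> {\<phi> \<in> carrier G. \<exists>S. P \<phi> S}"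
    then obtain S S' where "P \<phi> S" "P \<psi> S'" by auto
    then have "P (\<phi> \<oplus>\<^bsub>G\<^esub> \<psi>) (S \<union> S')"
      using submodule_add[OF mn sn] by (auto simp: P_def)
    then show "\<phi> \<oplus>\<^bsub>G\<^esub> \<psi> \<in> {\<phi> \<in> carrier G. \<exists>S. P \<phi> S}" using a G.a_closed by blast
  next
    fix c \<phi> assume a: "c \<in> carrier K" "\<phi> \<in> {\<phi> \<in> carrier G. \<exists>S. P \<phi> S}"
    then obtain S where "P \<phi> S" by auto
    then have "P (c \<odot>\<^bsub>G\<^esub> \<phi>) S"
      using submodule_smult[OF mn sn a(1)] by (auto simp: P_def)
    then show "c \<odot>\<^bsub>G\<^esub> \<phi> \<in> {\<phi> \<in> carrier G. \<exists>S. P \<phi> S}" using a G.smult_closed by blast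
  qed blast
  moreover have "tensor_relations K A X Y \<subseteq> {\<phi> \<in> carrier G. \<exists>S. P \<phi> S}"
  proof
    fix \<psi> assume \<psi>: "\<psi> \<in> tensor_relations K A X Y"
    obtain S where "P \<psi> S" by (rule relation_finite[OF \<psi>]) (auto simp: P_def)
    then show "\<psi> \<in> {\<phi> \<in> carrier G. \<exists>S. P \<phi> S}" using relations_closed \<psi> by blast
  qed
  ultimately have "null \<subseteq> {\<phi> \<in> carrier G. \<exists>S. P \<phi> S}"
    unfolding tensor_null_eq by (rule lin_span_minimal)
  then obtain S where "P \<phi> S" using assms by blast
  then show thesis by (intro that[of S]) (auto simp: P_def)
qed

end

text \<open>Moves a left module into the element type of the test modules of \<open>flat_right\<close>.\<close>

definition transport :: "('k, 'b, 'c, 'y) bimod \<Rightarrow> ('y \<Rightarrow> 'z) \<Rightarrow> ('k, 'b, unit, 'z) bimod"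
  where "transport Y \<tau> = (let \<sigma> = inv_into (carrier Y) \<tau> in
    \<lparr>carrier = \<tau> ` carrier Y, mult = undefined, one = undefined, zero = \<tau> \<zero>\<^bsub>Y\<^esub>,
     add = (\<lambda>P Q. \<tau> (\<sigma> P \<oplus>\<^bsub>Y\<^esub> \<sigma> Q)), smult = (\<lambda>c P. \<tau> (c \<odot>\<^bsub>Y\<^esub> \<sigma> P)),
     lact = (\<lambda>b P. \<tau> (b \<triangleright>\<^bsub>Y\<^esub> \<sigma> P)), ract = undefined\<rparr>)"

lemma
  fixes K (structure)
  assumes "left_module K B Y" "inj_on \<tau> (carrier Y)" "ring B" "module K B"
  shows left_module_transport: "left_module K B (transport Y \<tau>)"
    and transport_left_maps: "\<tau> \<in> left_maps K B Y (transport Y \<tau>)"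
    and transport_inverse: "inv_into (carrier Y) \<tau> \<in> left_maps K B (transport Y \<tau>) Y"
proof -
  interpret Y: module K Y by (rule left_module_module[OF assms(1)])
  interpret B: ring B by fact
  interpret BK: module K B by fact
  note [simp] = inv_into_f_f[OF assms(2)] lact_closed[OF assms(1)]
    lact_add[OF assms(1)] add_lact[OF assms(1)] lact_lact[OF assms(1)] one_lact[OF assms(1)]
    smult_lact[OF assms(1)] lact_smult[OF assms(1)]
  have [simp]: "carrier (transport Y \<tau>) = \<tau> ` carrier Y" "zero (transport Y \<tau>) = \<tau> \<zero>\<^bsub>Y\<^esub>"
    "\<lbrakk>x \<in> carrier Y; y \<in> carrier Y\<rbrakk> \<Longrightarrow> \<tau> x \<oplus>\<^bsub>transport Y \<tau>\<^esub> \<tau> y = \<tau> (x \<oplus>\<^bsub>Y\<^esub> y)"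
    "x \<in> carrier Y \<Longrightarrow> c \<odot>\<^bsub>transport Y \<tau>\<^esub> \<tau> x = \<tau> (c \<odot>\<^bsub>Y\<^esub> x)"
    "x \<in> carrier Y \<Longrightarrow> b \<triangleright>\<^bsub>transport Y \<tau>\<^esub> \<tau> x = \<tau> (b \<triangleright>\<^bsub>Y\<^esub> x)" for x y c b
    by (simp_all add: transport_def Let_def)
  have "abelian_group (transport Y \<tau>)"
  proof (rule abelian_groupI)
    show "\<exists>y\<in>carrier (transport Y \<tau>). y \<oplus>\<^bsub>transport Y \<tau>\<^esub> x = \<zero>\<^bsub>transport Y \<tau>\<^esub>"
      if x: "x \<in> carrier (transport Y \<tau>)" for x
    proof -
      obtain a where "a \<in> carrier Y" "x = \<tau> a" using x by auto
      then show ?thesis using Y.l_neg[of a] by (auto intro!: bexI[of _ "\<ominus>\<^bsub>Y\<^esub> a"])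
    qed
  qed (auto simp: Y.a_ac)
  then have m: "module K (transport Y \<tau>)"
    by (rule moduleI[OF Y.R.is_cring]) (auto simp: Y.smult_l_distr Y.smult_r_distr Y.smult_assoc1)
  show "left_module K B (transport Y \<tau>)"
    unfolding left_module_def by (auto simp: m)
  show "\<tau> \<in> left_maps K B Y (transport Y \<tau>)"
    by (intro left_mapsI lin_mapsI) auto
  show "inv_into (carrier Y) \<tau> \<in> left_maps K B (transport Y \<tau>) Y"
    by (intro left_mapsI lin_mapsI) auto
qed

text \<open>\<open>\<tau>\<close> places a copy of \<open>Y\<close> in the type of the test modules.
  Injectivity is applied there to the copy of the inclusion of \<open>U\<close>, and the vanishing
  is carried back along the inverse of \<open>\<tau>\<close>.\<close>

lemma flat_right_transport:
  fixes X :: "('k, 'c, 'b, 'x) bimod" and Y :: "('k, 'b, 'd, 'y) bimod" and \<tau> :: "'y \<Rightarrow> (nat \<Rightarrow> 'b) set"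
  assumes "flat_right K B X" "left_module K B Y" "inj_on \<tau> (carrier Y)" "ring B" "module K B"
  shows "flat_for K B X Y"
  unfolding flat_for_def
proof (intro allI impI ballI)
  fix U Z
  assume U: "left_submodule K B Y U" and Z: "Z \<in> carrier (tensor K B X (Y\<lparr>carrier := U\<rparr>))"
    "tensor_map K B X Y (\<lambda>y. y) Z = \<zero>\<^bsub>tensor K B X Y\<^esub>"
  have rX: "right_module K B X" using assms(1) by (simp add: flat_right_def)
  note tr = assms(2-5)
  let ?N = "transport Y \<tau>" and ?Y = "Y\<lparr>carrier := U\<rparr>"
  let ?M = "?N\<lparr>carrier := \<tau> ` U\<rparr>"
  note lN = left_module_transport[OF tr] and t = transport_left_maps[OF tr] and s = transport_inverse[OF tr]
  have lsM: "left_submodule K B ?N (\<tau> ` U)" by (rule left_submodule_image[OF assms(2) lN t U])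
  have lM: "left_module K B ?M" by (rule left_module_submodule[OF lN lsM])
  have lY: "left_module K B ?Y" by (rule left_module_submodule[OF assms(2) U])
  note su = left_submodule_subset[OF U]
  have tM: "\<tau> \<in> left_maps K B ?Y ?M"
    using t su by (auto simp: left_maps_def intro!: lin_maps_restrict)
  have sM: "inv_into (carrier Y) \<tau> \<in> left_maps K B ?M ?Y"
    using s su left_submodule_subset[OF lsM] inv_into_f_f[OF assms(3)]
    by (auto simp: left_maps_def subset_iff intro!: lin_maps_restrict)
  note inM = inclusion_left_maps(2)[OF left_submodule_subset[OF lsM], of K B]
  note inY = inclusion_left_maps(2)[OF su, of K B]
  interpret PY: tensor_pair K B X ?Y by (rule tensor_pair.intro[OF rX lY])
  interpret PM: tensor_pair K B X ?M by (rule tensor_pair.intro[OF rX lM])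
  interpret PN: tensor_pair K B X ?N by (rule tensor_pair.intro[OF rX lN])
  interpret Q: tensor_pair K B X Y by (rule tensor_pair.intro[OF rX assms(2)])
  note l1 = tensor_map_linear[OF rX lY lM tM] and t1 = tensor_map_tens[OF rX lY lM tM]
  note l2 = tensor_map_linear[OF rX lM lN inM] and t2 = tensor_map_tens[OF rX lM lN inM]
  note l3 = tensor_map_linear[OF rX lY assms(2) inY] and t3 = tensor_map_tens[OF rX lY assms(2) inY]
  note l4 = tensor_map_linear[OF rX assms(2) lN t] and t4 = tensor_map_tens[OF rX assms(2) lN t]
  note l5 = tensor_map_linear[OF rX lM lY sM] and t5 = tensor_map_tens[OF rX lM lY sM]
  let ?Z = "tensor_map K B X ?M \<tau> Z"
  have "tensor_map K B X ?N (\<lambda>y. y) ?Z = tensor_map K B X ?N \<tau> (tensor_map K B X Y (\<lambda>y. y) Z)"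
    by (rule PY.tensor_ext[OF lin_maps_comp[OF l1 l2] lin_maps_comp[OF l3 l4] Z(1)])
      (use su in \<open>auto simp: t1 t2 t3 t4 subset_iff\<close>)
  also have "\<dots> = \<zero>\<^bsub>PN.T\<^esub>"
    unfolding Z(2) by (rule lin_maps_zero[OF Q.module_tensor PN.module_tensor l4])
  also have "\<dots> = tensor_map K B X ?N (\<lambda>y. y) \<zero>\<^bsub>PM.T\<^esub>"
    by (rule lin_maps_zero[OF PM.module_tensor PN.module_tensor l2, symmetric])
  finally have eq: "tensor_map K B X ?N (\<lambda>y. y) ?Z = tensor_map K B X ?N (\<lambda>y. y) \<zero>\<^bsub>PM.T\<^esub>" .
  interpret PMT: module K PM.T by (rule PM.module_tensor)
  have "inj_on (tensor_map K B X ?N (\<lambda>y. y)) (carrier PM.T)"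
    by (rule conjunct2[OF assms(1)[unfolded flat_right_def], rule_format, of ?M ?N "\<lambda>y. y"])
      (use lM lN inM in \<open>simp add: inj_on_def\<close>)
  then have Z0: "?Z = \<zero>\<^bsub>PM.T\<^esub>"
    using eq lin_maps_closed[OF l1 Z(1)] PMT.zero_closed by (rule inj_onD)
  have "Z = tensor_map K B X ?Y (inv_into (carrier Y) \<tau>) ?Z"
    by (rule PY.tensor_ext[OF _ lin_maps_comp[OF l1 l5] Z(1)])
      (use su in \<open>auto intro!: lin_mapsI simp: t1 t5 subset_iff inv_into_f_f[OF assms(3)]\<close>)
  also have "\<dots> = \<zero>\<^bsub>PY.T\<^esub>"
    unfolding Z0 by (rule lin_maps_zero[OF PM.module_tensor PY.module_tensor l5])
  finally show "Z = \<zero>\<^bsub>PY.T\<^esub>" .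
qed

lemma act_linear:
  "\<lbrakk>left_module K B Y; y \<in> carrier Y\<rbrakk> \<Longrightarrow> (\<lambda>b. b \<triangleright>\<^bsub>Y\<^esub> y) \<in> lin_maps K B Y"
  by (intro lin_mapsI) (auto simp: lact_closed add_lact smult_lact)

text \<open>The module generated by \<open>r\<close> elements is a quotient of the
  \<open>r\<close>-fold sum of \<open>B\<close>. Each of its elements is named by the set of all its
  coefficient vectors; these sets are non-empty and pairwise disjoint, so the naming is injective
  into the type of the test modules.\<close>

lemma finitely_generated_submodule:
  fixes Y :: "('k, 'b, 'c, 'y) bimod"
  assumes "left_module K B Y" "ring B" "module K B" "finite S" "S \<subseteq> carrier Y"
  obtains U and \<tau> :: "'y \<Rightarrow> (nat \<Rightarrow> 'b) set"
    where "left_submodule K B Y U" "S \<subseteq> U" "inj_on \<tau> U"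
proof -
  interpret Y: module K Y by (rule left_module_module[OF assms(1)])
  interpret B: ring B by fact
  interpret BK: module K B by fact
  note [simp] = lact_closed[OF assms(1)]
  obtain h :: "nat \<Rightarrow> 'y" and r where h: "S = h ` {..<r}"
    using assms(4) by (metis finite_imp_nat_seg_image_inj_on lessThan_def)
  have hc [simp]: "h i \<in> carrier Y" if "i < r" for i using that h assms(5) by auto
  \<comment> \<open>The values from \<open>r\<close> on are arbitrary. The sum \<open>s\<close>
    ignores them, so the fibres become larger but stay disjoint.\<close>
  define C where "C = ({..<r} \<rightarrow> carrier B)"
  define s where "s c = (\<Oplus>\<^bsub>Y\<^esub>i\<in>{..<r}. c i \<triangleright>\<^bsub>Y\<^esub> h i)" for c
  have cl: "(\<lambda>i. c i \<triangleright>\<^bsub>Y\<^esub> h i) \<in> {..<r} \<rightarrow> carrier Y" if "c \<in> C" for c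
    using that by (auto simp: C_def Pi_def)
  let ?U = "s ` C"
  have "submodule ?U K Y"
  proof (rule submoduleI'[OF Y.module_axioms])
    show "?U \<subseteq> carrier Y" using cl by (auto simp: s_def intro!: Y.finsum_closed)
    have "s (\<lambda>i. \<zero>\<^bsub>B\<^esub>) = (\<Oplus>\<^bsub>Y\<^esub>i\<in>{..<r}. \<zero>\<^bsub>Y\<^esub>)"
      unfolding s_def using lin_maps_zero[OF BK.module_axioms Y.module_axioms act_linear[OF assms(1) hc]]
      by (intro Y.finsum_cong') auto
    then show "\<zero>\<^bsub>Y\<^esub> \<in> ?U" by (intro image_eqI[of _ _ "\<lambda>i. \<zero>\<^bsub>B\<^esub>"]) (auto simp: C_def)
  next
    fix x y assume "x \<in> ?U" "y \<in> ?U"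
    then obtain c c' where *: "c \<in> C" "c' \<in> C" "x = s c" "y = s c'" by auto
    have "s (\<lambda>i. c i \<oplus>\<^bsub>B\<^esub> c' i) = (\<Oplus>\<^bsub>Y\<^esub>i\<in>{..<r}. (c i \<triangleright>\<^bsub>Y\<^esub> h i) \<oplus>\<^bsub>Y\<^esub> (c' i \<triangleright>\<^bsub>Y\<^esub> h i))"
      unfolding s_def using * by (intro Y.finsum_cong') (auto simp: C_def Pi_def add_lact[OF assms(1)])
    also have "\<dots> = x \<oplus>\<^bsub>Y\<^esub> y"
      unfolding * s_def by (rule Y.finsum_addf) (use cl * in auto)
    finally show "x \<oplus>\<^bsub>Y\<^esub> y \<in> ?U"
      using * by (intro image_eqI[of _ _ "\<lambda>i. c i \<oplus>\<^bsub>B\<^esub> c' i"]) (auto simp: C_def Pi_def)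
  next
    fix k x assume k: "k \<in> carrier K" and "x \<in> ?U"
    then obtain c where *: "c \<in> C" "x = s c" by auto
    have "s (\<lambda>i. k \<odot>\<^bsub>B\<^esub> c i) = (\<Oplus>\<^bsub>Y\<^esub>i\<in>{..<r}. k \<odot>\<^bsub>Y\<^esub> (c i \<triangleright>\<^bsub>Y\<^esub> h i))"
      unfolding s_def using * k by (intro Y.finsum_cong') (auto simp: C_def Pi_def smult_lact[OF assms(1)])
    also have "\<dots> = k \<odot>\<^bsub>Y\<^esub> x"
      unfolding * s_def by (rule Y.finsum_smult_ldistr[symmetric]) (use cl * k in auto)
    finally show "k \<odot>\<^bsub>Y\<^esub> x \<in> ?U"
      using * k by (intro image_eqI[of _ _ "\<lambda>i. k \<odot>\<^bsub>B\<^esub> c i"]) (auto simp: C_def Pi_def)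
  qed
  moreover have "b \<triangleright>\<^bsub>Y\<^esub> x \<in> ?U" if b: "b \<in> carrier B" and x: "x \<in> ?U" for b x
  proof -
    obtain c where *: "c \<in> C" "x = s c" using x by auto
    have "b \<triangleright>\<^bsub>Y\<^esub> x = (\<Oplus>\<^bsub>Y\<^esub>i\<in>{..<r}. b \<triangleright>\<^bsub>Y\<^esub> (c i \<triangleright>\<^bsub>Y\<^esub> h i))"
      unfolding * s_def
      by (rule lin_maps_finsum[OF Y.module_axioms Y.module_axioms lact_linear[OF assms(1) b]]) (use cl * in auto)
    also have "\<dots> = s (\<lambda>i. b \<otimes>\<^bsub>B\<^esub> c i)"
      unfolding s_def using * b by (intro Y.finsum_cong') (auto simp: C_def Pi_def lact_lact[OF assms(1)])
    finally show ?thesis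
      using * b by (intro image_eqI[of _ _ "\<lambda>i. b \<otimes>\<^bsub>B\<^esub> c i"]) (auto simp: C_def Pi_def)
  qed
  ultimately have "left_submodule K B Y ?U" by (simp add: left_submodule_def)
  moreover have "h j \<in> ?U" if j: "j < r" for j
  proof -
    let ?c = "\<lambda>i. if i = j then \<one>\<^bsub>B\<^esub> else \<zero>\<^bsub>B\<^esub>"
    have "s ?c = (\<Oplus>\<^bsub>Y\<^esub>i\<in>{..<r}. if j = i then h i else \<zero>\<^bsub>Y\<^esub>)"
      unfolding s_def using lin_maps_zero[OF BK.module_axioms Y.module_axioms act_linear[OF assms(1) hc]]
      by (intro Y.finsum_cong') (auto simp: one_lact[OF assms(1)])
    also have "\<dots> = h j" using j by (intro Y.add.finprod_singleton) auto
    finally show ?thesis by (intro image_eqI[of _ _ ?c]) (auto simp: C_def)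
  qed
  then have "S \<subseteq> ?U" using h by auto
  moreover have "inj_on (\<lambda>y. {c \<in> C. s c = y}) ?U" by (rule inj_onI) blast
  ultimately show thesis by (rule that)
qed

text \<open>Reduction to finitely generated modules. The relations that annihilate \<open>Z\<close>
  over \<open>Y\<close> involve finitely many elements, so \<open>Z\<close> dies over some finitely
  generated \<open>U'\<close>, where \<open>flat_right_transport\<close> is available.\<close>

lemma flat_right_flat_for:
  fixes X :: "('k, 'c, 'b, 'x) bimod" and Y :: "('k, 'b, 'd, 'y) bimod"
  assumes "flat_right K B X" "left_module K B Y" "ring B" "module K B"
  shows "flat_for K B X Y"
  unfolding flat_for_def
proof (intro allI impI ballI)
  fix U Z
  assume U: "left_submodule K B Y U" and Z: "Z \<in> carrier (tensor K B X (Y\<lparr>carrier := U\<rparr>))"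
    "tensor_map K B X Y (\<lambda>y. y) Z = \<zero>\<^bsub>tensor K B X Y\<^esub>"
  have rX: "right_module K B X" using assms(1) by (simp add: flat_right_def)
  interpret Q: tensor_pair K B X Y by (rule tensor_pair.intro[OF rX assms(2)])
  let ?Y = "\<lambda>U. Y\<lparr>carrier := U\<rparr>"
  have pair: "tensor_pair K B X (?Y U)" if "left_submodule K B Y U" for U
    by (rule tensor_pair.intro[OF rX left_module_submodule[OF assms(2) that]])
  interpret P: tensor_pair K B X "?Y U" by (rule pair[OF U])
  obtain \<phi> where \<phi>: "\<phi> \<in> carrier P.G" "Z = P.null +>\<^bsub>P.G\<^esub> \<phi>" using Z(1) unfolding P.carrier_T by blast
  have zT: "\<zero>\<^bsub>tensor K B X V\<^esub> = tensor_null K B X V" for V :: "('k, 'b, 'd, 'y) bimod"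
    by (simp add: tensor_def)
  have "Q.null +>\<^bsub>Q.G\<^esub> \<phi> = Q.null" using Z(2) unfolding \<phi>(2) Q.inclusion_coset[OF U \<phi>(1)] zT .
  then have "\<phi> \<in> Q.null"
    using coset_zero_iff[OF Q.G.module_axioms Q.submodule_null Q.tensor_free_sub[OF U \<phi>(1)]] by simp
  then obtain S where S: "finite S" "S \<subseteq> carrier Y"
    "\<And>U. \<lbrakk>left_submodule K B Y U; S \<subseteq> U\<rbrakk> \<Longrightarrow> \<phi> \<in> tensor_null K B X (?Y U)"
    by (rule Q.null_finite) (rule that)
  let ?supp = "{s. \<phi> s \<noteq> \<zero>\<^bsub>K\<^esub>}"
  have sup: "finite ?supp" "?supp \<subseteq> carrier X \<times> U" using \<phi>(1) by (auto simp: free_space_carrier)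
  \<comment> \<open>Besides the witnesses in \<open>S\<close>, the second components of the support
    are included, so that \<open>\<phi>\<close> is itself an element of the free space over
    \<open>U'\<close>.\<close>
  have "finite (S \<union> snd ` ?supp)" "S \<union> snd ` ?supp \<subseteq> carrier Y"
    using S sup left_submodule_subset[OF U] by auto
  then obtain U' and \<tau> :: "'y \<Rightarrow> (nat \<Rightarrow> 'b) set" where U': "left_submodule K B Y U'" "S \<union> snd ` ?supp \<subseteq> U'" "inj_on \<tau> U'"
    by (rule finitely_generated_submodule[OF assms(2-4)])
  \<comment> \<open>The tensor is tested for the inclusion of \<open>?W\<close> in
    \<open>U'\<close>; since \<open>?W\<close> also lies in \<open>U\<close>, its vanishing over
    \<open>?W\<close> gives the vanishing over \<open>U\<close>.\<close>
  let ?W = "U \<inter> U'"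
  have W: "left_submodule K B Y ?W" by (rule left_submodule_Int[OF assms(2) U U'(1)])
  interpret P': tensor_pair K B X "?Y U'" by (rule pair[OF U'(1)])
  interpret PW: tensor_pair K B X "?Y ?W" by (rule pair[OF W])
  have mem: "s \<in> carrier X \<times> ?W" if "\<phi> s \<noteq> \<zero>\<^bsub>K\<^esub>" for s
  proof -
    have "s \<in> carrier X \<times> U" "snd s \<in> U'" using that sup(2) U'(2) by blast+
    then show ?thesis by (cases s) simp
  qed
  have "\<forall>s. s \<notin> carrier X \<times> ?W \<longrightarrow> \<phi> s = \<zero>\<^bsub>K\<^esub>" using mem by blast
  then have \<phi>W: "\<phi> \<in> carrier PW.G"
    using \<phi>(1) unfolding tensor_free_fields free_space_carrier by simp
  have WU': "left_submodule K B (?Y U') ?W" and WU: "left_submodule K B (?Y U) ?W"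
    by (rule left_submodule_restrict[OF assms(2) U'(1) W], blast)
      (rule left_submodule_restrict[OF assms(2) U W], blast)
  have "\<phi> \<in> P'.null" using S(3)[OF U'(1)] U'(2) by simp
  moreover have "\<phi> \<in> carrier P'.G"
    using P'.tensor_free_sub[OF WU'] \<phi>W by simp
  ultimately have n': "P'.null +>\<^bsub>P'.G\<^esub> \<phi> = P'.null"
    using coset_zero_iff[OF P'.G.module_axioms P'.submodule_null] by blast
  have "flat_for K B X (?Y U')"
    using U'(3) by (intro flat_right_transport[OF assms(1) left_module_submodule[OF assms(2) U'(1)] _ assms(3,4)]) simp
  note ff = this[unfolded flat_for_def, rule_format, OF WU', of "PW.null +>\<^bsub>PW.G\<^esub> \<phi>"]
  have "PW.null +>\<^bsub>PW.G\<^esub> \<phi> \<in> carrier PW.T" unfolding PW.carrier_T using \<phi>W by (rule imageI)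
  then have "PW.null +>\<^bsub>PW.G\<^esub> \<phi> = PW.null"
    using ff P'.inclusion_coset[OF WU', of \<phi>] \<phi>W n' zT[of "?Y ?W"] zT[of "?Y U'"]
    by (simp del: tensor_free_fields)
  then have "\<phi> \<in> PW.null" using coset_zero_iff[OF PW.G.module_axioms PW.submodule_null \<phi>W] by blast
  then have "\<phi> \<in> P.null" using P.null_sub[OF WU] by auto
  then show "Z = \<zero>\<^bsub>P.T\<^esub>"
    using coset_zero_iff[OF P.G.module_axioms P.submodule_null \<phi>(1)] \<phi>(2) zT by simp
qed

text \<open>Serves degree 0, since the bundle condition provides flatness only from degree 1 on.
  Every element of the tensor product with \<open>U\<close> has the form
  \<open>1 \<otimes> u\<close>, and the action map to \<open>Y\<close> recovers
  \<open>u\<close>.\<close>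

lemma regular_flat_for:
  assumes "right_module K B X" "left_module K B Y" "ring B"
    and X: "carrier X = carrier B" "add X = add B" "smult X = smult B" "ract X = mult B"
  shows "flat_for K B X Y"
  unfolding flat_for_def
proof (intro allI impI ballI)
  fix U Z
  assume U: "left_submodule K B Y U" and Z: "Z \<in> carrier (tensor K B X (Y\<lparr>carrier := U\<rparr>))"
    "tensor_map K B X Y (\<lambda>y. y) Z = \<zero>\<^bsub>tensor K B X Y\<^esub>"
  note lU = left_module_submodule[OF assms(2) U] and su = left_submodule_subset[OF U]
  interpret B: ring B by fact
  interpret Q: tensor_pair K B X Y by (rule tensor_pair.intro[OF assms(1,2)])
  interpret P: tensor_pair K B X "Y\<lparr>carrier := U\<rparr>" by (rule tensor_pair.intro[OF assms(1) lU])
  have bal: "balanced K B X Y Y (\<lambda>b y. b \<triangleright>\<^bsub>Y\<^esub> y)"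
    by (rule balancedI) (use lact_linear[OF assms(2)] act_linear[OF assms(2)] in
        \<open>auto simp: X lact_lact[OF assms(2)] lin_maps_def\<close>)
  interpret R: tensor_target K B X Y Y "\<lambda>b y. b \<triangleright>\<^bsub>Y\<^esub> y"
    by (intro tensor_target.intro tensor_target_axioms.intro Q.tensor_pair_axioms Q.Y.module_axioms bal)
  have "\<exists>u\<in>U. Z = P.tn \<one>\<^bsub>B\<^esub> u"
    using Z(1)
  proof (induction Z rule: P.tensor_induct)
    case (tens b u)
    then have "P.tn b u = P.tn \<one>\<^bsub>B\<^esub> (b \<triangleright>\<^bsub>Y\<^esub> u)"
      using P.tens_balanced[of "\<one>\<^bsub>B\<^esub>" b u] by (simp add: X)
    then show ?case using tens left_submodule_lact[OF U] X(1) by auto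
  next
    case (add Z W)
    then obtain u w where "u \<in> U" "w \<in> U" "Z = P.tn \<one>\<^bsub>B\<^esub> u" "W = P.tn \<one>\<^bsub>B\<^esub> w" by auto
    then show ?case
      using P.tens_add_right[of "\<one>\<^bsub>B\<^esub>" u w] P.Y.a_closed[of u w] by (auto simp: X)
  qed
  then obtain u where u: "u \<in> U" "Z = P.tn \<one>\<^bsub>B\<^esub> u" by auto
  have "Q.tn \<one>\<^bsub>B\<^esub> u = \<zero>\<^bsub>Q.T\<^esub>"
    using Z(2) tensor_map_tens[OF assms(1) lU assms(2) inclusion_left_maps(2)[OF su], of "\<one>\<^bsub>B\<^esub>" u] u
    by (simp add: X)
  then have "u = \<zero>\<^bsub>Y\<^esub>"
    using R.tensor_lift_tens[of "\<one>\<^bsub>B\<^esub>" u] lin_maps_zero[OF Q.module_tensor Q.Y.module_axioms R.tensor_lift_linear]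
      u su by (auto simp: X one_lact[OF assms(2)])
  then show "Z = \<zero>\<^bsub>P.T\<^esub>"
    using u lin_maps_zero[OF P.Y.module_axioms P.module_tensor P.tens_linear_right[of "\<one>\<^bsub>B\<^esub>"]] X(1) by simp
qed

text \<open>The inverse of \<open>(X \<otimes> N) / (X \<otimes> ker f) \<rightarrow> X \<otimes> P\<close> sends \<open>x \<otimes> f n\<close> to the class of \<open>x \<otimes> n\<close>.\<close>

lemma tensor_right_exact:
  assumes "right_module K B X" "left_module K B N" "left_module K B P" "f \<in> left_maps K B N P"
    and "f ` carrier N = carrier P"
    and Z: "Z \<in> carrier (tensor K B X N)" "tensor_map K B X P f Z = \<zero>\<^bsub>tensor K B X P\<^esub>"
  obtains W where "W \<in> carrier (tensor K B X (N\<lparr>carrier := {n \<in> carrier N. f n = \<zero>\<^bsub>P\<^esub>}\<rparr>))"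
    "tensor_map K B X N (\<lambda>n. n) W = Z"
proof -
  let ?L = "{n \<in> carrier N. f n = \<zero>\<^bsub>P\<^esub>}"
  have L: "left_submodule K B N ?L" by (rule left_submodule_kernel[OF assms(2-4)])
  note lL = left_module_submodule[OF assms(2) L]
  have inc: "(\<lambda>y. y) \<in> left_maps K B (N\<lparr>carrier := ?L\<rparr>) N" by (rule inclusion_left_maps) auto
  interpret TN: tensor_pair K B X N by (rule tensor_pair.intro[OF assms(1,2)])
  interpret TP: tensor_pair K B X P by (rule tensor_pair.intro[OF assms(1,3)])
  interpret TL: tensor_pair K B X "N\<lparr>carrier := ?L\<rparr>" by (rule tensor_pair.intro[OF assms(1) lL])
  note fl = left_mapsD(1)[OF assms(4)]
  note lin = tensor_map_linear[OF assms(1) lL assms(2) inc] and tns = tensor_map_tens[OF assms(1) lL assms(2) inc]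
  let ?S = "tensor_map K B X N (\<lambda>n. n) ` carrier TL.T"
  have S: "submodule ?S K TN.T"
    by (rule submodule_image[OF TL.module_tensor TN.module_tensor lin submodule_carrier[OF TL.module_tensor]])
  let ?Q = "quot_space TN.T ?S"
  have mQ: "module K ?Q" by (rule module_quot_space[OF TN.module_tensor S])
  note cQ = coset_linear[OF TN.module_tensor S]
  \<comment> \<open>A merely set-theoretic section of \<open>f\<close>. It is not linear, but by
    \<open>key\<close> the class of \<open>x \<otimes> s p\<close> modulo \<open>?S\<close> does not
    depend on the choice, which restores linearity and balancedness.\<close>
  define s where "s = inv_into (carrier N) f"
  have s: "s y \<in> carrier N" "f (s y) = y" if "y \<in> carrier P" for y
    using that assms(5) unfolding s_def by (auto intro: inv_into_into f_inv_into_f)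
  have key: "?S +>\<^bsub>TN.T\<^esub> TN.tn x n = ?S +>\<^bsub>TN.T\<^esub> TN.tn x n'"
    if "x \<in> carrier X" "n \<in> carrier N" "n' \<in> carrier N" "f n = f n'" for x n n'
  proof -
    have "n \<ominus>\<^bsub>N\<^esub> n' \<in> ?L"
      using that lin_maps_minus[OF TN.Y.module_axioms TP.Y.module_axioms fl, of n n']
        minus_zero_iff[OF TP.Y.module_axioms, of "f n" "f n"] lin_maps_closed[OF fl] by simp
    then have "TN.tn x n \<ominus>\<^bsub>TN.T\<^esub> TN.tn x n' \<in> ?S"
      using that tns[of x "n \<ominus>\<^bsub>N\<^esub> n'"] TL.tens_closed[of x "n \<ominus>\<^bsub>N\<^esub> n'"]
      by (auto simp: lin_maps_minus[OF TN.Y.module_axioms TN.module_tensor TN.tens_linear_right, symmetric]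
          intro!: image_eqI)
    then show ?thesis
      using that coset_eq_iff[OF TN.module_tensor S] TN.tens_closed by blast
  qed
  have "balanced K B X P ?Q (\<lambda>x p. ?S +>\<^bsub>TN.T\<^esub> TN.tn x (s p))"
  proof (rule balancedI)
    show "(\<lambda>x. ?S +>\<^bsub>TN.T\<^esub> TN.tn x (s p)) \<in> lin_maps K X ?Q" if "p \<in> carrier P" for p
      by (rule lin_maps_comp[OF TN.tens_linear_left[OF s(1)[OF that]] cQ])
    show "(\<lambda>p. ?S +>\<^bsub>TN.T\<^esub> TN.tn x (s p)) \<in> lin_maps K P ?Q" if x: "x \<in> carrier X" for x
    proof (rule lin_mapsI)
      note c = lin_maps_comp[OF TN.tens_linear_right[OF x] cQ]
      show "?S +>\<^bsub>TN.T\<^esub> TN.tn x (s p) \<in> carrier ?Q" if "p \<in> carrier P" for p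
        using lin_maps_closed[OF c s(1)[OF that]] .
      show "?S +>\<^bsub>TN.T\<^esub> TN.tn x (s (p \<oplus>\<^bsub>P\<^esub> p')) = (?S +>\<^bsub>TN.T\<^esub> TN.tn x (s p)) \<oplus>\<^bsub>?Q\<^esub> (?S +>\<^bsub>TN.T\<^esub> TN.tn x (s p'))"
        if "p \<in> carrier P" "p' \<in> carrier P" for p p'
        unfolding lin_maps_add[OF c s(1)[OF that(1)] s(1)[OF that(2)], symmetric]
        by (rule key[OF x]) (use that s in \<open>simp_all add: lin_maps_add[OF fl]\<close>)
      show "?S +>\<^bsub>TN.T\<^esub> TN.tn x (s (k \<odot>\<^bsub>P\<^esub> p)) = k \<odot>\<^bsub>?Q\<^esub> (?S +>\<^bsub>TN.T\<^esub> TN.tn x (s p))"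
        if "k \<in> carrier K" "p \<in> carrier P" for k p
        unfolding lin_maps_smult[OF c that(1) s(1)[OF that(2)], symmetric]
        by (rule key[OF x]) (use that s in \<open>simp_all add: lin_maps_smult[OF fl]\<close>)
    qed
    show "?S +>\<^bsub>TN.T\<^esub> TN.tn (x \<triangleleft>\<^bsub>X\<^esub> b) (s p) = ?S +>\<^bsub>TN.T\<^esub> TN.tn x (s (b \<triangleright>\<^bsub>P\<^esub> p))"
      if "x \<in> carrier X" "b \<in> carrier B" "p \<in> carrier P" for x b p
      unfolding TN.tens_balanced[OF that(1,2) s(1)[OF that(3)]]
      by (rule key) (use that s in \<open>simp_all add: left_mapsD(2)[OF assms(4)] lact_closed[OF assms(2)] lact_closed[OF assms(3)]\<close>)
  qed
  then interpret R: tensor_target K B X P ?Q "\<lambda>x p. ?S +>\<^bsub>TN.T\<^esub> TN.tn x (s p)"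
    by (intro tensor_target.intro tensor_target_axioms.intro TP.tensor_pair_axioms mQ)
  note fm = tensor_map_linear[OF assms(1-4)] tensor_map_tens[OF assms(1-4)]
  \<comment> \<open>The map just built, composed with \<open>id \<otimes> f\<close>, is the
    projection modulo \<open>?S\<close>. As \<open>id \<otimes> f\<close> sends \<open>Z\<close> to
    zero, so does the projection.\<close>
  have "?S +>\<^bsub>TN.T\<^esub> Z = tensor_lift K ?Q (\<lambda>x p. ?S +>\<^bsub>TN.T\<^esub> TN.tn x (s p)) (tensor_map K B X P f Z)"
  proof (rule TN.tensor_ext[OF cQ lin_maps_comp[OF fm(1) R.tensor_lift_linear] Z(1)])
    fix x n assume a: "x \<in> carrier X" "n \<in> carrier N"
    then have "f n \<in> carrier P" using lin_maps_closed[OF fl] by blast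
    then show "?S +>\<^bsub>TN.T\<^esub> TN.tn x n =
        tensor_lift K ?Q (\<lambda>x p. ?S +>\<^bsub>TN.T\<^esub> TN.tn x (s p)) (tensor_map K B X P f (TN.tn x n))"
      unfolding fm(2)[OF a] using a by (simp only: R.tensor_lift_tens) (rule key, use a s in auto)
  qed
  also have "\<dots> = ?S"
    unfolding Z(2) using lin_maps_zero[OF TP.module_tensor mQ R.tensor_lift_linear] by simp
  finally have "Z \<in> ?S" using coset_zero_iff[OF TN.module_tensor S Z(1)] by blast
  then show thesis using that by auto
qed

section \<open>Cochain complexes\<close>

locale cochain_complex =
  fixes K :: "('k, 'r) ring_scheme" and X :: "nat \<Rightarrow> ('k, 'x, 'm) module_scheme" and d :: "nat \<Rightarrow> 'x \<Rightarrow> 'x"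
  assumes module_X: "module K (X n)"
    and d_linear: "d n \<in> lin_maps K (X n) (X (Suc n))"
    and d_d: "x \<in> carrier (X n) \<Longrightarrow> d (Suc n) (d n x) = \<zero>\<^bsub>X (Suc (Suc n))\<^esub>"
begin

abbreviation "coc \<equiv> cocycles X d"
abbreviation "cob \<equiv> coboundaries X d"

lemma submodule_cocycles: "submodule (coc n) K (X n)"
  using submodule_kernel[OF module_X module_X d_linear] by (simp add: cocycles_def)

lemma cocycles_subset: "coc n \<subseteq> carrier (X n)"
  by (auto simp: cocycles_def)

lemma coboundaries_Suc: "cob (Suc n) = d n ` carrier (X n)"
  and coboundaries_0: "cob 0 = {\<zero>\<^bsub>X 0\<^esub>}"
  by (simp_all add: coboundaries_def)

lemma submodule_coboundaries: "submodule (cob n) K (X n)"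
  using submodule_image[OF module_X module_X d_linear submodule_carrier[OF module_X]] submodule_zero_set[OF module_X]
  by (cases n) (simp_all add: coboundaries_Suc coboundaries_0)

lemma coboundaries_cocycles: "cob n \<subseteq> coc n"
  using submodule_zero[OF module_X submodule_cocycles] lin_maps_closed[OF d_linear] d_d
  by (cases n) (auto simp: coboundaries_Suc coboundaries_0 cocycles_def)

lemma module_cocycles: "module K ((X n)\<lparr>carrier := coc n\<rparr>)"
  by (rule module_restrict[OF module_X submodule_cocycles])

lemma submodule_coboundaries_cocycles: "submodule (cob n) K ((X n)\<lparr>carrier := coc n\<rparr>)"
  by (rule submodule_restrict[OF module_X submodule_cocycles submodule_coboundaries coboundaries_cocycles])

lemma module_cohomology: "module K (cohomology X d n)"
  unfolding cohomology_def by (rule module_quot_space[OF module_cocycles submodule_coboundaries_cocycles])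

lemma carrier_cohomology: "carrier (cohomology X d n) = (\<lambda>x. cob n +>\<^bsub>X n\<^esub> x) ` coc n"
  by (simp add: cohomology_def)

lemma zero_cohomology: "\<zero>\<^bsub>cohomology X d n\<^esub> = cob n"
  by (simp add: cohomology_def)

lemma class_linear: "(\<lambda>x. cob n +>\<^bsub>X n\<^esub> x) \<in> lin_maps K ((X n)\<lparr>carrier := coc n\<rparr>) (cohomology X d n)"
  using coset_linear[OF module_cocycles submodule_coboundaries_cocycles] by (simp add: cohomology_def)

lemma class_zero_iff: "x \<in> carrier (X n) \<Longrightarrow> cob n +>\<^bsub>X n\<^esub> x = cob n \<longleftrightarrow> x \<in> cob n"
  by (rule coset_zero_iff[OF module_X submodule_coboundaries])

end

text \<open>The hypotheses compare cocycles and coboundaries in the single degree \<open>n\<close>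
  and do not ask for a chain map, because \<open>g\<close> commutes with the differentials only up
  to a sign.\<close>

lemma cohomology_iso:
  assumes "cochain_complex K X d" "cochain_complex K Y d'" "g \<in> lin_isos K (X n) (Y n)"
    and "\<And>x. x \<in> carrier (X n) \<Longrightarrow> g x \<in> cocycles Y d' n \<longleftrightarrow> x \<in> cocycles X d n"
    and "g ` coboundaries X d n = coboundaries Y d' n"
  shows "quot_map (Y n) (coboundaries Y d' n) g \<in> lin_isos K (cohomology X d n) (cohomology Y d' n)"
proof -
  interpret X: cochain_complex K X d by fact
  interpret Y: cochain_complex K Y d' by fact
  note g = lin_isosD[OF assms(3)]
  have gc: "g ` X.coc n = Y.coc n"
  proof
    show "g ` X.coc n \<subseteq> Y.coc n" using assms(4) X.cocycles_subset by blast
    show "Y.coc n \<subseteq> g ` X.coc n"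
    proof
      fix y assume y: "y \<in> Y.coc n"
      then obtain x where "x \<in> carrier (X n)" "y = g x" using g(3) Y.cocycles_subset by blast
      then show "y \<in> g ` X.coc n" using assms(4) y by blast
    qed
  qed
  have gl: "g \<in> lin_maps K ((X n)\<lparr>carrier := X.coc n\<rparr>) ((Y n)\<lparr>carrier := Y.coc n\<rparr>)"
    by (rule lin_maps_restrict[OF g(1) X.cocycles_subset]) (use gc in auto)
  show ?thesis
    unfolding cohomology_def[of X]
  proof (rule factor_iso[OF X.module_cocycles Y.module_cohomology lin_maps_comp[OF gl Y.class_linear]])
    show "carrier (cohomology Y d' n) \<subseteq> (\<lambda>x. Y.cob n +>\<^bsub>Y n\<^esub> g x) ` carrier ((X n)\<lparr>carrier := X.coc n\<rparr>)"
      unfolding Y.carrier_cohomology gc[symmetric] by auto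
    have "X.cob n \<subseteq> carrier (X n)" using X.cocycles_subset X.coboundaries_cocycles by blast
    then have "g x \<in> Y.cob n \<longleftrightarrow> x \<in> X.cob n" if "x \<in> carrier (X n)" for x
      unfolding assms(5)[symmetric] by (rule inj_on_image_mem_iff[OF g(2) that])
    then have "Y.cob n +>\<^bsub>Y n\<^esub> g x = \<zero>\<^bsub>cohomology Y d' n\<^esub> \<longleftrightarrow> x \<in> X.cob n" if "x \<in> X.coc n" for x
      using that X.cocycles_subset Y.class_zero_iff[OF lin_maps_closed[OF g(1)]]
      unfolding Y.zero_cohomology by blast
    then show "X.cob n = {x \<in> carrier ((X n)\<lparr>carrier := X.coc n\<rparr>). Y.cob n +>\<^bsub>Y n\<^esub> g x = \<zero>\<^bsub>cohomology Y d' n\<^esub>}"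
      using X.coboundaries_cocycles[of n] by auto
    show "quot_map (Y n) (Y.cob n) g (X.cob n +>\<^bsub>(X n)\<lparr>carrier := X.coc n\<rparr>\<^esub> x) = Y.cob n +>\<^bsub>Y n\<^esub> g x"
      if "x \<in> carrier ((X n)\<lparr>carrier := X.coc n\<rparr>)" for x
      using that assms(5) X.cocycles_subset
      by (simp, intro quot_map_linear[OF X.module_X Y.module_X g(1) X.submodule_coboundaries Y.submodule_coboundaries]) auto
  qed
qed

section \<open>Tensoring a complex with a flat module\<close>

locale tensor_complex =
  fixes K :: "('k, 'r) ring_scheme" and B :: "('k, 'b, 'm) module_scheme"
    and X :: "('k, 'c, 'b, 'x) bimod" and N :: "nat \<Rightarrow> ('k, 'b, 'a, 'y) bimod" and d :: "nat \<Rightarrow> 'y \<Rightarrow> 'y"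
  assumes right: "right_module K B X" and left_N: "left_module K B (N n)"
    and d_left: "d n \<in> left_maps K B (N n) (N (Suc n))"
    and d_d: "x \<in> carrier (N n) \<Longrightarrow> d (Suc n) (d n x) = \<zero>\<^bsub>N (Suc (Suc n))\<^esub>"
    and ring_B: "ring B" and module_B: "module K B"
    and flat: "flat_for K B X (N n)"
begin

sublocale N: cochain_complex K N d
  by (rule cochain_complex.intro) (rule left_module_module[OF left_N], rule left_mapsD(1)[OF d_left], erule d_d)

abbreviation "TX n \<equiv> tensor K B X (N n)"
abbreviation "tX n \<equiv> tens K B X (N n)"
abbreviation "dX n \<equiv> tensor_lift K (TX (Suc n)) (\<lambda>x y. tX (Suc n) x (d n y))"

sublocale P: tensor_pair K B X "N n" for n
  by (rule tensor_pair.intro[OF right left_N])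

lemma dX_linear: "dX n \<in> lin_maps K (TX n) (TX (Suc n))"
  by (rule tensor_map_linear[OF right left_N left_N d_left])

lemma dX_tens: "\<lbrakk>x \<in> carrier X; y \<in> carrier (N n)\<rbrakk> \<Longrightarrow> dX n (tX n x y) = tX (Suc n) x (d n y)"
  by (rule tensor_map_tens[OF right left_N left_N d_left])

lemma tens_zero: "x \<in> carrier X \<Longrightarrow> tX n x \<zero>\<^bsub>N n\<^esub> = \<zero>\<^bsub>TX n\<^esub>"
  by (rule lin_maps_zero[OF N.module_X P.module_tensor P.tens_linear_right])

lemma zero_map_linear: "\<lbrakk>module K V; module K W\<rbrakk> \<Longrightarrow> (\<lambda>x. \<zero>\<^bsub>W\<^esub>) \<in> lin_maps K V W"
proof -
  assume "module K V" "module K W"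
  then interpret W: module K W by simp
  show ?thesis by (rule lin_mapsI) auto
qed

sublocale T: cochain_complex K TX dX
proof (rule cochain_complex.intro)
  fix n Z assume "Z \<in> carrier (TX n)"
  then show "dX (Suc n) (dX n Z) = \<zero>\<^bsub>TX (Suc (Suc n))\<^esub>"
    by (rule P.tensor_ext[OF lin_maps_comp[OF dX_linear dX_linear] zero_map_linear[OF P.module_tensor P.module_tensor]])
      (simp add: dX_tens d_d tens_zero lin_maps_closed[OF N.d_linear])
qed (rule P.module_tensor dX_linear)+

abbreviation "Z n \<equiv> (N n)\<lparr>carrier := N.coc n\<rparr>"
abbreviation "H n \<equiv> quot_bimod (Z n) (N.cob n)"

lemma left_cocycles: "left_submodule K B (N n) (N.coc n)"
  using left_submodule_kernel[OF left_N left_N d_left, of n] by (simp add: cocycles_def)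

lemma left_coboundaries: "left_submodule K B (N n) (N.cob n)"
proof (cases n)
  case 0
  then show ?thesis
    using lin_maps_zero[OF N.module_X N.module_X lact_linear[OF left_N]] submodule_zero_set[OF N.module_X]
    by (auto simp: N.coboundaries_0 left_submodule_def)
next
  case (Suc m)
  then show ?thesis
    using left_submodule_image[OF left_N left_N d_left left_submodule_carrier[OF left_N]]
    by (simp add: N.coboundaries_Suc)
qed

lemma left_Z: "left_module K B (Z n)"
  by (rule left_module_submodule[OF left_N left_cocycles])

lemma left_H: "left_module K B (H n)"
  by (rule left_module_quot[OF left_Z N.submodule_coboundaries_cocycles _ ring_B module_B])
    (simp add: left_submodule_lact[OF left_coboundaries])

lemma class_left: "(\<lambda>x. N.cob n +>\<^bsub>N n\<^esub> x) \<in> left_maps K B (Z n) (H n)"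
proof (rule left_mapsI)
  show "(\<lambda>x. N.cob n +>\<^bsub>N n\<^esub> x) \<in> lin_maps K (Z n) (H n)"
    using coset_linear[OF N.module_cocycles N.submodule_coboundaries_cocycles] by (simp add: lin_maps_def)
  show "N.cob n +>\<^bsub>N n\<^esub> (b \<triangleright>\<^bsub>Z n\<^esub> x) = b \<triangleright>\<^bsub>H n\<^esub> (N.cob n +>\<^bsub>N n\<^esub> x)"
    if "b \<in> carrier B" "x \<in> carrier (Z n)" for b x
    using lact_coset[OF left_Z N.submodule_coboundaries_cocycles _ that] left_submodule_lact[OF left_coboundaries]
    by simp
qed

sublocale PZ: tensor_pair K B X "Z n" for n by (rule tensor_pair.intro[OF right left_Z])
sublocale PH: tensor_pair K B X "H n" for n by (rule tensor_pair.intro[OF right left_H])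

lemma inc_left: "(\<lambda>y. y) \<in> left_maps K B (Z n) (N n)"
  by (rule inclusion_left_maps[OF N.cocycles_subset])

abbreviation "inc n \<equiv> tensor_map K B X (N n) (\<lambda>y. y)"
abbreviation "proj n \<equiv> tensor_map K B X (H n) (\<lambda>x. N.cob n +>\<^bsub>N n\<^esub> x)"

lemmas inc_linear = tensor_map_linear[OF right left_Z left_N inc_left]
lemmas inc_tens = tensor_map_tens[OF right left_Z left_N inc_left]
lemmas proj_linear = tensor_map_linear[OF right left_Z left_H class_left]
lemmas proj_tens = tensor_map_tens[OF right left_Z left_H class_left]

lemma tens_cocycle: "\<lbrakk>x \<in> carrier X; y \<in> N.coc n\<rbrakk> \<Longrightarrow> tX n x y \<in> T.coc n"
  by (auto simp: cocycles_def dX_tens P.tens_closed tens_zero)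

lemma inc_cocycle: "W \<in> carrier (tensor K B X (Z n)) \<Longrightarrow> inc n W \<in> T.coc n"
  by (induction rule: PZ.tensor_induct)
    (simp_all add: inc_tens tens_cocycle lin_maps_add[OF inc_linear]
      submodule_add[OF T.module_X T.submodule_cocycles])

lemma tens_coboundary: "\<lbrakk>x \<in> carrier X; y \<in> N.cob n\<rbrakk> \<Longrightarrow> tX n x y \<in> T.cob n"
proof (cases n)
  case 0
  then show "\<lbrakk>x \<in> carrier X; y \<in> N.cob n\<rbrakk> \<Longrightarrow> tX n x y \<in> T.cob n"
    by (simp add: N.coboundaries_0 T.coboundaries_0 tens_zero)
next
  case (Suc m)
  then show "\<lbrakk>x \<in> carrier X; y \<in> N.cob n\<rbrakk> \<Longrightarrow> tX n x y \<in> T.cob n"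
    by (auto simp: N.coboundaries_Suc T.coboundaries_Suc dX_tens[symmetric] P.tens_closed intro!: imageI)
qed

abbreviation "cmp n \<equiv> tensor_lift K (cohomology TX dX n)
  (\<lambda>x. quot_map (TX n) (T.cob n) (\<lambda>y. tX n x y))"

lemma cmp_formula:
  assumes "x \<in> carrier X" "y \<in> N.coc n"
  shows "quot_map (TX n) (T.cob n) (\<lambda>y. tX n x y) (N.cob n +>\<^bsub>N n\<^esub> y) = T.cob n +>\<^bsub>TX n\<^esub> tX n x y"
  using assms N.cocycles_subset
  by (intro quot_map_linear[OF N.module_X T.module_X P.tens_linear_right N.submodule_coboundaries T.submodule_coboundaries])
    (auto simp: tens_coboundary)

lemma cmp_balanced: "balanced K B X (H n) (cohomology TX dX n) (\<lambda>x. quot_map (TX n) (T.cob n) (\<lambda>y. tX n x y))"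
proof (rule balancedI)
  have cls: "(\<lambda>y. T.cob n +>\<^bsub>TX n\<^esub> tX n x y) \<in> lin_maps K (Z n) (cohomology TX dX n)" if "x \<in> carrier X" for x
    using lin_maps_comp[OF lin_maps_restrict[OF P.tens_linear_right[OF that] N.cocycles_subset] T.class_linear]
      tens_cocycle[OF that] by blast
  note add = lin_maps_add[OF cls, simplified, symmetric] and smult = lin_maps_smult[OF cls, simplified, symmetric]
  note cadd = coset_add[OF N.module_cocycles N.submodule_coboundaries_cocycles, simplified]
    and csm = coset_smult[OF N.module_cocycles N.submodule_coboundaries_cocycles, simplified]
  note sc = submodule_add[OF N.module_X N.submodule_cocycles] submodule_smult[OF N.module_X N.submodule_cocycles]
  show "(\<lambda>Y. quot_map (TX n) (T.cob n) (\<lambda>y. tX n x y) Y) \<in> lin_maps K (H n) (cohomology TX dX n)"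
    if x: "x \<in> carrier X" for x
    using lin_maps_closed[OF cls[OF x]]
    by (intro lin_mapsI) (auto simp: cmp_formula x cadd csm sc add[OF x] smult[OF x])
  show "(\<lambda>x. quot_map (TX n) (T.cob n) (\<lambda>y. tX n x y) Y) \<in> lin_maps K X (cohomology TX dX n)"
    if "Y \<in> carrier (H n)" for Y
  proof -
    obtain y where y: "y \<in> N.coc n" "Y = N.cob n +>\<^bsub>N n\<^esub> y" using \<open>Y \<in> carrier (H n)\<close> by auto
    then have "y \<in> carrier (N n)" using N.cocycles_subset by auto
    then have "(\<lambda>x. tX n x y) \<in> lin_maps K X ((TX n)\<lparr>carrier := T.coc n\<rparr>)"
      using P.tens_linear_left[of y n] tens_cocycle[OF _ y(1)] by (simp add: lin_maps_def Pi_def)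
    from lin_maps_comp[OF this T.class_linear] show ?thesis
      by (rule lin_maps_cong) (simp_all add: y cmp_formula P.X.module_axioms)
  qed
  show "quot_map (TX n) (T.cob n) (\<lambda>y. tX n (x \<triangleleft>\<^bsub>X\<^esub> b) y) Y = quot_map (TX n) (T.cob n) (\<lambda>y. tX n x y) (b \<triangleright>\<^bsub>H n\<^esub> Y)"
    if a: "x \<in> carrier X" "b \<in> carrier B" "Y \<in> carrier (H n)" for x b Y
  proof -
    obtain y where y: "y \<in> N.coc n" "Y = N.cob n +>\<^bsub>N n\<^esub> y" using a(3) by auto
    have "b \<triangleright>\<^bsub>H n\<^esub> Y = N.cob n +>\<^bsub>N n\<^esub> (b \<triangleright>\<^bsub>N n\<^esub> y)"
      using left_mapsD(2)[OF class_left a(2), of y] y by simp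
    then show ?thesis
      using a y N.cocycles_subset ract_closed[OF right a(2,1)] left_submodule_lact[OF left_cocycles a(2) y(1)]
      by (simp only: cmp_formula) (simp add: P.tens_balanced subset_iff)
  qed
qed

sublocale C: tensor_target K B X "H n" "cohomology TX dX n" "\<lambda>x. quot_map (TX n) (T.cob n) (\<lambda>y. tX n x y)" for n
  by (intro tensor_target.intro tensor_target_axioms.intro PH.tensor_pair_axioms T.module_cohomology cmp_balanced)

lemma cmp_tens:
  "\<lbrakk>x \<in> carrier X; y \<in> N.coc n\<rbrakk> \<Longrightarrow> cmp n (tens K B X (H n) x (N.cob n +>\<^bsub>N n\<^esub> y)) = T.cob n +>\<^bsub>TX n\<^esub> tX n x y"
  by (subst C.tensor_lift_tens) (auto simp: cmp_formula)

text \<open>Controls \<open>cmp\<close> from above: the tensor product with the cocycles surjects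
  onto the tensor product with cohomology by \<open>proj\<close>, and maps to cocycles by
  \<open>inc\<close>. Both halves of the isomorphism are read off from this square.\<close>

lemma cmp_proj: "W \<in> carrier (tensor K B X (Z n)) \<Longrightarrow> cmp n (proj n W) = T.cob n +>\<^bsub>TX n\<^esub> inc n W"
proof (rule PZ.tensor_ext[OF lin_maps_comp[OF proj_linear C.tensor_lift_linear]])
  have "inc n \<in> lin_maps K (tensor K B X (Z n)) ((TX n)\<lparr>carrier := T.coc n\<rparr>)"
    using inc_linear inc_cocycle by (simp add: lin_maps_def Pi_def)
  from lin_maps_comp[OF this T.class_linear]
  show "(\<lambda>W. T.cob n +>\<^bsub>TX n\<^esub> inc n W) \<in> lin_maps K (tensor K B X (Z n)) (cohomology TX dX n)" .
qed (simp_all add: proj_tens inc_tens cmp_tens)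

text \<open>Factor \<open>d n\<close> through its image. By flatness the image stays embedded after
  tensoring, so \<open>Q\<close> is annihilated by the map onto the tensor product with the image,
  and right exactness lifts it to the tensor product with the kernel.\<close>

lemma cocycle_lifts:
  assumes "Q \<in> T.coc n"
  obtains W where "W \<in> carrier (tensor K B X (Z n))" "inc n W = Q"
proof -
  let ?I = "d n ` carrier (N n)"
  have I: "left_submodule K B (N (Suc n)) ?I"
    by (rule left_submodule_image[OF left_N left_N d_left left_submodule_carrier[OF left_N]])
  let ?P = "(N (Suc n))\<lparr>carrier := ?I\<rparr>"
  note lP = left_module_submodule[OF left_N I]
  have dP: "d n \<in> left_maps K B (N n) ?P" using d_left by (auto simp: left_maps_def lin_maps_def)
  have iP: "(\<lambda>y. y) \<in> left_maps K B ?P (N (Suc n))" by (rule inclusion_left_maps[OF left_submodule_subset[OF I]])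
  have Q: "Q \<in> carrier (TX n)" "dX n Q = \<zero>\<^bsub>TX (Suc n)\<^esub>" using assms by (auto simp: cocycles_def)
  note l = tensor_map_linear[OF right left_N lP dP] tensor_map_linear[OF right lP left_N iP]
  note t = tensor_map_tens[OF right left_N lP dP] tensor_map_tens[OF right lP left_N iP]
  have "tensor_map K B X (N (Suc n)) (\<lambda>y. y) (tensor_map K B X ?P (d n) Q) = dX n Q"
    by (rule P.tensor_ext[OF lin_maps_comp[OF l] dX_linear Q(1)]) (simp add: t dX_tens)
  then have "tensor_map K B X ?P (d n) Q = \<zero>\<^bsub>tensor K B X ?P\<^esub>"
    using flat[of "Suc n"] I lin_maps_closed[OF l(1) Q(1)] Q(2) by (auto simp: flat_for_def)
  then obtain W where "W \<in> carrier (tensor K B X ((N n)\<lparr>carrier := {x \<in> carrier (N n). d n x = \<zero>\<^bsub>?P\<^esub>}\<rparr>))"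
      "inc n W = Q"
    by (rule tensor_right_exact[OF right left_N lP dP _ Q(1), rotated]) (rule that, assumption+, simp)
  then show thesis using that by (simp add: cocycles_def)
qed

text \<open>Surjectivity is \<open>cocycle_lifts\<close>. For injectivity, lift a class killed by
  \<open>cmp\<close> to \<open>W\<close>; then \<open>inc n W\<close> is a coboundary, and flatness
  of the inclusion of the cocycles shows that \<open>W\<close> itself comes from boundaries, which
  \<open>proj\<close> kills.\<close>

theorem comparison_iso: "cmp n \<in> lin_isos K (tensor K B X (H n)) (cohomology TX dX n)"
proof (rule lin_isosI[OF PH.module_tensor T.module_cohomology C.tensor_lift_linear])
  show "carrier (cohomology TX dX n) \<subseteq> cmp n ` carrier (tensor K B X (H n))"
  proof
    fix Y assume "Y \<in> carrier (cohomology TX dX n)"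
    then obtain Q where Q: "Q \<in> T.coc n" "Y = T.cob n +>\<^bsub>TX n\<^esub> Q" unfolding T.carrier_cohomology by auto
    obtain W where "W \<in> carrier (tensor K B X (Z n))" "inc n W = Q" by (rule cocycle_lifts[OF Q(1)])
    note W = this
    have "Y = cmp n (proj n W)" using cmp_proj[OF W(1)] W(2) Q(2) by simp
    then show "Y \<in> cmp n ` carrier (tensor K B X (H n))"
      using lin_maps_closed[OF proj_linear W(1)] by (rule image_eqI)
  qed
next
  fix w assume w: "w \<in> carrier (tensor K B X (H n))" "cmp n w = \<zero>\<^bsub>cohomology TX dX n\<^esub>"
  obtain W where W: "W \<in> carrier (tensor K B X (Z n))" "proj n W = w"
    by (rule tensor_map_surj[OF right left_Z left_H class_left _ w(1)]) (simp, rule that)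
  have iW: "inc n W \<in> carrier (TX n)" by (rule lin_maps_closed[OF inc_linear W(1)])
  then have cobW: "inc n W \<in> T.cob n"
    using w(2) cmp_proj[OF W(1)] T.class_zero_iff[OF iW] W(2) by (simp add: T.zero_cohomology)
  have inj: "V = \<zero>\<^bsub>tensor K B X (Z n)\<^esub>" if "V \<in> carrier (tensor K B X (Z n))" "inc n V = \<zero>\<^bsub>TX n\<^esub>" for V
    using flat[of n] left_cocycles[of n] that by (auto simp: flat_for_def)
  show "w = \<zero>\<^bsub>tensor K B X (H n)\<^esub>"
  proof (cases n)
    case 0
    then have "W = \<zero>\<^bsub>tensor K B X (Z n)\<^esub>" using inj[OF W(1)] cobW by (simp add: T.coboundaries_0)
    then show ?thesis using W(2) lin_maps_zero[OF PZ.module_tensor PH.module_tensor proj_linear, of n] by simp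
  next
    case (Suc m)
    then obtain V where V: "V \<in> carrier (TX m)" "inc n W = dX m V" using cobW by (auto simp: T.coboundaries_Suc)
    \<comment> \<open>Viewed as a map into the cocycles, the differential turns the primitive
      \<open>V\<close> into an element with the same image under \<open>inc\<close> as
      \<open>W\<close>, hence into \<open>W\<close> itself.\<close>
    have dZ: "d m \<in> left_maps K B (N m) (Z n)"
      using d_left[of m] N.coboundaries_cocycles[of n]
      by (auto simp: left_maps_def lin_maps_def Suc N.coboundaries_Suc)
    note l = tensor_map_linear[OF right left_N left_Z dZ] and t = tensor_map_tens[OF right left_N left_Z dZ]
    let ?V = "tensor_map K B X (Z n) (d m) V"
    have V': "?V \<in> carrier (tensor K B X (Z n))" by (rule lin_maps_closed[OF l V(1)])
    have "inc n ?V = dX m V"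
      unfolding Suc
      by (rule P.tensor_ext[OF lin_maps_comp[OF l[unfolded Suc] inc_linear] dX_linear V(1)])
        (use lin_maps_closed[OF left_mapsD(1)[OF dZ]] in \<open>simp add: t[unfolded Suc] inc_tens dX_tens Suc\<close>)
    then have "inc n (W \<ominus>\<^bsub>tensor K B X (Z n)\<^esub> ?V) = \<zero>\<^bsub>TX n\<^esub>"
      using V(2) W(1) V' iW minus_zero_iff[OF T.module_X iW iW]
      by (simp add: lin_maps_minus[OF PZ.module_tensor T.module_X inc_linear])
    moreover interpret TZ: module K "tensor K B X (Z n)" by (rule PZ.module_tensor)
    have "W \<ominus>\<^bsub>tensor K B X (Z n)\<^esub> ?V \<in> carrier (tensor K B X (Z n))" using W(1) V' by simp
    ultimately have "W = ?V" using inj minus_zero_iff[OF PZ.module_tensor W(1) V'] by blast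
    moreover have "proj n ?V = \<zero>\<^bsub>tensor K B X (H n)\<^esub>"
    proof (rule P.tensor_ext[OF lin_maps_comp[OF l proj_linear] zero_map_linear[OF P.module_tensor PH.module_tensor] V(1)])
      fix x y assume a: "x \<in> carrier X" "y \<in> carrier (N m)"
      have "d m y \<in> N.cob n" using a Suc by (auto simp: N.coboundaries_Suc)
      then have "N.cob n +>\<^bsub>N n\<^esub> d m y = \<zero>\<^bsub>H n\<^esub>" "d m y \<in> N.coc n"
        using N.coboundaries_cocycles[of n] N.cocycles_subset[of n] N.class_zero_iff[of "d m y" n] by auto
      then show "proj n (tensor_map K B X (Z n) (d m) (tX m x y)) = \<zero>\<^bsub>tensor K B X (H n)\<^esub>"
        using a lin_maps_zero[OF left_module_module[OF left_H] PH.module_tensor PH.tens_linear_right[OF a(1)], of n]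
        by (simp add: t proj_tens)
    qed
    ultimately show ?thesis using W(2) by simp
  qed
qed

end

section \<open>Vector spaces with a finite filtration\<close>

lemma
  assumes "module K V" "a \<in> carrier V" "b \<in> carrier V" "c \<in> carrier V" "e \<in> carrier V"
  shows add_swap: "(a \<oplus>\<^bsub>V\<^esub> b) \<oplus>\<^bsub>V\<^esub> (c \<oplus>\<^bsub>V\<^esub> e) = (a \<oplus>\<^bsub>V\<^esub> c) \<oplus>\<^bsub>V\<^esub> (b \<oplus>\<^bsub>V\<^esub> e)"
    and minus_swap: "(a \<oplus>\<^bsub>V\<^esub> b) \<ominus>\<^bsub>V\<^esub> (c \<oplus>\<^bsub>V\<^esub> e) = (a \<ominus>\<^bsub>V\<^esub> c) \<oplus>\<^bsub>V\<^esub> (b \<ominus>\<^bsub>V\<^esub> e)"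
proof -
  interpret V: module K V by fact
  show "(a \<oplus>\<^bsub>V\<^esub> b) \<oplus>\<^bsub>V\<^esub> (c \<oplus>\<^bsub>V\<^esub> e) = (a \<oplus>\<^bsub>V\<^esub> c) \<oplus>\<^bsub>V\<^esub> (b \<oplus>\<^bsub>V\<^esub> e)"
    using assms by (simp add: V.a_ac)
  show "(a \<oplus>\<^bsub>V\<^esub> b) \<ominus>\<^bsub>V\<^esub> (c \<oplus>\<^bsub>V\<^esub> e) = (a \<ominus>\<^bsub>V\<^esub> c) \<oplus>\<^bsub>V\<^esub> (b \<ominus>\<^bsub>V\<^esub> e)"
    using assms by (simp add: V.minus_eq V.minus_add V.a_ac)
qed

lemma
  assumes "module K V" "a \<in> carrier V" "b \<in> carrier V"
  shows add_minus_cancel: "(a \<oplus>\<^bsub>V\<^esub> b) \<ominus>\<^bsub>V\<^esub> b = a" "(b \<oplus>\<^bsub>V\<^esub> a) \<ominus>\<^bsub>V\<^esub> b = a"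
    and minus_add_cancel: "(a \<ominus>\<^bsub>V\<^esub> b) \<oplus>\<^bsub>V\<^esub> b = a" "b \<oplus>\<^bsub>V\<^esub> (a \<ominus>\<^bsub>V\<^esub> b) = a"
    and minus_minus_cancel: "a \<ominus>\<^bsub>V\<^esub> (a \<ominus>\<^bsub>V\<^esub> b) = b"
proof -
  interpret V: module K V by fact
  show "(a \<oplus>\<^bsub>V\<^esub> b) \<ominus>\<^bsub>V\<^esub> b = a" "(b \<oplus>\<^bsub>V\<^esub> a) \<ominus>\<^bsub>V\<^esub> b = a"
    "(a \<ominus>\<^bsub>V\<^esub> b) \<oplus>\<^bsub>V\<^esub> b = a" "b \<oplus>\<^bsub>V\<^esub> (a \<ominus>\<^bsub>V\<^esub> b) = a"
    using assms(2,3) by (simp_all add: V.minus_eq V.minus_add V.a_ac V.r_neg V.l_neg V.r_neg1 V.r_neg2)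
  show "a \<ominus>\<^bsub>V\<^esub> (a \<ominus>\<^bsub>V\<^esub> b) = b"
    using assms(2,3) by (simp add: V.minus_eq V.minus_add V.a_lcomm[of a b] V.a_comm[of "\<ominus>\<^bsub>V\<^esub> a"] V.r_neg)
qed

text \<open>Two decompositions of one vector have \<open>A\<close>-parts that differ by an element
  of \<open>A \<inter> B\<close>. There \<open>h\<close> vanishes, so discarding the
  \<open>B\<close>-part is unambiguous.\<close>

lemma extend_by_zero:
  assumes V: "module K V" and W: "module K W" and A: "submodule A K V" and B: "submodule B K V"
    and h: "h \<in> lin_maps K (V\<lparr>carrier := A\<rparr>) W" and h0: "\<And>x. x \<in> A \<inter> B \<Longrightarrow> h x = \<zero>\<^bsub>W\<^esub>"
  obtains g where "g \<in> lin_maps K (V\<lparr>carrier := A <+>\<^bsub>V\<^esub> B\<rparr>) W"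
    "\<And>a b. \<lbrakk>a \<in> A; b \<in> B\<rbrakk> \<Longrightarrow> g (a \<oplus>\<^bsub>V\<^esub> b) = h a"
proof -
  interpret V: module K V by fact
  interpret W: module K W by fact
  note sA = subsetD[OF submodule_subset[OF A]] and sB = subsetD[OF submodule_subset[OF B]]
  note hadd = lin_maps_add[OF h, simplified] and hcl = lin_maps_closed[OF h, simplified]
  have unique: "h a = h a'" if "a \<in> A" "a' \<in> A" "b \<in> B" "b' \<in> B" "a \<oplus>\<^bsub>V\<^esub> b = a' \<oplus>\<^bsub>V\<^esub> b'" for a a' b b'
  proof -
    have "(a \<ominus>\<^bsub>V\<^esub> a') \<oplus>\<^bsub>V\<^esub> (b \<ominus>\<^bsub>V\<^esub> b') = \<zero>\<^bsub>V\<^esub>"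
      using that sA sB by (simp add: minus_swap[OF V, symmetric] minus_zero_iff[OF V])
    then have "a \<ominus>\<^bsub>V\<^esub> a' = b' \<ominus>\<^bsub>V\<^esub> b"
      using that sA sB V.minus_equality[of "a \<ominus>\<^bsub>V\<^esub> a'" "b \<ominus>\<^bsub>V\<^esub> b'"]
      by (simp add: V.minus_eq V.minus_add V.a_comm)
    then have m: "a \<ominus>\<^bsub>V\<^esub> a' \<in> A \<inter> B"
      using submodule_minus[OF V A that(1,2)] submodule_minus[OF V B that(4,3)] by simp
    have "h a = h ((a \<ominus>\<^bsub>V\<^esub> a') \<oplus>\<^bsub>V\<^esub> a')" using that sA by (simp add: minus_add_cancel[OF V])
    also have "\<dots> = h a'" using hadd[of "a \<ominus>\<^bsub>V\<^esub> a'" a'] m that h0[OF m] hcl by simp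
    finally show ?thesis .
  qed
  define g where "g x = h (SOME a. a \<in> A \<and> (\<exists>b\<in>B. x = a \<oplus>\<^bsub>V\<^esub> b))" for x
  have g: "g (a \<oplus>\<^bsub>V\<^esub> b) = h a" if "a \<in> A" "b \<in> B" for a b
  proof -
    let ?P = "\<lambda>a'. a' \<in> A \<and> (\<exists>b'\<in>B. a \<oplus>\<^bsub>V\<^esub> b = a' \<oplus>\<^bsub>V\<^esub> b')"
    let ?c = "SOME a'. ?P a'"
    have "?P ?c" by (rule someI[of ?P a]) (use that in blast)
    then obtain b' where "?c \<in> A" "b' \<in> B" "a \<oplus>\<^bsub>V\<^esub> b = ?c \<oplus>\<^bsub>V\<^esub> b'" by blast
    then have "h a = h ?c" using that by (intro unique)
    then show ?thesis by (simp add: g_def)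
  qed
  have "g \<in> lin_maps K (V\<lparr>carrier := A <+>\<^bsub>V\<^esub> B\<rparr>) W"
  proof (rule lin_mapsI)
    fix x assume "x \<in> carrier (V\<lparr>carrier := A <+>\<^bsub>V\<^esub> B\<rparr>)"
    then show "g x \<in> carrier W" using g hcl by (auto simp: set_add_iff)
  next
    fix x y assume "x \<in> carrier (V\<lparr>carrier := A <+>\<^bsub>V\<^esub> B\<rparr>)" "y \<in> carrier (V\<lparr>carrier := A <+>\<^bsub>V\<^esub> B\<rparr>)"
    then obtain a b a' b' where *: "a \<in> A" "b \<in> B" "a' \<in> A" "b' \<in> B" "x = a \<oplus>\<^bsub>V\<^esub> b" "y = a' \<oplus>\<^bsub>V\<^esub> b'"
      by (auto simp: set_add_iff)
    have "x \<oplus>\<^bsub>V\<^esub> y = (a \<oplus>\<^bsub>V\<^esub> a') \<oplus>\<^bsub>V\<^esub> (b \<oplus>\<^bsub>V\<^esub> b')" using * sA sB add_swap[OF V] by simp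
    then show "g (x \<oplus>\<^bsub>V\<lparr>carrier := A <+>\<^bsub>V\<^esub> B\<rparr>\<^esub> y) = g x \<oplus>\<^bsub>W\<^esub> g y"
      using * by (simp add: g hadd submodule_add[OF V A] submodule_add[OF V B])
  next
    fix k x assume k: "k \<in> carrier K" and "x \<in> carrier (V\<lparr>carrier := A <+>\<^bsub>V\<^esub> B\<rparr>)"
    then obtain a b where *: "a \<in> A" "b \<in> B" "x = a \<oplus>\<^bsub>V\<^esub> b" by (auto simp: set_add_iff)
    have "k \<odot>\<^bsub>V\<^esub> x = (k \<odot>\<^bsub>V\<^esub> a) \<oplus>\<^bsub>V\<^esub> (k \<odot>\<^bsub>V\<^esub> b)" using * k sA sB by (simp add: V.smult_r_distr)
    then show "g (k \<odot>\<^bsub>V\<lparr>carrier := A <+>\<^bsub>V\<^esub> B\<rparr>\<^esub> x) = k \<odot>\<^bsub>W\<^esub> g x"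
      using * k lin_maps_smult[OF h, of k a]
      by (simp add: g submodule_smult[OF V A] submodule_smult[OF V B])
  qed
  then show thesis using g by (rule that)
qed

text \<open>Zorn's lemma gives a subspace \<open>M\<close> maximal among those that meet
  \<open>U\<close> trivially. A vector outside \<open>U + M\<close> could be adjoined to
  \<open>M\<close> without creating an intersection, so none exists.\<close>

lemma complement_exists:
  assumes K: "field K" and V: "module K V" and U: "submodule U K V"
  obtains C where "submodule C K V" "U \<inter> C \<subseteq> {\<zero>\<^bsub>V\<^esub>}" "U <+>\<^bsub>V\<^esub> C = carrier V"
proof -
  interpret K: field K by fact
  interpret V: module K V by fact
  note sU = subsetD[OF submodule_subset[OF U]]
  let ?S = "{C. submodule C K V \<and> U \<inter> C \<subseteq> {\<zero>\<^bsub>V\<^esub>}}"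
  have "\<exists>M\<in>?S. \<forall>X\<in>?S. M \<subseteq> X \<longrightarrow> X = M"
  proof (rule subset_Zorn_nonempty)
    show "?S \<noteq> {}" using submodule_zero_set[OF V] by auto
  next
    fix CC assume CC: "CC \<noteq> {}" "subset.chain ?S CC"
    then have sub: "submodule C K V" "U \<inter> C \<subseteq> {\<zero>\<^bsub>V\<^esub>}" if "C \<in> CC" for C
      using that by (auto simp: subset_chain_def)
    have "submodule (\<Union>CC) K V"
    proof (rule submoduleI'[OF V])
      show "\<Union>CC \<subseteq> carrier V" using submodule_subset[OF sub(1)] by blast
      show "\<zero>\<^bsub>V\<^esub> \<in> \<Union>CC" using CC(1) submodule_zero[OF V sub(1)] by blast
    next
      fix x y assume "x \<in> \<Union>CC" "y \<in> \<Union>CC"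
      then obtain C C' where C: "C \<in> CC" "C' \<in> CC" "x \<in> C" "y \<in> C'" by blast
      then have "C \<subseteq> C' \<or> C' \<subseteq> C" using CC(2) by (auto simp: subset_chain_def)
      then show "x \<oplus>\<^bsub>V\<^esub> y \<in> \<Union>CC"
      proof
        assume "C \<subseteq> C'"
        then have "x \<oplus>\<^bsub>V\<^esub> y \<in> C'" using submodule_add[OF V sub(1)[OF C(2)], of x y] C by blast
        then show ?thesis using C(2) by blast
      next
        assume "C' \<subseteq> C"
        then have "x \<oplus>\<^bsub>V\<^esub> y \<in> C" using submodule_add[OF V sub(1)[OF C(1)], of x y] C by blast
        then show ?thesis using C(1) by blast
      qed
    next
      fix k x assume "k \<in> carrier K" "x \<in> \<Union>CC"
      then show "k \<odot>\<^bsub>V\<^esub> x \<in> \<Union>CC" using submodule_smult[OF V sub(1)] by blast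
    qed
    then show "\<Union>CC \<in> ?S" using sub(2) by blast
  qed
  then obtain M where "M \<in> ?S" and mx: "\<forall>X\<in>?S. M \<subseteq> X \<longrightarrow> X = M" by (rule bexE)
  then have M: "submodule M K V" "U \<inter> M \<subseteq> {\<zero>\<^bsub>V\<^esub>}" by simp_all
  have max: "X = M" if "submodule X K V" "U \<inter> X \<subseteq> {\<zero>\<^bsub>V\<^esub>}" "M \<subseteq> X" for X
    using mx that by simp
  note sM = subsetD[OF submodule_subset[OF M(1)]]
  have sUM: "submodule (U <+>\<^bsub>V\<^esub> M) K V" by (rule submodule_set_add[OF V U M(1)])
  have "x \<in> U <+>\<^bsub>V\<^esub> M" if x: "x \<in> carrier V" for x
  proof (rule ccontr)
    assume nx: "x \<notin> U <+>\<^bsub>V\<^esub> M"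
    let ?L = "(\<lambda>k. k \<odot>\<^bsub>V\<^esub> x) ` carrier K"
    have L: "submodule ?L K V"
    proof (rule submoduleI'[OF V])
      show "?L \<subseteq> carrier V" using x by auto
      show "\<zero>\<^bsub>V\<^esub> \<in> ?L" using x by (intro image_eqI[of _ _ "\<zero>\<^bsub>K\<^esub>"]) auto
    next
      fix a b assume "a \<in> ?L" "b \<in> ?L"
      then obtain k l where "k \<in> carrier K" "l \<in> carrier K" "a = k \<odot>\<^bsub>V\<^esub> x" "b = l \<odot>\<^bsub>V\<^esub> x" by blast
      then show "a \<oplus>\<^bsub>V\<^esub> b \<in> ?L" using x by (intro image_eqI[of _ _ "k \<oplus>\<^bsub>K\<^esub> l"]) (auto simp: V.smult_l_distr)
    next
      fix c a assume "c \<in> carrier K" "a \<in> ?L"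
      then obtain k where "c \<in> carrier K" "k \<in> carrier K" "a = k \<odot>\<^bsub>V\<^esub> x" by blast
      then show "c \<odot>\<^bsub>V\<^esub> a \<in> ?L" using x by (intro image_eqI[of _ _ "c \<otimes>\<^bsub>K\<^esub> k"]) (auto simp: V.smult_assoc1)
    qed
    have "U \<inter> (M <+>\<^bsub>V\<^esub> ?L) \<subseteq> {\<zero>\<^bsub>V\<^esub>}"
    proof
      fix u assume "u \<in> U \<inter> (M <+>\<^bsub>V\<^esub> ?L)"
      then obtain m k where *: "u \<in> U" "m \<in> M" "k \<in> carrier K" "u = m \<oplus>\<^bsub>V\<^esub> (k \<odot>\<^bsub>V\<^esub> x)"
        by (auto simp: set_add_iff)
      show "u \<in> {\<zero>\<^bsub>V\<^esub>}"
      proof (cases "k = \<zero>\<^bsub>K\<^esub>")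
        case True
        then show ?thesis using * x sM M(2) by auto
      next
        case False
        \<comment> \<open>Dividing by \<open>k\<close> would put \<open>x\<close> into
          \<open>U + M\<close>, against its choice. This is where scalars must be
          invertible.\<close>
        then have k: "k \<in> Units K" using * by (simp add: K.field_Units)
        have "u \<ominus>\<^bsub>V\<^esub> m = k \<odot>\<^bsub>V\<^esub> x" using * x sM sU add_minus_cancel(2)[OF V, of "k \<odot>\<^bsub>V\<^esub> x" m] by simp
        moreover have "u \<ominus>\<^bsub>V\<^esub> m \<in> U <+>\<^bsub>V\<^esub> M"
          using set_addI[OF *(1) submodule_neg[OF V M(1) *(2)], of V] by (simp add: V.minus_eq)
        ultimately have "inv\<^bsub>K\<^esub> k \<odot>\<^bsub>V\<^esub> (k \<odot>\<^bsub>V\<^esub> x) \<in> U <+>\<^bsub>V\<^esub> M"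
          using submodule_smult[OF V sUM K.Units_inv_closed[OF k]] by simp
        then have "x \<in> U <+>\<^bsub>V\<^esub> M"
          using k x * by (simp add: V.smult_assoc1[symmetric] K.Units_l_inv)
        then show ?thesis using nx by simp
      qed
    qed
    moreover have "M \<subseteq> M <+>\<^bsub>V\<^esub> ?L"
    proof
      fix m assume "m \<in> M"
      then show "m \<in> M <+>\<^bsub>V\<^esub> ?L" using set_addI[OF _ submodule_zero[OF V L], of m M V] sM by simp
    qed
    ultimately have "M <+>\<^bsub>V\<^esub> ?L = M" using submodule_set_add[OF V M(1) L] by (intro max)
    moreover have "x \<in> M <+>\<^bsub>V\<^esub> ?L"
      using set_addI[OF submodule_zero[OF V M(1)], of x ?L V] x
      by (simp add: image_iff) (metis K.one_closed V.smult_one)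
    ultimately have "x \<in> M" by simp
    then have "x \<in> U <+>\<^bsub>V\<^esub> M" using set_addI[OF submodule_zero[OF V U], of x M V] x by simp
    then show False using nx by simp
  qed
  then have "U <+>\<^bsub>V\<^esub> M = carrier V" using submodule_subset[OF sUM] by blast
  then show thesis using M by (intro that)
qed

lemma extend_linear:
  assumes "field K" "module K V" "module K W" "submodule U K V" "f \<in> lin_maps K (V\<lparr>carrier := U\<rparr>) W"
  obtains g where "g \<in> lin_maps K V W" "\<And>x. x \<in> U \<Longrightarrow> g x = f x"
proof -
  interpret V: module K V by fact
  obtain C where C: "submodule C K V" "U \<inter> C \<subseteq> {\<zero>\<^bsub>V\<^esub>}" "U <+>\<^bsub>V\<^esub> C = carrier V"
    by (rule complement_exists[OF assms(1,2,4)])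
  have "f x = \<zero>\<^bsub>W\<^esub>" if "x \<in> U \<inter> C" for x
    using that C(2) lin_maps_zero[OF module_restrict[OF assms(2,4)] assms(3,5)] by auto
  then obtain g where "g \<in> lin_maps K (V\<lparr>carrier := U <+>\<^bsub>V\<^esub> C\<rparr>) W"
    "\<And>a b. \<lbrakk>a \<in> U; b \<in> C\<rbrakk> \<Longrightarrow> g (a \<oplus>\<^bsub>V\<^esub> b) = f a"
    by (rule extend_by_zero[OF assms(2,3,4) C(1) assms(5)]) (auto intro: that)
  note g = this
  show thesis
  proof (rule that)
    show "g \<in> lin_maps K V W" using g(1) by (simp add: C(3) lin_maps_def)
    show "g x = f x" if "x \<in> U" for x
      using g(2)[OF that submodule_zero[OF assms(2) C(1)]] subsetD[OF submodule_subset[OF assms(4)] that] by simp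
  qed
qed

section \<open>Direct sums and the splitting of a finite filtration\<close>

lemma direct_sum_fields [simp]:
  "zero (direct_sum I V) = (\<lambda>i\<in>I. \<zero>\<^bsub>V i\<^esub>)"
  "add (direct_sum I V) = (\<lambda>f g. \<lambda>i\<in>I. f i \<oplus>\<^bsub>V i\<^esub> g i)"
  "smult (direct_sum I V) = (\<lambda>c f. \<lambda>i\<in>I. c \<odot>\<^bsub>V i\<^esub> f i)"
  by (simp_all add: direct_sum_def)

lemma direct_sum_carrier:
  "f \<in> carrier (direct_sum I V) \<longleftrightarrow> f \<in> (\<Pi>\<^sub>E i\<in>I. carrier (V i)) \<and> finite {i \<in> I. f i \<noteq> \<zero>\<^bsub>V i\<^esub>}"
  by (simp add: direct_sum_def)

lemma module_direct_sum:
  assumes "cring K" "\<And>i. i \<in> I \<Longrightarrow> module K (V i)"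
  shows "module K (direct_sum I V)"
proof -
  note ag = module.axioms(2)[OF assms(2)]
  note cl = abelian_groupE(1)[OF ag] abelian_groupE(2)[OF ag] module.smult_closed[OF assms(2)]
  have zz: "i \<in> I \<Longrightarrow> \<zero>\<^bsub>V i\<^esub> \<oplus>\<^bsub>V i\<^esub> \<zero>\<^bsub>V i\<^esub> = \<zero>\<^bsub>V i\<^esub>" "\<lbrakk>i \<in> I; c \<in> carrier K\<rbrakk> \<Longrightarrow> c \<odot>\<^bsub>V i\<^esub> \<zero>\<^bsub>V i\<^esub> = \<zero>\<^bsub>V i\<^esub>"
    for i c using abelian_groupE(5)[OF ag] cl module.smult_r_null[OF assms(2)] by auto
  have ac: "f \<oplus>\<^bsub>direct_sum I V\<^esub> g \<in> carrier (direct_sum I V)"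
    if "f \<in> carrier (direct_sum I V)" "g \<in> carrier (direct_sum I V)" for f g
  proof -
    have "{i \<in> I. f i \<oplus>\<^bsub>V i\<^esub> g i \<noteq> \<zero>\<^bsub>V i\<^esub>} \<subseteq> {i \<in> I. f i \<noteq> \<zero>\<^bsub>V i\<^esub>} \<union> {i \<in> I. g i \<noteq> \<zero>\<^bsub>V i\<^esub>}"
      using zz(1) by auto
    then have "finite {i \<in> I. f i \<oplus>\<^bsub>V i\<^esub> g i \<noteq> \<zero>\<^bsub>V i\<^esub>}"
      using that by (auto simp: direct_sum_carrier intro: finite_subset)
    then show ?thesis using that cl by (auto simp: direct_sum_carrier PiE_iff cong: conj_cong)
  qed
  have sc: "c \<odot>\<^bsub>direct_sum I V\<^esub> f \<in> carrier (direct_sum I V)"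
    if "c \<in> carrier K" "f \<in> carrier (direct_sum I V)" for f c
  proof -
    have "{i \<in> I. c \<odot>\<^bsub>V i\<^esub> f i \<noteq> \<zero>\<^bsub>V i\<^esub>} \<subseteq> {i \<in> I. f i \<noteq> \<zero>\<^bsub>V i\<^esub>}"
      using zz(2) that(1) by auto
    then have "finite {i \<in> I. c \<odot>\<^bsub>V i\<^esub> f i \<noteq> \<zero>\<^bsub>V i\<^esub>}"
      using that by (auto simp: direct_sum_carrier intro: finite_subset)
    then show ?thesis using that cl by (auto simp: direct_sum_carrier PiE_iff cong: conj_cong)
  qed
  have mem: "f i \<in> carrier (V i)" if "f \<in> carrier (direct_sum I V)" "i \<in> I" for f i
    using that by (auto simp: direct_sum_carrier)
  have ext: "f = g" if "f \<in> extensional I" "g \<in> extensional I" "\<And>i. i \<in> I \<Longrightarrow> f i = g i" for f g :: "'c \<Rightarrow> 'd"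
    using that by (rule extensionalityI)
  have fe: "f \<in> carrier (direct_sum I V) \<Longrightarrow> f \<in> extensional I" for f
    by (auto simp: direct_sum_carrier PiE_def)
  have mone: "\<ominus>\<^bsub>K\<^esub> \<one>\<^bsub>K\<^esub> \<in> carrier K" using assms(1) by (simp add: cring_def ring.ring_simprules)
  show ?thesis
  proof (rule moduleI[OF assms(1) abelian_groupI])
    show "\<exists>g\<in>carrier (direct_sum I V). g \<oplus>\<^bsub>direct_sum I V\<^esub> f = \<zero>\<^bsub>direct_sum I V\<^esub>"
      if f: "f \<in> carrier (direct_sum I V)" for f
    proof (rule bexI[OF _ sc[OF mone f]])
      have "(\<ominus>\<^bsub>K\<^esub> \<one>\<^bsub>K\<^esub>) \<odot>\<^bsub>V i\<^esub> f i \<oplus>\<^bsub>V i\<^esub> f i = \<zero>\<^bsub>V i\<^esub>" if "i \<in> I" for i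
      proof -
        interpret W: module K "V i" by (rule assms(2)[OF that])
        show ?thesis using mem[OF f that] by (simp add: W.smult_l_minus W.l_neg)
      qed
      then show "((\<ominus>\<^bsub>K\<^esub> \<one>\<^bsub>K\<^esub>) \<odot>\<^bsub>direct_sum I V\<^esub> f) \<oplus>\<^bsub>direct_sum I V\<^esub> f = \<zero>\<^bsub>direct_sum I V\<^esub>"
        by (auto intro!: ext)
    qed
  qed (auto intro!: ext ac[simplified] sc[simplified] dest: fe
      simp: mem direct_sum_carrier[of "\<lambda>i\<in>I. \<zero>\<^bsub>V i\<^esub>"] cl abelian_groupE(3)[OF ag] abelian_groupE(4)[OF ag]
      abelian_groupE(5)[OF ag] abelian_monoid.r_zero[OF abelian_group.axioms(1)[OF ag]]
      abelian_monoid.a_lcomm[OF abelian_group.axioms(1)[OF ag]] module.smult_l_distr[OF assms(2)] module.smult_r_distr[OF assms(2)]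
      module.smult_assoc1[OF assms(2)] module.smult_one[OF assms(2)])
qed

text \<open>Here \<open>c p\<close> identifies \<open>G (\<iota> p)\<close> with the \<open>p\<close>-th graded piece of the filtration that \<open>A\<close>
  induces on \<open>V / B\<close>. Extending these maps to all of \<open>V\<close> needs complements, hence a field.\<close>

lemma filtered_quotient_splits:
  fixes A :: "nat \<Rightarrow> 'x set" and G :: "'i \<Rightarrow> ('k, 'z, 'n) module_scheme"
  assumes K: "field K" and V: "module K V" and A: "\<And>p. submodule (A p) K V" and B: "submodule B K V"
    and A0: "A 0 = carrier V" and Ak: "A (Suc k) = {\<zero>\<^bsub>V\<^esub>}" and mono: "\<And>p. A (Suc p) \<subseteq> A p"
    and inj: "inj_on \<iota> {..k}" and img: "\<iota> ` {..k} \<subseteq> I" and mG: "\<And>i. i \<in> I \<Longrightarrow> module K (G i)"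
    and Gz: "\<And>i. i \<in> I - \<iota> ` {..k} \<Longrightarrow> carrier (G i) = {\<zero>\<^bsub>G i\<^esub>}"
    and c: "\<And>p. p \<le> k \<Longrightarrow> c p \<in> lin_maps K (V\<lparr>carrier := A p\<rparr>) (G (\<iota> p))"
    and c_surj: "\<And>p. p \<le> k \<Longrightarrow> carrier (G (\<iota> p)) \<subseteq> c p ` A p"
    and c_zero: "\<And>p x. \<lbrakk>p \<le> k; x \<in> A p\<rbrakk> \<Longrightarrow> c p x = \<zero>\<^bsub>G (\<iota> p)\<^esub> \<longleftrightarrow> x \<in> A (Suc p) <+>\<^bsub>V\<^esub> (B \<inter> A p)"
  shows "lin_isomorphic K (quot_space V B) (direct_sum I G)"
proof -
  interpret V: module K V by fact
  interpret K: field K by fact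
  note sA = subsetD[OF submodule_subset[OF A]] and sB = subsetD[OF submodule_subset[OF B]]
  \<comment> \<open>\<open>?W p\<close> is the preimage in \<open>V\<close> of step \<open>p\<close>
    of the filtration induced on the quotient by \<open>B\<close>.\<close>
  let ?W = "\<lambda>p. A p <+>\<^bsub>V\<^esub> B"
  have sW: "submodule (?W p) K V" for p by (rule submodule_set_add[OF V A B])
  have BW: "b \<in> ?W p" if "b \<in> B" for b p
    using set_addI[OF submodule_zero[OF V A[of p]] that, of V] sB[OF that] by simp
  have AW: "a \<in> ?W p" if "a \<in> A p" for a p
    using set_addI[OF that submodule_zero[OF V B], of V] sA[OF that] by simp
  have Wmono: "?W (Suc p) \<subseteq> ?W p" for p using mono[of p] by (fastforce simp: set_add_iff)
  have Wmono': "?W q \<subseteq> ?W p" if "p \<le> q" for p q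
    using that by (induction q rule: dec_induct) (use Wmono in blast)+
  \<comment> \<open>\<open>c p\<close> vanishes on \<open>A p \<inter> B\<close>, so it extends by
    zero over \<open>B\<close> to \<open>?W p\<close>, and from there to \<open>V\<close> by means
    of a complement.\<close>
  have "\<exists>g. g \<in> lin_maps K V (G (\<iota> p)) \<and> (\<forall>a\<in>A p. \<forall>b\<in>B. g (a \<oplus>\<^bsub>V\<^esub> b) = c p a)" if p: "p \<le> k" for p
  proof -
    have mGp: "module K (G (\<iota> p))" using mG img p by auto
    have "c p x = \<zero>\<^bsub>G (\<iota> p)\<^esub>" if x: "x \<in> A p \<inter> B" for x
      using c_zero[OF p, of x] set_addI[OF submodule_zero[OF V A[of "Suc p"]], of x "B \<inter> A p" V] x sA[of x p] by auto
    then obtain h where h: "h \<in> lin_maps K (V\<lparr>carrier := ?W p\<rparr>) (G (\<iota> p))"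
      "\<And>a b. \<lbrakk>a \<in> A p; b \<in> B\<rbrakk> \<Longrightarrow> h (a \<oplus>\<^bsub>V\<^esub> b) = c p a"
      by (rule extend_by_zero[OF V mGp A B c[OF p]]) (auto intro: that)
    obtain g where "g \<in> lin_maps K V (G (\<iota> p))" "\<And>x. x \<in> ?W p \<Longrightarrow> g x = h x"
      by (rule extend_linear[OF K V mGp sW h(1)]) (auto intro: that)
    then show ?thesis using h(2) set_addI[of _ "A p" _ B V] by fastforce
  qed
  then obtain g where g: "\<And>p. p \<le> k \<Longrightarrow> g p \<in> lin_maps K V (G (\<iota> p))"
    "\<And>p a b. \<lbrakk>p \<le> k; a \<in> A p; b \<in> B\<rbrakk> \<Longrightarrow> g p (a \<oplus>\<^bsub>V\<^esub> b) = c p a" by metis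
  have g_zero: "g p x = \<zero>\<^bsub>G (\<iota> p)\<^esub> \<longleftrightarrow> x \<in> ?W (Suc p)" if p: "p \<le> k" and x: "x \<in> ?W p" for p x
  proof -
    obtain a b where ab: "a \<in> A p" "b \<in> B" "x = a \<oplus>\<^bsub>V\<^esub> b" using x by (auto simp: set_add_iff)
    have "a \<in> A (Suc p) <+>\<^bsub>V\<^esub> (B \<inter> A p) \<longleftrightarrow> x \<in> ?W (Suc p)"
    proof
      assume "a \<in> A (Suc p) <+>\<^bsub>V\<^esub> (B \<inter> A p)"
      then obtain a' b' where "a' \<in> A (Suc p)" "b' \<in> B" "a = a' \<oplus>\<^bsub>V\<^esub> b'" by (auto simp: set_add_iff)
      then show "x \<in> ?W (Suc p)"
        using ab set_addI[of a' "A (Suc p)" "b' \<oplus>\<^bsub>V\<^esub> b" B V] submodule_add[OF V B] sA sB by (simp add: V.a_assoc)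
    next
      assume "x \<in> ?W (Suc p)"
      then obtain a' b' where a': "a' \<in> A (Suc p)" "b' \<in> B" "x = a' \<oplus>\<^bsub>V\<^esub> b'" by (auto simp: set_add_iff)
      have ma: "a' \<in> A p" using a'(1) mono by blast
      have "(a \<ominus>\<^bsub>V\<^esub> a') \<oplus>\<^bsub>V\<^esub> (b \<ominus>\<^bsub>V\<^esub> b') = \<zero>\<^bsub>V\<^esub>"
        using ab a' ma sA sB by (simp add: minus_swap[OF V, symmetric] minus_zero_iff[OF V])
      then have "a \<ominus>\<^bsub>V\<^esub> a' = b' \<ominus>\<^bsub>V\<^esub> b"
        using ab a' ma sA sB V.minus_equality[of "a \<ominus>\<^bsub>V\<^esub> a'" "b \<ominus>\<^bsub>V\<^esub> b'"]
        by (simp add: V.minus_eq V.minus_add V.a_comm)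
      then have "a \<ominus>\<^bsub>V\<^esub> a' \<in> B \<inter> A p"
        using submodule_minus[OF V A ab(1) ma] submodule_minus[OF V B a'(2) ab(2)] by simp
      then show "a \<in> A (Suc p) <+>\<^bsub>V\<^esub> (B \<inter> A p)"
        using set_addI[OF a'(1), of "a \<ominus>\<^bsub>V\<^esub> a'" "B \<inter> A p" V] minus_add_cancel(2)[OF V, of a a'] sA ab ma by simp
    qed
    then show ?thesis using ab g(2)[OF p ab(1,2)] c_zero[OF p ab(1)] by simp
  qed
  define pos where "pos = inv_into {..k} \<iota>"
  have pos: "pos (\<iota> p) = p" if "p \<le> k" for p using inj that by (simp add: pos_def)
  define \<Phi> where "\<Phi> x = (\<lambda>i\<in>I. if i \<in> \<iota> ` {..k} then g (pos i) x else \<zero>\<^bsub>G i\<^esub>)" for x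
  have \<Phi>_\<iota>: "\<Phi> x (\<iota> p) = g p x" if "p \<le> k" for x p using that img pos by (auto simp: \<Phi>_def)
  have \<Phi>_o: "\<Phi> x i = \<zero>\<^bsub>G i\<^esub>" if "i \<in> I - \<iota> ` {..k}" for x i using that by (auto simp: \<Phi>_def)
  have mD: "module K (direct_sum I G)" by (rule module_direct_sum[OF V.R.is_cring mG])
  have eqI: "u = \<Phi> x" if "u \<in> extensional I" "\<And>p. p \<le> k \<Longrightarrow> u (\<iota> p) = g p x" "\<And>i. i \<in> I - \<iota> ` {..k} \<Longrightarrow> u i = \<zero>\<^bsub>G i\<^esub>" for u x
  proof (rule extensionalityI[OF that(1)])
    show "\<Phi> x \<in> extensional I" by (simp add: \<Phi>_def)
    show "u i = \<Phi> x i" if "i \<in> I" for i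
      using that \<open>\<And>p. p \<le> k \<Longrightarrow> u (\<iota> p) = g p x\<close> \<open>\<And>i. i \<in> I - \<iota> ` {..k} \<Longrightarrow> u i = \<zero>\<^bsub>G i\<^esub>\<close> \<Phi>_\<iota> \<Phi>_o
      by (cases "i \<in> \<iota> ` {..k}") auto
  qed
  have \<Phi>_lin: "\<Phi> \<in> lin_maps K V (direct_sum I G)"
  proof (rule lin_mapsI)
    fix x assume x: "x \<in> carrier V"
    have "\<Phi> x i \<in> carrier (G i)" if "i \<in> I" for i
    proof (cases "i \<in> \<iota> ` {..k}")
      case True
      then show ?thesis using \<Phi>_\<iota> lin_maps_closed[OF g(1) x] by auto
    next
      case False
      then show ?thesis using \<Phi>_o[of i] Gz[of i] that by simp
    qed
    moreover have "{i \<in> I. \<Phi> x i \<noteq> \<zero>\<^bsub>G i\<^esub>} \<subseteq> \<iota> ` {..k}" using \<Phi>_o by blast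
    then have "finite {i \<in> I. \<Phi> x i \<noteq> \<zero>\<^bsub>G i\<^esub>}" by (rule finite_subset) simp
    ultimately show "\<Phi> x \<in> carrier (direct_sum I G)" by (simp add: direct_sum_carrier PiE_iff) (simp add: \<Phi>_def)
  next
    fix x y assume "x \<in> carrier V" "y \<in> carrier V"
    then show "\<Phi> (x \<oplus>\<^bsub>V\<^esub> y) = \<Phi> x \<oplus>\<^bsub>direct_sum I G\<^esub> \<Phi> y"
      using img abelian_groupE(5)[OF module.axioms(2)[OF mG]] abelian_groupE(2)[OF module.axioms(2)[OF mG]]
      by (intro eqI[symmetric]) (auto simp: \<Phi>_\<iota> \<Phi>_o lin_maps_add[OF g(1)])
  next
    fix a x assume "a \<in> carrier K" "x \<in> carrier V"
    then show "\<Phi> (a \<odot>\<^bsub>V\<^esub> x) = a \<odot>\<^bsub>direct_sum I G\<^esub> \<Phi> x"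
      using img module.smult_r_null[OF mG]
      by (intro eqI[symmetric]) (auto simp: \<Phi>_\<iota> \<Phi>_o lin_maps_smult[OF g(1)])
  qed
  \<comment> \<open>The coordinates are prescribed in increasing order of \<open>p\<close>. The
    correction \<open>a\<close> from \<open>A j\<close> adjusts coordinate \<open>j\<close> and
    leaves the earlier ones alone, since \<open>g p\<close> vanishes on \<open>A j\<close> for
    \<open>p < j\<close>.\<close>
  have onto: "\<exists>x\<in>carrier V. \<forall>p<j. g p x = u (\<iota> p)" if u: "u \<in> carrier (direct_sum I G)" and j: "j \<le> Suc k" for u j
    using j
  proof (induction j)
    case 0
    then show ?case using V.zero_closed by blast
  next
    case (Suc j)
    then obtain x where x: "x \<in> carrier V" "\<forall>p<j. g p x = u (\<iota> p)" by auto
    have jk: "j \<le> k" using Suc by simp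
    interpret G: module K "G (\<iota> j)" using mG img jk by auto
    have uj: "u (\<iota> j) \<in> carrier (G (\<iota> j))" using u img jk by (auto simp: direct_sum_carrier)
    note gx = lin_maps_closed[OF g(1)[OF jk] x(1)]
    obtain a where a: "a \<in> A j" "c j a = u (\<iota> j) \<ominus>\<^bsub>G (\<iota> j)\<^esub> g j x"
      using subsetD[OF c_surj[OF jk] G.minus_closed[OF uj gx]] by auto
    have ga: "g j a = c j a" using g(2)[OF jk a(1) submodule_zero[OF V B]] sA[OF a(1)] by simp
    have "g p (x \<oplus>\<^bsub>V\<^esub> a) = u (\<iota> p)" if p: "p < Suc j" for p
    proof (cases "p = j")
      case True
      then show ?thesis
        using x a sA[OF a(1)] ga gx uj jk by (simp add: lin_maps_add[OF g(1)] minus_add_cancel[OF G.module_axioms])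
    next
      case False
      then have pj: "p < j" "p \<le> k" using p jk by auto
      interpret Gp: module K "G (\<iota> p)" using mG img pj by auto
      have "a \<in> ?W (Suc p)" using AW[OF a(1)] Wmono'[of "Suc p" j] pj by auto
      then have "g p a = \<zero>\<^bsub>G (\<iota> p)\<^esub>" using g_zero[OF pj(2)] Wmono by blast
      then show ?thesis
        using x pj sA[OF a(1)] lin_maps_closed[OF g(1)[OF pj(2)] x(1)] by (simp add: lin_maps_add[OF g(1)])
    qed
    then show ?case using x(1) sA[OF a(1)] by blast
  qed
  have ker: "g p x = \<zero>\<^bsub>G (\<iota> p)\<^esub>" if "x \<in> B" "p \<le> k" for x p
    using g_zero[OF that(2)] BW[OF that(1)] by blast
  \<comment> \<open>A vector with all coordinates zero sinks through the filtration step by step and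
    ends in \<open>?W (Suc k)\<close>, which is \<open>B\<close>.\<close>
  have in_W: "x \<in> ?W j" if x: "x \<in> carrier V" "\<And>p. p \<le> k \<Longrightarrow> g p x = \<zero>\<^bsub>G (\<iota> p)\<^esub>" and j: "j \<le> Suc k" for x j
    using j
  proof (induction j)
    case 0
    show ?case using AW[of x 0] x A0 by simp
  next
    case (Suc j)
    then show ?case using g_zero[of j x] x(2)[of j] by simp
  qed
  have Wk: "?W (Suc k) = B" unfolding Ak using sB by (auto simp: set_add_iff)
  show ?thesis
  proof (rule factor_isomorphic[OF V mD \<Phi>_lin])
    show "carrier (direct_sum I G) \<subseteq> \<Phi> ` carrier V"
    proof
      fix u assume u: "u \<in> carrier (direct_sum I G)"
      obtain x where x: "x \<in> carrier V" "\<forall>p<Suc k. g p x = u (\<iota> p)" using onto[OF u le_refl] by auto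
      have "u = \<Phi> x"
        using u x Gz by (intro eqI) (auto simp: direct_sum_carrier PiE_iff)
      then show "u \<in> \<Phi> ` carrier V" using x by auto
    qed
    have z: "\<Phi> x = \<zero>\<^bsub>direct_sum I G\<^esub> \<longleftrightarrow> (\<forall>p\<le>k. g p x = \<zero>\<^bsub>G (\<iota> p)\<^esub>)" for x
    proof
      assume "\<Phi> x = \<zero>\<^bsub>direct_sum I G\<^esub>"
      then have "\<Phi> x (\<iota> p) = \<zero>\<^bsub>G (\<iota> p)\<^esub>" if "p \<le> k" for p using that img by auto
      then show "\<forall>p\<le>k. g p x = \<zero>\<^bsub>G (\<iota> p)\<^esub>" using \<Phi>_\<iota> by simp
    next
      assume "\<forall>p\<le>k. g p x = \<zero>\<^bsub>G (\<iota> p)\<^esub>"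
      then show "\<Phi> x = \<zero>\<^bsub>direct_sum I G\<^esub>" using img by (intro eqI[symmetric]) auto
    qed
    show "B = {x \<in> carrier V. \<Phi> x = \<zero>\<^bsub>direct_sum I G\<^esub>}"
    proof (intro equalityI subsetI)
      fix x assume "x \<in> B" then show "x \<in> {x \<in> carrier V. \<Phi> x = \<zero>\<^bsub>direct_sum I G\<^esub>}"
        using sB ker unfolding z by simp
    next
      fix x assume "x \<in> {x \<in> carrier V. \<Phi> x = \<zero>\<^bsub>direct_sum I G\<^esub>}"
      then show "x \<in> B" using in_W[of x "Suc k"] unfolding z Wk by simp
    qed
  qed
qed

section \<open>The spectral sequence of a filtered complex\<close>

text \<open>Pages are indexed here by the filtration degree \<open>p\<close> and the total degree \<open>n = p + q\<close>.\<close>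

locale filtered_complex =
  fixes K :: "('k, 'r) ring_scheme" and C :: "int \<Rightarrow> ('k, 'x, 'm) module_scheme"
    and d :: "int \<Rightarrow> 'x \<Rightarrow> 'x" and F :: "int \<Rightarrow> int \<Rightarrow> 'x set"
  assumes module_C: "module K (C n)"
    and d_linear: "d n \<in> lin_maps K (C n) (C (n + 1))"
    and d_d: "x \<in> carrier (C n) \<Longrightarrow> d (n + 1) (d n x) = \<zero>\<^bsub>C (n + 2)\<^esub>"
    and submodule_F: "submodule (F p n) K (C n)"
    and F_step: "F (p + 1) n \<subseteq> F p n"
    and d_F: "x \<in> F p n \<Longrightarrow> d n x \<in> F p (n + 1)"
begin

lemma F_carrier: "x \<in> F p n \<Longrightarrow> x \<in> carrier (C n)"
  using submodule_subset[OF submodule_F] by blast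

lemma F_mono: "\<lbrakk>x \<in> F p' n; p \<le> p'\<rbrakk> \<Longrightarrow> x \<in> F p n"
proof -
  have "F (p + int k) n \<subseteq> F p n" for k
  proof (induction k)
    case (Suc k)
    have "F (p + int (Suc k)) n \<subseteq> F (p + int k) n" using F_step[of "p + int k" n] by (simp add: ac_simps)
    then show ?case using Suc by blast
  qed simp
  from this[of "nat (p' - p)"] show "\<lbrakk>x \<in> F p' n; p \<le> p'\<rbrakk> \<Longrightarrow> x \<in> F p n" by auto
qed

lemma d_linear': "d (n - 1) \<in> lin_maps K (C (n - 1)) (C n)"
  using d_linear[of "n - 1"] by simp

lemma d_d': "x \<in> carrier (C (n - 1)) \<Longrightarrow> d n (d (n - 1) x) = \<zero>\<^bsub>C (n + 1)\<^esub>"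
  using d_d[of x "n - 1"] by (simp add: algebra_simps)

lemma zero_F: "\<zero>\<^bsub>C n\<^esub> \<in> F p n"
  by (rule submodule_zero[OF module_C submodule_F])

definition cyc :: "int \<Rightarrow> int \<Rightarrow> int \<Rightarrow> 'x set"
  where "cyc r p n = {x \<in> F p n. d n x \<in> F (p + r) (n + 1)}"

definition bnd :: "int \<Rightarrow> int \<Rightarrow> int \<Rightarrow> 'x set"
  where "bnd r p n = cyc (r - 1) (p + 1) n <+>\<^bsub>C n\<^esub> d (n - 1) ` cyc (r - 1) (p - r + 1) (n - 1)"

abbreviation pg :: "int \<Rightarrow> int \<Rightarrow> int \<Rightarrow> ('k, 'x set) module"
  where "pg r p n \<equiv> quot_space ((C n)\<lparr>carrier := cyc r p n\<rparr>) (bnd r p n)"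

abbreviation dpg :: "int \<Rightarrow> int \<Rightarrow> int \<Rightarrow> 'x set \<Rightarrow> 'x set"
  where "dpg r p n \<equiv> quot_map (C (n + 1)) (bnd r (p + r) (n + 1)) (d n)"

abbreviation cl :: "int \<Rightarrow> int \<Rightarrow> int \<Rightarrow> 'x \<Rightarrow> 'x set"
  where "cl r p n x \<equiv> bnd r p n +>\<^bsub>C n\<^esub> x"

lemma ss_cycles_eq: "ss_cycles d F r p q = cyc r p (p + q)"
  by (simp add: ss_cycles_def cyc_def)

lemma ss_null_eq: "ss_null C d F r p q = bnd r p (p + q)"
proof -
  have "p + 1 + (q - 1) = p + q" "p - r + 1 + (q + r - 2) = p + q - 1" by simp_all
  then show ?thesis by (simp only: ss_null_def bnd_def ss_cycles_eq)
qed

lemma ss_page_eq: "ss_page C d F r p q = pg (int r) p (p + q)"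
  by (simp add: ss_page_def ss_cycles_eq ss_null_eq)

lemma ss_diff_eq: "ss_diff C d F r p q = dpg (int r) p (p + q)"
proof -
  have "p + int r + (q + 1 - int r) = p + q + 1" by simp
  then show ?thesis by (simp only: ss_diff_def ss_null_eq)
qed

lemma submodule_cyc: "submodule (cyc r p n) K (C n)"
  using submodule_preimage[OF module_C module_C d_linear submodule_F submodule_F] by (simp add: cyc_def)

lemma cyc_carrier: "x \<in> cyc r p n \<Longrightarrow> x \<in> carrier (C n)"
  by (auto simp: cyc_def F_carrier)

lemma submodule_bnd: "submodule (bnd r p n) K (C n)"
  unfolding bnd_def
  by (rule submodule_set_add[OF module_C submodule_cyc submodule_image[OF module_C module_C d_linear' submodule_cyc]])

lemma bnd_iff: "x \<in> bnd r p n \<longleftrightarrow>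
    (\<exists>z\<in>cyc (r - 1) (p + 1) n. \<exists>y\<in>cyc (r - 1) (p - r + 1) (n - 1). x = z \<oplus>\<^bsub>C n\<^esub> d (n - 1) y)"
  by (auto simp: bnd_def set_add_iff)

lemma cyc_Suc_subset: "cyc (r - 1) (p + 1) n \<subseteq> cyc r p n"
  by (auto simp: cyc_def intro: F_mono)

text \<open>The order \<open>s\<close> is arbitrary because \<open>d (d x) = 0\<close> lies in every
  filtration step.\<close>

lemma d_cyc: "x \<in> cyc r p n \<Longrightarrow> d n x \<in> cyc s (p + r) (n + 1)"
  using d_d[of x n] zero_F by (auto simp: cyc_def F_carrier algebra_simps)

lemma d_cyc': "x \<in> cyc r p (n - 1) \<Longrightarrow> d (n - 1) x \<in> cyc s (p + r) n"
  using d_cyc[of x r p "n - 1"] by simp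

lemma bnd_cyc: "bnd r p n \<subseteq> cyc r p n"
proof
  fix x assume "x \<in> bnd r p n"
  then obtain z y where "z \<in> cyc (r - 1) (p + 1) n" "y \<in> cyc (r - 1) (p - r + 1) (n - 1)" "x = z \<oplus>\<^bsub>C n\<^esub> d (n - 1) y"
    by (auto simp: bnd_iff)
  then show "x \<in> cyc r p n"
    using submodule_add[OF module_C submodule_cyc] subsetD[OF cyc_Suc_subset] d_cyc'[of y "r - 1" "p - r + 1" n r]
    by auto
qed

lemma submodule_bnd_cyc: "submodule (bnd r p n) K ((C n)\<lparr>carrier := cyc r p n\<rparr>)"
  by (rule submodule_restrict[OF module_C submodule_cyc submodule_bnd bnd_cyc])

lemma module_cyc: "module K ((C n)\<lparr>carrier := cyc r p n\<rparr>)"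
  by (rule module_restrict[OF module_C submodule_cyc])

lemma module_pg: "module K (pg r p n)"
  by (rule module_quot_space[OF module_cyc submodule_bnd_cyc])

lemma cl_linear: "(\<lambda>x. cl r p n x) \<in> lin_maps K ((C n)\<lparr>carrier := cyc r p n\<rparr>) (pg r p n)"
  using coset_linear[OF module_cyc submodule_bnd_cyc] by simp

lemma cl_zero_iff: "x \<in> cyc r p n \<Longrightarrow> cl r p n x = bnd r p n \<longleftrightarrow> x \<in> bnd r p n"
  by (rule coset_zero_iff[OF module_C submodule_bnd cyc_carrier])

lemma cl_eq_iff: "\<lbrakk>x \<in> cyc r p n; y \<in> cyc r p n\<rbrakk> \<Longrightarrow> cl r p n x = cl r p n y \<longleftrightarrow> x \<ominus>\<^bsub>C n\<^esub> y \<in> bnd r p n"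
  by (rule coset_eq_iff[OF module_C submodule_bnd cyc_carrier cyc_carrier])

text \<open>\<open>d\<close> kills the exact summand. The other summand \<open>z\<close> has step
  \<open>p + 1 = (p + r) - r + 1\<close>, exactly where the exact part of the null space at
  \<open>p + r\<close> takes its sources.\<close>

lemma d_bnd: "x \<in> bnd r p n \<Longrightarrow> d n x \<in> bnd r (p + r) (n + 1)"
proof -
  interpret C1: module K "C (n + 1)" by (rule module_C)
  assume "x \<in> bnd r p n"
  then obtain z y where *: "z \<in> cyc (r - 1) (p + 1) n" "y \<in> cyc (r - 1) (p - r + 1) (n - 1)" "x = z \<oplus>\<^bsub>C n\<^esub> d (n - 1) y"
    by (auto simp: bnd_iff)
  note z = cyc_carrier[OF *(1)] and y = cyc_carrier[OF *(2)]
  have "d n x = d n z"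
    using z y * lin_maps_closed[OF d_linear' y] lin_maps_closed[OF d_linear z] d_d'[OF y]
    by (simp add: lin_maps_add[OF d_linear])
  then have "d n x = \<zero>\<^bsub>C (n + 1)\<^esub> \<oplus>\<^bsub>C (n + 1)\<^esub> d n z" using lin_maps_closed[OF d_linear z] by simp
  moreover have "z \<in> cyc (r - 1) (p + r - r + 1) (n + 1 - 1)" using *(1) by simp
  ultimately show ?thesis
    using submodule_zero[OF module_C submodule_cyc[of "r - 1" "p + r + 1" "n + 1"]] unfolding bnd_iff by force
qed

lemma dpg_cl: "x \<in> cyc r p n \<Longrightarrow> dpg r p n (cl r p n x) = cl r (p + r) (n + 1) (d n x)"
  by (rule quot_map_linear[OF module_C module_C d_linear submodule_bnd submodule_bnd _ cyc_carrier])
    (use d_bnd in auto)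

lemma dpg_linear: "dpg r p n \<in> lin_maps K (pg r p n) (pg r (p + r) (n + 1))"
proof -
  note c = lin_maps_comp[OF lin_maps_restrict[OF d_linear, of "cyc r p n" n "cyc r (p + r) (n + 1)"] cl_linear]
  have l: "(\<lambda>x. cl r (p + r) (n + 1) (d n x)) \<in> lin_maps K ((C n)\<lparr>carrier := cyc r p n\<rparr>) (pg r (p + r) (n + 1))"
    by (rule c) (auto simp: cyc_carrier d_cyc)
  note add = coset_add[OF module_cyc submodule_bnd_cyc, simplified] and sm = coset_smult[OF module_cyc submodule_bnd_cyc, simplified]
  note sc = submodule_add[OF module_C submodule_cyc] submodule_smult[OF module_C submodule_cyc]
  show ?thesis
    using lin_maps_closed[OF l]
    by (intro lin_mapsI) (auto simp: dpg_cl add sm sc lin_maps_add[OF l, simplified] lin_maps_smult[OF l, simplified])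
qed

lemma dpg_linear': "dpg r (p - r) (n - 1) \<in> lin_maps K (pg r (p - r) (n - 1)) (pg r p n)"
  using dpg_linear[where r=r and p="p - r" and n="n - 1"] by simp

lemma dpg_cl': "x \<in> cyc r (p - r) (n - 1) \<Longrightarrow> dpg r (p - r) (n - 1) (cl r (p - r) (n - 1) x) = cl r p n (d (n - 1) x)"
  using dpg_cl[of x r "p - r" "n - 1"] by simp

lemma dpg_dpg: "X \<in> carrier (pg r p n) \<Longrightarrow> dpg r (p + r) (n + 1) (dpg r p n X) = \<zero>\<^bsub>pg r (p + r + r) (n + 1 + 1)\<^esub>"
proof -
  assume "X \<in> carrier (pg r p n)"
  then obtain x where x: "x \<in> cyc r p n" "X = cl r p n x" by auto
  have "n + 1 + 1 = n + 2" by simp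
  then have "d (n + 1) (d n x) = \<zero>\<^bsub>C (n + 1 + 1)\<^esub>" using d_d[OF cyc_carrier[OF x(1)]] by (simp only:)
  then show ?thesis
    unfolding x(2) dpg_cl[OF x(1)] dpg_cl[OF d_cyc[OF x(1)]]
    by (simp only: coset_zero[OF module_C submodule_bnd] quot_space_fields)
qed

text \<open>Writing \<open>d n x = z + d n y\<close> with \<open>z\<close> in a deep step and
  \<open>y\<close> negligible on page \<open>r\<close>, the difference of \<open>x\<close> and
  \<open>y\<close> is a cycle of order \<open>r + 1\<close> with the same class. This is why each
  page is onto the kernel of the previous differential.\<close>

lemma cycle_lift:
  assumes "1 \<le> r" "x \<in> cyc r p n" "d n x \<in> bnd r (p + r) (n + 1)"
  obtains x' where "x' \<in> cyc (r + 1) p n" "x \<ominus>\<^bsub>C n\<^esub> x' \<in> cyc (r - 1) (p + 1) n"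
proof -
  obtain z y where *: "z \<in> cyc (r - 1) (p + r + 1) (n + 1)" "y \<in> cyc (r - 1) (p + 1) n" "d n x = z \<oplus>\<^bsub>C (n + 1)\<^esub> d n y"
    using assms(3) by (auto simp: bnd_iff)
  note x = cyc_carrier[OF assms(2)] and y = cyc_carrier[OF *(2)] and z = cyc_carrier[OF *(1)]
  have y': "y \<in> cyc r p n" using *(2) cyc_Suc_subset by blast
  have "d n (x \<ominus>\<^bsub>C n\<^esub> y) = z"
    using x y z *(3) lin_maps_closed[OF d_linear y]
    by (simp add: lin_maps_minus[OF module_C module_C d_linear] add_minus_cancel[OF module_C])
  moreover have "z \<in> F (p + (r + 1)) (n + 1)" using *(1) by (simp add: cyc_def add.assoc)
  ultimately have "x \<ominus>\<^bsub>C n\<^esub> y \<in> cyc (r + 1) p n"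
    using submodule_minus[OF module_C submodule_cyc assms(2) y'] by (simp add: cyc_def)
  then show thesis using that *(2) minus_minus_cancel[OF module_C x y] by simp
qed

lemma cycle_lift_conv:
  assumes "x \<in> cyc (r + 1) p n"
  shows "x \<in> cyc r p n" "d n x \<in> bnd r (p + r) (n + 1)"
proof -
  interpret C1: module K "C (n + 1)" by (rule module_C)
  interpret C0: module K "C n" by (rule module_C)
  show "x \<in> cyc r p n" using assms by (auto simp: cyc_def intro: F_mono)
  have "d n x \<in> cyc (r - 1) (p + r + 1) (n + 1)" using d_cyc[OF assms, of "r - 1"] by (simp add: add.assoc)
  moreover have "d n x = d n x \<oplus>\<^bsub>C (n + 1)\<^esub> d n \<zero>\<^bsub>C n\<^esub>"
    using lin_maps_closed[OF d_linear cyc_carrier[OF assms]] by (simp add: lin_maps_zero[OF module_C module_C d_linear])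
  moreover have "\<zero>\<^bsub>C n\<^esub> \<in> cyc (r - 1) (p + r - r + 1) (n + 1 - 1)"
    using submodule_zero[OF module_C submodule_cyc] by simp
  ultimately show "d n x \<in> bnd r (p + r) (n + 1)" unfolding bnd_iff by force
qed

text \<open>Passing to page \<open>r + 1\<close> raises the required order of the non-exact summand
  by one and lets the exact summand start one step earlier. From right to left, the two exact
  contributions \<open>y\<close> and \<open>w\<close> merge into one source.\<close>

lemma boundary_next_iff:
  assumes "1 \<le> r" "x \<in> cyc (r + 1) p n"
  shows "x \<in> bnd (r + 1) p n \<longleftrightarrow> (\<exists>y\<in>cyc r (p - r) (n - 1). x \<ominus>\<^bsub>C n\<^esub> d (n - 1) y \<in> bnd r p n)"
proof -
  interpret Cn: module K "C n" by (rule module_C)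
  note x = cyc_carrier[OF assms(2)]
  show ?thesis
  proof
    assume "x \<in> bnd (r + 1) p n"
    then obtain z y where *: "z \<in> cyc r (p + 1) n" "y \<in> cyc r (p - r) (n - 1)" "x = z \<oplus>\<^bsub>C n\<^esub> d (n - 1) y"
      by (auto simp: bnd_iff)
    note y = lin_maps_closed[OF d_linear' cyc_carrier[OF *(2)]]
    have "z \<in> cyc (r - 1) (p + 1) n" using *(1) by (auto simp: cyc_def intro: F_mono)
    moreover have "\<zero>\<^bsub>C (n - 1)\<^esub> \<in> cyc (r - 1) (p - r + 1) (n - 1)" by (rule submodule_zero[OF module_C submodule_cyc])
    moreover have "x \<ominus>\<^bsub>C n\<^esub> d (n - 1) y = z \<oplus>\<^bsub>C n\<^esub> d (n - 1) \<zero>\<^bsub>C (n - 1)\<^esub>"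
      using *(3) y cyc_carrier[OF *(1)] by (simp add: add_minus_cancel[OF module_C] lin_maps_zero[OF module_C module_C d_linear'])
    ultimately show "\<exists>y\<in>cyc r (p - r) (n - 1). x \<ominus>\<^bsub>C n\<^esub> d (n - 1) y \<in> bnd r p n"
      using *(2) unfolding bnd_iff by blast
  next
    assume "\<exists>y\<in>cyc r (p - r) (n - 1). x \<ominus>\<^bsub>C n\<^esub> d (n - 1) y \<in> bnd r p n"
    then obtain y z w where *: "y \<in> cyc r (p - r) (n - 1)" "z \<in> cyc (r - 1) (p + 1) n"
      "w \<in> cyc (r - 1) (p - r + 1) (n - 1)" "x \<ominus>\<^bsub>C n\<^esub> d (n - 1) y = z \<oplus>\<^bsub>C n\<^esub> d (n - 1) w"
      unfolding bnd_iff by blast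
    note y = cyc_carrier[OF *(1)] and w = cyc_carrier[OF *(3)] and z = cyc_carrier[OF *(2)]
    note dy = lin_maps_closed[OF d_linear' y] and dw = lin_maps_closed[OF d_linear' w]
    have w': "w \<in> cyc r (p - r) (n - 1)" using *(3) cyc_Suc_subset[of r "p - r" "n - 1"] by (auto simp: algebra_simps)
    have wy: "w \<oplus>\<^bsub>C (n - 1)\<^esub> y \<in> cyc r (p - r) (n - 1)" by (rule submodule_add[OF module_C submodule_cyc w' *(1)])
    have "x = (x \<ominus>\<^bsub>C n\<^esub> d (n - 1) y) \<oplus>\<^bsub>C n\<^esub> d (n - 1) y" using x dy by (simp add: minus_add_cancel[OF module_C])
    also have "\<dots> = z \<oplus>\<^bsub>C n\<^esub> d (n - 1) (w \<oplus>\<^bsub>C (n - 1)\<^esub> y)"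
      unfolding *(4) using z dw dy w y by (simp add: lin_maps_add[OF d_linear'] Cn.a_assoc)
    finally have xe: "x = z \<oplus>\<^bsub>C n\<^esub> d (n - 1) (w \<oplus>\<^bsub>C (n - 1)\<^esub> y)" .
    \<comment> \<open>\<open>x\<close> has order \<open>r + 1\<close>; as \<open>d n z\<close>
      equals \<open>d n x\<close>, the summand \<open>z\<close>, so far of order
      \<open>r - 1\<close> in step \<open>p + 1\<close>, has order \<open>r\<close> there.\<close>
    have "d n x = d n z"
      using xe z d_d'[OF cyc_carrier[OF wy]] lin_maps_closed[OF d_linear' cyc_carrier[OF wy]]
        lin_maps_closed[OF d_linear z] abelian_monoid.r_zero[OF abelian_group.axioms(1)[OF module.axioms(2)[OF module_C]]]
      by (simp add: lin_maps_add[OF d_linear])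
    then have "z \<in> cyc r (p + 1) n" using assms(2) *(2) by (auto simp: cyc_def algebra_simps)
    then show "x \<in> bnd (r + 1) p n"
      using xe wy unfolding bnd_iff by (auto simp: algebra_simps)
  qed
qed

text \<open>Cycles of order \<open>r + 1\<close> map to the cohomology of page \<open>r\<close>.
  \<open>cycle_lift\<close> makes this map surjective and \<open>boundary_next_iff\<close>
  identifies its kernel with the null space of page \<open>r + 1\<close>.\<close>

lemma next_page:
  fixes r p n :: int
  assumes r: "1 \<le> r"
  defines "Zr \<equiv> {X \<in> carrier (pg r p n). dpg r p n X = \<zero>\<^bsub>pg r (p + r) (n + 1)\<^esub>}"
    and "Br \<equiv> dpg r (p - r) (n - 1) ` carrier (pg r (p - r) (n - 1))"
  shows "lin_isomorphic K (pg (r + 1) p n) (quot_space ((pg r p n)\<lparr>carrier := Zr\<rparr>) Br)"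
proof -
  interpret Cn: module K "C n" by (rule module_C)
  have sZ: "submodule Zr K (pg r p n)" unfolding Zr_def by (rule submodule_kernel[OF module_pg module_pg dpg_linear])
  have sB: "submodule Br K (pg r p n)"
    unfolding Br_def by (rule submodule_image[OF module_pg module_pg dpg_linear' submodule_carrier[OF module_pg]])
  have BZ: "Br \<subseteq> Zr"
    using dpg_dpg[where r=r and p="p - r" and n="n - 1"] lin_maps_closed[OF dpg_linear'[where r=r and p=p and n=n]] unfolding Zr_def Br_def by auto
  note mZ = module_restrict[OF module_pg sZ] and sBZ = submodule_restrict[OF module_pg sZ sB BZ]
  let ?Q = "quot_space ((pg r p n)\<lparr>carrier := Zr\<rparr>) Br"
  have mQ: "module K ?Q" by (rule module_quot_space[OF mZ sBZ])
  have cl_Z: "cl r p n x \<in> Zr" if "x \<in> cyc (r + 1) p n" for x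
    using cycle_lift_conv[OF that] dpg_cl[of x r p n] cl_zero_iff[OF d_cyc[of x r p n r]]
    unfolding Zr_def by auto
  have sub: "cyc (r + 1) p n \<subseteq> cyc r p n" using cycle_lift_conv(1) by blast
  have "(\<lambda>x. cl r p n x) \<in> lin_maps K ((C n)\<lparr>carrier := cyc (r + 1) p n\<rparr>) ((pg r p n)\<lparr>carrier := Zr\<rparr>)"
    using lin_maps_restrict[OF cl_linear[where r=r and p=p and n=n], of "cyc (r + 1) p n" Zr] sub cl_Z by simp
  from lin_maps_comp[OF this coset_linear[OF mZ sBZ]]
  have lin: "(\<lambda>x. Br +>\<^bsub>pg r p n\<^esub> cl r p n x) \<in> lin_maps K ((C n)\<lparr>carrier := cyc (r + 1) p n\<rparr>) ?Q" by simp
  show ?thesis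
  proof (rule factor_isomorphic[OF module_cyc mQ lin])
    show "carrier ?Q \<subseteq> (\<lambda>x. Br +>\<^bsub>pg r p n\<^esub> cl r p n x) ` carrier ((C n)\<lparr>carrier := cyc (r + 1) p n\<rparr>)"
    proof
      fix Q assume "Q \<in> carrier ?Q"
      then obtain X where X: "X \<in> Zr" "Q = Br +>\<^bsub>pg r p n\<^esub> X" by auto
      then obtain x where x: "x \<in> cyc r p n" "X = cl r p n x" by (auto simp: Zr_def)
      have "d n x \<in> bnd r (p + r) (n + 1)"
        using X(1) x dpg_cl[OF x(1)] cl_zero_iff[OF d_cyc[OF x(1), of r]] by (simp add: Zr_def)
      then obtain x' where x': "x' \<in> cyc (r + 1) p n" "x \<ominus>\<^bsub>C n\<^esub> x' \<in> cyc (r - 1) (p + 1) n"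
        by (rule cycle_lift[OF r x(1)])
      have "x \<ominus>\<^bsub>C n\<^esub> x' \<in> bnd r p n"
      proof -
        have "x \<ominus>\<^bsub>C n\<^esub> x' = (x \<ominus>\<^bsub>C n\<^esub> x') \<oplus>\<^bsub>C n\<^esub> d (n - 1) \<zero>\<^bsub>C (n - 1)\<^esub>"
          using cyc_carrier[OF x'(2)] by (simp add: lin_maps_zero[OF module_C module_C d_linear'])
        then show ?thesis
          unfolding bnd_iff using x'(2) submodule_zero[OF module_C submodule_cyc] by blast
      qed
      then have "X = cl r p n x'" using cl_eq_iff[OF x(1), of x'] x' sub x(2) by auto
      then show "Q \<in> (\<lambda>x. Br +>\<^bsub>pg r p n\<^esub> cl r p n x) ` carrier ((C n)\<lparr>carrier := cyc (r + 1) p n\<rparr>)"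
        using X(2) x'(1) by auto
    qed
    show "bnd (r + 1) p n = {x \<in> carrier ((C n)\<lparr>carrier := cyc (r + 1) p n\<rparr>). Br +>\<^bsub>pg r p n\<^esub> cl r p n x = \<zero>\<^bsub>?Q\<^esub>}"
    proof -
      have "Br +>\<^bsub>pg r p n\<^esub> cl r p n x = Br \<longleftrightarrow> x \<in> bnd (r + 1) p n" if x: "x \<in> cyc (r + 1) p n" for x
      proof -
        have xr: "x \<in> cyc r p n" using sub x by blast
        have "Br +>\<^bsub>pg r p n\<^esub> cl r p n x = Br \<longleftrightarrow> cl r p n x \<in> Br"
          by (rule coset_zero_iff[OF module_pg sB]) (use xr in auto)
        also have "\<dots> \<longleftrightarrow> (\<exists>y\<in>cyc r (p - r) (n - 1). cl r p n x = cl r p n (d (n - 1) y))"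
          unfolding Br_def by (auto simp: dpg_cl'[simplified] image_iff)
        also have "\<dots> \<longleftrightarrow> (\<exists>y\<in>cyc r (p - r) (n - 1). x \<ominus>\<^bsub>C n\<^esub> d (n - 1) y \<in> bnd r p n)"
          using cl_eq_iff[OF xr] d_cyc'[of _ r "p - r" n r] by auto
        also have "\<dots> \<longleftrightarrow> x \<in> bnd (r + 1) p n" using boundary_next_iff[OF r x] by simp
        finally show ?thesis .
      qed
      then show ?thesis using bnd_cyc[of "r + 1" p n] by auto
    qed
  qed
qed

abbreviation "Epage \<equiv> ss_page C d F"
abbreviation "Ediff \<equiv> ss_diff C d F"

theorem spectral_sequence: "spectral_sequence K Epage Ediff"
  unfolding spectral_sequence_def
proof (intro allI impI conjI ballI)
  fix r :: nat and p q :: int assume r: "1 \<le> r"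
  have e: "p + int r + (q + 1 - int r) = p + q + 1" "p - int r + (q - 1 + int r) = p + q - 1"
    "p + int r + int r + (q + 2 - 2 * int r) = p + q + 1 + 1" "p + 2 * int r = p + int r + int r"
    "int (r + 1) = int r + 1" by simp_all
  note eqs = ss_page_eq ss_diff_eq e
  show "module K (Epage r p q)" unfolding eqs by (rule module_pg)
  show "Ediff r p q \<in> lin_maps K (Epage r p q) (Epage r (p + int r) (q + 1 - int r))"
    unfolding eqs by (rule dpg_linear)
  show "Ediff r (p + int r) (q + 1 - int r) (Ediff r p q x) = \<zero>\<^bsub>Epage r (p + 2 * int r) (q + 2 - 2 * int r)\<^esub>"
    if "x \<in> carrier (Epage r p q)" for x
    using that unfolding eqs by (rule dpg_dpg)
  show "lin_isomorphic K (Epage (r + 1) p q)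
       (quot_space ((Epage r p q)\<lparr>carrier := {x \<in> carrier (Epage r p q). Ediff r p q x = \<zero>\<^bsub>Epage r (p + int r) (q + 1 - int r)\<^esub>}\<rparr>)
         (Ediff r (p - int r) (q - 1 + int r) ` carrier (Epage r (p - int r) (q - 1 + int r))))"
    unfolding eqs by (rule next_page) (use r in simp)
qed

end

section \<open>Bounded filtrations: vanishing, stabilisation and the limit\<close>

locale first_quadrant_complex = filtered_complex +
  assumes F_full: "p \<le> 0 \<Longrightarrow> F p n = carrier (C n)"
    and F_trivial: "n < p \<Longrightarrow> F p n = {\<zero>\<^bsub>C n\<^esub>}"
begin

text \<open>For \<open>p < 0\<close> the steps \<open>p\<close> and \<open>p + 1\<close> both equal
  the whole complex, so every cycle is already null; for \<open>n < p\<close> the step itself is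
  zero. The second alternative is \<open>q < 0\<close>.\<close>

lemma pg_trivial:
  assumes "1 \<le> r" "p < 0 \<or> n < p"
  shows "carrier (pg r p n) = {\<zero>\<^bsub>pg r p n\<^esub>}"
proof -
  interpret Cn: module K "C n" by (rule module_C)
  have z: "d (n - 1) \<zero>\<^bsub>C (n - 1)\<^esub> = \<zero>\<^bsub>C n\<^esub>" by (rule lin_maps_zero[OF module_C module_C d_linear'])
  have "cyc r p n \<subseteq> bnd r p n"
  proof (cases "p < 0")
    case True
    then have "cyc r p n = cyc (r - 1) (p + 1) n" by (simp add: cyc_def F_full)
    then show ?thesis
      using z submodule_zero[OF module_C submodule_cyc[of "r - 1" "p - r + 1" "n - 1"]] cyc_carrier
      unfolding bnd_iff subset_iff by (metis Cn.r_zero)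
  next
    case False
    then show ?thesis
      using assms(2) F_trivial[of n p] submodule_zero[OF module_C submodule_bnd] by (auto simp: cyc_def)
  qed
  then have "cl r p n x = bnd r p n" if "x \<in> cyc r p n" for x using cl_zero_iff[OF that] that by blast
  moreover have "\<zero>\<^bsub>C n\<^esub> \<in> cyc r p n" by (rule submodule_zero[OF module_C submodule_cyc])
  ultimately show ?thesis by auto
qed

lemma page_trivial: "\<lbrakk>1 \<le> r; p < 0 \<or> q < 0\<rbrakk> \<Longrightarrow> carrier (Epage r p q) = {\<zero>\<^bsub>Epage r p q\<^esub>}"
  unfolding ss_page_eq by (rule pg_trivial) auto

text \<open>The bound exceeds \<open>p\<close>, so incoming differentials start in negative
  filtration degree, and it exceeds \<open>q + 1\<close>, so outgoing ones end in a step beyond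
  their total degree. Both ends then vanish.\<close>

definition stable :: "int \<Rightarrow> int \<Rightarrow> nat" where "stable p q = nat (\<bar>p\<bar> + \<bar>q\<bar>) + 2"

lemma stable_from: "stable_from Epage Ediff p q (stable p q)"
  unfolding stable_from_def
proof (intro conjI allI impI ballI)
  fix r x assume r: "stable p q \<le> r"
  have e: "p + int r + (q + 1 - int r) = p + q + 1" "p - int r + (q - 1 + int r) = p + q - 1" by simp_all
  note eqs = ss_page_eq ss_diff_eq e
  have rr: "1 \<le> int r" "p + q + 1 < p + int r" "p - int r < 0" using r by (auto simp: stable_def)
  show "Ediff r p q x = \<zero>\<^bsub>Epage r (p + int r) (q + 1 - int r)\<^esub>" if "x \<in> carrier (Epage r p q)"
    using lin_maps_closed[OF dpg_linear that[unfolded eqs]] pg_trivial[OF rr(1), of "p + int r" "p + q + 1"] rr(2)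
    unfolding eqs by blast
  assume x: "x \<in> carrier (Epage r (p - int r) (q - 1 + int r))"
  then have "x = \<zero>\<^bsub>pg (int r) (p - int r) (p + q - 1)\<^esub>"
    using pg_trivial[OF rr(1), of "p - int r" "p + q - 1"] rr(3) unfolding eqs by blast
  then show "Ediff r (p - int r) (q - 1 + int r) x = \<zero>\<^bsub>Epage r p q\<^esub>"
    using lin_maps_zero[OF module_pg module_pg dpg_linear'[where r="int r" and p=p and n="p + q"]] unfolding eqs by blast
qed (simp add: stable_def)

text \<open>On the stable page the cycles are the true cocycles in \<open>F p\<close>, and the null
  elements are the cocycles in \<open>F (p + 1)\<close> plus the coboundaries in \<open>F p\<close>.
  The page is thus a graded piece of the filtration on cohomology; only \<open>p\<close> from 0 to
  \<open>k\<close> contribute, and \<open>filtered_quotient_splits\<close> applies.\<close>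

lemma E_infinity:
  assumes "field K" "0 \<le> k"
  defines "Zk \<equiv> {x \<in> carrier (C k). d k x = \<zero>\<^bsub>C (k + 1)\<^esub>}"
  shows "lin_isomorphic K (quot_space ((C k)\<lparr>carrier := Zk\<rparr>) (d (k - 1) ` carrier (C (k - 1))))
    (direct_sum {(p, q). p + q = k} (\<lambda>(p, q). Epage (stable p q) p q))"
proof -
  interpret Ck: module K "C k" by (rule module_C)
  let ?V = "(C k)\<lparr>carrier := Zk\<rparr>" and ?B = "d (k - 1) ` carrier (C (k - 1))"
  let ?A = "\<lambda>p::nat. F (int p) k \<inter> Zk" and ?I = "{(p, q). p + q = k}"
  have sZ: "submodule Zk K (C k)" unfolding Zk_def by (rule submodule_kernel[OF module_C module_C d_linear])
  have sB: "submodule ?B K (C k)" by (rule submodule_image[OF module_C module_C d_linear' submodule_carrier[OF module_C]])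
  have BZ: "?B \<subseteq> Zk" using d_d' lin_maps_closed[OF d_linear'] by (auto simp: Zk_def)
  have V: "module K ?V" by (rule module_restrict[OF module_C sZ])
  have sA: "submodule (?A p) K (C k)" for p by (rule submodule_Int[OF module_C submodule_F sZ])
  define r where "r p = int (stable (int p) (k - int p))" for p :: nat
  have cyc: "cyc (r p) (int p) k = ?A p" "cyc (r p - 1) (int p + 1) k = ?A (Suc p)" if "p \<le> nat k" for p
  proof -
    have "k + 1 < int p + r p" using that assms(2) by (simp add: r_def stable_def)
    then have "F (int p + r p) (k + 1) = {\<zero>\<^bsub>C (k + 1)\<^esub>}" by (rule F_trivial)
    then show "cyc (r p) (int p) k = ?A p" "cyc (r p - 1) (int p + 1) k = ?A (Suc p)"
      by (auto simp: cyc_def Zk_def F_carrier add.commute)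
  qed
  \<comment> \<open>The sources lie in step \<open>p - r + 1 \<le> 0\<close>, that is, anywhere in
    degree \<open>k - 1\<close>. So all coboundaries that lie in \<open>F p\<close> occur.\<close>
  have bnd: "bnd (r p) (int p) k = ?A (Suc p) <+>\<^bsub>C k\<^esub> (?B \<inter> ?A p)" if "p \<le> nat k" for p
  proof -
    have "int p - r p + 1 \<le> 0" using that by (simp add: r_def stable_def)
    then have "d (k - 1) ` cyc (r p - 1) (int p - r p + 1) (k - 1) = ?B \<inter> F (int p) k"
      by (auto simp: cyc_def F_full)
    also have "\<dots> = ?B \<inter> ?A p" using BZ by auto
    finally show ?thesis unfolding bnd_def cyc(2)[OF that] by simp
  qed
  show ?thesis
  proof (rule filtered_quotient_splits[OF assms(1) V, where A="?A" and k="nat k" and \<iota>="\<lambda>p. (int p, k - int p)"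
        and c="\<lambda>p x. cl (r p) (int p) k x"])
    show "submodule (?A p) K ?V" for p by (rule submodule_restrict[OF module_C sZ sA]) auto
    show "submodule ?B K ?V" by (rule submodule_restrict[OF module_C sZ sB BZ])
    show "?A 0 = carrier ?V" using F_full[of 0 k] by (auto simp: Zk_def)
    show "?A (Suc (nat k)) = {\<zero>\<^bsub>?V\<^esub>}"
      using F_trivial[of k "1 + k"] submodule_zero[OF module_C sZ] assms(2) by auto
    show "?A (Suc p) \<subseteq> ?A p" for p using F_step[of "int p" k] by (auto simp: add.commute)
    show "inj_on (\<lambda>p. (int p, k - int p)) {..nat k}" by (auto simp: inj_on_def)
    show "(\<lambda>p. (int p, k - int p)) ` {..nat k} \<subseteq> ?I" by auto
    show "module K (case i of (p, q) \<Rightarrow> Epage (stable p q) p q)" for i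
      by (auto simp: ss_page_eq module_pg split: prod.split)
    show "carrier (case i of (p, q) \<Rightarrow> Epage (stable p q) p q) = {\<zero>\<^bsub>case i of (p, q) \<Rightarrow> Epage (stable p q) p q\<^esub>}"
      if "i \<in> ?I - (\<lambda>p. (int p, k - int p)) ` {..nat k}" for i
    proof -
      from that obtain p q where i: "i = (p, q)" "p + q = k" by auto
      have "p < 0 \<or> q < 0"
      proof (rule ccontr)
        assume "\<not> (p < 0 \<or> q < 0)"
        then have "i = (\<lambda>p. (int p, k - int p)) (nat p)" "nat p \<in> {..nat k}" using i by auto
        then show False using that by blast
      qed
      then show ?thesis using page_trivial[of "stable p q" p q] by (simp add: i stable_def)
    qed
    fix p assume p: "p \<le> nat k"
    have G: "(case (int p, k - int p) of (p, q) \<Rightarrow> Epage (stable p q) p q) = pg (r p) (int p) k"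
      by (simp add: ss_page_eq r_def)
    show "cl (r p) (int p) k \<in> lin_maps K (?V\<lparr>carrier := ?A p\<rparr>) (case (int p, k - int p) of (p, q) \<Rightarrow> Epage (stable p q) p q)"
      unfolding G using cl_linear[where r="r p" and p="int p" and n=k] unfolding cyc(1)[OF p] by simp
    show "carrier (case (int p, k - int p) of (p, q) \<Rightarrow> Epage (stable p q) p q) \<subseteq> cl (r p) (int p) k ` ?A p"
      unfolding G using cyc(1)[OF p] by simp
    show "cl (r p) (int p) k x = \<zero>\<^bsub>case (int p, k - int p) of (p, q) \<Rightarrow> Epage (stable p q) p q\<^esub> \<longleftrightarrow>
        x \<in> ?A (Suc p) <+>\<^bsub>?V\<^esub> (?B \<inter> ?A p)" if x: "x \<in> ?A p" for x
      unfolding G using cl_zero_iff[of x "r p" "int p" k] x cyc(1)[OF p] bnd[OF p] by simp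
  qed
qed

end

section \<open>Differential calculi\<close>

lemma forms_fields [simp]:
  "carrier (forms \<Omega> n) = grade \<Omega> n" "zero (forms \<Omega> n) = zero \<Omega>" "add (forms \<Omega> n) = add \<Omega>"
  "smult (forms \<Omega> n) = smult \<Omega>" "lact (forms \<Omega> n) = mult \<Omega>" "ract (forms \<Omega> n) = mult \<Omega>"
  by (simp_all add: forms_def)

lemma lin_maps_sum:
  assumes "module K V" "module K W" "f \<in> lin_maps K V W" "g \<in> lin_maps K V W"
  shows "(\<lambda>x. f x \<oplus>\<^bsub>W\<^esub> g x) \<in> lin_maps K V W"
proof -
  interpret V: module K V by fact
  interpret W: module K W by fact
  show ?thesis
    using lin_maps_closed[OF assms(3)] lin_maps_closed[OF assms(4)]
    by (intro lin_mapsI) (auto simp: lin_maps_add[OF assms(3)] lin_maps_add[OF assms(4)] lin_maps_smult[OF assms(3)]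
        lin_maps_smult[OF assms(4)] add_swap[OF assms(2)] W.smult_r_distr)
qed

lemma smult_linear:
  assumes "module K V" "c \<in> carrier K"
  shows "(\<lambda>x. c \<odot>\<^bsub>V\<^esub> x) \<in> lin_maps K V V"
proof -
  interpret V: module K V by fact
  show ?thesis using assms(2)
    by (intro lin_mapsI) (auto simp: V.smult_r_distr V.smult_assoc1[symmetric] V.R.m_comm)
qed

lemma
  assumes "cring K"
  shows msign_closed: "msign K n \<in> carrier K"
    and msign_0: "msign K 0 = \<one>\<^bsub>K\<^esub>"
    and msign_Suc_0: "msign K (Suc 0) = \<ominus>\<^bsub>K\<^esub> \<one>\<^bsub>K\<^esub>"
    and msign_add: "msign K (m + n) = msign K m \<otimes>\<^bsub>K\<^esub> msign K n"
    and msign_square: "msign K n \<otimes>\<^bsub>K\<^esub> msign K n = \<one>\<^bsub>K\<^esub>"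
proof -
  interpret K: cring K by fact
  show "msign K n \<in> carrier K" "msign K 0 = \<one>\<^bsub>K\<^esub>" "msign K (Suc 0) = \<ominus>\<^bsub>K\<^esub> \<one>\<^bsub>K\<^esub>"
    "msign K (m + n) = msign K m \<otimes>\<^bsub>K\<^esub> msign K n"
    by (simp_all add: msign_def K.nat_pow_mult)
  have "(\<ominus>\<^bsub>K\<^esub> \<one>\<^bsub>K\<^esub>) \<otimes>\<^bsub>K\<^esub> (\<ominus>\<^bsub>K\<^esub> \<one>\<^bsub>K\<^esub>) = \<one>\<^bsub>K\<^esub>" by (simp add: K.l_minus)
  then show "msign K n \<otimes>\<^bsub>K\<^esub> msign K n = \<one>\<^bsub>K\<^esub>"
    by (simp add: msign_def K.nat_pow_distrib[symmetric])
qed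

locale calculus =
  fixes K :: "('k, 'r) ring_scheme" and A :: "('k, 'w) module" and \<Omega> :: "('k, 'w) calculus"
  assumes calculus: "differential_calculus K A \<Omega>"
begin

lemma k_algebra: "k_algebra K \<Omega>"
  using calculus by (simp add: differential_calculus_def)

sublocale \<Omega>: k_algebra K \<Omega> by (rule k_algebra)

lemma module_\<Omega>: "module K \<Omega>" by (rule \<Omega>.module_axioms)

lemma degree_zero: "degree_zero \<Omega> = A"
  using calculus by (simp add: differential_calculus_def)

lemma A_fields: "carrier A = grade \<Omega> 0" "mult A = mult \<Omega>" "one A = one \<Omega>" "zero A = zero \<Omega>"
  "add A = add \<Omega>" "smult A = smult \<Omega>"
  using degree_zero by (auto simp: degree_zero_def)

lemma submodule_grade: "submodule (grade \<Omega> n) K \<Omega>"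
  and grade_one: "\<one>\<^bsub>\<Omega>\<^esub> \<in> grade \<Omega> 0"
  and grade_mult: "\<lbrakk>\<xi> \<in> grade \<Omega> m; \<eta> \<in> grade \<Omega> n\<rbrakk> \<Longrightarrow> \<xi> \<otimes>\<^bsub>\<Omega>\<^esub> \<eta> \<in> grade \<Omega> (m + n)"
  and dif_linear: "dif \<Omega> \<in> lin_maps K (forms \<Omega> n) (forms \<Omega> (Suc n))"
  and dif_dif: "\<xi> \<in> grade \<Omega> n \<Longrightarrow> dif \<Omega> (dif \<Omega> \<xi>) = \<zero>\<^bsub>\<Omega>\<^esub>"
  and dif_mult: "\<lbrakk>\<xi> \<in> grade \<Omega> m; \<eta> \<in> grade \<Omega> n\<rbrakk> \<Longrightarrow> dif \<Omega> (\<xi> \<otimes>\<^bsub>\<Omega>\<^esub> \<eta>) =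
        (dif \<Omega> \<xi> \<otimes>\<^bsub>\<Omega>\<^esub> \<eta>) \<oplus>\<^bsub>\<Omega>\<^esub> (msign K m \<odot>\<^bsub>\<Omega>\<^esub> (\<xi> \<otimes>\<^bsub>\<Omega>\<^esub> dif \<Omega> \<eta>))"
  and grade_Suc_0: "grade \<Omega> (Suc 0) = lin_span K \<Omega> {a' \<otimes>\<^bsub>\<Omega>\<^esub> dif \<Omega> a | a a'. a \<in> carrier A \<and> a' \<in> carrier A}"
  and grade_span: "n \<ge> 1 \<Longrightarrow> grade \<Omega> n = lin_span K \<Omega>
        {foldr (mult \<Omega>) \<xi>s \<one>\<^bsub>\<Omega>\<^esub> | \<xi>s. length \<xi>s = n \<and> set \<xi>s \<subseteq> grade \<Omega> (Suc 0)}"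
  using calculus unfolding differential_calculus_def One_nat_def add_Suc_right add_0_right by (elim conjE; blast)+

lemma grade_carrier: "\<xi> \<in> grade \<Omega> n \<Longrightarrow> \<xi> \<in> carrier \<Omega>"
  using submodule_subset[OF submodule_grade] by blast

lemmas grade_add = submodule_add[OF module_\<Omega> submodule_grade]
  and grade_smult = submodule_smult[OF module_\<Omega> submodule_grade]
  and grade_zero = submodule_zero[OF module_\<Omega> submodule_grade]

lemma grade_mult': "\<lbrakk>\<xi> \<in> grade \<Omega> m; \<eta> \<in> grade \<Omega> n; m + n = l\<rbrakk> \<Longrightarrow> \<xi> \<otimes>\<^bsub>\<Omega>\<^esub> \<eta> \<in> grade \<Omega> l"
  using grade_mult by blast

lemma dif_grade: "\<xi> \<in> grade \<Omega> n \<Longrightarrow> dif \<Omega> \<xi> \<in> grade \<Omega> (Suc n)"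
  using lin_maps_closed[OF dif_linear] by simp

lemma dif_add: "\<lbrakk>\<xi> \<in> grade \<Omega> n; \<eta> \<in> grade \<Omega> n\<rbrakk> \<Longrightarrow> dif \<Omega> (\<xi> \<oplus>\<^bsub>\<Omega>\<^esub> \<eta>) = dif \<Omega> \<xi> \<oplus>\<^bsub>\<Omega>\<^esub> dif \<Omega> \<eta>"
  and dif_smult: "\<lbrakk>c \<in> carrier K; \<xi> \<in> grade \<Omega> n\<rbrakk> \<Longrightarrow> dif \<Omega> (c \<odot>\<^bsub>\<Omega>\<^esub> \<xi>) = c \<odot>\<^bsub>\<Omega>\<^esub> dif \<Omega> \<xi>"
  using lin_maps_add[OF dif_linear] lin_maps_smult[OF dif_linear] by simp_all

lemma module_forms: "module K (forms \<Omega> n)"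
  by (rule module_cong[OF module_restrict[OF module_\<Omega> submodule_grade]]) simp_all

lemma dif_zero: "dif \<Omega> \<zero>\<^bsub>\<Omega>\<^esub> = \<zero>\<^bsub>\<Omega>\<^esub>"
  using lin_maps_zero[OF module_forms module_forms dif_linear] by simp

lemma module_A: "module K A"
  by (rule module_cong[OF module_forms[of 0]]) (simp_all add: A_fields)

lemma ring_A: "ring A"
proof (rule ringI)
  show "abelian_group A" by (rule module.axioms(2)[OF module_A])
  show "monoid A"
    by (rule monoidI) (auto simp: A_fields grade_one grade_mult'[of _ 0 _ 0] grade_carrier \<Omega>.m_assoc)
qed (auto simp: A_fields grade_carrier \<Omega>.l_distr \<Omega>.r_distr)

lemma bimodule_forms: "bimodule K A A (forms \<Omega> n)"
  by (auto simp: bimodule_def left_module_def right_module_def module_forms A_fields grade_carrier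
      grade_mult'[of _ 0 _ n n] grade_mult'[of _ n _ 0 n] \<Omega>.l_distr \<Omega>.r_distr \<Omega>.m_assoc
      \<Omega>.smult_mult_left \<Omega>.smult_mult_right)

lemma left_forms: "left_module K A (forms \<Omega> n)"
  and right_forms: "right_module K A (forms \<Omega> n)"
  using bimodule_forms by (simp_all add: bimodule_def)

lemma mult_linear_left: "\<eta> \<in> grade \<Omega> n \<Longrightarrow> (\<lambda>\<xi>. \<xi> \<otimes>\<^bsub>\<Omega>\<^esub> \<eta>) \<in> lin_maps K (forms \<Omega> m) (forms \<Omega> (m + n))"
  and mult_linear_right: "\<xi> \<in> grade \<Omega> m \<Longrightarrow> (\<lambda>\<eta>. \<xi> \<otimes>\<^bsub>\<Omega>\<^esub> \<eta>) \<in> lin_maps K (forms \<Omega> n) (forms \<Omega> (m + n))"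
  by (auto intro!: lin_mapsI simp: grade_mult grade_carrier \<Omega>.l_distr \<Omega>.r_distr
      \<Omega>.smult_mult_left \<Omega>.smult_mult_right)

lemma foldr_grade: "set \<xi>s \<subseteq> grade \<Omega> (Suc 0) \<Longrightarrow> foldr (mult \<Omega>) \<xi>s \<one>\<^bsub>\<Omega>\<^esub> \<in> grade \<Omega> (length \<xi>s)"
  by (induction \<xi>s) (auto simp: grade_one intro: grade_mult')

text \<open>The spanning products are nested to the right, so detaching the last factor uses
  associativity. The one-form is split off on the right because in \<open>filt_Suc\<close> it must
  act before the remaining form.\<close>

lemma grade_Suc_induct:
  assumes "\<zeta> \<in> grade \<Omega> (Suc n)" "submodule {\<xi> \<in> grade \<Omega> (Suc n). P \<xi>} K \<Omega>"
    and "\<And>\<xi> \<eta>. \<lbrakk>\<xi> \<in> grade \<Omega> n; \<eta> \<in> grade \<Omega> (Suc 0)\<rbrakk> \<Longrightarrow> P (\<xi> \<otimes>\<^bsub>\<Omega>\<^esub> \<eta>)"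
  shows "P \<zeta>"
proof -
  have "grade \<Omega> (Suc n) \<subseteq> {\<xi> \<in> grade \<Omega> (Suc n). P \<xi>}"
    unfolding grade_span[of "Suc n", simplified]
  proof (rule lin_span_minimal[OF assms(2)[unfolded grade_span[of "Suc n", simplified]]], safe)
    fix \<xi>s assume \<xi>s: "length \<xi>s = Suc n" "set \<xi>s \<subseteq> grade \<Omega> (Suc 0)"
    then show "foldr (mult \<Omega>) \<xi>s \<one>\<^bsub>\<Omega>\<^esub> \<in> lin_span K \<Omega>
        {foldr (mult \<Omega>) \<xi>s \<one>\<^bsub>\<Omega>\<^esub> |\<xi>s. length \<xi>s = Suc n \<and> set \<xi>s \<subseteq> grade \<Omega> (Suc 0)}"
      using foldr_grade[OF \<xi>s(2)] grade_span[of "Suc n"] by simp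
    have split: "foldr (mult \<Omega>) (xs @ [\<eta>]) \<one>\<^bsub>\<Omega>\<^esub> = foldr (mult \<Omega>) xs \<one>\<^bsub>\<Omega>\<^esub> \<otimes>\<^bsub>\<Omega>\<^esub> \<eta>"
      if "set xs \<subseteq> grade \<Omega> (Suc 0)" "\<eta> \<in> grade \<Omega> (Suc 0)" for xs \<eta>
      using that by (induction xs) (auto simp: grade_carrier foldr_grade \<Omega>.m_assoc grade_carrier[OF foldr_grade])
    obtain xs \<eta> where x: "\<xi>s = xs @ [\<eta>]" using \<xi>s(1) by (cases \<xi>s rule: rev_cases) auto
    then have "set xs \<subseteq> grade \<Omega> (Suc 0)" "\<eta> \<in> grade \<Omega> (Suc 0)" "length xs = n" using \<xi>s by auto
    then show "P (foldr (mult \<Omega>) \<xi>s \<one>\<^bsub>\<Omega>\<^esub>)"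
      using assms(3)[of "foldr (mult \<Omega>) xs \<one>\<^bsub>\<Omega>\<^esub>" \<eta>] foldr_grade[of xs] split[of xs \<eta>] x by simp
  qed
  then show ?thesis using assms(1) by blast
qed

text \<open>One-forms are sums of products of a function with an exact form, and higher forms are
  sums of products of one-forms. A linear and multiplicative property therefore propagates from
  functions and exact one-forms to all degrees.\<close>

lemma grade_induct [consumes 1, case_names submodule degree_0 dif mult]:
  assumes "\<zeta> \<in> grade \<Omega> n" "\<And>n. submodule {\<xi> \<in> grade \<Omega> n. P n \<xi>} K \<Omega>"
    and P0: "\<And>a. a \<in> grade \<Omega> 0 \<Longrightarrow> P 0 a" and Pd: "\<And>a. a \<in> grade \<Omega> 0 \<Longrightarrow> P (Suc 0) (dif \<Omega> a)"
    and Pm: "\<And>m n \<xi> \<eta>. \<lbrakk>\<xi> \<in> grade \<Omega> m; \<eta> \<in> grade \<Omega> n; P m \<xi>; P n \<eta>\<rbrakk> \<Longrightarrow> P (m + n) (\<xi> \<otimes>\<^bsub>\<Omega>\<^esub> \<eta>)"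
  shows "P n \<zeta>"
proof -
  have P1: "P (Suc 0) \<xi>" if "\<xi> \<in> grade \<Omega> (Suc 0)" for \<xi>
  proof -
    have "lin_span K \<Omega> {a' \<otimes>\<^bsub>\<Omega>\<^esub> dif \<Omega> a | a a'. a \<in> carrier A \<and> a' \<in> carrier A} \<subseteq> {\<xi> \<in> grade \<Omega> (Suc 0). P (Suc 0) \<xi>}"
    proof (rule lin_span_minimal[OF assms(2)], safe)
      fix a a' assume "a \<in> carrier A" "a' \<in> carrier A"
      then have a: "a \<in> grade \<Omega> 0" "a' \<in> grade \<Omega> 0" by (simp_all add: A_fields)
      then show "a' \<otimes>\<^bsub>\<Omega>\<^esub> dif \<Omega> a \<in> grade \<Omega> (Suc 0)" using grade_mult[OF a(2) dif_grade[OF a(1)]] by simp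
      show "P (Suc 0) (a' \<otimes>\<^bsub>\<Omega>\<^esub> dif \<Omega> a)" using Pm[OF a(2) dif_grade[OF a(1)] P0[OF a(2)] Pd[OF a(1)]] by simp
    qed
    then show ?thesis using that grade_Suc_0 by auto
  qed
  show ?thesis
    using assms(1)
  proof (induction n arbitrary: \<zeta>)
    case 0
    then show ?case by (rule P0)
  next
    case (Suc n)
    show ?case
      by (rule grade_Suc_induct[OF Suc.prems assms(2)]) (use Pm[of _ n _ "Suc 0"] Suc.IH P1 in simp)
  qed
qed

end

section \<open>The complex of a flat bimodule connection\<close>

locale flat_connection =
  fixes D :: "('k, 'w, 'v, 'e) bundle_data"
  assumes field_K: "field (scal D)"
    and calcA: "differential_calculus (scal D) (algA D) (calA D)"
    and calcB: "differential_calculus (scal D) (algB D) (calB D)"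
    and bimE: "bimodule (scal D) (algB D) (algA D) (bim D)"
    and connection: "right_bimodule_connection D"
    and ext: "extendable D"
    and flat: "zero_curvature D"
begin

abbreviation "K \<equiv> scal D"
abbreviation "A \<equiv> algA D"
abbreviation "B \<equiv> algB D"
abbreviation "\<Omega> \<equiv> calA D"
abbreviation "\<Gamma> \<equiv> calB D"
abbreviation "E \<equiv> bim D"
abbreviation "C \<equiv> cochains D"
abbreviation "ct \<equiv> ctens D"
abbreviation "wr \<equiv> wedge_right D"
abbreviation "L \<equiv> sigma_wedge D"
abbreviation "nab \<equiv> nabla D"
abbreviation "ms \<equiv> msign K"

sublocale K: field K by (rule field_K)
sublocale a: calculus K A \<Omega> by (rule calculus.intro[OF calcA])
sublocale b: calculus K B \<Gamma> by (rule calculus.intro[OF calcB])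

lemmas K_cring = K.is_cring

lemma left_E: "left_module K B E" and right_E: "right_module K A E"
  using bimE by (simp_all add: bimodule_def)

sublocale CP: tensor_pair K A E "forms \<Omega> n" for n
  by (rule tensor_pair.intro[OF right_E a.left_forms])

sublocale SP: tensor_pair K B "forms \<Gamma> n" E for n
  by (rule tensor_pair.intro[OF b.right_forms left_E])

lemmas module_C = CP.module_tensor[folded cochains_def]
  and ct_linear_left = CP.tens_linear_left[folded cochains_def, unfolded forms_fields]
  and ct_linear_right = CP.tens_linear_right[folded cochains_def]
  and ct_balanced = CP.tens_balanced[unfolded forms_fields]
  and ct_closed = CP.tens_closed[folded cochains_def, unfolded forms_fields]
  and left_C = CP.left_module_tensor[OF bimE b.ring_A b.module_A, folded cochains_def]
  and lact_ct = CP.lact_tens[OF bimE, folded cochains_def, unfolded forms_fields]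
  and ract_C_linear = CP.ract_tensor_linear[OF a.bimodule_forms, folded cochains_def]
  and ract_ct = CP.ract_tens[OF a.bimodule_forms, folded cochains_def, unfolded forms_fields]
  and ct_add_right = CP.tens_add_right[folded cochains_def, unfolded forms_fields]
  and ct_smult_right = CP.tens_smult_right[folded cochains_def, unfolded forms_fields]

lemmas C_induct [consumes 1, case_names tens add] = CP.tensor_induct[folded cochains_def, unfolded forms_fields]

sublocale C: module K "C n" for n by (rule module_C)

lemma ct_zero: "e \<in> carrier E \<Longrightarrow> ct n e \<zero>\<^bsub>\<Omega>\<^esub> = \<zero>\<^bsub>C n\<^esub>"
  using lin_maps_zero[OF a.module_forms module_C ct_linear_right] by simp

section \<open>The right wedge action of the forms on \<open>A\<close>\<close>

lemma wr_target:
  assumes "\<kappa> \<in> grade \<Omega> n"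
  shows "tensor_target K A E (forms \<Omega> m) (C (m + n)) (\<lambda>e \<eta>. ct (m + n) e (\<eta> \<otimes>\<^bsub>\<Omega>\<^esub> \<kappa>))"
proof -
  have "balanced K A E (forms \<Omega> m) (tensor K A E (forms \<Omega> (m + n))) (\<lambda>e \<eta>. ct (m + n) e (\<eta> \<otimes>\<^bsub>\<Omega>\<^esub> \<kappa>))"
    by (rule balanced_map[OF CP.tensor_pair_axioms CP.tensor_pair_axioms _ a.mult_linear_left[OF assms], where u="\<lambda>e. e"])
      (auto intro!: lin_mapsI simp: ct_balanced a.A_fields a.grade_mult assms a.\<Omega>.m_assoc a.grade_carrier
        a.grade_carrier[OF assms])
  then show ?thesis
    by (intro tensor_target.intro tensor_target_axioms.intro CP.tensor_pair_axioms module_C) (simp add: cochains_def)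
qed

lemma wr_linear: "\<kappa> \<in> grade \<Omega> n \<Longrightarrow> (\<lambda>x. wr m n x \<kappa>) \<in> lin_maps K (C m) (C (m + n))"
  using tensor_target.tensor_lift_linear[OF wr_target, folded cochains_def] by (simp add: wedge_right_def)

lemma wr_ct: "\<lbrakk>e \<in> carrier E; \<eta> \<in> grade \<Omega> m; \<kappa> \<in> grade \<Omega> n\<rbrakk> \<Longrightarrow> wr m n (ct m e \<eta>) \<kappa> = ct (m + n) e (\<eta> \<otimes>\<^bsub>\<Omega>\<^esub> \<kappa>)"
  using tensor_target.tensor_lift_tens[OF wr_target] by (simp add: wedge_right_def)

lemmas wr_closed = lin_maps_closed[OF wr_linear]
  and wr_add = lin_maps_add[OF wr_linear]

lemma wr_linear_right: "x \<in> carrier (C m) \<Longrightarrow> (\<lambda>\<kappa>. wr m n x \<kappa>) \<in> lin_maps K (forms \<Omega> n) (C (m + n))"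
proof (induction x rule: C_induct)
  case (tens e \<eta>)
  show ?case
    by (rule lin_maps_cong[OF lin_maps_comp[OF a.mult_linear_right[OF tens(2)] ct_linear_right[OF tens(1)]] _ a.module_forms])
      (use tens in \<open>simp add: wr_ct\<close>)
next
  case (add x y)
  show ?case
    by (rule lin_maps_cong[OF lin_maps_sum[OF a.module_forms module_C add(3,4)] _ a.module_forms])
      (use add in \<open>simp add: wr_add\<close>)
qed

lemma wr_ract: "\<lbrakk>x \<in> carrier (C m); \<alpha> \<in> carrier A; \<kappa> \<in> grade \<Omega> n\<rbrakk> \<Longrightarrow> wr m n (x \<triangleleft>\<^bsub>C m\<^esub> \<alpha>) \<kappa> = wr m n x (\<alpha> \<otimes>\<^bsub>\<Omega>\<^esub> \<kappa>)"
proof (induction x rule: C_induct)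
  case (tens e \<eta>)
  then show ?case
    using a.grade_mult'[of \<eta> m \<alpha> 0 m] a.grade_mult'[of \<alpha> 0 \<kappa> n n]
    by (simp add: ract_ct wr_ct a.A_fields a.\<Omega>.m_assoc a.grade_carrier)
next
  case (add x y)
  then show ?case
    using lin_maps_closed[OF ract_C_linear] a.grade_mult'[of \<alpha> 0 \<kappa> n n]
    by (simp add: lin_maps_add[OF ract_C_linear] wr_add a.A_fields)
qed

lemma wr_wr: "\<lbrakk>x \<in> carrier (C m); \<kappa> \<in> grade \<Omega> n; \<kappa>' \<in> grade \<Omega> k\<rbrakk> \<Longrightarrow>
    wr (m + n) k (wr m n x \<kappa>) \<kappa>' = wr m (n + k) x (\<kappa> \<otimes>\<^bsub>\<Omega>\<^esub> \<kappa>')"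
proof (induction x rule: C_induct)
  case (tens e \<eta>)
  then show ?case
    by (simp add: wr_ct a.grade_mult a.\<Omega>.m_assoc a.grade_carrier add.assoc)
next
  case (add x y)
  then show ?case
    by (simp add: wr_add wr_closed a.grade_mult add.assoc)
qed

lemmas lact_C_linear = lact_linear[OF left_C]
  and lact_C_closed = lact_closed[OF left_C]

lemma wr_lact: "\<lbrakk>x \<in> carrier (C m); \<beta> \<in> carrier B; \<kappa> \<in> grade \<Omega> n\<rbrakk> \<Longrightarrow>
    wr m n (\<beta> \<triangleright>\<^bsub>C m\<^esub> x) \<kappa> = \<beta> \<triangleright>\<^bsub>C (m + n)\<^esub> wr m n x \<kappa>"
proof (induction x rule: C_induct)
  case (tens e \<eta>)
  then show ?case
    using lact_closed[OF left_E] by (simp add: wr_ct lact_ct a.grade_mult)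
next
  case (add x y)
  then show ?case
    by (simp add: lact_add[OF left_C] wr_add wr_closed lact_C_closed)
qed

section \<open>The left action of the forms on \<open>B\<close>\<close>

lemma braid_linear: "braid D n \<in> lin_maps K (formsE D n) (C n)"
  and braid_ract: "\<lbrakk>z \<in> carrier (formsE D n); \<alpha> \<in> carrier A\<rbrakk> \<Longrightarrow> braid D n (z \<triangleleft>\<^bsub>formsE D n\<^esub> \<alpha>) = braid D n z \<triangleleft>\<^bsub>C n\<^esub> \<alpha>"
  and braid_0: "\<lbrakk>\<beta> \<in> carrier B; e \<in> carrier E\<rbrakk> \<Longrightarrow> braid D 0 (formsE_tens D 0 \<beta> e) = ct 0 (\<beta> \<triangleright>\<^bsub>E\<^esub> e) \<one>\<^bsub>A\<^esub>"
  and braid_mult: "\<lbrakk>\<xi> \<in> grade \<Gamma> m; \<eta> \<in> grade \<Gamma> n; e \<in> carrier E\<rbrakk> \<Longrightarrow>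
      braid D (m + n) (formsE_tens D (m + n) (\<xi> \<otimes>\<^bsub>\<Gamma>\<^esub> \<eta>) e) = L m n \<xi> (braid D n (formsE_tens D n \<eta> e))"
  using ext by (auto simp: extendable_def bimodule_maps_def left_maps_def)

lemma braid_tens_ract: "\<lbrakk>\<xi> \<in> grade \<Gamma> n; e \<in> carrier E; \<alpha> \<in> carrier A\<rbrakk> \<Longrightarrow>
    braid D n (formsE_tens D n \<xi> (e \<triangleleft>\<^bsub>E\<^esub> \<alpha>)) = braid D n (formsE_tens D n \<xi> e) \<triangleleft>\<^bsub>C n\<^esub> \<alpha>"
  using braid_ract[OF SP.tens_closed] SP.ract_tens[OF bimE] by simp

lemma braid_closed: "\<lbrakk>\<xi> \<in> grade \<Gamma> n; e \<in> carrier E\<rbrakk> \<Longrightarrow> braid D n (formsE_tens D n \<xi> e) \<in> carrier (C n)"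
  using lin_maps_closed[OF braid_linear] SP.tens_closed by simp

lemmas braid_tens_linear = lin_maps_comp[OF SP.tens_linear_right braid_linear, unfolded forms_fields]
  and braid_tens_linear_left = lin_maps_comp[OF SP.tens_linear_left braid_linear]

lemma L_target:
  assumes "\<xi> \<in> grade \<Gamma> m"
  shows "tensor_target K A E (forms \<Omega> n) (C (m + n)) (\<lambda>e \<eta>. wr m n (braid D m (formsE_tens D m \<xi> e)) \<eta>)"
proof (intro tensor_target.intro tensor_target_axioms.intro CP.tensor_pair_axioms module_C balancedI)
  show "(\<lambda>e. wr m n (braid D m (formsE_tens D m \<xi> e)) \<eta>) \<in> lin_maps K E (C (m + n))" if "\<eta> \<in> carrier (forms \<Omega> n)" for \<eta>
    using lin_maps_comp[OF braid_tens_linear[OF assms] wr_linear] that by simp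
  show "wr m n (braid D m (formsE_tens D m \<xi> e)) \<in> lin_maps K (forms \<Omega> n) (C (m + n))" if "e \<in> carrier E" for e
    by (rule wr_linear_right[OF braid_closed[OF assms that]])
  show "wr m n (braid D m (formsE_tens D m \<xi> (e \<triangleleft>\<^bsub>E\<^esub> \<alpha>))) \<eta> = wr m n (braid D m (formsE_tens D m \<xi> e)) (\<alpha> \<triangleright>\<^bsub>forms \<Omega> n\<^esub> \<eta>)"
    if "e \<in> carrier E" "\<alpha> \<in> carrier A" "\<eta> \<in> carrier (forms \<Omega> n)" for e \<alpha> \<eta>
    using that assms by (simp add: braid_tens_ract wr_ract braid_closed)
qed

lemma L_linear: "\<xi> \<in> grade \<Gamma> m \<Longrightarrow> (\<lambda>x. L m n \<xi> x) \<in> lin_maps K (C n) (C (m + n))"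
  using tensor_target.tensor_lift_linear[OF L_target, folded cochains_def] by (simp add: sigma_wedge_def)

lemma L_ct: "\<lbrakk>\<xi> \<in> grade \<Gamma> m; e \<in> carrier E; \<eta> \<in> grade \<Omega> n\<rbrakk> \<Longrightarrow> L m n \<xi> (ct n e \<eta>) = wr m n (braid D m (formsE_tens D m \<xi> e)) \<eta>"
  using tensor_target.tensor_lift_tens[OF L_target] by (simp add: sigma_wedge_def)

lemmas L_closed = lin_maps_closed[OF L_linear]
  and L_add = lin_maps_add[OF L_linear]
  and L_smult = lin_maps_smult[OF L_linear]

lemma L_linear_left: "x \<in> carrier (C n) \<Longrightarrow> (\<lambda>\<xi>. L m n \<xi> x) \<in> lin_maps K (forms \<Gamma> m) (C (m + n))"
proof (induction x rule: C_induct)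
  case (tens e \<eta>)
  show ?case
    by (rule lin_maps_cong[OF lin_maps_comp[OF braid_tens_linear_left[OF tens(1)] wr_linear[OF tens(2)]] _ b.module_forms])
      (use tens in \<open>simp add: L_ct\<close>)
next
  case (add x y)
  show ?case
    by (rule lin_maps_cong[OF lin_maps_sum[OF b.module_forms module_C add(3,4)] _ b.module_forms])
      (use add in \<open>simp add: L_add\<close>)
qed

lemmas L_add_left = lin_maps_add[OF L_linear_left, unfolded forms_fields]
  and L_smult_left = lin_maps_smult[OF L_linear_left, unfolded forms_fields]

lemma L_zero_left: "x \<in> carrier (C n) \<Longrightarrow> L m n \<zero>\<^bsub>\<Gamma>\<^esub> x = \<zero>\<^bsub>C (m + n)\<^esub>"
  using lin_maps_zero[OF b.module_forms module_C L_linear_left] by simp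

lemma L_balanced: "\<lbrakk>x \<in> carrier (C n); \<xi> \<in> grade \<Gamma> m; \<beta> \<in> carrier B\<rbrakk> \<Longrightarrow> L m n (\<xi> \<otimes>\<^bsub>\<Gamma>\<^esub> \<beta>) x = L m n \<xi> (\<beta> \<triangleright>\<^bsub>C n\<^esub> x)"
proof (induction x rule: C_induct)
  case (tens e \<eta>)
  then show ?case
    using SP.tens_balanced[of \<xi> m \<beta> e] b.grade_mult'[of \<xi> m \<beta> 0 m] lact_closed[OF left_E]
    by (simp add: L_ct lact_ct b.A_fields)
next
  case (add x y)
  then show ?case
    using b.grade_mult'[of \<xi> m \<beta> 0 m]
    by (simp add: L_add lact_add[OF left_C] lact_C_closed b.A_fields)
qed

lemma L_0: "\<lbrakk>x \<in> carrier (C n); \<beta> \<in> carrier B\<rbrakk> \<Longrightarrow> L 0 n \<beta> x = \<beta> \<triangleright>\<^bsub>C n\<^esub> x"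
proof (induction x rule: C_induct)
  case (tens e \<eta>)
  then show ?case
    using lact_closed[OF left_E] a.grade_one
    by (simp add: L_ct lact_ct b.A_fields a.A_fields braid_0 wr_ct a.grade_carrier)
next
  case (add x y)
  then show ?case
    using L_add[of \<beta> 0 x n y] by (simp add: lact_add[OF left_C] b.A_fields)
qed

lemma L_wr: "\<lbrakk>x \<in> carrier (C n); \<xi> \<in> grade \<Gamma> m; \<kappa> \<in> grade \<Omega> k\<rbrakk> \<Longrightarrow>
    L m (n + k) \<xi> (wr n k x \<kappa>) = wr (m + n) k (L m n \<xi> x) \<kappa>"
proof (induction x rule: C_induct)
  case (tens e \<eta>)
  then show ?case
    by (simp add: wr_ct L_ct wr_wr a.grade_mult braid_closed)
next
  case (add x y)
  then show ?case
    by (simp add: wr_add L_add L_closed wr_closed add.assoc)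
qed

text \<open>On a pure tensor \<open>e \<otimes> \<kappa>\<close> extendability is this identity
  before wedging with \<open>\<kappa>\<close>, and \<open>L_wr\<close> moves the wedge past
  \<open>L \<xi>\<close>.\<close>

lemma L_mult: "\<lbrakk>x \<in> carrier (C k); \<xi> \<in> grade \<Gamma> m; \<eta> \<in> grade \<Gamma> n\<rbrakk> \<Longrightarrow>
    L (m + n) k (\<xi> \<otimes>\<^bsub>\<Gamma>\<^esub> \<eta>) x = L m (n + k) \<xi> (L n k \<eta> x)"
proof (induction x rule: C_induct)
  case (tens e \<kappa>)
  then show ?case
    by (simp add: L_ct braid_mult b.grade_mult L_wr braid_closed)
next
  case (add x y)
  then show ?case
    by (simp add: L_add L_closed b.grade_mult add.assoc)
qed

section \<open>The differential extending the connection\<close>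

lemma conn_linear: "conn D \<in> lin_maps K E (C (Suc 0))"
  and conn_ract: "\<lbrakk>e \<in> carrier E; \<alpha> \<in> carrier A\<rbrakk> \<Longrightarrow> conn D (e \<triangleleft>\<^bsub>E\<^esub> \<alpha>) =
       (conn D e \<triangleleft>\<^bsub>C (Suc 0)\<^esub> \<alpha>) \<oplus>\<^bsub>C (Suc 0)\<^esub> ct (Suc 0) e (dif \<Omega> \<alpha>)"
  and conn_lact: "\<lbrakk>\<beta> \<in> carrier B; e \<in> carrier E\<rbrakk> \<Longrightarrow> conn D (\<beta> \<triangleright>\<^bsub>E\<^esub> e) =
       braid D (Suc 0) (formsE_tens D (Suc 0) (dif \<Gamma> \<beta>) e) \<oplus>\<^bsub>C (Suc 0)\<^esub> (\<beta> \<triangleright>\<^bsub>C (Suc 0)\<^esub> conn D e)"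
  using connection by (simp_all add: right_bimodule_connection_def)

lemmas conn_closed = lin_maps_closed[OF conn_linear]

lemma nab_def': "nab n = tensor_lift K (C (Suc n)) (\<lambda>e \<xi>. ct (Suc n) e (dif \<Omega> \<xi>) \<oplus>\<^bsub>C (Suc n)\<^esub> wr (Suc 0) n (conn D e) \<xi>)"
  by (simp add: nabla_def)

text \<open>Moving \<open>\<alpha>\<close> across the tensor sign, the connection contributes
  \<open>e \<otimes> (d \<alpha> \<and> \<xi>)\<close>, and the same term appears in
  \<open>e \<otimes> d (\<alpha> \<and> \<xi>)\<close>. The defects of the two summands
  cancel.\<close>

lemma nab_target:
  "tensor_target K A E (forms \<Omega> n) (C (Suc n)) (\<lambda>e \<xi>. ct (Suc n) e (dif \<Omega> \<xi>) \<oplus>\<^bsub>C (Suc n)\<^esub> wr (Suc 0) n (conn D e) \<xi>)"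
proof (intro tensor_target.intro tensor_target_axioms.intro CP.tensor_pair_axioms module_C balancedI)
  have eq: "Suc 0 + n = Suc n" by simp
  note wl = wr_linear[of _ n "Suc 0", unfolded eq] and wlr = wr_linear_right[of _ "Suc 0" n, unfolded eq]
  show "(\<lambda>e. ct (Suc n) e (dif \<Omega> \<xi>) \<oplus>\<^bsub>C (Suc n)\<^esub> wr (Suc 0) n (conn D e) \<xi>) \<in> lin_maps K E (C (Suc n))"
    if "\<xi> \<in> carrier (forms \<Omega> n)" for \<xi>
    using that a.dif_grade
    by (intro lin_maps_sum[OF CP.X.module_axioms module_C] lin_maps_comp[OF conn_linear wl] ct_linear_left) auto
  show "(\<lambda>\<xi>. ct (Suc n) e (dif \<Omega> \<xi>) \<oplus>\<^bsub>C (Suc n)\<^esub> wr (Suc 0) n (conn D e) \<xi>) \<in> lin_maps K (forms \<Omega> n) (C (Suc n))"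
    if "e \<in> carrier E" for e
    using that
    by (intro lin_maps_sum[OF a.module_forms module_C] lin_maps_comp[OF a.dif_linear ct_linear_right] wlr conn_closed)
  fix e \<alpha> \<xi> assume a: "e \<in> carrier E" "\<alpha> \<in> carrier A" "\<xi> \<in> carrier (forms \<Omega> n)"
  then have g: "\<alpha> \<in> grade \<Omega> 0" "\<xi> \<in> grade \<Omega> n" "dif \<Omega> \<alpha> \<in> grade \<Omega> (Suc 0)" "dif \<Omega> \<xi> \<in> grade \<Omega> (Suc n)"
    using a.dif_grade by (auto simp: a.A_fields)
  have m: "\<alpha> \<otimes>\<^bsub>\<Omega>\<^esub> \<xi> \<in> grade \<Omega> n" "\<alpha> \<otimes>\<^bsub>\<Omega>\<^esub> dif \<Omega> \<xi> \<in> grade \<Omega> (Suc n)" "dif \<Omega> \<alpha> \<otimes>\<^bsub>\<Omega>\<^esub> \<xi> \<in> grade \<Omega> (Suc n)"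
    using g by (auto intro: a.grade_mult')
  let ?c = "conn D e"
  have c: "?c \<in> carrier (C (Suc 0))" "?c \<triangleleft>\<^bsub>C (Suc 0)\<^esub> \<alpha> \<in> carrier (C (Suc 0))"
    using conn_closed[OF a(1)] lin_maps_closed[OF ract_C_linear[OF a(2)]] by auto
  have w: "wr (Suc 0) n ?c (\<alpha> \<otimes>\<^bsub>\<Omega>\<^esub> \<xi>) \<in> carrier (C (Suc n))"
    using wr_closed[of "\<alpha> \<otimes>\<^bsub>\<Omega>\<^esub> \<xi>" n ?c "Suc 0"] m c by simp
  have "wr (Suc 0) n (conn D (e \<triangleleft>\<^bsub>E\<^esub> \<alpha>)) \<xi> =
      wr (Suc 0) n ?c (\<alpha> \<otimes>\<^bsub>\<Omega>\<^esub> \<xi>) \<oplus>\<^bsub>C (Suc n)\<^esub> ct (Suc n) e (dif \<Omega> \<alpha> \<otimes>\<^bsub>\<Omega>\<^esub> \<xi>)"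
    using wr_add[of \<xi> n "?c \<triangleleft>\<^bsub>C (Suc 0)\<^esub> \<alpha>" "Suc 0" "ct (Suc 0) e (dif \<Omega> \<alpha>)"] a g c
    by (simp add: conn_ract ct_closed wr_ract wr_ct)
  moreover have "ct (Suc n) (e \<triangleleft>\<^bsub>E\<^esub> \<alpha>) (dif \<Omega> \<xi>) = ct (Suc n) e (\<alpha> \<otimes>\<^bsub>\<Omega>\<^esub> dif \<Omega> \<xi>)"
    using ct_balanced[of e \<alpha> "dif \<Omega> \<xi>" "Suc n"] a g by simp
  moreover have "ct (Suc n) e (dif \<Omega> (\<alpha> \<otimes>\<^bsub>\<Omega>\<^esub> \<xi>)) =
      ct (Suc n) e (dif \<Omega> \<alpha> \<otimes>\<^bsub>\<Omega>\<^esub> \<xi>) \<oplus>\<^bsub>C (Suc n)\<^esub> ct (Suc n) e (\<alpha> \<otimes>\<^bsub>\<Omega>\<^esub> dif \<Omega> \<xi>)"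
    using a g m a.grade_carrier[OF m(2)]
    by (simp add: a.dif_mult msign_0[OF K_cring] ct_add_right[symmetric])
  ultimately show "ct (Suc n) (e \<triangleleft>\<^bsub>E\<^esub> \<alpha>) (dif \<Omega> \<xi>) \<oplus>\<^bsub>C (Suc n)\<^esub> wr (Suc 0) n (conn D (e \<triangleleft>\<^bsub>E\<^esub> \<alpha>)) \<xi> =
      ct (Suc n) e (dif \<Omega> (\<alpha> \<triangleright>\<^bsub>forms \<Omega> n\<^esub> \<xi>)) \<oplus>\<^bsub>C (Suc n)\<^esub> wr (Suc 0) n ?c (\<alpha> \<triangleright>\<^bsub>forms \<Omega> n\<^esub> \<xi>)"
    using w ct_closed[OF a(1) m(2)] ct_closed[OF a(1) m(3)] by (simp add: C.a_ac)
qed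

lemma nab_linear: "nab n \<in> lin_maps K (C n) (C (Suc n))"
  using tensor_target.tensor_lift_linear[OF nab_target, folded cochains_def] unfolding nab_def' .

lemma nab_ct: "\<lbrakk>e \<in> carrier E; \<xi> \<in> grade \<Omega> n\<rbrakk> \<Longrightarrow>
    nab n (ct n e \<xi>) = ct (Suc n) e (dif \<Omega> \<xi>) \<oplus>\<^bsub>C (Suc n)\<^esub> wr (Suc 0) n (conn D e) \<xi>"
  using tensor_target.tensor_lift_tens[OF nab_target] unfolding nab_def' by simp


lemmas nab_closed = lin_maps_closed[OF nab_linear]
  and nab_add = lin_maps_add[OF nab_linear]
  and nab_smult = lin_maps_smult[OF nab_linear]
  and nab_minus = lin_maps_minus[OF module_C module_C nab_linear]
  and nab_zero = lin_maps_zero[OF module_C module_C nab_linear]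
  and ms_closed = msign_closed[OF K_cring]

lemma wr_closed': "\<lbrakk>\<kappa> \<in> grade \<Omega> n; x \<in> carrier (C m); m + n = l\<rbrakk> \<Longrightarrow> wr m n x \<kappa> \<in> carrier (C l)"
  using wr_closed by blast

lemma L_closed': "\<lbrakk>\<xi> \<in> grade \<Gamma> m; x \<in> carrier (C n); m + n = l\<rbrakk> \<Longrightarrow> L m n \<xi> x \<in> carrier (C l)"
  using L_closed by blast

text \<open>Makes \<open>nab\<close> a derivation for the right action of the forms on
  \<open>A\<close>. With it the square of \<open>nab\<close> on \<open>e \<otimes> \<eta>\<close>
  reduces to the curvature at \<open>e\<close>.\<close>

lemma nab_wr: "\<lbrakk>x \<in> carrier (C m); \<kappa> \<in> grade \<Omega> n\<rbrakk> \<Longrightarrow> nab (m + n) (wr m n x \<kappa>) =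
    wr (Suc m) n (nab m x) \<kappa> \<oplus>\<^bsub>C (Suc (m + n))\<^esub> (ms m \<odot>\<^bsub>C (Suc (m + n))\<^esub> wr m (Suc n) x (dif \<Omega> \<kappa>))"
proof (induction x rule: C_induct)
  case (tens e \<eta>)
  note d\<kappa> = a.dif_grade[OF tens(3)] and d\<eta> = a.dif_grade[OF tens(2)]
  have g: "\<eta> \<otimes>\<^bsub>\<Omega>\<^esub> \<kappa> \<in> grade \<Omega> (m + n)" "dif \<Omega> \<eta> \<otimes>\<^bsub>\<Omega>\<^esub> \<kappa> \<in> grade \<Omega> (Suc (m + n))"
    "\<eta> \<otimes>\<^bsub>\<Omega>\<^esub> dif \<Omega> \<kappa> \<in> grade \<Omega> (Suc (m + n))"
    using tens d\<kappa> d\<eta> by (auto intro: a.grade_mult')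
  let ?c = "conn D e"
  have w: "wr (Suc 0) m ?c \<eta> \<in> carrier (C (Suc m))" "wr (Suc 0) (m + n) ?c (\<eta> \<otimes>\<^bsub>\<Omega>\<^esub> \<kappa>) \<in> carrier (C (Suc (m + n)))"
    using tens g conn_closed[OF tens(1)] by (auto intro!: wr_closed')
  have "wr (Suc m) n (wr (Suc 0) m ?c \<eta>) \<kappa> = wr (Suc 0) (m + n) ?c (\<eta> \<otimes>\<^bsub>\<Omega>\<^esub> \<kappa>)"
    using wr_wr[OF conn_closed[OF tens(1)] tens(2,3)] by simp
  then have r: "wr (Suc m) n (nab m (ct m e \<eta>)) \<kappa> =
      ct (Suc (m + n)) e (dif \<Omega> \<eta> \<otimes>\<^bsub>\<Omega>\<^esub> \<kappa>) \<oplus>\<^bsub>C (Suc (m + n))\<^esub> wr (Suc 0) (m + n) ?c (\<eta> \<otimes>\<^bsub>\<Omega>\<^esub> \<kappa>)"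
    using tens d\<eta> w wr_add[OF tens(3), of "ct (Suc m) e (dif \<Omega> \<eta>)" "Suc m"] wr_ct[of e "dif \<Omega> \<eta>" "Suc m" \<kappa> n]
    by (simp add: nab_ct ct_closed)
  have "ct (Suc (m + n)) e (dif \<Omega> (\<eta> \<otimes>\<^bsub>\<Omega>\<^esub> \<kappa>)) = ct (Suc (m + n)) e (dif \<Omega> \<eta> \<otimes>\<^bsub>\<Omega>\<^esub> \<kappa>) \<oplus>\<^bsub>C (Suc (m + n))\<^esub>
      (ms m \<odot>\<^bsub>C (Suc (m + n))\<^esub> ct (Suc (m + n)) e (\<eta> \<otimes>\<^bsub>\<Omega>\<^esub> dif \<Omega> \<kappa>))"
    using tens g a.grade_smult[OF ms_closed g(3)]
    by (simp add: a.dif_mult ct_add_right ct_smult_right ms_closed)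
  moreover have "wr m (Suc n) (ct m e \<eta>) (dif \<Omega> \<kappa>) = ct (Suc (m + n)) e (\<eta> \<otimes>\<^bsub>\<Omega>\<^esub> dif \<Omega> \<kappa>)"
    using wr_ct[OF tens(1,2) d\<kappa>] by simp
  ultimately show ?case
    using r tens g w ct_closed[OF tens(1) g(2)] ct_closed[OF tens(1) g(3)]
    by (simp add: wr_ct nab_ct C.a_ac ms_closed)
next
  case (add x y)
  note d\<kappa> = a.dif_grade[OF add(5)]
  have w: "wr m n x \<kappa> \<in> carrier (C (m + n))" "wr m n y \<kappa> \<in> carrier (C (m + n))"
    "wr (Suc m) n (nab m x) \<kappa> \<in> carrier (C (Suc (m + n)))" "wr (Suc m) n (nab m y) \<kappa> \<in> carrier (C (Suc (m + n)))"
    "wr m (Suc n) x (dif \<Omega> \<kappa>) \<in> carrier (C (Suc (m + n)))" "wr m (Suc n) y (dif \<Omega> \<kappa>) \<in> carrier (C (Suc (m + n)))"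
    using add(1,2,5) d\<kappa> nab_closed by (auto intro!: wr_closed')
  have e: "wr m (Suc n) (x \<oplus>\<^bsub>C m\<^esub> y) (dif \<Omega> \<kappa>) = wr m (Suc n) x (dif \<Omega> \<kappa>) \<oplus>\<^bsub>C (Suc (m + n))\<^esub> wr m (Suc n) y (dif \<Omega> \<kappa>)"
    "wr (Suc m) n (nab m x \<oplus>\<^bsub>C (Suc m)\<^esub> nab m y) \<kappa> = wr (Suc m) n (nab m x) \<kappa> \<oplus>\<^bsub>C (Suc (m + n))\<^esub> wr (Suc m) n (nab m y) \<kappa>"
    using wr_add[OF d\<kappa> add(1,2)] wr_add[OF add(5) nab_closed[OF add(1)] nab_closed[OF add(2)]] by simp_all
  show ?case
    using add w e by (simp add: wr_add nab_add C.smult_r_distr ms_closed add_swap[OF module_C])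
qed

lemma curvature: "e \<in> carrier E \<Longrightarrow> nab (Suc 0) (conn D e) = \<zero>\<^bsub>C (Suc (Suc 0))\<^esub>"
  using flat by (simp add: zero_curvature_def numeral_2_eq_2)

text \<open>On \<open>e \<otimes> \<eta>\<close> the two terms with \<open>conn D e\<close> wedged
  with \<open>d \<eta>\<close> have opposite signs, \<open>d (d \<eta>)\<close> is zero, and what
  remains is the curvature at \<open>e\<close> wedged with \<open>\<eta>\<close>.\<close>

lemma nab_nab: "x \<in> carrier (C n) \<Longrightarrow> nab (Suc n) (nab n x) = \<zero>\<^bsub>C (Suc (Suc n))\<^esub>"
proof (induction x rule: C_induct)
  case (tens e \<eta>)
  note d\<eta> = a.dif_grade[OF tens(2)] and c = conn_closed[OF tens(1)]
  have w: "wr (Suc 0) n (conn D e) \<eta> \<in> carrier (C (Suc n))"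
    "wr (Suc 0) (Suc n) (conn D e) (dif \<Omega> \<eta>) \<in> carrier (C (Suc (Suc n)))"
    using tens c d\<eta> by (auto intro!: wr_closed')
  have z: "wr (Suc (Suc 0)) n \<zero>\<^bsub>C (Suc (Suc 0))\<^esub> \<eta> = \<zero>\<^bsub>C (Suc (Suc n))\<^esub>"
    using lin_maps_zero[OF module_C module_C wr_linear[OF tens(2)], of "Suc (Suc 0)"] by simp
  have "nab (Suc n) (wr (Suc 0) n (conn D e) \<eta>) = (\<ominus>\<^bsub>K\<^esub> \<one>\<^bsub>K\<^esub>) \<odot>\<^bsub>C (Suc (Suc n))\<^esub> wr (Suc 0) (Suc n) (conn D e) (dif \<Omega> \<eta>)"
    using nab_wr[OF c tens(2)] w z by (simp add: curvature[OF tens(1)] msign_Suc_0[OF K_cring])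
  moreover have "nab (Suc n) (ct (Suc n) e (dif \<Omega> \<eta>)) = wr (Suc 0) (Suc n) (conn D e) (dif \<Omega> \<eta>)"
    using tens w d\<eta> a.dif_dif[OF tens(2)] by (simp add: nab_ct ct_zero)
  ultimately show ?case
    using tens w d\<eta> by (simp add: nab_ct nab_add ct_closed C.smult_l_minus C.r_neg)
next
  case (add x y)
  then show ?case by (simp add: nab_add nab_closed)
qed

text \<open>Degree 0 of the Leibniz rule: the left rule of the connection is wedged with
  \<open>\<eta>\<close>, where the \<open>braid\<close> of \<open>d \<beta>\<close> turns into
  \<open>L (d \<beta>)\<close>.\<close>

lemma nab_lact: "\<lbrakk>x \<in> carrier (C n); \<beta> \<in> carrier B\<rbrakk> \<Longrightarrow>
    nab n (\<beta> \<triangleright>\<^bsub>C n\<^esub> x) = L (Suc 0) n (dif \<Gamma> \<beta>) x \<oplus>\<^bsub>C (Suc n)\<^esub> (\<beta> \<triangleright>\<^bsub>C (Suc n)\<^esub> nab n x)"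
proof (induction x rule: C_induct)
  case (tens e \<eta>)
  note d\<eta> = a.dif_grade[OF tens(2)] and c = conn_closed[OF tens(1)]
  have d\<beta>: "dif \<Gamma> \<beta> \<in> grade \<Gamma> (Suc 0)" using b.dif_grade tens(3) by (simp add: b.A_fields)
  let ?s = "braid D (Suc 0) (formsE_tens D (Suc 0) (dif \<Gamma> \<beta>) e)"
  note s = braid_closed[OF d\<beta> tens(1)] and be = lact_closed[OF left_E tens(3,1)]
  have w: "wr (Suc 0) n (conn D e) \<eta> \<in> carrier (C (Suc n))" "wr (Suc 0) n ?s \<eta> \<in> carrier (C (Suc n))"
    using tens c s by (auto intro!: wr_closed')
  have "wr (Suc 0) n (conn D (\<beta> \<triangleright>\<^bsub>E\<^esub> e)) \<eta> = wr (Suc 0) n ?s \<eta> \<oplus>\<^bsub>C (Suc n)\<^esub> (\<beta> \<triangleright>\<^bsub>C (Suc n)\<^esub> wr (Suc 0) n (conn D e) \<eta>)"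
    using wr_add[OF tens(2) s, of "\<beta> \<triangleright>\<^bsub>C (Suc 0)\<^esub> conn D e"] wr_lact[OF c tens(3,2)] lact_C_closed[OF tens(3) c]
    by (simp add: conn_lact[OF tens(3,1)])
  then show ?case
    using tens d\<eta> be w L_ct[OF d\<beta> tens(1,2)] lact_C_closed[OF tens(3) w(1)]
      lact_C_closed[OF tens(3) ct_closed[OF tens(1) d\<eta>]]
    by (simp add: lact_ct nab_ct lact_add[OF left_C] ct_closed C.a_ac)
next
  case (add x y)
  have d\<beta>: "dif \<Gamma> \<beta> \<in> grade \<Gamma> (Suc 0)" using b.dif_grade add(5) by (simp add: b.A_fields)
  have w: "L (Suc 0) n (dif \<Gamma> \<beta>) x \<in> carrier (C (Suc n))" "L (Suc 0) n (dif \<Gamma> \<beta>) y \<in> carrier (C (Suc n))"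
    using add d\<beta> by (auto intro!: L_closed')
  have "L (Suc 0) n (dif \<Gamma> \<beta>) (x \<oplus>\<^bsub>C n\<^esub> y) = L (Suc 0) n (dif \<Gamma> \<beta>) x \<oplus>\<^bsub>C (Suc n)\<^esub> L (Suc 0) n (dif \<Gamma> \<beta>) y"
    using L_add[OF d\<beta> add(1,2)] by simp
  then show ?case
    using add w by (simp add: lact_add[OF left_C] nab_add nab_closed lact_C_closed add_swap[OF module_C])
qed

text \<open>The graded Leibniz rule for the action of \<open>\<Omega>\<^sub>B\<close>. The set of forms satisfying it is closed under products;
  on exact 1-forms it follows from the case of degree 0 and \<open>\<nabla>\<^sup>2 = 0\<close>.\<close>

lemma nab_L:
  assumes "\<xi> \<in> grade \<Gamma> m" "x \<in> carrier (C n)"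
  shows "nab (m + n) (L m n \<xi> x) =
    L (Suc m) n (dif \<Gamma> \<xi>) x \<oplus>\<^bsub>C (Suc (m + n))\<^esub> (ms m \<odot>\<^bsub>C (Suc (m + n))\<^esub> L m (Suc n) \<xi> (nab n x))"
proof -
  \<comment> \<open>Quantified over all \<open>n\<close> and \<open>x\<close>, since for a product
    the hypothesis on \<open>\<xi>\<close> is applied to the cochain
    \<open>L n k \<eta> x\<close>.\<close>
  define P where "P m \<xi> \<longleftrightarrow> (\<forall>n. \<forall>x\<in>carrier (C n). nab (m + n) (L m n \<xi> x) =
    L (Suc m) n (dif \<Gamma> \<xi>) x \<oplus>\<^bsub>C (Suc (m + n))\<^esub> (ms m \<odot>\<^bsub>C (Suc (m + n))\<^esub> L m (Suc n) \<xi> (nab n x)))" for m \<xi>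
  have P: "nab (m + n) (L m n \<xi> x) =
    L (Suc m) n (dif \<Gamma> \<xi>) x \<oplus>\<^bsub>C (Suc (m + n))\<^esub> (ms m \<odot>\<^bsub>C (Suc (m + n))\<^esub> L m (Suc n) \<xi> (nab n x))"
    if "P m \<xi>" "x \<in> carrier (C n)" for m n \<xi> x using that by (simp add: P_def)
  have cl: "L (Suc m) n (dif \<Gamma> \<xi>) x \<in> carrier (C (Suc (m + n)))" "L m (Suc n) \<xi> (nab n x) \<in> carrier (C (Suc (m + n)))"
    "L m n \<xi> x \<in> carrier (C (m + n))"
    if "\<xi> \<in> grade \<Gamma> m" "x \<in> carrier (C n)" for m n \<xi> x
    using that b.dif_grade nab_closed by (auto intro!: L_closed')
  have "P m \<xi>" using assms(1)
  proof (induction rule: b.grade_induct)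
    case (submodule n)
    show ?case
    proof (rule submoduleI'[OF b.module_\<Omega>])
      show "{\<xi> \<in> grade \<Gamma> n. P n \<xi>} \<subseteq> carrier \<Gamma>" using b.grade_carrier by blast
      have "P n \<zero>\<^bsub>\<Gamma>\<^esub>"
        unfolding P_def
      proof (intro allI ballI)
        fix k x assume x: "x \<in> carrier (C k)"
        show "nab (n + k) (L n k \<zero>\<^bsub>\<Gamma>\<^esub> x) =
          L (Suc n) k (dif \<Gamma> \<zero>\<^bsub>\<Gamma>\<^esub>) x \<oplus>\<^bsub>C (Suc (n + k))\<^esub> (ms n \<odot>\<^bsub>C (Suc (n + k))\<^esub> L n (Suc k) \<zero>\<^bsub>\<Gamma>\<^esub> (nab k x))"
          using L_zero_left[OF x, of n] L_zero_left[OF x, of "Suc n"] L_zero_left[OF nab_closed[OF x], of n]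
          by (simp add: b.dif_zero nab_zero ms_closed)
      qed
      then show "\<zero>\<^bsub>\<Gamma>\<^esub> \<in> {\<xi> \<in> grade \<Gamma> n. P n \<xi>}" using b.grade_zero by simp
    next
      fix \<xi> \<eta> assume "\<xi> \<in> {\<xi> \<in> grade \<Gamma> n. P n \<xi>}" "\<eta> \<in> {\<xi> \<in> grade \<Gamma> n. P n \<xi>}"
      then have *: "\<xi> \<in> grade \<Gamma> n" "\<eta> \<in> grade \<Gamma> n" "P n \<xi>" "P n \<eta>" by auto
      have "P n (\<xi> \<oplus>\<^bsub>\<Gamma>\<^esub> \<eta>)"
        unfolding P_def
      proof (intro allI ballI)
        fix k x assume x: "x \<in> carrier (C k)"
        have "L (Suc n) k (dif \<Gamma> \<xi> \<oplus>\<^bsub>\<Gamma>\<^esub> dif \<Gamma> \<eta>) x = L (Suc n) k (dif \<Gamma> \<xi>) x \<oplus>\<^bsub>C (Suc (n + k))\<^esub> L (Suc n) k (dif \<Gamma> \<eta>) x"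
          "L n (Suc k) (\<xi> \<oplus>\<^bsub>\<Gamma>\<^esub> \<eta>) (nab k x) = L n (Suc k) \<xi> (nab k x) \<oplus>\<^bsub>C (Suc (n + k))\<^esub> L n (Suc k) \<eta> (nab k x)"
          using L_add_left[OF x b.dif_grade[OF *(1)] b.dif_grade[OF *(2)]] L_add_left[OF nab_closed[OF x] *(1,2)] by simp_all
        then show "nab (n + k) (L n k (\<xi> \<oplus>\<^bsub>\<Gamma>\<^esub> \<eta>) x) =
          L (Suc n) k (dif \<Gamma> (\<xi> \<oplus>\<^bsub>\<Gamma>\<^esub> \<eta>)) x \<oplus>\<^bsub>C (Suc (n + k))\<^esub> (ms n \<odot>\<^bsub>C (Suc (n + k))\<^esub> L n (Suc k) (\<xi> \<oplus>\<^bsub>\<Gamma>\<^esub> \<eta>) (nab k x))"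
          using * x cl[OF *(1) x] cl[OF *(2) x]
          by (simp add: L_add_left b.dif_add nab_add P C.smult_r_distr ms_closed add_swap[OF module_C])
      qed
      then show "\<xi> \<oplus>\<^bsub>\<Gamma>\<^esub> \<eta> \<in> {\<xi> \<in> grade \<Gamma> n. P n \<xi>}" using * b.grade_add by simp
    next
      fix c \<xi> assume c: "c \<in> carrier K" and "\<xi> \<in> {\<xi> \<in> grade \<Gamma> n. P n \<xi>}"
      then have *: "\<xi> \<in> grade \<Gamma> n" "P n \<xi>" by auto
      have "P n (c \<odot>\<^bsub>\<Gamma>\<^esub> \<xi>)"
        unfolding P_def
      proof (intro allI ballI)
        fix k x assume x: "x \<in> carrier (C k)"
        have "L (Suc n) k (c \<odot>\<^bsub>\<Gamma>\<^esub> dif \<Gamma> \<xi>) x = c \<odot>\<^bsub>C (Suc (n + k))\<^esub> L (Suc n) k (dif \<Gamma> \<xi>) x"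
          "L n (Suc k) (c \<odot>\<^bsub>\<Gamma>\<^esub> \<xi>) (nab k x) = c \<odot>\<^bsub>C (Suc (n + k))\<^esub> L n (Suc k) \<xi> (nab k x)"
          using L_smult_left[OF x c b.dif_grade[OF *(1)]] L_smult_left[OF nab_closed[OF x] c *(1)] by simp_all
        then show "nab (n + k) (L n k (c \<odot>\<^bsub>\<Gamma>\<^esub> \<xi>) x) =
          L (Suc n) k (dif \<Gamma> (c \<odot>\<^bsub>\<Gamma>\<^esub> \<xi>)) x \<oplus>\<^bsub>C (Suc (n + k))\<^esub> (ms n \<odot>\<^bsub>C (Suc (n + k))\<^esub> L n (Suc k) (c \<odot>\<^bsub>\<Gamma>\<^esub> \<xi>) (nab k x))"
          using * x c cl[OF *(1) x]
          by (simp add: L_smult_left b.dif_smult nab_smult P C.smult_r_distr C.smult_assoc1[symmetric] K.m_comm ms_closed)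
      qed
      then show "c \<odot>\<^bsub>\<Gamma>\<^esub> \<xi> \<in> {\<xi> \<in> grade \<Gamma> n. P n \<xi>}" using * c b.grade_smult by simp
    qed
  next
    case (degree_0 \<beta>)
    then have \<beta>: "\<beta> \<in> carrier B" by (simp add: b.A_fields)
    show ?case
      unfolding P_def using \<beta> nab_closed lact_C_closed
      by (auto simp: L_0 nab_lact msign_0[OF K_cring])
  next
    case (dif \<beta>)
    then have \<beta>: "\<beta> \<in> carrier B" by (simp add: b.A_fields)
    have d\<beta>: "dif \<Gamma> \<beta> \<in> grade \<Gamma> (Suc 0)" using b.dif_grade[OF dif] by simp
    show ?case
      unfolding P_def
    proof (intro allI ballI)
      fix k x assume x: "x \<in> carrier (C k)"
      note bx = lact_C_closed[OF \<beta> x] and bn = lact_C_closed[OF \<beta> nab_closed[OF x]]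
      have l: "L (Suc 0) k (dif \<Gamma> \<beta>) x \<in> carrier (C (Suc k))"
        "L (Suc 0) (Suc k) (dif \<Gamma> \<beta>) (nab k x) \<in> carrier (C (Suc (Suc k)))"
        using x d\<beta> nab_closed by (auto intro!: L_closed')
      have z: "\<beta> \<triangleright>\<^bsub>C (Suc (Suc k))\<^esub> \<zero>\<^bsub>C (Suc (Suc k))\<^esub> = \<zero>\<^bsub>C (Suc (Suc k))\<^esub>"
        by (rule lin_maps_zero[OF module_C module_C lact_C_linear[OF \<beta>]])
      \<comment> \<open>Expanding the square of \<open>nab\<close> on \<open>\<beta> x\<close> by
        the degree 0 rule twice expresses \<open>nab\<close> of \<open>L (d \<beta>) x\<close> as
        minus \<open>L (d \<beta>) (nab x)\<close>, which is the rule for \<open>d \<beta>\<close>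
        because \<open>d (d \<beta>) = 0\<close>.\<close>
      have "\<zero>\<^bsub>C (Suc (Suc k))\<^esub> = nab (Suc k) (nab k (\<beta> \<triangleright>\<^bsub>C k\<^esub> x))" using nab_nab[OF bx] by simp
      also have "\<dots> = nab (Suc k) (L (Suc 0) k (dif \<Gamma> \<beta>) x) \<oplus>\<^bsub>C (Suc (Suc k))\<^esub> L (Suc 0) (Suc k) (dif \<Gamma> \<beta>) (nab k x)"
        using l bn z by (simp add: nab_lact[OF x \<beta>] nab_add nab_lact[OF nab_closed[OF x] \<beta>] nab_nab[OF x])
      finally have "nab (Suc k) (L (Suc 0) k (dif \<Gamma> \<beta>) x) = \<ominus>\<^bsub>C (Suc (Suc k))\<^esub> L (Suc 0) (Suc k) (dif \<Gamma> \<beta>) (nab k x)"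
        using l nab_closed[OF l(1)] by (intro C.minus_equality[symmetric]) simp_all
      then show "nab (Suc 0 + k) (L (Suc 0) k (dif \<Gamma> \<beta>) x) =
          L (Suc (Suc 0)) k (dif \<Gamma> (dif \<Gamma> \<beta>)) x \<oplus>\<^bsub>C (Suc (Suc 0 + k))\<^esub>
          (ms (Suc 0) \<odot>\<^bsub>C (Suc (Suc 0 + k))\<^esub> L (Suc 0) (Suc k) (dif \<Gamma> \<beta>) (nab k x))"
        using l L_zero_left[OF x, of "Suc (Suc 0)"]
        by (simp add: b.dif_dif[OF dif] msign_Suc_0[OF K_cring] C.smult_l_minus)
    qed
  next
    case (mult m n \<xi> \<eta>)
    note d\<xi> = b.dif_grade[OF mult(1)] and d\<eta> = b.dif_grade[OF mult(2)]
    have g: "dif \<Gamma> \<xi> \<otimes>\<^bsub>\<Gamma>\<^esub> \<eta> \<in> grade \<Gamma> (Suc (m + n))" "\<xi> \<otimes>\<^bsub>\<Gamma>\<^esub> dif \<Gamma> \<eta> \<in> grade \<Gamma> (Suc (m + n))"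
      using mult d\<xi> d\<eta> by (auto intro: b.grade_mult')
    show ?case
      unfolding P_def
    proof (intro allI ballI)
      fix k x assume x: "x \<in> carrier (C k)"
      note nx = nab_closed[OF x]
      let ?N = "Suc (m + n + k)"
      \<comment> \<open>\<open>u\<close>, \<open>v\<close> and \<open>w\<close> are the terms in
        which the derivative falls on \<open>\<xi>\<close>, on \<open>\<eta>\<close> and on
        \<open>x\<close>.\<close>
      define u where "u = L (Suc (m + n)) k (dif \<Gamma> \<xi> \<otimes>\<^bsub>\<Gamma>\<^esub> \<eta>) x"
      define v where "v = L (Suc (m + n)) k (\<xi> \<otimes>\<^bsub>\<Gamma>\<^esub> dif \<Gamma> \<eta>) x"
      define w where "w = L (m + n) (Suc k) (\<xi> \<otimes>\<^bsub>\<Gamma>\<^esub> \<eta>) (nab k x)"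
      have uvw: "u \<in> carrier (C ?N)" "v \<in> carrier (C ?N)" "w \<in> carrier (C ?N)"
        using g x nx b.grade_mult[OF mult(1,2)] by (auto simp: u_def v_def w_def intro!: L_closed')
      have y: "L n k \<eta> x \<in> carrier (C (n + k))" "L (Suc n) k (dif \<Gamma> \<eta>) x \<in> carrier (C (Suc (n + k)))"
        "L n (Suc k) \<eta> (nab k x) \<in> carrier (C (Suc (n + k)))"
        using mult x nx d\<eta> by (auto intro!: L_closed')
      have u: "u = L (Suc m) (n + k) (dif \<Gamma> \<xi>) (L n k \<eta> x)" using L_mult[OF x d\<xi> mult(2)] by (simp add: u_def)
      have v: "v = L m (Suc (n + k)) \<xi> (L (Suc n) k (dif \<Gamma> \<eta>) x)" using L_mult[OF x mult(1) d\<eta>] by (simp add: v_def)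
      have w: "w = L m (Suc (n + k)) \<xi> (L n (Suc k) \<eta> (nab k x))" using L_mult[OF nx mult(1,2)] by (simp add: w_def)
      have ysm: "ms n \<odot>\<^bsub>C (Suc (n + k))\<^esub> L n (Suc k) \<eta> (nab k x) \<in> carrier (C (Suc (n + k)))"
        using y by (simp add: ms_closed)
      have e: "C (m + Suc (n + k)) = C ?N" by (simp add: add.assoc)
      have "L m (Suc (n + k)) \<xi> (nab (n + k) (L n k \<eta> x)) = v \<oplus>\<^bsub>C ?N\<^esub> (ms n \<odot>\<^bsub>C ?N\<^esub> w)"
        unfolding v w P[OF mult(4) x] L_add[OF mult(1) y(2) ysm] L_smult[OF mult(1) ms_closed y(3)] e ..
      moreover have "nab (m + n + k) (L (m + n) k (\<xi> \<otimes>\<^bsub>\<Gamma>\<^esub> \<eta>) x) =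
          u \<oplus>\<^bsub>C ?N\<^esub> (ms m \<odot>\<^bsub>C ?N\<^esub> L m (Suc (n + k)) \<xi> (nab (n + k) (L n k \<eta> x)))"
        using P[OF mult(3) y(1)] unfolding u L_mult[OF x mult(1,2)] by (simp add: add.assoc)
      ultimately have lhs: "nab (m + n + k) (L (m + n) k (\<xi> \<otimes>\<^bsub>\<Gamma>\<^esub> \<eta>) x) =
          (u \<oplus>\<^bsub>C ?N\<^esub> (ms m \<odot>\<^bsub>C ?N\<^esub> v)) \<oplus>\<^bsub>C ?N\<^esub> (ms (m + n) \<odot>\<^bsub>C ?N\<^esub> w)"
        using uvw by (simp add: C.smult_r_distr ms_closed msign_add[OF K_cring] C.smult_assoc1 C.a_assoc)
      have "L (Suc (m + n)) k (dif \<Gamma> (\<xi> \<otimes>\<^bsub>\<Gamma>\<^esub> \<eta>)) x = u \<oplus>\<^bsub>C ?N\<^esub> (ms m \<odot>\<^bsub>C ?N\<^esub> v)"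
        using L_add_left[OF x g(1) b.grade_smult[OF ms_closed g(2)]] L_smult_left[OF x ms_closed g(2)]
        by (simp add: b.dif_mult[OF mult(1,2)] u_def v_def)
      then show "nab (m + n + k) (L (m + n) k (\<xi> \<otimes>\<^bsub>\<Gamma>\<^esub> \<eta>) x) =
          L (Suc (m + n)) k (dif \<Gamma> (\<xi> \<otimes>\<^bsub>\<Gamma>\<^esub> \<eta>)) x \<oplus>\<^bsub>C ?N\<^esub> (ms (m + n) \<odot>\<^bsub>C ?N\<^esub> L (m + n) (Suc k) (\<xi> \<otimes>\<^bsub>\<Gamma>\<^esub> \<eta>) (nab k x))"
        using lhs unfolding w_def by simp
    qed
  qed
  then show ?thesis using P assms(2) by blast
qed

subsection \<open>The filtration\<close>

sublocale FP: tensor_pair K B "forms \<Gamma> m" "C n" for m n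
  by (rule tensor_pair.intro[OF b.right_forms left_C])

lemma filt_target: "tensor_target K B (forms \<Gamma> m) (C k) (C (m + k)) (L m k)"
  by (intro tensor_target.intro tensor_target_axioms.intro FP.tensor_pair_axioms module_C balancedI)
    (use L_linear L_linear_left L_balanced in auto)

lemma filt_eq: "filt D m (m + k) = tensor_lift K (C (m + k)) (L m k) ` carrier (tensor K B (forms \<Gamma> m) (C k))"
  by (simp add: filt_def)

lemma filt_gt: "n < m \<Longrightarrow> filt D m n = {\<zero>\<^bsub>C n\<^esub>}"
  by (simp add: filt_def)

lemma submodule_filt: "submodule (filt D m n) K (C n)"
proof (cases "m \<le> n")
  case True
  then obtain k where n: "n = m + k" using le_Suc_ex by blast
  show ?thesis
    unfolding n filt_eq
    by (rule submodule_image[OF FP.module_tensor module_C tensor_target.tensor_lift_linear[OF filt_target]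
          submodule_carrier[OF FP.module_tensor]])
next
  case False
  then show ?thesis by (simp add: filt_gt submodule_zero_set module_C)
qed

lemmas filt_add = submodule_add[OF module_C submodule_filt]
  and filt_zero = submodule_zero[OF module_C submodule_filt]
  and filt_smult = submodule_smult[OF module_C submodule_filt]
  and filt_minus = submodule_minus[OF module_C submodule_filt]

lemma filt_carrier: "x \<in> filt D m n \<Longrightarrow> x \<in> carrier (C n)"
  using submodule_subset[OF submodule_filt] by blast

lemma filt_gen: "\<lbrakk>\<xi> \<in> grade \<Gamma> m; x \<in> carrier (C k); m + k = n\<rbrakk> \<Longrightarrow> L m k \<xi> x \<in> filt D m n"
proof -
  assume a: "\<xi> \<in> grade \<Gamma> m" "x \<in> carrier (C k)" "m + k = n"
  have "L m k \<xi> x = tensor_lift K (C (m + k)) (L m k) (tens K B (forms \<Gamma> m) (C k) \<xi> x)"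
    using tensor_target.tensor_lift_tens[OF filt_target, of \<xi> m x k] a(1,2) by simp
  then show ?thesis using FP.tens_closed[of \<xi> m x k] a filt_eq[of m k] by auto
qed

text \<open>The case \<open>zero\<close> serves \<open>m > n\<close>, where the filtration step is
  \<open>{0}\<close>; otherwise every element is a sum of values
  \<open>L m k \<xi> x\<close>.\<close>

lemma filt_induct [consumes 1, case_names zero gen add]:
  assumes "z \<in> filt D m n" "P \<zero>\<^bsub>C n\<^esub>"
    and gen: "\<And>\<xi> x k. \<lbrakk>n = m + k; \<xi> \<in> grade \<Gamma> m; x \<in> carrier (C k)\<rbrakk> \<Longrightarrow> P (L m k \<xi> x)"
    and add: "\<And>x y. \<lbrakk>x \<in> filt D m n; y \<in> filt D m n; P x; P y\<rbrakk> \<Longrightarrow> P (x \<oplus>\<^bsub>C n\<^esub> y)"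
  shows "P z"
proof (cases "m \<le> n")
  case True
  then obtain k where n: "n = m + k" using le_Suc_ex by blast
  let ?l = "tensor_lift K (C (m + k)) (L m k)"
  obtain Z where Z: "Z \<in> carrier (tensor K B (forms \<Gamma> m) (C k))" "z = ?l Z"
    using assms(1) unfolding n filt_eq by blast
  have "P (?l Z)" using Z(1)
  proof (induction Z rule: FP.tensor_induct)
    case (tens \<xi> x)
    then show ?case using tensor_target.tensor_lift_tens[OF filt_target, of \<xi> m x k] gen[OF n] by simp
  next
    case (add Z W)
    then have "?l Z \<in> filt D m n" "?l W \<in> filt D m n" unfolding n filt_eq by auto
    then show ?case
      using assms(4)[of "?l Z" "?l W"] add lin_maps_add[OF tensor_target.tensor_lift_linear[OF filt_target]] n by simp
  qed
  then show ?thesis using Z by simp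
next
  case False
  then show ?thesis using assms(1,2) by (simp add: filt_gt)
qed

lemma filt_0: "filt D 0 n = carrier (C n)"
proof
  show "carrier (C n) \<subseteq> filt D 0 n"
  proof
    fix x assume x: "x \<in> carrier (C n)"
    have "\<one>\<^bsub>B\<^esub> \<in> grade \<Gamma> 0" using b.grade_one by (simp add: b.A_fields)
    then show "x \<in> filt D 0 n"
      using filt_gen[of "\<one>\<^bsub>B\<^esub>" 0 x n n] L_0[OF x, of "\<one>\<^bsub>B\<^esub>"] one_lact[OF left_C x] x by (simp add: b.A_fields)
  qed
qed (use filt_carrier in blast)

lemma L_filt: "\<lbrakk>x \<in> filt D p n; \<xi> \<in> grade \<Gamma> m\<rbrakk> \<Longrightarrow> L m n \<xi> x \<in> filt D (m + p) (m + n)"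
proof (induction x rule: filt_induct)
  case zero
  then show ?case using lin_maps_zero[OF module_C module_C L_linear] filt_zero by simp
next
  case (gen \<eta> x k)
  then show ?case
    using filt_gen[of "\<xi> \<otimes>\<^bsub>\<Gamma>\<^esub> \<eta>" "m + p" x k "m + n"] L_mult[of x k \<xi> m \<eta> p] b.grade_mult by (simp add: add.assoc)
next
  case (add x y)
  then show ?case using filt_carrier filt_add by (simp add: L_add)
qed

lemma lact_filt: "\<lbrakk>x \<in> filt D p n; \<beta> \<in> carrier B\<rbrakk> \<Longrightarrow> \<beta> \<triangleright>\<^bsub>C n\<^esub> x \<in> filt D p n"
  using L_filt[of x p n \<beta> 0] L_0[OF filt_carrier] by (simp add: b.A_fields)

text \<open>A form of degree \<open>m + 1\<close> is a sum of products of an \<open>m\<close>-form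
  and a one-form. By \<open>L_mult\<close> the one-form acts inside, leaving a value of the action
  of an \<open>m\<close>-form.\<close>

lemma filt_Suc: "filt D (Suc m) n \<subseteq> filt D m n"
proof
  fix z assume "z \<in> filt D (Suc m) n"
  then show "z \<in> filt D m n"
  proof (induction z rule: filt_induct)
    case (gen \<xi> x k)
    let ?P = "\<lambda>\<xi>. L (Suc m) k \<xi> x \<in> filt D m n"
    have l: "(\<lambda>\<xi>. L (Suc m) k \<xi> x) \<in> lin_maps K (forms \<Gamma> (Suc m)) (C n)"
      using L_linear_left[OF gen(3), of "Suc m"] gen(1) by simp
    have s: "submodule (grade \<Gamma> (Suc m)) K (forms \<Gamma> (Suc m))"
      using submodule_carrier[OF b.module_forms[of "Suc m"]] by simp
    note sub = submodule_preimage[OF b.module_forms module_C l s submodule_filt]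
    show ?case
      using gen(2)
    proof (rule b.grade_Suc_induct)
      show "submodule {\<xi> \<in> grade \<Gamma> (Suc m). ?P \<xi>} K \<Gamma>"
        using sub submodule_zero[OF b.module_forms sub[of m]] submodule_add[OF b.module_forms sub[of m]]
          submodule_smult[OF b.module_forms sub[of m]] b.grade_carrier
        by (intro submoduleI'[OF b.module_\<Omega>]) auto
      fix \<xi> \<eta> assume "\<xi> \<in> grade \<Gamma> m" "\<eta> \<in> grade \<Gamma> (Suc 0)"
      then show "?P (\<xi> \<otimes>\<^bsub>\<Gamma>\<^esub> \<eta>)"
        using L_mult[OF gen(3), of \<xi> m \<eta> "Suc 0"] filt_gen[of \<xi> m "L (Suc 0) k \<eta> x" "Suc k" n] gen
          L_closed'[of \<eta> "Suc 0" x k "Suc k"] by simp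
    qed
  qed (auto intro: filt_zero filt_add)
qed

text \<open>Of the two Leibniz terms for \<open>L \<xi> x\<close>, the one with
  \<open>d \<xi>\<close> lies in step \<open>p + 1\<close> and the one with \<open>\<xi>\<close> in
  step \<open>p\<close>.\<close>

lemma nab_filt: "x \<in> filt D p n \<Longrightarrow> nab n x \<in> filt D p (Suc n)"
proof (induction x rule: filt_induct)
  case zero
  then show ?case by (simp add: nab_zero filt_zero)
next
  case (gen \<xi> x k)
  have "L (Suc p) k (dif \<Gamma> \<xi>) x \<in> filt D p (Suc n)"
    using filt_gen[OF b.dif_grade[OF gen(2)] gen(3), of "Suc n"] filt_Suc gen(1) by auto
  moreover have "L p (Suc k) \<xi> (nab k x) \<in> filt D p (Suc n)"
    using filt_gen[OF gen(2) nab_closed[OF gen(3)], of "Suc n"] gen(1) by simp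
  ultimately show ?case
    using nab_L[OF gen(2,3)] gen(1) by (simp add: filt_add filt_smult ms_closed)
next
  case (add x y)
  then show ?case using filt_carrier filt_add by (simp add: nab_add)
qed

end

text \<open>The shape required by \<open>page1_map\<close> and \<open>page2_map\<close>, whose
  values are unions of \<open>f\<close> over a coset; \<open>f\<close> is constant there, so the
  union is that common value.\<close>

lemma factor_iso_union:
  assumes "module K V" "module K W" "f \<in> lin_maps K V W" "carrier W \<subseteq> f ` carrier V"
    and "H = {x \<in> carrier V. f x = \<zero>\<^bsub>W\<^esub>}"
  shows "(\<lambda>X. \<Union>x\<in>X. f x) \<in> lin_isos K (quot_space V H) W"
proof (rule factor_iso[OF assms])
  fix x assume x: "x \<in> carrier V"
  have sH: "submodule H K V" unfolding assms(5) by (rule submodule_kernel[OF assms(1-3)])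
  have "f y = f x" if y: "y \<in> H +>\<^bsub>V\<^esub> x" for y
  proof -
    have yV: "y \<in> carrier V" "y \<ominus>\<^bsub>V\<^esub> x \<in> H"
      using coset_mem[OF assms(1) sH x y] coset_eq_iff[OF assms(1) sH _ x] by blast+
    then have "f y \<ominus>\<^bsub>W\<^esub> f x = \<zero>\<^bsub>W\<^esub>" using x assms(5) by (simp add: lin_maps_minus[OF assms(1-3), symmetric])
    then show ?thesis using minus_zero_iff[OF assms(2)] lin_maps_closed[OF assms(3)] x yV by blast
  qed
  then show "(\<Union>x\<in>H +>\<^bsub>V\<^esub> x. f x) = f x"
    using coset_self[OF assms(1) sH x] by blast
qed

section \<open>The filtered complex in integer degrees\<close>

context flat_connection
begin

lemma int_cochains_fields:
  "zero (int_cochains D n) = zero (C (nat n))" "add (int_cochains D n) = add (C (nat n))"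
  "smult (int_cochains D n) = smult (C (nat n))"
  "carrier (int_cochains D n) = (if n < 0 then {\<zero>\<^bsub>C 0\<^esub>} else carrier (C (nat n)))"
  by (simp_all add: int_cochains_def)

lemma int_cochains_nat: "int_cochains D (int n) = C n"
  and int_nabla_nat: "int_nabla D (int n) = nab n"
  and int_filt_nat: "int_filt D (int p) (int n) = filt D p n"
  by (simp_all add: int_cochains_def int_nabla_def int_filt_def fun_eq_iff)

lemma int_filt_submodule: "submodule (int_filt D p n) K (int_cochains D n)"
proof -
  have m: "module K (int_cochains D n)"
    using module_C module_restrict[OF module_C submodule_zero_set[OF module_C]] by (simp add: int_cochains_def)
  show ?thesis
  proof (cases "n < 0")
    case True
    then have "int_filt D p n = carrier (int_cochains D n)" by (simp add: int_filt_def int_cochains_def)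
    then show ?thesis using submodule_carrier[OF m] by simp
  next
    case False
    then show ?thesis by (simp add: int_filt_def int_cochains_def submodule_filt)
  qed
qed

sublocale IC: first_quadrant_complex K "int_cochains D" "int_nabla D" "int_filt D"
proof (intro first_quadrant_complex.intro filtered_complex.intro first_quadrant_complex_axioms.intro)
  fix n p :: int and x
  show "module K (int_cochains D n)"
    using module_C module_restrict[OF module_C submodule_zero_set[OF module_C]] by (simp add: int_cochains_def)
  have sn: "nat (n + 1) = Suc (nat n)" "nat (n + 2) = Suc (Suc (nat n))" if "\<not> n < 0" using that by simp_all
  show "int_nabla D n \<in> lin_maps K (int_cochains D n) (int_cochains D (n + 1))"
  proof (cases "n < 0")
    case True
    then have "nat (n + 1) = 0" by simp
    then show ?thesis
      using True by (intro lin_mapsI) (auto simp: int_cochains_fields int_nabla_def)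
  next
    case False
    then show ?thesis
      using sn nab_closed nab_add nab_smult
      by (intro lin_mapsI) (auto simp: int_cochains_fields int_nabla_def)
  qed
  show "int_nabla D (n + 1) (int_nabla D n x) = \<zero>\<^bsub>int_cochains D (n + 2)\<^esub>" if "x \<in> carrier (int_cochains D n)"
  proof (cases "n < 0")
    case True
    show ?thesis
    \<comment> \<open>At \<open>n = -1\<close> the second differential is already
      \<open>nab 0\<close>, applied to zero; below that it is zero by definition.\<close>
    proof (cases "n = - 1")
      case True
      then show ?thesis by (simp add: int_cochains_fields int_nabla_def nab_zero)
    next
      case False
      then have "n + 1 < 0" "nat (n + 2) = 0" using True by simp_all
      then show ?thesis by (simp add: int_cochains_fields int_nabla_def)
    qed
  next
    case False
    then show ?thesis using that sn[OF False] by (simp add: int_cochains_fields int_nabla_def nab_nab)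
  qed
  show "submodule (int_filt D p n) K (int_cochains D n)" by (rule int_filt_submodule)
  show "int_filt D (p + 1) n \<subseteq> int_filt D p n"
  proof (cases "p < 0")
    case True
    then have "nat (p + 1) = 0" by simp
    then show ?thesis using True by (simp add: int_filt_def)
  next
    case False
    then have "nat (p + 1) = Suc (nat p)" by simp
    then show ?thesis using filt_Suc by (simp add: int_filt_def)
  qed
  show "int_nabla D n x \<in> int_filt D p (n + 1)" if "x \<in> int_filt D p n"
  proof (cases "n < 0")
    case True
    then have "nat (n + 1) = 0" by simp
    then show ?thesis using True filt_zero by (simp add: int_filt_def int_nabla_def)
  next
    case False
    then show ?thesis using that sn[OF False] nab_filt by (simp add: int_filt_def int_nabla_def)
  qed
  show "int_filt D p n = carrier (int_cochains D n)" if "p \<le> 0"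
    using that by (simp add: int_filt_def int_cochains_fields filt_0)
  show "int_filt D p n = {\<zero>\<^bsub>int_cochains D n\<^esub>}" if "n < p"
    using that by (auto simp: int_filt_def int_cochains_fields filt_gt nat_less_iff)
qed

subsection \<open>The graded pieces\<close>

abbreviation "fl p q \<equiv> (C (p + q))\<lparr>carrier := filt D p (p + q)\<rparr>"
abbreviation "mc \<equiv> M_class D"
abbreviation "M \<equiv> M_mod D"

lemma M_mod_eq: "M p q = quot_bimod (fl p q) (filt D (Suc p) (p + q))"
  by (simp add: M_mod_def)

lemma mc_eq: "mc p q x = filt D (Suc p) (p + q) +>\<^bsub>C (p + q)\<^esub> x"
  by (simp add: M_class_def)

lemma module_fl: "module K (fl p q)"
  by (rule module_restrict[OF module_C submodule_filt])

lemma submodule_filt_Suc: "submodule (filt D (Suc p) (p + q)) K (fl p q)"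
  by (rule submodule_restrict[OF module_C submodule_filt submodule_filt filt_Suc])

lemma module_M: "module K (M p q)"
  unfolding M_mod_eq by (rule module_quot_bimod[OF module_fl submodule_filt_Suc])

lemma carrier_M: "carrier (M p q) = mc p q ` filt D p (p + q)"
  by (simp add: M_mod_eq mc_eq)

lemma zero_M: "\<zero>\<^bsub>M p q\<^esub> = filt D (Suc p) (p + q)"
  by (simp add: M_mod_eq)

lemma mc_linear: "mc p q \<in> lin_maps K (fl p q) (M p q)"
proof -
  have "(\<lambda>x. filt D (Suc p) (p + q) +>\<^bsub>fl p q\<^esub> x) \<in> lin_maps K (fl p q) (quot_space (fl p q) (filt D (Suc p) (p + q)))"
    by (rule coset_linear[OF module_fl submodule_filt_Suc])
  then show ?thesis by (simp add: lin_maps_def M_mod_eq mc_eq)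
qed

lemma mc_add: "\<lbrakk>x \<in> filt D p (p + q); y \<in> filt D p (p + q)\<rbrakk> \<Longrightarrow> mc p q (x \<oplus>\<^bsub>C (p + q)\<^esub> y) = mc p q x \<oplus>\<^bsub>M p q\<^esub> mc p q y"
  and mc_smult: "\<lbrakk>c \<in> carrier K; x \<in> filt D p (p + q)\<rbrakk> \<Longrightarrow> mc p q (c \<odot>\<^bsub>C (p + q)\<^esub> x) = c \<odot>\<^bsub>M p q\<^esub> mc p q x"
  and mc_closed: "x \<in> filt D p (p + q) \<Longrightarrow> mc p q x \<in> carrier (M p q)"
  using lin_maps_add[OF mc_linear] lin_maps_smult[OF mc_linear] lin_maps_closed[OF mc_linear] by simp_all

lemma mc_zero_iff: "x \<in> carrier (C (p + q)) \<Longrightarrow> mc p q x = \<zero>\<^bsub>M p q\<^esub> \<longleftrightarrow> x \<in> filt D (Suc p) (p + q)"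
  unfolding mc_eq zero_M by (rule coset_zero_iff[OF module_C submodule_filt])

lemma mc_eq_iff: "\<lbrakk>x \<in> carrier (C (p + q)); y \<in> carrier (C (p + q))\<rbrakk> \<Longrightarrow>
    mc p q x = mc p q y \<longleftrightarrow> x \<ominus>\<^bsub>C (p + q)\<^esub> y \<in> filt D (Suc p) (p + q)"
  unfolding mc_eq by (rule coset_eq_iff[OF module_C submodule_filt])

lemma mc_mem: "\<lbrakk>y \<in> mc p q x; x \<in> carrier (C (p + q))\<rbrakk> \<Longrightarrow> y \<in> carrier (C (p + q)) \<and> mc p q y = mc p q x"
  unfolding mc_eq by (rule coset_mem[OF module_C submodule_filt])

lemma left_M: "left_module K B (M p q)"
  and lact_M: "\<lbrakk>\<beta> \<in> carrier B; x \<in> filt D p (p + q)\<rbrakk> \<Longrightarrow> \<beta> \<triangleright>\<^bsub>M p q\<^esub> mc p q x = mc p q (\<beta> \<triangleright>\<^bsub>C (p + q)\<^esub> x)"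
proof -
  have l: "left_module K B (fl p q)" by (rule left_module_restrict[OF left_C submodule_filt lact_filt])
  show "left_module K B (M p q)"
    unfolding M_mod_eq by (rule left_module_quot[OF l submodule_filt_Suc _ b.ring_A b.module_A]) (simp add: lact_filt)
  show "\<beta> \<triangleright>\<^bsub>M p q\<^esub> mc p q x = mc p q (\<beta> \<triangleright>\<^bsub>C (p + q)\<^esub> x)" if "\<beta> \<in> carrier B" "x \<in> filt D p (p + q)"
    using lact_coset[OF l submodule_filt_Suc _ that(1), of x] that by (simp add: M_mod_eq mc_eq lact_filt)
qed

lemma M_diff_mc: "x \<in> carrier (C (p + q)) \<Longrightarrow> M_diff D p q (mc p q x) = mc p (Suc q) (nab (p + q) x)"
  by (simp add: M_diff_def mc_eq)
    (rule quot_map_linear[OF module_C module_C nab_linear submodule_filt submodule_filt], use nab_filt in auto)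

lemma M_diff_linear: "M_diff D p q \<in> lin_maps K (M p q) (M p (Suc q))"
proof (rule lin_mapsI)
  have n: "nab (p + q) x \<in> filt D p (p + Suc q)" if "x \<in> filt D p (p + q)" for x using nab_filt[OF that] by simp
  note [simp] = M_diff_mc filt_carrier nab_add nab_smult filt_add filt_smult
  show "M_diff D p q X \<in> carrier (M p (Suc q))" if "X \<in> carrier (M p q)" for X
    using that n mc_closed[of _ p "Suc q"] by (auto simp: carrier_M)
  show "M_diff D p q (X \<oplus>\<^bsub>M p q\<^esub> Y) = M_diff D p q X \<oplus>\<^bsub>M p (Suc q)\<^esub> M_diff D p q Y"
    if XY: "X \<in> carrier (M p q)" "Y \<in> carrier (M p q)" for X Y
  proof -
    obtain x y where *: "x \<in> filt D p (p + q)" "y \<in> filt D p (p + q)" "X = mc p q x" "Y = mc p q y"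
      using XY by (auto simp: carrier_M)
    then show ?thesis using mc_add[of "nab (p + q) x" p "Suc q" "nab (p + q) y"] n by (simp add: mc_add[symmetric])
  qed
  show "M_diff D p q (c \<odot>\<^bsub>M p q\<^esub> X) = c \<odot>\<^bsub>M p (Suc q)\<^esub> M_diff D p q X" if c: "c \<in> carrier K" "X \<in> carrier (M p q)" for c X
  proof -
    obtain x where *: "x \<in> filt D p (p + q)" "X = mc p q x" using c by (auto simp: carrier_M)
    then show ?thesis using mc_smult[OF c(1), of "nab (p + q) x" p "Suc q"] n c by (simp add: mc_smult[symmetric])
  qed
qed

sublocale MC: cochain_complex K "M p" "M_diff D p" for p
proof (rule cochain_complex.intro)
  fix n X assume "X \<in> carrier (M p n)"
  then obtain x where x: "x \<in> filt D p (p + n)" "X = mc p n x" by (auto simp: carrier_M)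
  note c = filt_carrier[OF x(1)]
  have "M_diff D p n X = mc p (Suc n) (nab (p + n) x)" using x c by (simp add: M_diff_mc)
  moreover have "M_diff D p (Suc n) (mc p (Suc n) (nab (p + n) x)) = mc p (Suc (Suc n)) \<zero>\<^bsub>C (p + Suc (Suc n))\<^esub>"
    using M_diff_mc[of "nab (p + n) x" p "Suc n"] nab_closed[OF c] nab_nab[OF c] by simp
  ultimately show "M_diff D p (Suc n) (M_diff D p n X) = \<zero>\<^bsub>M p (Suc (Suc n))\<^esub>"
    using mc_zero_iff[of "\<zero>\<^bsub>C (p + Suc (Suc n))\<^esub>" p "Suc (Suc n)"] filt_zero by simp
qed (rule module_M M_diff_linear)+

text \<open>\<open>nab\<close> itself is not left \<open>B\<close>-linear, but its defect
  \<open>L (d \<beta>) x\<close> lies in the first filtration step, which is divided out. This is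
  what turns \<open>N\<close> into a complex of left \<open>B\<close>-modules, so that it may be
  tensored over \<open>B\<close>.\<close>

lemma N_diff_left: "N_diff D q \<in> left_maps K B (M 0 q) (M 0 (Suc q))"
proof (rule left_mapsI[OF M_diff_linear])
  fix \<beta> X assume \<beta>: "\<beta> \<in> carrier B" and "X \<in> carrier (M 0 q)"
  then obtain x where x: "x \<in> filt D 0 q" "X = mc 0 q x" by (auto simp: carrier_M)
  note c = filt_carrier[OF x(1)]
  have d\<beta>: "dif \<Gamma> \<beta> \<in> grade \<Gamma> (Suc 0)" using b.dif_grade \<beta> by (simp add: b.A_fields)
  have l: "L (Suc 0) q (dif \<Gamma> \<beta>) x \<in> filt D (Suc 0) (Suc q)" by (rule filt_gen[OF d\<beta> c]) simp
  note bn = lact_C_closed[OF \<beta> nab_closed[OF c]]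
  have "nab q (\<beta> \<triangleright>\<^bsub>C q\<^esub> x) \<ominus>\<^bsub>C (Suc q)\<^esub> (\<beta> \<triangleright>\<^bsub>C (Suc q)\<^esub> nab q x) \<in> filt D (Suc 0) (Suc q)"
    using l by (simp add: nab_lact[OF c \<beta>] add_minus_cancel[OF module_C filt_carrier[OF l] bn])
  then have "mc 0 (Suc q) (nab q (\<beta> \<triangleright>\<^bsub>C q\<^esub> x)) = mc 0 (Suc q) (\<beta> \<triangleright>\<^bsub>C (Suc q)\<^esub> nab q x)"
    using mc_eq_iff[of _ 0 "Suc q"] bn nab_closed[OF lact_C_closed[OF \<beta> c]] by simp
  then show "N_diff D q (\<beta> \<triangleright>\<^bsub>M 0 q\<^esub> X) = \<beta> \<triangleright>\<^bsub>M 0 (Suc q)\<^esub> N_diff D q X"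
    using lact_M[OF \<beta>, of x 0 q] lact_M[OF \<beta>, of "nab q x" 0 "Suc q"] x c M_diff_mc[of x 0 q]
      M_diff_mc[of "\<beta> \<triangleright>\<^bsub>C q\<^esub> x" 0 q] lact_C_closed[OF \<beta> c] nab_filt[OF x(1)] by simp
qed

end

section \<open>The map \<open>g\<close> and its effect on cohomology\<close>

locale fibre_bundle = flat_connection D for D :: "('k, 'w, 'v, 'e) bundle_data" +
  assumes flat_forms: "1 \<le> p \<Longrightarrow> flat_right K B (forms \<Gamma> p)"
    and g_iso: "g_map D p q \<in> lin_isos K (forms_N D p q) (M p q)"
begin

lemma forms_flat_for: "flat_for K B (forms \<Gamma> p) (M 0 q)"
proof (cases "p = 0")
  case True
  show ?thesis
    unfolding True by (rule regular_flat_for[OF b.right_forms left_M b.ring_A]) (simp_all add: b.A_fields)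
next
  case False
  then show ?thesis by (intro flat_right_flat_for[OF flat_forms left_M b.ring_A b.module_A]) simp
qed

sublocale TC: tensor_complex K B "forms \<Gamma> p" "N_mod D" "N_diff D" for p
  by (intro tensor_complex.intro b.right_forms left_M N_diff_left MC.d_d b.ring_A b.module_A forms_flat_for)

lemma forms_N_eq: "forms_N D p = TC.TX p"
  and forms_N_diff_eq: "forms_N_diff D p = TC.dX p"
  by (simp_all add: fun_eq_iff forms_N_def forms_N_diff_def)

lemma H_forms_N_eq: "H_forms_N D p q = cohomology (TC.TX p) (TC.dX p) q"
  by (simp add: H_forms_N_def forms_N_eq forms_N_diff_eq)

lemma HN_eq: "HN D q = TC.H q"
  by (simp add: HN_def)

lemma forms_HN_eq: "forms_HN D p q = tensor K B (forms \<Gamma> p) (TC.H q)"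
  by (simp add: forms_HN_def HN_eq)

lemma comparison_eq: "comparison D p q = TC.cmp p q"
  by (simp add: comparison_def H_forms_N_eq forms_N_eq forms_N_diff_eq)

lemma comparison_lin_iso: "comparison D p q \<in> lin_isos K (forms_HN D p q) (H_forms_N D p q)"
  unfolding comparison_eq forms_HN_eq H_forms_N_eq by (rule TC.comparison_iso)

text \<open>\<open>L \<xi>\<close> shifts the filtration by \<open>p\<close>, so it carries step 1,
  divided out in \<open>N\<close>, into step \<open>p + 1\<close>, divided out in
  \<open>M p\<close>.\<close>

lemma g_formula:
  assumes "\<xi> \<in> grade \<Gamma> p" "x \<in> filt D 0 q"
  shows "quot_map (C (p + q)) (filt D (Suc p) (p + q)) (L p q \<xi>) (mc 0 q x) = mc p q (L p q \<xi> x)"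
  by (simp add: mc_eq)
    (rule quot_map_linear[OF module_C module_C L_linear[OF assms(1)] submodule_filt submodule_filt],
      use L_filt[OF _ assms(1), of _ "Suc 0" q] assms(2) filt_carrier in auto)

lemma L_filt_0: "\<lbrakk>\<xi> \<in> grade \<Gamma> p; x \<in> filt D 0 q\<rbrakk> \<Longrightarrow> L p q \<xi> x \<in> filt D p (p + q)"
  using L_filt[of x 0 q \<xi> p] by simp

lemma g_target:
  "tensor_target K B (forms \<Gamma> p) (M 0 q) (M p q) (\<lambda>\<xi>. quot_map (C (p + q)) (filt D (Suc p) (p + q)) (L p q \<xi>))"
proof (intro tensor_target.intro tensor_target_axioms.intro TC.P.tensor_pair_axioms module_M balancedI)
  note [simp] = g_formula L_filt_0 filt_carrier
  have mem: "\<exists>x\<in>filt D 0 q. X = mc 0 q x" if "X \<in> carrier (M 0 q)" for X using that by (auto simp: carrier_M)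
  show "(\<lambda>\<xi>. quot_map (C (p + q)) (filt D (Suc p) (p + q)) (L p q \<xi>) X) \<in> lin_maps K (forms \<Gamma> p) (M p q)"
    if X: "X \<in> carrier (M 0 q)" for X
  proof -
    obtain x where x: "x \<in> filt D 0 q" "X = mc 0 q x" using mem[OF X] by blast
    have "(\<lambda>\<xi>. L p q \<xi> x) \<in> lin_maps K (forms \<Gamma> p) (fl p q)"
      using L_linear_left[OF filt_carrier[OF x(1)], of p] x(1) by (simp add: lin_maps_def Pi_def)
    from lin_maps_comp[OF this mc_linear] show ?thesis
      by (rule lin_maps_cong) (use x in \<open>simp_all add: b.module_forms\<close>)
  qed
  show "quot_map (C (p + q)) (filt D (Suc p) (p + q)) (L p q \<xi>) \<in> lin_maps K (M 0 q) (M p q)" if "\<xi> \<in> carrier (forms \<Gamma> p)" for \<xi>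
  proof (rule lin_mapsI)
    have \<xi>: "\<xi> \<in> grade \<Gamma> p" using that by simp
    note add = mc_add[of _ 0 q, simplified, symmetric] and sm = mc_smult[of _ _ 0 q, simplified, symmetric]
    show "quot_map (C (p + q)) (filt D (Suc p) (p + q)) (L p q \<xi>) X \<in> carrier (M p q)" if "X \<in> carrier (M 0 q)" for X
      using mem[OF that] \<xi> by (auto simp: mc_closed)
    show "quot_map (C (p + q)) (filt D (Suc p) (p + q)) (L p q \<xi>) (X \<oplus>\<^bsub>M 0 q\<^esub> Y) =
      quot_map (C (p + q)) (filt D (Suc p) (p + q)) (L p q \<xi>) X \<oplus>\<^bsub>M p q\<^esub> quot_map (C (p + q)) (filt D (Suc p) (p + q)) (L p q \<xi>) Y"
      if "X \<in> carrier (M 0 q)" "Y \<in> carrier (M 0 q)" for X Y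
      using mem[OF that(1)] mem[OF that(2)] \<xi> by (auto simp: add filt_add L_add mc_add simp del: set_eq_iff)
    show "quot_map (C (p + q)) (filt D (Suc p) (p + q)) (L p q \<xi>) (c \<odot>\<^bsub>M 0 q\<^esub> X) =
      c \<odot>\<^bsub>M p q\<^esub> quot_map (C (p + q)) (filt D (Suc p) (p + q)) (L p q \<xi>) X"
      if "c \<in> carrier K" "X \<in> carrier (M 0 q)" for c X
      using mem[OF that(2)] \<xi> that(1) by (auto simp: sm filt_smult L_smult mc_smult)
  qed
  show "quot_map (C (p + q)) (filt D (Suc p) (p + q)) (L p q (\<xi> \<triangleleft>\<^bsub>forms \<Gamma> p\<^esub> \<beta>)) X =
      quot_map (C (p + q)) (filt D (Suc p) (p + q)) (L p q \<xi>) (\<beta> \<triangleright>\<^bsub>M 0 q\<^esub> X)"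
    if a: "\<xi> \<in> carrier (forms \<Gamma> p)" "\<beta> \<in> carrier B" "X \<in> carrier (M 0 q)" for \<xi> \<beta> X
  proof -
    obtain x where x: "x \<in> filt D 0 q" "X = mc 0 q x" using mem[OF a(3)] by blast
    have "\<xi> \<otimes>\<^bsub>\<Gamma>\<^esub> \<beta> \<in> grade \<Gamma> p" using a b.grade_mult'[of \<xi> p \<beta> 0 p] by (simp add: b.A_fields)
    then show ?thesis
      using a x L_balanced[OF filt_carrier[OF x(1)]] lact_M[OF a(2), of x 0 q] lact_filt[OF x(1) a(2)] by simp
  qed
qed

lemma g_tens: "\<lbrakk>\<xi> \<in> grade \<Gamma> p; x \<in> filt D 0 q\<rbrakk> \<Longrightarrow> g_map D p q (TC.tX p q \<xi> (mc 0 q x)) = mc p q (L p q \<xi> x)"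
  using tensor_target.tensor_lift_tens[OF g_target, of \<xi> p "mc 0 q x" q] mc_closed[of x 0 q]
  by (simp add: g_map_def g_formula)

lemma g_lin_iso: "g_map D p q \<in> lin_isos K (TC.TX p q) (M p q)"
  using g_iso by (simp add: forms_N_def)

lemmas g_linear = lin_isosD(1)[OF g_lin_iso]

text \<open>In the Leibniz rule for \<open>L \<xi> x\<close> the term with \<open>d \<xi>\<close>
  lies in step \<open>p + 1\<close> and vanishes in the quotient. The remaining term carries the
  sign \<open>ms p\<close>.\<close>

lemma M_diff_g: "Z \<in> carrier (TC.TX p q) \<Longrightarrow>
    M_diff D p q (g_map D p q Z) = ms p \<odot>\<^bsub>M p (Suc q)\<^esub> g_map D p (Suc q) (TC.dX p q Z)"
proof (rule TC.P.tensor_ext[OF lin_maps_comp[OF g_linear M_diff_linear]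
      lin_maps_comp[OF lin_maps_comp[OF TC.dX_linear g_linear] smult_linear[OF module_M ms_closed]]])
  fix \<xi> X assume "\<xi> \<in> carrier (forms \<Gamma> p)" "X \<in> carrier (M 0 q)"
  then obtain x where \<xi>: "\<xi> \<in> grade \<Gamma> p" and x: "x \<in> filt D 0 q" "X = mc 0 q x" by (auto simp: carrier_M)
  note c = filt_carrier[OF x(1)] and n = nab_filt[OF x(1)]
  have dX: "M_diff D 0 q X = mc 0 (Suc q) (nab q x)" using M_diff_mc[of x 0 q] c x(2) by simp
  have l: "L (Suc p) q (dif \<Gamma> \<xi>) x \<in> filt D (Suc p) (Suc (p + q))" by (rule filt_gen[OF b.dif_grade[OF \<xi>] c]) simp
  have m: "L p (Suc q) \<xi> (nab q x) \<in> filt D p (p + Suc q)" using L_filt_0[OF \<xi> n] by simp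
  have sm: "ms p \<odot>\<^bsub>C (Suc (p + q))\<^esub> L p (Suc q) \<xi> (nab q x) \<in> carrier (C (Suc (p + q)))"
    using filt_carrier[OF m] by (simp add: ms_closed)
  have "M_diff D p q (g_map D p q (TC.tX p q \<xi> X)) = mc p (Suc q) (nab (p + q) (L p q \<xi> x))"
    using x \<xi> by (simp add: g_tens M_diff_mc L_closed c)
  also have "\<dots> = mc p (Suc q) (ms p \<odot>\<^bsub>C (p + Suc q)\<^esub> L p (Suc q) \<xi> (nab q x))"
    using mc_eq_iff[of "nab (p + q) (L p q \<xi> x)" p "Suc q" "ms p \<odot>\<^bsub>C (p + Suc q)\<^esub> L p (Suc q) \<xi> (nab q x)"]
      nab_L[OF \<xi> c] add_minus_cancel(1)[OF module_C filt_carrier[OF l] sm] l sm nab_closed[OF L_closed[OF \<xi> c]] by simp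
  also have "\<dots> = ms p \<odot>\<^bsub>M p (Suc q)\<^esub> g_map D p (Suc q) (TC.tX p (Suc q) \<xi> (M_diff D 0 q X))"
    using mc_smult[OF ms_closed m] \<xi> n dX by (simp add: g_tens)
  also have "TC.tX p (Suc q) \<xi> (M_diff D 0 q X) = TC.dX p q (TC.tX p q \<xi> X)"
    using \<xi> x mc_closed[of x 0 q] by (simp add: TC.dX_tens)
  finally show "M_diff D p q (g_map D p q (TC.tX p q \<xi> X)) =
      ms p \<odot>\<^bsub>M p (Suc q)\<^esub> g_map D p (Suc q) (TC.dX p q (TC.tX p q \<xi> X))" .
qed

lemma smult_ms_zero_iff: "\<lbrakk>module K V; x \<in> carrier V\<rbrakk> \<Longrightarrow> ms p \<odot>\<^bsub>V\<^esub> x = \<zero>\<^bsub>V\<^esub> \<longleftrightarrow> x = \<zero>\<^bsub>V\<^esub>"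
proof -
  assume "module K V" and x: "x \<in> carrier V"
  then interpret V: module K V by simp
  have "ms p \<odot>\<^bsub>V\<^esub> (ms p \<odot>\<^bsub>V\<^esub> x) = x"
    using x by (simp add: V.smult_assoc1[symmetric] ms_closed msign_square[OF K_cring])
  then show ?thesis using ms_closed V.smult_r_null by metis
qed

lemma g_cocycle: "Z \<in> carrier (TC.TX p q) \<Longrightarrow> g_map D p q Z \<in> MC.coc p q \<longleftrightarrow> Z \<in> TC.T.coc p q"
proof -
  assume Z: "Z \<in> carrier (TC.TX p q)"
  note dZ = lin_maps_closed[OF TC.dX_linear Z]
  interpret T: module K "TC.TX p (Suc q)" by (rule TC.P.module_tensor)
  have "g_map D p (Suc q) (TC.dX p q Z) = \<zero>\<^bsub>M p (Suc q)\<^esub> \<longleftrightarrow> TC.dX p q Z = \<zero>\<^bsub>TC.TX p (Suc q)\<^esub>"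
    using inj_on_eq_iff[OF lin_isosD(2)[OF g_lin_iso] dZ T.zero_closed]
      lin_maps_zero[OF TC.P.module_tensor module_M g_linear, of p "Suc q"] by simp
  then show ?thesis
    using Z lin_maps_closed[OF g_linear Z] smult_ms_zero_iff[OF module_M lin_maps_closed[OF g_linear dZ]]
    by (simp add: cocycles_def M_diff_g)
qed

text \<open>Replacing \<open>Z\<close> by \<open>ms p\<close> times \<open>Z\<close> absorbs the
  sign of \<open>M_diff_g\<close>, so the two sets of values coincide.\<close>

lemma g_coboundary: "g_map D p q ` TC.T.cob p q = MC.cob p q"
proof (cases q)
  case 0
  then show ?thesis
    using lin_maps_zero[OF TC.P.module_tensor module_M g_linear, of p 0]
    by (simp add: TC.T.coboundaries_0 MC.coboundaries_0)
next
  case (Suc r)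
  interpret T: module K "TC.TX p r" by (rule TC.P.module_tensor)
  interpret T': module K "TC.TX p q" by (rule TC.P.module_tensor)
  interpret Mq: module K "M p (Suc r)" by (rule module_M)
  have *: "M_diff D p r (g_map D p r (ms p \<odot>\<^bsub>TC.TX p r\<^esub> Z)) = g_map D p q (TC.dX p r Z)" if Z: "Z \<in> carrier (TC.TX p r)" for Z
  proof -
    have dZ: "TC.dX p r Z \<in> carrier (TC.TX p q)" using lin_maps_closed[OF TC.dX_linear Z] Suc by simp
    have "TC.dX p r (ms p \<odot>\<^bsub>TC.TX p r\<^esub> Z) = ms p \<odot>\<^bsub>TC.TX p q\<^esub> TC.dX p r Z"
      using lin_maps_smult[OF TC.dX_linear ms_closed Z] Suc by simp
    then show ?thesis
      using M_diff_g[of "ms p \<odot>\<^bsub>TC.TX p r\<^esub> Z" p r] Z dZ lin_maps_closed[OF g_linear dZ] Suc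
      by (simp add: ms_closed lin_maps_smult[OF g_linear] Mq.smult_assoc1[symmetric] msign_square[OF K_cring])
  qed
  show ?thesis
    unfolding Suc TC.T.coboundaries_Suc MC.coboundaries_Suc
  proof (intro equalityI subsetI)
    fix Y assume "Y \<in> g_map D p (Suc r) ` TC.dX p r ` carrier (TC.TX p r)"
    then obtain Z where Z: "Z \<in> carrier (TC.TX p r)" "Y = g_map D p (Suc r) (TC.dX p r Z)" by auto
    have "Y = M_diff D p r (g_map D p r (ms p \<odot>\<^bsub>TC.TX p r\<^esub> Z))"
      unfolding Z(2) *[OF Z(1)] Suc ..
    moreover have "g_map D p r (ms p \<odot>\<^bsub>TC.TX p r\<^esub> Z) \<in> carrier (M p r)"
      by (rule lin_maps_closed[OF g_linear T.smult_closed[OF ms_closed Z(1)]])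
    ultimately show "Y \<in> M_diff D p r ` carrier (M p r)" by (rule image_eqI)
  next
    fix Y assume "Y \<in> M_diff D p r ` carrier (M p r)"
    then obtain Z where Z: "Z \<in> carrier (TC.TX p r)" "Y = M_diff D p r (g_map D p r Z)"
      unfolding lin_isosD(3)[OF g_lin_iso, of p r, symmetric] by auto
    have mZ: "ms p \<odot>\<^bsub>TC.TX p r\<^esub> Z \<in> carrier (TC.TX p r)" by (rule T.smult_closed[OF ms_closed Z(1)])
    have "ms p \<odot>\<^bsub>TC.TX p r\<^esub> (ms p \<odot>\<^bsub>TC.TX p r\<^esub> Z) = Z"
      using Z(1) by (simp add: T.smult_assoc1[symmetric] ms_closed msign_square[OF K_cring])
    then have "Y = g_map D p (Suc r) (TC.dX p r (ms p \<odot>\<^bsub>TC.TX p r\<^esub> Z))"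
      using *[OF mZ] unfolding Suc Z(2) by (simp only:)
    then show "Y \<in> g_map D p (Suc r) ` TC.dX p r ` carrier (TC.TX p r)"
      using mZ by simp
  qed
qed

lemma HM_eq: "HM D p q = cohomology (M p) (M_diff D p) q"
  by (simp add: HM_def)

lemma g_coh_lin_iso: "g_coh D p q \<in> lin_isos K (H_forms_N D p q) (HM D p q)"
  unfolding H_forms_N_eq HM_eq g_coh_def
  by (rule cohomology_iso[OF TC.T.cochain_complex_axioms MC.cochain_complex_axioms g_lin_iso g_cocycle g_coboundary])

lemma g_coh_class: "Z \<in> TC.T.coc p q \<Longrightarrow> g_coh D p q (TC.T.cob p q +>\<^bsub>TC.TX p q\<^esub> Z) = MC.cob p q +>\<^bsub>M p q\<^esub> g_map D p q Z"
  unfolding g_coh_def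
  by (rule quot_map_linear[OF TC.P.module_tensor module_M g_linear TC.T.submodule_coboundaries MC.submodule_coboundaries])
    (use TC.T.cocycles_subset g_coboundary in auto)

text \<open>\<open>g_hat\<close> is a formula on pure tensors only. Agreement there with a composite
  of two known isomorphisms settles its well-definedness, linearity and bijectivity at once.\<close>

lemma g_hat_factor:
  assumes "Z \<in> carrier (forms_HN D p q)"
  shows "g_hat D p q Z = g_coh D p q (comparison D p q Z)"
  unfolding g_hat_def
proof (rule TC.PH.tensor_lift_factor)
  show "module K (HM D p q)" unfolding HM_eq by (rule MC.module_cohomology)
  show "(\<lambda>Z. g_coh D p q (comparison D p q Z)) \<in> lin_maps K (TC.PH.T p q) (HM D p q)"
    using lin_maps_comp[OF lin_isosD(1)[OF comparison_lin_iso] lin_isosD(1)[OF g_coh_lin_iso]] by (simp add: forms_HN_eq)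
  show "Z \<in> carrier (TC.PH.T p q)" using assms by (simp add: forms_HN_eq)
  fix \<xi> Y assume "\<xi> \<in> carrier (forms \<Gamma> p)" "Y \<in> carrier (TC.H q)"
  then obtain X where \<xi>: "\<xi> \<in> carrier (forms \<Gamma> p)" and X: "X \<in> MC.coc 0 q" "Y = MC.cob 0 q +>\<^bsub>M 0 q\<^esub> X" by auto
  have XM: "X \<in> carrier (M 0 q)" using X(1) MC.cocycles_subset by auto
  have cob: "(\<lambda>X. g_map D p q (TC.tX p q \<xi> X)) ` MC.cob 0 q \<subseteq> MC.cob p q"
    unfolding g_coboundary[of p q, symmetric] using TC.tens_coboundary[OF \<xi>] by auto
  have "quot_map (M p q) (MC.cob p q) (\<lambda>X. g_map D p q (TC.tX p q \<xi> X)) Y = MC.cob p q +>\<^bsub>M p q\<^esub> g_map D p q (TC.tX p q \<xi> X)"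
    unfolding X(2)
    by (rule quot_map_linear[OF module_M module_M lin_maps_comp[OF TC.P.tens_linear_right[OF \<xi>] g_linear]
          MC.submodule_coboundaries MC.submodule_coboundaries cob XM])
  also have "\<dots> = g_coh D p q (comparison D p q (TC.PH.tn p q \<xi> Y))"
    unfolding X(2) comparison_eq TC.cmp_tens[OF \<xi> X(1)] by (rule g_coh_class[OF TC.tens_cocycle[OF \<xi> X(1)], symmetric])
  finally show "quot_map (M p q) (MC.cob p q) (\<lambda>X. g_map D p q (forms_N_tens D p q \<xi> X)) Y =
      g_coh D p q (comparison D p q (TC.PH.tn p q \<xi> Y))" .
qed

lemma module_forms_HN: "module K (forms_HN D p q)"
  unfolding forms_HN_eq by (rule TC.PH.module_tensor)

lemma g_hat_lin_iso: "g_hat D p q \<in> lin_isos K (forms_HN D p q) (HM D p q)"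
  by (rule lin_isos_cong[OF lin_isos_comp[OF comparison_lin_iso g_coh_lin_iso] g_hat_factor[symmetric] module_forms_HN])

lemma g_hat_tens:
  assumes "\<xi> \<in> grade \<Gamma> p" "X \<in> MC.coc 0 q"
  shows "g_hat D p q (forms_HN_tens D p q \<xi> (MC.cob 0 q +>\<^bsub>M 0 q\<^esub> X)) = MC.cob p q +>\<^bsub>M p q\<^esub> g_map D p q (TC.tX p q \<xi> X)"
proof -
  have \<xi>: "\<xi> \<in> carrier (forms \<Gamma> p)" using assms(1) by simp
  have "TC.PH.tn p q \<xi> (MC.cob 0 q +>\<^bsub>M 0 q\<^esub> X) \<in> carrier (forms_HN D p q)"
    unfolding forms_HN_eq by (rule TC.PH.tens_closed) (use assms in auto)
  then show ?thesis
    unfolding HN_eq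
    by (simp only: g_hat_factor comparison_eq TC.cmp_tens[OF \<xi> assms(2)] g_coh_class[OF TC.tens_cocycle[OF \<xi> assms(2)]])
qed


subsection \<open>The first page\<close>

abbreviation "Z1 p q \<equiv> IC.cyc 1 (int p) (int (p + q))"
abbreviation "B1 p q \<equiv> IC.bnd 1 (int p) (int (p + q))"
abbreviation "cls p q x \<equiv> HM_class D p q (mc p q x)"
abbreviation "ZC p q \<equiv> (C (p + q))\<lparr>carrier := Z1 p q\<rparr>"

lemma int_Suc': "int n + 1 = int (Suc n)" and int_add': "int m + int n = int (m + n)"
  by simp_all

lemma Z1_iff: "x \<in> Z1 p q \<longleftrightarrow> x \<in> filt D p (p + q) \<and> nab (p + q) x \<in> filt D (Suc p) (Suc (p + q))"
  by (simp only: IC.cyc_def mem_Collect_eq int_Suc' int_filt_nat int_nabla_nat)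

lemma Z1_filt: "x \<in> Z1 p q \<Longrightarrow> x \<in> filt D p (p + q)"
  and Z1_carrier: "x \<in> Z1 p q \<Longrightarrow> x \<in> carrier (C (p + q))"
  using filt_carrier by (auto simp: Z1_iff simp del: of_nat_add)

lemma submodule_Z1: "submodule (Z1 p q) K (C (p + q))"
  using IC.submodule_cyc[of 1 "int p" "int (p + q)"] by (simp only: int_cochains_nat)

lemma submodule_B1: "submodule (B1 p q) K (C (p + q))"
  using IC.submodule_bnd[of 1 "int p" "int (p + q)"] by (simp only: int_cochains_nat)

lemma B1_Z1: "B1 p q \<subseteq> Z1 p q"
  by (rule IC.bnd_cyc)

lemma module_ZC: "module K (ZC p q)"
  by (rule module_restrict[OF module_C submodule_Z1])

text \<open>Order 0 imposes no condition, since \<open>nab\<close> preserves every filtration step.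
  Hence the null space of the first page is step \<open>p + 1\<close> plus the image of step
  \<open>p\<close> under the differential.\<close>

lemma cyc_0: "IC.cyc 0 (int p) (int n) = filt D p n"
  using nab_filt by (auto simp: IC.cyc_def int_filt_nat int_nabla_nat int_Suc' simp del: of_nat_Suc)

text \<open>In total degree \<open>p\<close> the incoming differential starts in step
  \<open>p\<close> of degree \<open>p - 1\<close>. It contributes nothing: that step is zero for
  \<open>p > 0\<close>, and for \<open>p = 0\<close> the differential out of negative degree is
  zero.\<close>

lemma B1_0: "x \<in> B1 p 0 \<longleftrightarrow> x \<in> filt D (Suc p) p"
proof -
  have z: "z \<oplus>\<^bsub>C p\<^esub> int_nabla D (int p - 1) y = z" if "z \<in> filt D (Suc p) p" "y \<in> IC.cyc 0 (int p) (int p - 1)" for y z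
  proof -
    have "int_nabla D (int p - 1) y = \<zero>\<^bsub>C p\<^esub>"
    proof (cases p)
      case (Suc r)
      have "int p - 1 = int r" using Suc by simp
      then have "y \<in> filt D (Suc r) r" using that(2) Suc cyc_0[of "Suc r" r] by simp
      then show ?thesis using \<open>int p - 1 = int r\<close> Suc by (simp add: filt_gt int_nabla_nat nab_zero)
    qed (simp add: int_nabla_def)
    then show ?thesis using filt_carrier[OF that(1)] by simp
  qed
  have ne: "IC.cyc 0 (int p) (int p - 1) \<noteq> {}"
    using submodule_zero[OF IC.module_C IC.submodule_cyc] by blast
  have e: "int p - 1 + 1 = int p" "(1::int) - 1 = 0" "int (p + 0) = int p" by simp_all
  show ?thesis
    unfolding IC.bnd_iff e int_Suc' cyc_0 int_cochains_nat using z ne by (metis ex_in_conv)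
qed

lemma B1_Suc: "x \<in> B1 p (Suc r) \<longleftrightarrow> (\<exists>z\<in>filt D (Suc p) (Suc (p + r)). \<exists>y\<in>filt D p (p + r). x = z \<oplus>\<^bsub>C (Suc (p + r))\<^esub> nab (p + r) y)"
proof -
  have e: "int p - 1 + 1 = int p" "(1::int) - 1 = 0" "int (p + Suc r) - 1 = int (p + r)" "p + Suc r = Suc (p + r)" by simp_all
  show ?thesis
    unfolding IC.bnd_iff e(1-3) unfolding e(4) int_Suc' cyc_0 int_cochains_nat int_nabla_nat ..
qed

lemma cls_eq: "cls p q x = MC.cob p q +>\<^bsub>M p q\<^esub> mc p q x"
  by (simp add: HM_class_def)

lemma mc_cocycle: "x \<in> Z1 p q \<Longrightarrow> mc p q x \<in> MC.coc p q"
  using mc_closed[of x p q] M_diff_mc[of x p q] mc_zero_iff[of "nab (p + q) x" p "Suc q"] Z1_carrier[of x p q]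
    nab_closed[OF Z1_carrier[of x p q]]
  by (simp add: cocycles_def Z1_iff del: of_nat_add)

lemma cls_linear: "(\<lambda>x. cls p q x) \<in> lin_maps K (ZC p q) (HM D p q)"
proof -
  have "mc p q \<in> lin_maps K (ZC p q) ((M p q)\<lparr>carrier := MC.coc p q\<rparr>)"
    using mc_linear[of p q] mc_cocycle Z1_filt by (simp add: lin_maps_def Pi_def del: of_nat_add)
  from lin_maps_comp[OF this MC.class_linear] show ?thesis unfolding cls_eq HM_eq .
qed

lemma module_HM: "module K (HM D p q)"
  unfolding HM_eq by (rule MC.module_cohomology)

lemma cls_add: "\<lbrakk>x \<in> Z1 p q; y \<in> Z1 p q\<rbrakk> \<Longrightarrow> cls p q (x \<oplus>\<^bsub>C (p + q)\<^esub> y) = cls p q x \<oplus>\<^bsub>HM D p q\<^esub> cls p q y"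
  and cls_smult: "\<lbrakk>c \<in> carrier K; x \<in> Z1 p q\<rbrakk> \<Longrightarrow> cls p q (c \<odot>\<^bsub>C (p + q)\<^esub> x) = c \<odot>\<^bsub>HM D p q\<^esub> cls p q x"
  and cls_closed: "x \<in> Z1 p q \<Longrightarrow> cls p q x \<in> carrier (HM D p q)"
  using lin_maps_add[OF cls_linear] lin_maps_smult[OF cls_linear] lin_maps_closed[OF cls_linear]
  by (simp_all del: of_nat_add)

text \<open>A cocycle of the quotient complex is represented by some \<open>x\<close> in step
  \<open>p\<close> with \<open>nab x\<close> in step \<open>p + 1\<close>, which is the condition
  for a cycle of order 1.\<close>

lemma cls_surj: "carrier (HM D p q) = (\<lambda>x. cls p q x) ` Z1 p q"
proof (intro equalityI subsetI)
  fix Y assume "Y \<in> carrier (HM D p q)"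
  then obtain X where X: "X \<in> MC.coc p q" "Y = MC.cob p q +>\<^bsub>M p q\<^esub> X" unfolding HM_eq MC.carrier_cohomology by blast
  then obtain x where x: "x \<in> filt D p (p + q)" "X = mc p q x" by (auto simp: cocycles_def carrier_M)
  note c = filt_carrier[OF x(1)]
  have "mc p (Suc q) (nab (p + q) x) = \<zero>\<^bsub>M p (Suc q)\<^esub>" using X(1) x c by (simp add: cocycles_def M_diff_mc)
  then have "x \<in> Z1 p q" using x(1) mc_zero_iff[of "nab (p + q) x" p "Suc q"] nab_closed[OF c] unfolding Z1_iff by simp
  then show "Y \<in> (\<lambda>x. cls p q x) ` Z1 p q" using X(2) x(2) cls_eq by blast
qed (auto simp: cls_closed simp del: of_nat_add)

text \<open>Unwinding two quotients: the class of \<open>x\<close> in \<open>M p q\<close> is the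
  boundary of the class of \<open>y\<close> exactly when the difference of \<open>x\<close> and
  \<open>nab y\<close> lies in step \<open>p + 1\<close>, which is the shape of the elements of
  \<open>B1\<close>.\<close>

lemma cls_zero_iff: "x \<in> Z1 p q \<Longrightarrow> cls p q x = \<zero>\<^bsub>HM D p q\<^esub> \<longleftrightarrow> x \<in> B1 p q"
proof -
  assume x: "x \<in> Z1 p q"
  note xc = Z1_carrier[OF x] and xf = Z1_filt[OF x]
  have "cls p q x = \<zero>\<^bsub>HM D p q\<^esub> \<longleftrightarrow> mc p q x \<in> MC.cob p q"
    unfolding cls_eq HM_eq MC.zero_cohomology by (rule MC.class_zero_iff[OF mc_closed[OF xf]])
  also have "\<dots> \<longleftrightarrow> x \<in> B1 p q"
  proof (cases q)
    case 0
    then show ?thesis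
      using mc_zero_iff[of x p 0] xc B1_0[of x p] by (simp add: MC.coboundaries_0 del: of_nat_add)
  next
    case (Suc r)
    have nf: "nab (p + r) y \<in> carrier (C (Suc (p + r)))" if "y \<in> filt D p (p + r)" for y
      using nab_closed[OF filt_carrier[OF that]] .
    have xc': "x \<in> carrier (C (Suc (p + r)))" using xc Suc by simp
    have "mc p q x \<in> MC.cob p q \<longleftrightarrow> (\<exists>y\<in>filt D p (p + r). mc p (Suc r) x = mc p (Suc r) (nab (p + r) y))"
    proof -
      have "M_diff D p r ` mc p r ` filt D p (p + r) = (\<lambda>y. mc p (Suc r) (nab (p + r) y)) ` filt D p (p + r)"
        unfolding image_image by (intro image_cong refl M_diff_mc filt_carrier)
      then show ?thesis unfolding Suc MC.coboundaries_Suc carrier_M by (simp only: image_iff)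
    qed
    also have "\<dots> \<longleftrightarrow> (\<exists>y\<in>filt D p (p + r). x \<ominus>\<^bsub>C (Suc (p + r))\<^esub> nab (p + r) y \<in> filt D (Suc p) (Suc (p + r)))"
      using mc_eq_iff[of x p "Suc r"] xc' nf by simp
    also have "\<dots> \<longleftrightarrow> x \<in> B1 p (Suc r)"
      unfolding B1_Suc
    proof
      assume "\<exists>y\<in>filt D p (p + r). x \<ominus>\<^bsub>C (Suc (p + r))\<^esub> nab (p + r) y \<in> filt D (Suc p) (Suc (p + r))"
      then obtain y where y: "y \<in> filt D p (p + r)" "x \<ominus>\<^bsub>C (Suc (p + r))\<^esub> nab (p + r) y \<in> filt D (Suc p) (Suc (p + r))" ..
      have "x = (x \<ominus>\<^bsub>C (Suc (p + r))\<^esub> nab (p + r) y) \<oplus>\<^bsub>C (Suc (p + r))\<^esub> nab (p + r) y"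
        using minus_add_cancel(1)[OF module_C xc' nf[OF y(1)]] by simp
      then show "\<exists>z\<in>filt D (Suc p) (Suc (p + r)). \<exists>y\<in>filt D p (p + r). x = z \<oplus>\<^bsub>C (Suc (p + r))\<^esub> nab (p + r) y"
        using y by blast
    next
      assume "\<exists>z\<in>filt D (Suc p) (Suc (p + r)). \<exists>y\<in>filt D p (p + r). x = z \<oplus>\<^bsub>C (Suc (p + r))\<^esub> nab (p + r) y"
      then obtain z y where zy: "z \<in> filt D (Suc p) (Suc (p + r))" "y \<in> filt D p (p + r)"
        "x = z \<oplus>\<^bsub>C (Suc (p + r))\<^esub> nab (p + r) y" by blast
      then show "\<exists>y\<in>filt D p (p + r). x \<ominus>\<^bsub>C (Suc (p + r))\<^esub> nab (p + r) y \<in> filt D (Suc p) (Suc (p + r))"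
        using add_minus_cancel(1)[OF module_C filt_carrier[OF zy(1)] nf[OF zy(2)]] by (intro bexI[of _ y]) simp_all
    qed
    finally show ?thesis using Suc by simp
  qed
  finally show ?thesis .
qed

lemma cls_eq_iff: "\<lbrakk>x \<in> Z1 p q; y \<in> Z1 p q\<rbrakk> \<Longrightarrow> cls p q x = cls p q y \<longleftrightarrow> x \<ominus>\<^bsub>C (p + q)\<^esub> y \<in> B1 p q"
proof -
  assume xy: "x \<in> Z1 p q" "y \<in> Z1 p q"
  have m: "x \<ominus>\<^bsub>C (p + q)\<^esub> y \<in> Z1 p q" by (rule submodule_minus[OF module_C submodule_Z1 xy])
  have "x = (x \<ominus>\<^bsub>C (p + q)\<^esub> y) \<oplus>\<^bsub>C (p + q)\<^esub> y" using minus_add_cancel(1)[OF module_C] Z1_carrier xy by simp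
  then have "cls p q x = cls p q (x \<ominus>\<^bsub>C (p + q)\<^esub> y) \<oplus>\<^bsub>HM D p q\<^esub> cls p q y" using cls_add[OF m xy(2)] by simp
  moreover interpret H: module K "HM D p q" by (rule module_HM)
  have "u \<oplus>\<^bsub>HM D p q\<^esub> cls p q y = cls p q y \<longleftrightarrow> u = \<zero>\<^bsub>HM D p q\<^esub>" if "u \<in> carrier (HM D p q)" for u
    using that cls_closed[OF xy(2)] add_minus_cancel(1)[OF module_HM that cls_closed[OF xy(2)]]
      minus_zero_iff[OF module_HM cls_closed[OF xy(2)] cls_closed[OF xy(2)]] H.l_zero by metis
  ultimately show ?thesis using cls_zero_iff[OF m] cls_closed[OF m] by simp
qed

lemma page_eq: "page D r (int p) (int q) =
    quot_space ((C (p + q))\<lparr>carrier := IC.cyc (int r) (int p) (int (p + q))\<rparr>) (IC.bnd (int r) (int p) (int (p + q)))"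
  unfolding IC.ss_page_eq int_add' int_cochains_nat ..

lemma page1_lin_iso: "page1_map D p q \<in> lin_isos K (page D 1 (int p) (int q)) (HM D p q)"
proof -
  have "(\<lambda>X. \<Union>x\<in>X. cls p q x) \<in> lin_isos K (quot_space (ZC p q) (B1 p q)) (HM D p q)"
  proof (rule factor_iso_union[OF module_ZC module_HM cls_linear])
    show "carrier (HM D p q) \<subseteq> (\<lambda>x. cls p q x) ` carrier (ZC p q)" unfolding cls_surj by simp
    show "B1 p q = {x \<in> carrier (ZC p q). cls p q x = \<zero>\<^bsub>HM D p q\<^esub>}"
      using cls_zero_iff[of _ p q] subsetD[OF B1_Z1, of _ p q] by (simp del: of_nat_add cong: conj_cong) blast
  qed
  then show ?thesis unfolding page_eq page1_map_def of_nat_1 .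
qed

text \<open>The differential of the first page carried over to \<open>HM\<close>, that is, the
  connecting map between consecutive graded pieces. The representative is chosen arbitrarily;
  \<open>dlt_cls\<close> shows that the choice does not matter.\<close>

definition dlt :: "nat \<Rightarrow> nat \<Rightarrow> ('e \<times> 'w \<Rightarrow> 'k) set set set \<Rightarrow> ('e \<times> 'w \<Rightarrow> 'k) set set set"
  where "dlt p q X = cls (Suc p) q (nab (p + q) (SOME x. x \<in> Z1 p q \<and> cls p q x = X))"

lemma nab_Z1: "x \<in> Z1 p q \<Longrightarrow> nab (p + q) x \<in> Z1 (Suc p) q"
  using nab_nab[OF Z1_carrier, of x p q] filt_zero[of "Suc (Suc (p + q))" "Suc (Suc p)"] unfolding Z1_iff by simp

lemma nab_B1: "x \<in> B1 p q \<Longrightarrow> nab (p + q) x \<in> B1 (Suc p) q"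
  using IC.d_bnd[of x 1 "int p" "int (p + q)"] unfolding int_nabla_nat int_Suc' by simp

lemma cls_nab_cong: "\<lbrakk>x \<in> Z1 p q; y \<in> Z1 p q; cls p q x = cls p q y\<rbrakk> \<Longrightarrow> cls (Suc p) q (nab (p + q) x) = cls (Suc p) q (nab (p + q) y)"
  using nab_B1[of "x \<ominus>\<^bsub>C (p + q)\<^esub> y" p q] cls_eq_iff[of x p q y] cls_eq_iff[OF nab_Z1 nab_Z1, of x p q y] nab_minus[OF Z1_carrier Z1_carrier, of x p q y]
  by (simp del: of_nat_add)

lemma dlt_cls: "x \<in> Z1 p q \<Longrightarrow> dlt p q (cls p q x) = cls (Suc p) q (nab (p + q) x)"
proof -
  assume x: "x \<in> Z1 p q"
  let ?y = "SOME y. y \<in> Z1 p q \<and> cls p q y = cls p q x"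
  have "?y \<in> Z1 p q \<and> cls p q ?y = cls p q x" by (rule someI[of _ x]) (use x in simp)
  then show ?thesis unfolding dlt_def using cls_nab_cong x by blast
qed

lemma dlt_linear: "dlt p q \<in> lin_maps K (HM D p q) (HM D (Suc p) q)"
proof (rule lin_mapsI)
  note Zc = Z1_carrier and nZ = nab_Z1
  have e: "C (Suc p + q) = C (Suc (p + q))" by simp
  show "dlt p q X \<in> carrier (HM D (Suc p) q)" if "X \<in> carrier (HM D p q)" for X
    using that unfolding cls_surj[of p q] by (auto simp: dlt_cls cls_closed[OF nab_Z1] simp del: of_nat_add add_Suc)
  show "dlt p q (X \<oplus>\<^bsub>HM D p q\<^esub> Y) = dlt p q X \<oplus>\<^bsub>HM D (Suc p) q\<^esub> dlt p q Y"
    if XY: "X \<in> carrier (HM D p q)" "Y \<in> carrier (HM D p q)" for X Y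
  proof -
    obtain x y where *: "x \<in> Z1 p q" "y \<in> Z1 p q" "X = cls p q x" "Y = cls p q y" using XY unfolding cls_surj by blast
    then show ?thesis
      using cls_add[OF nZ nZ, of x p q y] unfolding e
      by (simp add: cls_add[symmetric] dlt_cls submodule_add[OF module_C submodule_Z1] nab_add Zc del: of_nat_add)
  qed
  show "dlt p q (c \<odot>\<^bsub>HM D p q\<^esub> X) = c \<odot>\<^bsub>HM D (Suc p) q\<^esub> dlt p q X" if c: "c \<in> carrier K" "X \<in> carrier (HM D p q)" for c X
  proof -
    obtain x where *: "x \<in> Z1 p q" "X = cls p q x" using c(2) unfolding cls_surj by blast
    then show ?thesis
      using c(1) cls_smult[OF c(1) nZ, of x p q] unfolding e
      by (simp add: cls_smult[symmetric] dlt_cls submodule_smult[OF module_C submodule_Z1] nab_smult Zc del: of_nat_add)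
  qed
qed

text \<open>Both Leibniz terms reach step \<open>m + p + 1\<close>: one because
  \<open>d \<omega>\<close> has degree \<open>m + 1\<close>, the other because \<open>nab z\<close>
  already lies one step deeper than \<open>z\<close>.\<close>

lemma L_Z1:
  assumes "\<omega> \<in> grade \<Gamma> m" "z \<in> Z1 p q"
  shows "L m (p + q) \<omega> z \<in> Z1 (m + p) q"
proof -
  have z: "z \<in> filt D p (p + q)" "nab (p + q) z \<in> filt D (Suc p) (Suc (p + q))" using assms(2) unfolding Z1_iff by auto
  note c = filt_carrier[OF z(1)]
  have "L (Suc m) (p + q) (dif \<Gamma> \<omega>) z \<in> filt D (Suc (m + p)) (Suc (m + p + q))"
    using L_filt[OF z(1) b.dif_grade[OF assms(1)]] by (simp add: add.assoc)
  moreover have "L m (Suc (p + q)) \<omega> (nab (p + q) z) \<in> filt D (Suc (m + p)) (Suc (m + p + q))"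
    using L_filt[OF z(2) assms(1)] by (simp add: add.assoc)
  ultimately have "nab (m + (p + q)) (L m (p + q) \<omega> z) \<in> filt D (Suc (m + p)) (Suc (m + (p + q)))"
    unfolding nab_L[OF assms(1) c] by (simp add: add.assoc filt_add filt_smult ms_closed)
  then show ?thesis using L_filt[OF z(1) assms(1)] unfolding Z1_iff by (simp add: add.assoc)
qed

text \<open>For \<open>z = f + nab y\<close> the Leibniz rule turns
  \<open>L \<omega> (nab y)\<close> into a signed \<open>nab\<close> of \<open>L \<omega> y\<close>,
  up to the term \<open>L (d \<omega>) y\<close>, which lies in step \<open>m + p + 1\<close> and
  joins the part coming from \<open>f\<close>.\<close>

lemma L_B1:
  assumes "\<omega> \<in> grade \<Gamma> m" "z \<in> B1 p q"
  shows "L m (p + q) \<omega> z \<in> B1 (m + p) q"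
proof (cases q)
  case 0
  then show ?thesis
    using assms(2) L_filt[of z "Suc p" p \<omega> m] assms(1) B1_0[of z p] B1_0[of "L m p \<omega> z" "m + p"] by simp
next
  case (Suc r)
  obtain f y where *: "f \<in> filt D (Suc p) (Suc (p + r))" "y \<in> filt D p (p + r)" "z = f \<oplus>\<^bsub>C (Suc (p + r))\<^esub> nab (p + r) y"
    using assms(2) unfolding Suc B1_Suc by blast
  let ?N = "Suc (m + p + r)"
  note yc = filt_carrier[OF *(2)] and fc = filt_carrier[OF *(1)]
  have e: "m + Suc (p + r) = ?N" "m + (p + r) = m + p + r" "Suc (m + (p + r)) = ?N" "m + Suc p = Suc (m + p)" "Suc m + p = Suc (m + p)"
    "Suc m + (p + r) = ?N" by simp_all
  define a where "a = L m (Suc (p + r)) \<omega> f"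
  define s where "s = L (Suc m) (p + r) (dif \<Gamma> \<omega>) y"
  define t where "t = L m (Suc (p + r)) \<omega> (nab (p + r) y)"
  define w where "w = L m (p + r) \<omega> y"
  have a: "a \<in> filt D (Suc (m + p)) ?N" using L_filt[OF *(1) assms(1)] unfolding e a_def .
  have s: "s \<in> filt D (Suc (m + p)) ?N" using L_filt[OF *(2) b.dif_grade[OF assms(1)]] unfolding e s_def .
  have w: "w \<in> filt D (m + p) (m + p + r)" using L_filt[OF *(2) assms(1)] unfolding e w_def .
  have t: "t \<in> carrier (C ?N)" using L_closed[OF assms(1) nab_closed[OF yc]] unfolding e t_def .
  note ac = filt_carrier[OF a] and sc = filt_carrier[OF s] and wc = filt_carrier[OF w]
  have Lz: "L m (Suc (p + r)) \<omega> z = a \<oplus>\<^bsub>C ?N\<^esub> t"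
    unfolding *(3) a_def t_def using L_add[OF assms(1) fc nab_closed[OF yc]] unfolding e .
  have nw: "nab (m + p + r) w = s \<oplus>\<^bsub>C ?N\<^esub> (ms m \<odot>\<^bsub>C ?N\<^esub> t)"
    using nab_L[OF assms(1) yc] unfolding e s_def t_def w_def .
  \<comment> \<open>The sign squares to one, so multiplying by it isolates \<open>t\<close>.\<close>
  have "ms m \<odot>\<^bsub>C ?N\<^esub> nab (m + p + r) w = (ms m \<odot>\<^bsub>C ?N\<^esub> s) \<oplus>\<^bsub>C ?N\<^esub> t"
    unfolding nw using sc t
    by (simp add: C.smult_r_distr ms_closed C.smult_assoc1[symmetric] msign_square[OF K_cring])
  then have "t = nab (m + p + r) (ms m \<odot>\<^bsub>C (m + p + r)\<^esub> w) \<ominus>\<^bsub>C ?N\<^esub> (ms m \<odot>\<^bsub>C ?N\<^esub> s)"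
    using wc t sc add_minus_cancel(2)[OF module_C t, of "ms m \<odot>\<^bsub>C ?N\<^esub> s"] by (simp add: nab_smult ms_closed)
  then have "a \<oplus>\<^bsub>C ?N\<^esub> t = (a \<ominus>\<^bsub>C ?N\<^esub> (ms m \<odot>\<^bsub>C ?N\<^esub> s)) \<oplus>\<^bsub>C ?N\<^esub> nab (m + p + r) (ms m \<odot>\<^bsub>C (m + p + r)\<^esub> w)"
    using ac sc wc by (simp add: C.minus_eq C.a_ac ms_closed nab_closed)
  moreover have "a \<ominus>\<^bsub>C ?N\<^esub> (ms m \<odot>\<^bsub>C ?N\<^esub> s) \<in> filt D (Suc (m + p)) ?N"
    using a s by (simp add: filt_minus filt_smult ms_closed)
  moreover have "ms m \<odot>\<^bsub>C (m + p + r)\<^esub> w \<in> filt D (m + p) (m + p + r)" using w by (simp add: filt_smult ms_closed)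
  ultimately have "L m (Suc (p + r)) \<omega> z \<in> B1 (m + p) (Suc r)"
    unfolding Lz B1_Suc by blast
  then show ?thesis unfolding Suc by simp
qed

lemma cls_L_cong:
  assumes "\<omega> \<in> grade \<Gamma> m" "x \<in> Z1 p q" "y \<in> Z1 p q" "cls p q x = cls p q y"
  shows "cls (m + p) q (L m (p + q) \<omega> x) = cls (m + p) q (L m (p + q) \<omega> y)"
proof -
  have "x \<ominus>\<^bsub>C (p + q)\<^esub> y \<in> B1 p q" using assms cls_eq_iff by blast
  from L_B1[OF assms(1) this]
  have "L m (p + q) \<omega> x \<ominus>\<^bsub>C (m + p + q)\<^esub> L m (p + q) \<omega> y \<in> B1 (m + p) q"
    using lin_maps_minus[OF module_C module_C L_linear[OF assms(1)] Z1_carrier[OF assms(2)] Z1_carrier[OF assms(3)]]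
    by (simp add: add.assoc del: of_nat_add)
  then show ?thesis using cls_eq_iff[OF L_Z1[OF assms(1,2)] L_Z1[OF assms(1,3)]] by blast
qed


subsection \<open>The second page\<close>

abbreviation "FH p q \<equiv> forms_HN D p q"

lemma carrier_HN: "carrier (TC.H q) = (\<lambda>x. cls 0 q x) ` Z1 0 q"
proof -
  have "carrier (TC.H q) = carrier (HM D 0 q)" unfolding HM_eq MC.carrier_cohomology by simp
  then show ?thesis using cls_surj by simp
qed

lemma g_hat_cls:
  assumes "\<xi> \<in> grade \<Gamma> p" "y \<in> Z1 0 q"
  shows "g_hat D p q (TC.PH.tn p q \<xi> (cls 0 q y)) = cls p q (L p q \<xi> y)"
proof -
  have y: "y \<in> filt D 0 q" using Z1_filt[OF assms(2)] by simp
  show ?thesis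
    using g_hat_tens[OF assms(1) mc_cocycle[OF assms(2)]] unfolding g_tens[OF assms(1) y] cls_eq HN_eq .
qed

lemma g_hat_inv:
  assumes "X \<in> carrier (HM D p q)"
  shows "g_hat_inv D p q X \<in> carrier (FH p q)" "g_hat D p q (g_hat_inv D p q X) = X"
  using assms inv_into_into[of X "g_hat D p q" "carrier (FH p q)"] f_inv_into_f[of X "g_hat D p q" "carrier (FH p q)"]
    lin_isosD(3)[OF g_hat_lin_iso, of p q] by auto

lemma g_hat_eq_iff: "\<lbrakk>U \<in> carrier (FH p q); V \<in> carrier (FH p q)\<rbrakk> \<Longrightarrow> g_hat D p q U = g_hat D p q V \<longleftrightarrow> U = V"
  using inj_on_eq_iff[OF lin_isosD(2)[OF g_hat_lin_iso]] .

lemma g_hat_inv_eq: "U \<in> carrier (FH p q) \<Longrightarrow> g_hat_inv D p q (g_hat D p q U) = U"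
  using inv_into_f_f[OF lin_isosD(2)[OF g_hat_lin_iso]] .

lemmas g_hat_linear = lin_isosD(1)[OF g_hat_lin_iso]
lemmas g_hat_inv_linear = lin_isosD(1)[OF inv_lin_isos[OF module_forms_HN g_hat_lin_iso]]

text \<open>Every cochain met by the double union in \<open>nabla_q\<close> lies in
  \<open>Z1 0 q\<close> and has the same class as \<open>y\<close>, so by
  \<open>cls_nab_cong\<close> all members of the union coincide.\<close>

lemma nabla_q_cls:
  assumes "y \<in> Z1 0 q"
  shows "nabla_q D q (cls 0 q y) = g_hat_inv D 1 q (cls 1 q (nab q y))"
proof -
  have y: "y \<in> filt D 0 (0 + q)" using Z1_filt[OF assms] .
  have "cls 1 q (nab q x) = cls 1 q (nab q y)" if X: "X \<in> cls 0 q y" "x \<in> X" for X x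
  proof -
    have X': "X \<in> carrier (M 0 q)" "MC.cob 0 q +>\<^bsub>M 0 q\<^esub> X = MC.cob 0 q +>\<^bsub>M 0 q\<^esub> mc 0 q y"
      using coset_mem[OF module_M MC.submodule_coboundaries mc_closed[OF y], of X] X(1) unfolding cls_eq by blast+
    then obtain x' where x': "x' \<in> filt D 0 (0 + q)" "X = mc 0 q x'" unfolding carrier_M by blast
    have x: "x \<in> carrier (C (0 + q))" "mc 0 q x = mc 0 q x'"
      using mc_mem[of x 0 q x'] X(2) x' filt_carrier[OF x'(1)] by simp_all
    have cxy: "cls 0 q x = cls 0 q y" using X'(2) x(2) x'(2) unfolding cls_eq by simp
    have "mc 0 q x \<in> MC.coc 0 q"
      using coset_mem[where x="mc 0 q y" and y=X, OF MC.module_cocycles MC.submodule_coboundaries_cocycles] mc_cocycle[OF assms] X(1) x x'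
      unfolding cls_eq by simp
    then have "nab (0 + q) x \<in> filt D (Suc 0) (Suc (0 + q))"
      using mc_zero_iff[of "nab q x" 0 "Suc q"] nab_closed[of x q] x(1) M_diff_mc[of x 0 q] by (simp add: cocycles_def)
    then have "x \<in> Z1 0 q" using x(1) filt_0[of q] unfolding Z1_iff by simp
    then show ?thesis using cls_nab_cong[OF _ assms cxy] by simp
  qed
  moreover have "mc 0 q y \<in> cls 0 q y" unfolding cls_eq by (rule coset_self[OF module_M MC.submodule_coboundaries mc_closed[OF y]])
  moreover have "y \<in> mc 0 q y" unfolding mc_eq by (rule coset_self[OF module_C submodule_filt filt_carrier[OF y]])
  ultimately have "(\<Union>X\<in>cls 0 q y. \<Union>x\<in>X. cls 1 q (nab q x)) = cls 1 q (nab q y)" by blast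
  then show ?thesis unfolding nabla_q_def by (rule arg_cong)
qed

lemma wedge_left_target:
  assumes "\<omega> \<in> grade \<Gamma> p"
  shows "tensor_target K B (forms \<Gamma> 1) (TC.H q) (FH (Suc p) q) (\<lambda>\<eta> Y. TC.PH.tn (Suc p) q (\<omega> \<otimes>\<^bsub>\<Gamma>\<^esub> \<eta>) Y)"
proof -
  have l: "(\<lambda>\<eta>. \<omega> \<otimes>\<^bsub>\<Gamma>\<^esub> \<eta>) \<in> lin_maps K (forms \<Gamma> 1) (forms \<Gamma> (Suc p))"
    using b.mult_linear_right[OF assms, of 1] by simp
  have "balanced K B (forms \<Gamma> 1) (TC.H q) (tensor K B (forms \<Gamma> (Suc p)) (TC.H q)) (\<lambda>\<eta> Y. TC.PH.tn (Suc p) q (\<omega> \<otimes>\<^bsub>\<Gamma>\<^esub> \<eta>) Y)"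
  proof (rule balanced_map[OF TC.PH.tensor_pair_axioms TC.PH.tensor_pair_axioms l, where v="\<lambda>Y. Y"])
    show "(\<lambda>Y. Y) \<in> lin_maps K (TC.H q) (TC.H q)" by (rule lin_mapsI) (assumption | rule refl)+
    fix \<eta> \<beta> Y assume a: "\<eta> \<in> carrier (forms \<Gamma> 1)" "\<beta> \<in> carrier B" "Y \<in> carrier (TC.H q)"
    have "\<omega> \<otimes>\<^bsub>\<Gamma>\<^esub> (\<eta> \<otimes>\<^bsub>\<Gamma>\<^esub> \<beta>) = (\<omega> \<otimes>\<^bsub>\<Gamma>\<^esub> \<eta>) \<otimes>\<^bsub>\<Gamma>\<^esub> \<beta>"
      using a assms b.grade_carrier by (simp add: b.A_fields b.\<Omega>.m_assoc b.grade_carrier[OF assms])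
    then show "TC.PH.tn (Suc p) q (\<omega> \<otimes>\<^bsub>\<Gamma>\<^esub> (\<eta> \<triangleleft>\<^bsub>forms \<Gamma> 1\<^esub> \<beta>)) Y = TC.PH.tn (Suc p) q (\<omega> \<otimes>\<^bsub>\<Gamma>\<^esub> \<eta>) (\<beta> \<triangleright>\<^bsub>TC.H q\<^esub> Y)"
      using TC.PH.tens_balanced[of "\<omega> \<otimes>\<^bsub>\<Gamma>\<^esub> \<eta>" "Suc p" \<beta> Y q] lin_maps_closed[OF l a(1)] a by simp
  qed
  then show ?thesis
    by (intro tensor_target.intro tensor_target_axioms.intro TC.PH.tensor_pair_axioms module_forms_HN) (simp only: forms_HN_eq)
qed

lemma wedge_left_eq: "wedge_left D p q \<omega> = tensor_lift K (FH (Suc p) q) (\<lambda>\<eta> Y. TC.PH.tn (Suc p) q (\<omega> \<otimes>\<^bsub>\<Gamma>\<^esub> \<eta>) Y)"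
  by (simp add: wedge_left_def HN_eq fun_eq_iff)

text \<open>On pure tensors this is \<open>L_mult\<close>. Induction over sums can only provide some
  representative of \<open>g_hat D 1 q Z\<close>, the sum of those of the summands;
  \<open>cls_L_cong\<close> then passes to the given \<open>z\<close>.\<close>

lemma wedge_left_g_hat:
  assumes \<omega>: "\<omega> \<in> grade \<Gamma> p" and Z: "Z \<in> carrier (FH 1 q)" and z: "z \<in> Z1 1 q" "g_hat D 1 q Z = cls 1 q z"
  shows "wedge_left D p q \<omega> Z \<in> carrier (FH (Suc p) q)"
    and "g_hat D (Suc p) q (wedge_left D p q \<omega> Z) = cls (Suc p) q (L p (Suc q) \<omega> z)"
proof -
  note T = wedge_left_target[OF \<omega>, of q]
  note lin = tensor_target.tensor_lift_linear[OF T, folded forms_HN_eq wedge_left_eq]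
    and tns = tensor_target.tensor_lift_tens[OF T, folded wedge_left_eq]
  show "wedge_left D p q \<omega> Z \<in> carrier (FH (Suc p) q)" by (rule lin_maps_closed[OF lin Z])
  have LZ: "L p (Suc q) \<omega> z \<in> Z1 (Suc p) q" if "z \<in> Z1 1 q" for z
    using L_Z1[OF \<omega> that] by simp
  have Lc: "cls (Suc p) q (L p (Suc q) \<omega> x) = cls (Suc p) q (L p (Suc q) \<omega> y)"
    if "x \<in> Z1 1 q" "y \<in> Z1 1 q" "cls 1 q x = cls 1 q y" for x y
    using cls_L_cong[OF \<omega> that] by simp
  have "Z \<in> carrier (TC.PH.T 1 q)" using Z by (simp only: forms_HN_eq)
  then have "\<exists>z\<in>Z1 1 q. g_hat D 1 q Z = cls 1 q z \<and> g_hat D (Suc p) q (wedge_left D p q \<omega> Z) = cls (Suc p) q (L p (Suc q) \<omega> z)"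
  proof (induction Z rule: TC.PH.tensor_induct)
    case (tens \<eta> Y)
    then obtain y where y: "y \<in> Z1 0 q" "Y = cls 0 q y" unfolding carrier_HN by blast
    have \<eta>: "\<eta> \<in> grade \<Gamma> 1" using tens by simp
    have yc: "y \<in> carrier (C q)" using Z1_carrier[OF y(1)] by simp
    have "L 1 q \<eta> y \<in> Z1 1 q" using L_Z1[OF \<eta> y(1)] by simp
    moreover have "g_hat D 1 q (TC.PH.tn 1 q \<eta> Y) = cls 1 q (L 1 q \<eta> y)" unfolding y(2) by (rule g_hat_cls[OF \<eta> y(1)])
    moreover have "g_hat D (Suc p) q (wedge_left D p q \<omega> (TC.PH.tn 1 q \<eta> Y)) = cls (Suc p) q (L p (Suc q) \<omega> (L 1 q \<eta> y))"
    proof -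
      have \<omega>\<eta>: "\<omega> \<otimes>\<^bsub>\<Gamma>\<^esub> \<eta> \<in> grade \<Gamma> (Suc p)" using b.grade_mult'[OF \<omega> \<eta>] by simp
      have "L (Suc p) q (\<omega> \<otimes>\<^bsub>\<Gamma>\<^esub> \<eta>) y = L p (Suc q) \<omega> (L 1 q \<eta> y)" using L_mult[OF yc \<omega> \<eta>] by simp
      then show ?thesis unfolding tns[OF tens] unfolding y(2) g_hat_cls[OF \<omega>\<eta> y(1)] by simp
    qed
    ultimately show ?case by blast
  next
    case (add U V)
    have UV: "U \<in> carrier (FH 1 q)" "V \<in> carrier (FH 1 q)" using add(1,2) by (simp_all only: forms_HN_eq)
    obtain u v where u: "u \<in> Z1 1 q" "g_hat D 1 q U = cls 1 q u" "g_hat D (Suc p) q (wedge_left D p q \<omega> U) = cls (Suc p) q (L p (Suc q) \<omega> u)"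
      and v: "v \<in> Z1 1 q" "g_hat D 1 q V = cls 1 q v" "g_hat D (Suc p) q (wedge_left D p q \<omega> V) = cls (Suc p) q (L p (Suc q) \<omega> v)"
      using add(3,4) by blast
    let ?w = "u \<oplus>\<^bsub>C (1 + q)\<^esub> v"
    have "?w \<in> Z1 1 q" by (rule submodule_add[OF module_C submodule_Z1 u(1) v(1)])
    moreover have "g_hat D 1 q (U \<oplus>\<^bsub>FH 1 q\<^esub> V) = cls 1 q ?w"
      unfolding lin_maps_add[OF g_hat_linear UV] u(2) v(2) by (rule cls_add[OF u(1) v(1), symmetric])
    moreover have "g_hat D (Suc p) q (wedge_left D p q \<omega> (U \<oplus>\<^bsub>FH 1 q\<^esub> V)) = cls (Suc p) q (L p (Suc q) \<omega> ?w)"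
    proof -
      have "L p (Suc q) \<omega> ?w = L p (Suc q) \<omega> u \<oplus>\<^bsub>C (Suc p + q)\<^esub> L p (Suc q) \<omega> v"
        using L_add[OF \<omega> Z1_carrier[OF u(1)] Z1_carrier[OF v(1)]] by simp
      then show ?thesis
        unfolding lin_maps_add[OF lin UV] lin_maps_add[OF g_hat_linear lin_maps_closed[OF lin UV(1)] lin_maps_closed[OF lin UV(2)]] u(3) v(3)
        using cls_add[OF LZ[OF u(1)] LZ[OF v(1)]] by simp
    qed
    ultimately show ?case unfolding forms_HN_eq by blast
  qed
  then obtain z' where z': "z' \<in> Z1 1 q" "g_hat D 1 q Z = cls 1 q z'"
    "g_hat D (Suc p) q (wedge_left D p q \<omega> Z) = cls (Suc p) q (L p (Suc q) \<omega> z')" by blast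
  have "cls 1 q z' = cls 1 q z" using z'(2) z(2) by simp
  then show "g_hat D (Suc p) q (wedge_left D p q \<omega> Z) = cls (Suc p) q (L p (Suc q) \<omega> z)"
    unfolding z'(3) by (rule Lc[OF z'(1) z(1)])
qed

text \<open>Under \<open>g_hat\<close>, the extended connection is the first differential of the spectral sequence.\<close>

lemma nabla_q_ext_eq:
  assumes "Z \<in> carrier (FH p q)"
  shows "nabla_q_ext D q p Z = g_hat_inv D (Suc p) q (dlt p q (g_hat D p q Z))"
proof -
  let ?f = "\<lambda>\<omega> Y. TC.PH.tn (Suc p) q (dif \<Gamma> \<omega>) Y \<oplus>\<^bsub>FH (Suc p) q\<^esub>
    (ms p \<odot>\<^bsub>FH (Suc p) q\<^esub> wedge_left D p q \<omega> (nabla_q D q Y))"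
  have "nabla_q_ext D q p Z = tensor_lift K (FH (Suc p) q) ?f Z"
    by (simp add: nabla_q_ext_def HN_eq)
  also have "\<dots> = g_hat_inv D (Suc p) q (dlt p q (g_hat D p q Z))"
  \<comment> \<open>The right-hand side is linear in \<open>Z\<close>, so only pure tensors need
    comparing, and balancedness of \<open>?f\<close> over \<open>B\<close> is a consequence.\<close>
  proof (rule TC.PH.tensor_lift_factor[OF module_forms_HN])
    show "(\<lambda>Z. g_hat_inv D (Suc p) q (dlt p q (g_hat D p q Z))) \<in> lin_maps K (TC.PH.T p q) (FH (Suc p) q)"
      using lin_maps_comp[OF lin_maps_comp[OF g_hat_linear dlt_linear] g_hat_inv_linear] by (simp only: forms_HN_eq)
    show "Z \<in> carrier (TC.PH.T p q)" using assms by (simp only: forms_HN_eq)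
    fix \<omega> Y assume "\<omega> \<in> carrier (forms \<Gamma> p)" "Y \<in> carrier (TC.H q)"
    then obtain y where \<omega>: "\<omega> \<in> grade \<Gamma> p" and y: "y \<in> Z1 0 q" "Y = cls 0 q y" unfolding carrier_HN by auto
    note d\<omega> = b.dif_grade[OF \<omega>]
    have yc: "y \<in> carrier (C q)" using Z1_carrier[OF y(1)] by simp
    have ny: "nab q y \<in> Z1 1 q" using nab_Z1[OF y(1)] by simp
    have e: "C (p + Suc q) = C (Suc p + q)" by simp
    have Y: "cls 0 q y \<in> carrier (TC.H q)" using y(1) unfolding carrier_HN by blast
    have t: "TC.PH.tn (Suc p) q (dif \<Gamma> \<omega>) (cls 0 q y) \<in> carrier (FH (Suc p) q)"
      unfolding forms_HN_eq by (rule TC.PH.tens_closed[OF _ Y]) (use d\<omega> in simp)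
    have L\<omega>: "L p q \<omega> y \<in> Z1 p q" using L_Z1[OF \<omega> y(1)] by simp
    have Ld\<omega>: "L (Suc p) q (dif \<Gamma> \<omega>) y \<in> Z1 (Suc p) q" using L_Z1[OF d\<omega> y(1)] by simp
    have Ln: "L p (Suc q) \<omega> (nab q y) \<in> Z1 (Suc p) q" using L_Z1[OF \<omega> ny] by simp
    note W = wedge_left_g_hat[OF \<omega> g_hat_inv(1)[OF cls_closed[OF ny]] ny g_hat_inv(2)[OF cls_closed[OF ny]]]
    note W' = W[folded nabla_q_cls[OF y(1)]]
    interpret FHm: module K "FH (Suc p) q" by (rule module_forms_HN)
    have sm: "ms p \<odot>\<^bsub>C (Suc p + q)\<^esub> L p (Suc q) \<omega> (nab q y) \<in> Z1 (Suc p) q"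
      by (rule submodule_smult[OF module_C submodule_Z1 ms_closed Ln])
    have fc: "?f \<omega> Y \<in> carrier (FH (Suc p) q)"
      using t W'(1) y(2) by (simp add: ms_closed)
    have "g_hat D (Suc p) q (?f \<omega> Y) = cls (Suc p) q (L (Suc p) q (dif \<Gamma> \<omega>) y) \<oplus>\<^bsub>HM D (Suc p) q\<^esub>
        (ms p \<odot>\<^bsub>HM D (Suc p) q\<^esub> cls (Suc p) q (L p (Suc q) \<omega> (nab q y)))"
      unfolding y(2) lin_maps_add[OF g_hat_linear t FHm.smult_closed[OF ms_closed W'(1)]]
        lin_maps_smult[OF g_hat_linear ms_closed W'(1)] g_hat_cls[OF d\<omega> y(1)] W'(2) ..
    also have "\<dots> = cls (Suc p) q (L (Suc p) q (dif \<Gamma> \<omega>) y \<oplus>\<^bsub>C (Suc p + q)\<^esub> (ms p \<odot>\<^bsub>C (Suc p + q)\<^esub> L p (Suc q) \<omega> (nab q y)))"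
      unfolding cls_smult[OF ms_closed Ln, symmetric] cls_add[OF Ld\<omega> sm, symmetric] ..
    also have "\<dots> = cls (Suc p) q (nab (p + q) (L p q \<omega> y))"
      using nab_L[OF \<omega> yc] by simp
    also have "\<dots> = dlt p q (g_hat D p q (TC.PH.tn p q \<omega> Y))"
      unfolding y(2) g_hat_cls[OF \<omega> y(1)] dlt_cls[OF L\<omega>] ..
    finally show "?f \<omega> Y = g_hat_inv D (Suc p) q (dlt p q (g_hat D p q (TC.PH.tn p q \<omega> Y)))"
      using g_hat_inv_eq[OF fc] by simp
  qed
  finally show ?thesis .
qed

lemma nabla_q_ext_linear: "nabla_q_ext D q p \<in> lin_maps K (FH p q) (FH (Suc p) q)"
  by (rule lin_maps_cong[OF lin_maps_comp[OF lin_maps_comp[OF g_hat_linear dlt_linear] g_hat_inv_linear]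
        nabla_q_ext_eq[symmetric] module_forms_HN])

lemma nabla_q_ext_g_hat: "Z \<in> carrier (FH p q) \<Longrightarrow> g_hat D (Suc p) q (nabla_q_ext D q p Z) = dlt p q (g_hat D p q Z)"
  unfolding nabla_q_ext_eq by (rule g_hat_inv(2)[OF lin_maps_closed[OF dlt_linear lin_maps_closed[OF g_hat_linear]]])

lemma dlt_dlt: "X \<in> carrier (HM D p q) \<Longrightarrow> dlt (Suc p) q (dlt p q X) = \<zero>\<^bsub>HM D (Suc (Suc p)) q\<^esub>"
proof -
  assume "X \<in> carrier (HM D p q)"
  then obtain x where x: "x \<in> Z1 p q" "X = cls p q x" unfolding cls_surj by blast
  have "nab (Suc p + q) (nab (p + q) x) = \<zero>\<^bsub>C (Suc (Suc p) + q)\<^esub>" using nab_nab[OF Z1_carrier[OF x(1)]] by simp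
  then show ?thesis
    using dlt_cls[OF x(1)] dlt_cls[OF nab_Z1[OF x(1)]] x(2) lin_maps_zero[OF module_ZC module_HM cls_linear, of "Suc (Suc p)" q] by simp
qed

text \<open>The square of the extended connection vanishes because \<open>g_hat\<close> is injective
  and turns it into \<open>dlt\<close> applied twice, which vanishes by \<open>nab_nab\<close>. In
  degree 0 this is the zero curvature of \<open>nabla_q\<close>.\<close>

sublocale QC: cochain_complex K "\<lambda>p. FH p q" "nabla_q_ext D q" for q
proof (rule cochain_complex.intro)
  fix p Z assume Z: "Z \<in> carrier (FH p q)"
  interpret FHm: module K "FH (Suc (Suc p)) q" by (rule module_forms_HN)
  note c1 = lin_maps_closed[OF nabla_q_ext_linear Z]
  have "g_hat D (Suc (Suc p)) q (nabla_q_ext D q (Suc p) (nabla_q_ext D q p Z)) = g_hat D (Suc (Suc p)) q \<zero>\<^bsub>FH (Suc (Suc p)) q\<^esub>"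
    unfolding nabla_q_ext_g_hat[OF c1] nabla_q_ext_g_hat[OF Z] dlt_dlt[OF lin_maps_closed[OF g_hat_linear Z]]
    by (rule lin_maps_zero[OF module_forms_HN module_HM g_hat_linear, symmetric])
  then show "nabla_q_ext D q (Suc p) (nabla_q_ext D q p Z) = \<zero>\<^bsub>FH (Suc (Suc p)) q\<^esub>"
    using g_hat_eq_iff[OF lin_maps_closed[OF nabla_q_ext_linear c1] FHm.zero_closed] by blast
qed (rule module_forms_HN nabla_q_ext_linear)+

lemma HB_eq: "HB D p q = cohomology (\<lambda>p. FH p q) (nabla_q_ext D q) p"
  by (simp add: HB_def)

section \<open>Cycles and boundaries of the second page\<close>

abbreviation "Z2 p q \<equiv> IC.cyc 2 (int p) (int (p + q))"
abbreviation "B2 p q \<equiv> IC.bnd 2 (int p) (int (p + q))"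

lemma nabla_q_ext_zero_iff:
  assumes "x \<in> Z1 p q"
  shows "nabla_q_ext D q p (g_hat_inv D p q (cls p q x)) = \<zero>\<^bsub>FH (Suc p) q\<^esub> \<longleftrightarrow> nab (p + q) x \<in> B1 (Suc p) q"
proof -
  note i = g_hat_inv[OF cls_closed[OF assms]]
  interpret FHm: module K "FH (Suc p) q" by (rule module_forms_HN)
  have "nabla_q_ext D q p (g_hat_inv D p q (cls p q x)) = \<zero>\<^bsub>FH (Suc p) q\<^esub> \<longleftrightarrow>
      cls (Suc p) q (nab (p + q) x) = \<zero>\<^bsub>HM D (Suc p) q\<^esub>"
    using g_hat_eq_iff[OF lin_maps_closed[OF nabla_q_ext_linear i(1)] FHm.zero_closed]
    unfolding nabla_q_ext_g_hat[OF i(1)] i(2) dlt_cls[OF assms] lin_maps_zero[OF module_forms_HN module_HM g_hat_linear] by simp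
  then show ?thesis using cls_zero_iff[OF nab_Z1[OF assms]] by simp
qed

lemma Z2_iff: "x \<in> Z2 p q \<Longrightarrow> x \<in> Z1 p q \<and> nab (p + q) x \<in> B1 (Suc p) q"
proof -
  assume x: "x \<in> Z2 p q"
  have e: "(1::int) + 1 = 2" "Suc (p + q) = Suc p + q" by simp_all
  show ?thesis
    using IC.cycle_lift_conv[of x 1 "int p" "int (p + q)", unfolded e int_Suc' int_nabla_nat] x by blast
qed

text \<open>\<open>cycle_lift\<close> at \<open>r = 1\<close>: the correction lies in step
  \<open>p + 1\<close>, so it is invisible in \<open>M p q\<close> and the class does not
  change.\<close>

lemma Z2_lift:
  assumes "x \<in> Z1 p q" "nab (p + q) x \<in> B1 (Suc p) q"
  obtains x' where "x' \<in> Z2 p q" "cls p q x' = cls p q x"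
proof -
  have e: "(1::int) + 1 = 2" "(1::int) - 1 = 0" "Suc (p + q) = Suc p + q" by simp_all
  have "int_nabla D (int (p + q)) x \<in> IC.bnd 1 (int p + 1) (int (p + q) + 1)"
    unfolding int_nabla_nat int_Suc' e using assms(2) .
  then obtain x' where x': "x' \<in> IC.cyc (1 + 1) (int p) (int (p + q))"
    "x \<ominus>\<^bsub>int_cochains D (int (p + q))\<^esub> x' \<in> IC.cyc (1 - 1) (int p + 1) (int (p + q))"
    by (rule IC.cycle_lift[OF order_refl assms(1)])
  have z2: "x' \<in> Z2 p q" using x'(1) unfolding e .
  have "x \<ominus>\<^bsub>C (p + q)\<^esub> x' \<in> filt D (Suc p) (p + q)" using x'(2) unfolding e int_Suc' cyc_0 int_cochains_nat .
  moreover have "x' \<in> Z1 p q" using Z2_iff[OF z2] by blast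
  moreover have "mc p q x = mc p q x'"
    using mc_eq_iff[OF Z1_carrier[OF assms(1)] Z1_carrier[OF calculation(2)]] calculation(1) by blast
  ultimately show thesis using that[OF z2] by simp
qed

text \<open>\<open>boundary_next_iff\<close> at \<open>r = 1\<close> reduces the left side to images
  of first-page cycles from step \<open>p - 1\<close>. Through \<open>cls\<close> and
  \<open>g_hat\<close> these images are the values of \<open>nabla_q_ext\<close>.\<close>

lemma B2_iff:
  assumes "x \<in> Z2 p q"
  shows "x \<in> B2 p q \<longleftrightarrow> g_hat_inv D p q (cls p q x) \<in> QC.cob q p"
proof -
  have x1: "x \<in> Z1 p q" using Z2_iff[OF assms] by blast
  note i = g_hat_inv[OF cls_closed[OF x1]]
  have e: "(1::int) + 1 = 2" by simp
  have "x \<in> B2 p q \<longleftrightarrow> (\<exists>y\<in>IC.cyc 1 (int p - 1) (int (p + q) - 1). x \<ominus>\<^bsub>C (p + q)\<^esub> int_nabla D (int (p + q) - 1) y \<in> B1 p q)"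
    using IC.boundary_next_iff[of 1 x "int p" "int (p + q)", unfolded e int_cochains_nat] assms by simp
  also have "\<dots> \<longleftrightarrow> g_hat_inv D p q (cls p q x) \<in> QC.cob q p"
  proof (cases p)
    case 0
    let ?n = "int (p + q)"
    \<comment> \<open>For \<open>p = 0\<close> the sources lie in step -1, which coincides with step
      0, so their images are already null on the first page. This matches the convention that
      coboundaries in degree 0 are zero.\<close>
    have dB: "int_nabla D (?n - 1) y \<in> B1 p q" if y: "y \<in> IC.cyc 1 (int p - 1) (?n - 1)" for y
    proof -
      interpret Cn: module K "int_cochains D ?n" by (rule IC.module_C)
      have "y \<in> IC.cyc (1 - 1) (int p - 1 + 1) (?n - 1)" using y 0 by (simp add: IC.cyc_def IC.F_full)
      moreover have "int_nabla D (?n - 1) y = \<zero>\<^bsub>int_cochains D ?n\<^esub> \<oplus>\<^bsub>int_cochains D ?n\<^esub> int_nabla D (?n - 1) y"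
        by (rule Cn.l_zero[OF lin_maps_closed[OF IC.d_linear' IC.cyc_carrier[OF y]], symmetric])
      ultimately show ?thesis
        unfolding IC.bnd_iff using submodule_zero[OF IC.module_C IC.submodule_cyc[of "1 - 1" "int p + 1" ?n]] by blast
    qed
    have z: "\<zero>\<^bsub>int_cochains D (?n - 1)\<^esub> \<in> IC.cyc 1 (int p - 1) (?n - 1)" by (rule submodule_zero[OF IC.module_C IC.submodule_cyc])
    have "(\<exists>y\<in>IC.cyc 1 (int p - 1) (?n - 1). x \<ominus>\<^bsub>C (p + q)\<^esub> int_nabla D (?n - 1) y \<in> B1 p q) \<longleftrightarrow> x \<in> B1 p q"
    proof
      assume "\<exists>y\<in>IC.cyc 1 (int p - 1) (?n - 1). x \<ominus>\<^bsub>C (p + q)\<^esub> int_nabla D (?n - 1) y \<in> B1 p q"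
      then obtain y where y: "y \<in> IC.cyc 1 (int p - 1) (?n - 1)" "x \<ominus>\<^bsub>C (p + q)\<^esub> int_nabla D (?n - 1) y \<in> B1 p q" by blast
      have "(x \<ominus>\<^bsub>C (p + q)\<^esub> int_nabla D (?n - 1) y) \<oplus>\<^bsub>C (p + q)\<^esub> int_nabla D (?n - 1) y = x"
        using minus_add_cancel(1)[OF module_C Z1_carrier[OF x1]] dB[OF y(1)] B1_Z1 Z1_carrier by blast
      then show "x \<in> B1 p q" using submodule_add[OF module_C submodule_B1 y(2) dB[OF y(1)]] by simp
    next
      assume "x \<in> B1 p q"
      then show "\<exists>y\<in>IC.cyc 1 (int p - 1) (?n - 1). x \<ominus>\<^bsub>C (p + q)\<^esub> int_nabla D (?n - 1) y \<in> B1 p q"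
        using submodule_minus[OF module_C submodule_B1 _ dB[OF z]] z by blast
    qed
    also have "\<dots> \<longleftrightarrow> g_hat_inv D p q (cls p q x) \<in> QC.cob q p"
    proof -
      interpret FHm: module K "FH p q" by (rule module_forms_HN)
      have "cls p q x = \<zero>\<^bsub>HM D p q\<^esub> \<longleftrightarrow> g_hat_inv D p q (cls p q x) = \<zero>\<^bsub>FH p q\<^esub>"
        using g_hat_eq_iff[OF i(1) FHm.zero_closed] unfolding i(2) lin_maps_zero[OF module_forms_HN module_HM g_hat_linear] .
      then show ?thesis using cls_zero_iff[OF x1] QC.coboundaries_0[of q] 0 by (simp del: of_nat_add)
    qed
    finally show ?thesis .
  next
    case (Suc r)
    have e2: "int p - 1 = int r" "int (p + q) - 1 = int (r + q)" using Suc by simp_all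
    have ny: "nab (r + q) y \<in> Z1 p q" if "y \<in> Z1 r q" for y using nab_Z1[OF that] Suc by simp
    have "(\<exists>y\<in>Z1 r q. x \<ominus>\<^bsub>C (p + q)\<^esub> nab (r + q) y \<in> B1 p q) \<longleftrightarrow> (\<exists>y\<in>Z1 r q. cls p q x = dlt r q (cls r q y))"
      using cls_eq_iff[OF x1 ny] dlt_cls[of _ r q] Suc by (simp del: of_nat_add cong: bex_cong)
    also have "\<dots> \<longleftrightarrow> (\<exists>Y\<in>carrier (HM D r q). cls p q x = dlt r q Y)" unfolding cls_surj by blast
    also have "\<dots> \<longleftrightarrow> (\<exists>W\<in>carrier (FH r q). cls p q x = dlt r q (g_hat D r q W))"
      unfolding lin_isosD(3)[OF g_hat_lin_iso, symmetric] by blast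
    also have "\<dots> \<longleftrightarrow> (\<exists>W\<in>carrier (FH r q). g_hat_inv D p q (cls p q x) = nabla_q_ext D q r W)"
    proof (rule bex_cong[OF refl])
      fix W assume W: "W \<in> carrier (FH r q)"
      have c: "nabla_q_ext D q r W \<in> carrier (FH p q)" using lin_maps_closed[OF nabla_q_ext_linear W] Suc by simp
      have "g_hat D p q (nabla_q_ext D q r W) = dlt r q (g_hat D r q W)" using nabla_q_ext_g_hat[OF W] Suc by simp
      then show "cls p q x = dlt r q (g_hat D r q W) \<longleftrightarrow> g_hat_inv D p q (cls p q x) = nabla_q_ext D q r W"
        using g_hat_eq_iff[OF i(1) c] unfolding i(2) by simp
    qed
    also have "\<dots> \<longleftrightarrow> g_hat_inv D p q (cls p q x) \<in> QC.cob q p"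
      unfolding Suc QC.coboundaries_Suc by (simp only: image_iff)
    finally show ?thesis unfolding e2 int_nabla_nat .
  qed
  finally show ?thesis .
qed

text \<open>A cocycle of the extended connection corresponds to some \<open>x\<close> in
  \<open>Z1\<close> with \<open>nab x\<close> in \<open>B1\<close>; \<open>Z2_lift\<close> improves
  it to a cycle of order 2 with the same class, which gives surjectivity. The kernel is
  \<open>B2_iff\<close>.\<close>

lemma page2_lin_iso: "page2_map D p q \<in> lin_isos K (page D 2 (int p) (int q)) (HB D p q)"
proof -
  let ?V = "(C (p + q))\<lparr>carrier := Z2 p q\<rparr>"
  let ?f = "\<lambda>x. QC.cob q p +>\<^bsub>FH p q\<^esub> g_hat_inv D p q (cls p q x)"
  have sub: "Z2 p q \<subseteq> Z1 p q" using Z2_iff by blast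
  have sZ: "submodule (Z2 p q) K (C (p + q))"
    using IC.submodule_cyc[of 2 "int p" "int (p + q)"] by (simp only: int_cochains_nat)
  have mV: "module K ?V" by (rule module_restrict[OF module_C sZ])
  have coc: "g_hat_inv D p q (cls p q x) \<in> QC.coc q p" if "x \<in> Z2 p q" for x
    using Z2_iff[OF that] nabla_q_ext_zero_iff[of x p q] g_hat_inv(1)[OF cls_closed, of x p q]
    by (simp add: cocycles_def del: of_nat_add)
  have "(\<lambda>x. cls p q x) \<in> lin_maps K ?V (HM D p q)"
    using cls_linear[of p q] sub by (auto simp: lin_maps_def Pi_def subset_iff simp del: of_nat_add)
  from lin_maps_comp[OF this g_hat_inv_linear]
  have "(\<lambda>x. g_hat_inv D p q (cls p q x)) \<in> lin_maps K ?V ((FH p q)\<lparr>carrier := QC.coc q p\<rparr>)"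
    using coc by (simp add: lin_maps_def Pi_def del: of_nat_add)
  from lin_maps_comp[OF this QC.class_linear]
  have lin: "?f \<in> lin_maps K ?V (HB D p q)" unfolding HB_eq .
  have "(\<lambda>X. \<Union>x\<in>X. ?f x) \<in> lin_isos K (quot_space ?V (B2 p q)) (HB D p q)"
  proof (rule factor_iso_union[OF mV _ lin])
    show "module K (HB D p q)" unfolding HB_eq by (rule QC.module_cohomology)
    show "carrier (HB D p q) \<subseteq> ?f ` carrier ?V"
    proof
      fix Y assume "Y \<in> carrier (HB D p q)"
      then obtain W where W: "W \<in> QC.coc q p" "Y = QC.cob q p +>\<^bsub>FH p q\<^esub> W" unfolding HB_eq QC.carrier_cohomology by blast
      have Wc: "W \<in> carrier (FH p q)" "nabla_q_ext D q p W = \<zero>\<^bsub>FH (Suc p) q\<^esub>" using W(1) by (simp_all add: cocycles_def)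
      obtain x where x: "x \<in> Z1 p q" "g_hat D p q W = cls p q x" using lin_maps_closed[OF g_hat_linear Wc(1)] unfolding cls_surj by blast
      have Wx: "W = g_hat_inv D p q (cls p q x)" using g_hat_inv_eq[OF Wc(1)] x(2) by simp
      have "nab (p + q) x \<in> B1 (Suc p) q" using nabla_q_ext_zero_iff[OF x(1)] Wc(2) Wx by blast
      then obtain x' where "x' \<in> Z2 p q" "cls p q x' = cls p q x" by (rule Z2_lift[OF x(1)])
      then have "Y = ?f x'" "x' \<in> carrier ?V" using W(2) Wx by simp_all
      then show "Y \<in> ?f ` carrier ?V" by (rule image_eqI)
    qed
    have "?f x = \<zero>\<^bsub>HB D p q\<^esub> \<longleftrightarrow> x \<in> B2 p q" if x: "x \<in> Z2 p q" for x
      unfolding HB_eq QC.zero_cohomology B2_iff[OF x]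
      by (rule QC.class_zero_iff[OF subsetD[OF QC.cocycles_subset coc[OF x]]])
    then show "B2 p q = {x \<in> carrier ?V. ?f x = \<zero>\<^bsub>HB D p q\<^esub>}"
      using IC.bnd_cyc[of 2 "int p" "int (p + q)"] by (simp del: of_nat_add cong: conj_cong) blast
  qed
  then show ?thesis unfolding page_eq page2_map_def quot_map_def of_nat_numeral .
qed

lemma convergence: "converges_to K (page D) (page_diff D) (HE D)"
  unfolding converges_to_def
proof (intro exI[of _ IC.stable] conjI allI)
  show "stable_from (page D) (page_diff D) p q (IC.stable p q)" for p q by (rule IC.stable_from)
  fix k
  have e: "{x \<in> carrier (C k). nab k x = \<zero>\<^bsub>C (Suc k)\<^esub>} = cocycles C nab k" by (simp add: cocycles_def)
  \<comment> \<open>In degree 0 the integer-indexed complex has the zero space in front, whose image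
    is the singleton that \<open>coboundaries\<close> prescribes.\<close>
  have b: "int_nabla D (int k - 1) ` carrier (int_cochains D (int k - 1)) = coboundaries C nab k"
  proof (cases k)
    case 0
    then show ?thesis by (simp add: coboundaries_def int_nabla_def int_cochains_fields)
  next
    case (Suc m)
    then have "int k - 1 = int m" by simp
    then show ?thesis using Suc by (simp add: coboundaries_def int_nabla_nat int_cochains_nat)
  qed
  show "lin_isomorphic K (HE D k) (direct_sum {(p, q). p + q = int k} (\<lambda>(p, q). page D (IC.stable p q) p q))"
    using IC.E_infinity[OF field_K, of "int k"]
    unfolding int_cochains_nat int_nabla_nat int_Suc' b e HE_def cohomology_def by simp
qed

end

text \<open>The explicit isomorphisms are indexed by natural numbers; the vanishing of the carriers
  for negative \<open>p\<close> or \<open>q\<close> accounts for all other positions. Composing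
  \<open>comparison\<close> with \<open>g_coh\<close> gives \<open>g_hat\<close>, the map that also
  enters the definition of \<open>nabla_q\<close>.\<close>

theorem theorem3p6:
  fixes D :: "('k, 'w, 'v, 'e) bundle_data"
  assumes "field (scal D)"
    and "differential_calculus (scal D) (algA D) (calA D)"
    and "differential_calculus (scal D) (algB D) (calB D)"
    and "bimodule (scal D) (algB D) (algA D) (bim D)"
    and "bimodule_differential_fibre_bundle D"
  shows "spectral_sequence (scal D) (page D) (page_diff D) \<and>
    (\<forall>r\<ge>1. \<forall>p q. p < 0 \<or> q < 0 \<longrightarrow> carrier (page D r p q) = {\<zero>\<^bsub>page D r p q\<^esub>}) \<and>
    (\<forall>p q.
      page1_map D p q \<in> lin_isos (scal D) (page D 1 (int p) (int q)) (HM D p q) \<and>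
      g_coh D p q \<in> lin_isos (scal D) (H_forms_N D p q) (HM D p q) \<and>
      comparison D p q \<in> lin_isos (scal D) (forms_HN D p q) (H_forms_N D p q) \<and>
      page2_map D p q \<in> lin_isos (scal D) (page D 2 (int p) (int q)) (HB D p q)) \<and>
    converges_to (scal D) (page D) (page_diff D) (HE D)"
proof -
  interpret fibre_bundle D
    using assms by (intro fibre_bundle.intro flat_connection.intro fibre_bundle_axioms.intro)
      (simp_all add: bimodule_differential_fibre_bundle_def)
  show ?thesis
    by (intro conjI allI impI IC.spectral_sequence IC.page_trivial page1_lin_iso g_coh_lin_iso
        comparison_lin_iso page2_lin_iso convergence)
qed

end
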